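(* Let $f$ be a non-constant entire function with hyper-order $\rho_1(f)<1$, let $c\in\mathbb{C}\setminus\{0\}$, let $k$ be a positive integer, and let $b_0,b_1,\ldots,b_k\in S(f)$ with $(b_0,b_1,\ldots,b_k)\not\equiv(0,0,\ldots,0)$. Let $a_1,a_2\in S(f)$ be distinct such that either $a_1$ and $a_2$ are both $c$-periodic, or $a_1'-a_2'$ is non-constant. Put $$\mathscr{L}_k(f(z+c))=b_0(z)f(z+c)+b_1(z)f'(z+c)+\cdots+b_k(z)f^{(k)}(z+c)$$ and $$\phi(z)=\frac{\Big((a_1'(z)-a_2'(z))(f(z)-a_1(z))-(a_1(z)-a_2(z))(f'(z)-a_1'(z))\Big)\Big(f(z)-\mathscr{L}_k(f(z+c))\Big)}{(f(z)-a_1(z))(f(z)-a_2(z))}.$$ If $f(z)$ and $\mathscr{L}_k(f(z+c))$ share $a_1$ and $a_2$ IM, then either $f(z)\equiv\mathscr{L}_k(f(z+c))$ or $$\sum_{i=1}^k b_i\psi_i=-b_0,$$ where $$\psi_1(z)=\frac{a_1'(z+c)-a_2'(z+c)-\phi(z+c)}{a_1(z+c)-a_2(z+c)}\quad\text{and}\quad \psi_{i+1}=\psi_i'+\psi_1\psi_i,\quad i=1,2,\ldots,k-1.$$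
   Context: Standard Nevanlinna theory notation is used: $T(r,f)$ is the Nevanlinna characteristic of a meromorphic function $f$ on $\mathbb{C}$. $S(r,f)$ denotes any quantity satisfying $S(r,f)=o(T(r,f))$ as $r\to\infty$, possibly outside an exceptional set of finite linear measure. A meromorphic function $a$ on $\mathbb{C}$ is a small function of $f$ if $T(r,a)=S(r,f)$; $S(f)$ denotes the set of small functions of $f$. The hyper-order of $f$ is $\rho_1(f)=\limsup_{r\to\infty}\frac{\log\log T(r,f)}{\log r}$. A function $a$ is $c$-periodic if $a(z+c)\equiv a(z)$. Two meromorphic functions $f,g$ share a small function $a$ IM (ignoring multiplicities) if $f-a$ and $g-a$ have the same zeros, multiplicities being ignored. *)

theory Defs
  imports "HOL-Complex_Analysis.Complex_Analysis" "HOL-Library.Landau_Symbols"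
begin

(* Throughout, a meromorphic function on the plane is some f with f meromorphic_on UNIV.
   Its values at the points of a sparse set are irrelevant (in the library even poles carry
   values), so identities between meromorphic functions are stated for all points outside a
   set without limit points, i.e. with the quantifier of the filter cosparse UNIV. *)

definition log_plus :: "real \<Rightarrow> real" where
  "log_plus x = max 0 (ln x)"

definition proximity :: "real \<Rightarrow> (complex \<Rightarrow> complex) \<Rightarrow> real" where
  "proximity r f =
     1 / (2 * pi) * integral {0..2 * pi} (\<lambda>\<theta>. log_plus (norm (f (of_real r * cis \<theta>))))"

definition pole_count :: "real \<Rightarrow> (complex \<Rightarrow> complex) \<Rightarrow> nat" where
  "pole_count r f = (\<Sum>z | norm z \<le> r \<and> is_pole f z. nat (- zorder f z))"

definition pole_counting :: "real \<Rightarrow> (complex \<Rightarrow> complex) \<Rightarrow> real" where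
  "pole_counting r f =
     integral {0..r} (\<lambda>t. (real (pole_count t f) - real (pole_count 0 f)) / t)
     + real (pole_count 0 f) * ln r"

definition nevanlinna_T :: "real \<Rightarrow> (complex \<Rightarrow> complex) \<Rightarrow> real" where
  "nevanlinna_T r f = proximity r f + pole_counting r f"

(* The exceptional set E may depend on the small quantity q. *)
definition is_S :: "(complex \<Rightarrow> complex) \<Rightarrow> (real \<Rightarrow> real) \<Rightarrow> bool" where
  "is_S f q \<longleftrightarrow>
     (\<exists>E \<in> lmeasurable. q \<in> o[inf at_top (principal (- E))](\<lambda>r. nevanlinna_T r f))"

definition small_functions :: "(complex \<Rightarrow> complex) \<Rightarrow> (complex \<Rightarrow> complex) set" where
  "small_functions f = {a. a meromorphic_on UNIV \<and> is_S f (\<lambda>r. nevanlinna_T r a)}"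

definition hyper_order :: "(complex \<Rightarrow> complex) \<Rightarrow> ereal" where
  "hyper_order f = Limsup at_top (\<lambda>r. ereal (ln (ln (nevanlinna_T r f)) / ln r))"

definition c_periodic :: "complex \<Rightarrow> (complex \<Rightarrow> complex) \<Rightarrow> bool" where
  "c_periodic c a \<longleftrightarrow> (\<forall>\<^sub>\<approx>z. a (z + c) = a z)"

(* Zeros of f - a are read off from limits, so that removable singularities (such as common
   poles of f and a) and the values assigned to poles play no role. *)
definition share_IM :: "(complex \<Rightarrow> complex) \<Rightarrow> (complex \<Rightarrow> complex) \<Rightarrow> (complex \<Rightarrow> complex) \<Rightarrow> bool" where
  "share_IM f g a \<longleftrightarrow>
     (\<forall>z. (\<lambda>w. f w - a w) \<midarrow>z\<rightarrow> 0 \<longleftrightarrow> (\<lambda>w. g w - a w) \<midarrow>z\<rightarrow> 0)"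

end

theory Submission
  imports Defs
begin

text \<open>Write $F = (f-a_1)/(a_2-a_1)$ and $G = (L-a_1)/(a_2-a_1)$, so that $F$ and $G$ share 0 and 1, and let
  $W_F = F'/(F-1) - F'/F$. The function $\Phi = W_F (F-G)$ has few poles by the sharing, and a small
  proximity function by the lemmas on logarithmic derivatives and on the quotients $f(z+c)/f(z)$; it equals
  $\phi/(a_2-a_1)$. Put $\theta = (a_2-a_1)'/(a_2-a_1) + \Phi$. Reducing all derivatives by
  $f' = \theta f + p$ turns $L$ into $\kappa(z) f(z+c)$ plus terms dominated by $p$, where
  $\kappa = b_0 + \sum b_i \psi_i$. If $\kappa \not\equiv 0$, this expresses $F$ through $G$ and $F' - \Phi F$,
  and the identity $(F' - \Phi F)(F-G) = \Phi F (G-1)$ yields $|F| \le e (|G|+1)$ with small $e$. Then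
  $W_G(F-G)$ is small too. Comparing residues at shared points, either all factors
  $q W_F - p W_G$ with $p, q \le 4$ are nonzero, and an auxiliary function with few poles forces $T(r,F)$ to be
  small, or $q W_F = p W_G$, so that $((F-1)/F)^q = C ((G-1)/G)^p$, which again makes $T(r,F)$ small unless
  $F = G$.

  All estimates are made on a sequence of intervals $[r_n, r_n+h_n]$ on which $T(r,f)$ at most doubles; since
  the hyper-order is less than 1, $h_n$ can be taken to be a power of $r_n$, which is what the difference
  quotient estimate needs.\<close>

section \<open>Circle means and the Schwarz integral formula\<close>

text \<open>Sharing ignores multiplicities, and this is the main obstacle: if a shared point has
  multiplicity p for F and q for G, then W_F - W_G may keep its pole there and only q W_F - p W_G
  loses it. High multiplicities need no such factor, because F(F-1)G(G-1) vanishes to order p + q.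
  The bound 4 comes from growth. Up to small factors F(F-1)G(G-1) is at most |F|^4 and W_F is of
  size 1/|F| where F is large, so the fifth power of W_F is the lowest whose product with
  F(F-1)G(G-1) stays small after multiplication by F. Its five poles are cancelled as soon as p + q
  >= 5, which leaves p, q <= 4 to the factors. Smallness is split into proximity
  (\<open>msmall\<close>) and pole counting (\<open>nsmall\<close>), which have different sources: f
  is entire, so F and G have few poles for free and the whole argument is about the proximity
  function of F. Every circle estimate rests on the power -\<alpha> of a distance with a fixed
  \<alpha> < 1: its mean is bounded independently of the position of the singularity, and 1 -
  \<alpha> is chosen against the length of the windows.\<close>

definition circ_mean :: "real \<Rightarrow> (complex \<Rightarrow> 'a::banach) \<Rightarrow> 'a" where
  "circ_mean r g = (1 / (2 * pi)) *\<^sub>R integral {0..2 * pi} (\<lambda>\<theta>. g (of_real r * cis \<theta>))"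

lemma continuous_on_circ:
  assumes "continuous_on (sphere 0 r) g" "r \<ge> 0"
  shows "continuous_on A (\<lambda>\<theta>. g (of_real r * cis \<theta>))"
  by (rule continuous_on_compose2[OF assms(1)]) (use assms(2) in \<open>auto intro!: continuous_intros simp: norm_mult\<close>)

lemma integrable_circ:
  fixes g :: "complex \<Rightarrow> 'a::banach"
  assumes "continuous_on (sphere 0 r) g" "r \<ge> 0"
  shows "(\<lambda>\<theta>. g (of_real r * cis \<theta>)) integrable_on {0..2 * pi}"
  by (rule integrable_continuous_real, rule continuous_on_circ[OF assms])

lemma circ_mean_cong:
  assumes "\<And>z. norm z = r \<Longrightarrow> f z = g z" "r \<ge> 0"
  shows "circ_mean r f = circ_mean r g"
  unfolding circ_mean_def using assms by (intro arg_cong[where f="\<lambda>x. _ *\<^sub>R x"] integral_cong) (auto simp: norm_mult)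

lemma circ_mean_add:
  assumes "continuous_on (sphere 0 r) f" "continuous_on (sphere 0 r) g" "r \<ge> 0"
  shows "circ_mean r (\<lambda>z. f z + g z) = circ_mean r f + circ_mean r g"
  unfolding circ_mean_def using integrable_circ[OF assms(1,3)] integrable_circ[OF assms(2,3)]
  by (simp add: integral_add scaleR_add_right)

lemma circ_mean_diff:
  assumes "continuous_on (sphere 0 r) f" "continuous_on (sphere 0 r) g" "r \<ge> 0"
  shows "circ_mean r (\<lambda>z. f z - g z) = circ_mean r f - circ_mean r g"
  unfolding circ_mean_def using integrable_circ[OF assms(1,3)] integrable_circ[OF assms(2,3)]
  by (simp add: integral_diff scaleR_diff_right)

lemma circ_mean_const [simp]: "circ_mean r (\<lambda>z. c) = c"
  by (simp add: circ_mean_def)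

lemma circ_mean_cmult:
  fixes c :: "'a::{banach,real_normed_field}"
  shows "circ_mean r (\<lambda>z. c * f z) = c * circ_mean r f"
  unfolding circ_mean_def by (simp add: integral_mult_right)

lemma circ_mean_linear:
  assumes "continuous_on (sphere 0 r) f" "r \<ge> 0" "bounded_linear h"
  shows "circ_mean r (\<lambda>z. h (f z)) = h (circ_mean r f)"
  unfolding circ_mean_def using integral_linear[OF integrable_circ[OF assms(1,2)] assms(3)]
  by (simp add: o_def linear_simps(5)[OF assms(3)])

lemma circ_mean_sum:
  assumes "finite A" "\<And>a. a \<in> A \<Longrightarrow> continuous_on (sphere 0 r) (f a)" "r \<ge> 0"
  shows "circ_mean r (\<lambda>z. \<Sum>a\<in>A. f a z) = (\<Sum>a\<in>A. circ_mean r (f a))"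
  using assms by (induction A) (auto simp: circ_mean_add continuous_on_sum)

lemma circ_mean_mono:
  fixes f g :: "complex \<Rightarrow> real"
  assumes "continuous_on (sphere 0 r) f" "continuous_on (sphere 0 r) g" "r \<ge> 0"
    "\<And>z. norm z = r \<Longrightarrow> f z \<le> g z"
  shows "circ_mean r f \<le> circ_mean r g"
  unfolding circ_mean_def scaleR_conv_of_real
  by (intro mult_left_mono integral_le integrable_circ) (use assms in \<open>auto simp: norm_mult\<close>)

lemma norm_circ_mean_le:
  assumes "continuous_on (sphere 0 r) f" "r \<ge> 0"
  shows "norm (circ_mean r f) \<le> circ_mean r (\<lambda>z. norm (f z))"
proof -
  have "norm (integral {0..2 * pi} (\<lambda>\<theta>. f (of_real r * cis \<theta>)))
    \<le> integral {0..2 * pi} (\<lambda>\<theta>. norm (f (of_real r * cis \<theta>)))"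
    by (intro integral_norm_bound_integral integrable_circ[OF assms]
        integrable_circ[OF continuous_on_norm[OF assms(1)] assms(2)]) auto
  thus ?thesis unfolding circ_mean_def by (simp add: divide_right_mono)
qed

lemma circ_mean_swap:
  fixes k :: "complex \<Rightarrow> complex \<Rightarrow> real"
  assumes "continuous_on (sphere 0 r \<times> sphere 0 R) (\<lambda>(z, w). k z w)" "r \<ge> 0" "R \<ge> 0"
  shows "circ_mean r (\<lambda>z. circ_mean R (\<lambda>w. k z w)) = circ_mean R (\<lambda>w. circ_mean r (\<lambda>z. k z w))"
proof -
  have c: "continuous_on (cbox (0,0) (2*pi,2*pi)) (\<lambda>(s,t). k (of_real r * cis s) (of_real R * cis t))"
  proof -
    have "continuous_on (cbox (0,0) (2*pi,2*pi)) (\<lambda>x. (of_real r * cis (fst x) :: complex, of_real R * cis (snd x) :: complex))"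
      by (intro continuous_intros)
    from continuous_on_compose2[OF assms(1) this] show ?thesis
      using assms(2,3) by (auto simp: norm_mult case_prod_unfold image_subset_iff)
  qed
  show ?thesis
    using integral_swap_continuous[OF c] by (simp add: circ_mean_def)
qed

section \<open>Cauchy, Schwarz and Poisson formulas on a disc\<close>

lemma circ_mean_Cauchy:
  assumes "h holomorphic_on cball 0 R" "norm z < R"
  shows "circ_mean R (\<lambda>w. h w * w / (w - z)) = h z"
proof -
  have "((\<lambda>u. h u / (u - z)) has_contour_integral (2 * of_real pi * \<i> * h z)) (part_circlepath 0 R 0 (2*pi))"
    using Cauchy_integral_circlepath_simple[OF assms(1), of z] assms(2) by (simp add: circlepath_def)
  hence "((\<lambda>t. h (R * cis t) / (R * cis t - z) * R * \<i> * cis t) has_integral (2 * of_real pi * \<i> * h z)) {0..2*pi}"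
    by (subst (asm) has_contour_integral_part_circlepath_iff) simp_all
  from has_integral_mult_right[OF this, of "-\<i>"]
  have "((\<lambda>t. h (R * cis t) * (R * cis t) / (R * cis t - z)) has_integral (2 * of_real pi * h z)) {0..2*pi}"
    by (simp add: field_simps)
  thus ?thesis
    unfolding circ_mean_def by (simp add: integral_unique scaleR_conv_of_real)
qed

lemma circ_mean_holomorphic:
  assumes "h holomorphic_on cball 0 R" "R > 0"
  shows "circ_mean R h = h 0"
  using circ_mean_Cauchy[OF assms(1), of 0] assms(2)
  by (subst circ_mean_cong[of R h "\<lambda>w. h w * w / (w - 0)"]) auto

text \<open>Cauchy's kernel w/(w-z) equals 1 + z/(w-z). The mean of h times the reflected kernel cnj
  z w/(R^2 - cnj z w) is zero, since that product is holomorphic and vanishes at 0; on the circle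
  the conjugate of the reflected kernel is z/(w-z). Adding the conjugate of this zero mean replaces
  h by h + cnj h = 2 Re h.\<close>

lemma Schwarz_formula:
  assumes h: "h holomorphic_on cball 0 R" and z: "norm z < R"
  shows "h z = h 0 + circ_mean R (\<lambda>w. of_real (Re (h w)) * (2 * z / (w - z)))"
proof -
  have R: "R > 0" using z le_less_trans norm_ge_zero by blast
  have hc: "continuous_on (sphere 0 R) h"
    by (rule continuous_on_subset[OF holomorphic_on_imp_continuous_on[OF h]]) auto
  have nz: "w - z \<noteq> 0" if "norm w = R" for w using that z by auto
  have nz2: "of_real (R\<^sup>2) - cnj z * w \<noteq> 0" if "norm w \<le> R" for w
  proof
    assume "of_real (R\<^sup>2) - cnj z * w = 0"
    hence "norm (of_real (R\<^sup>2) :: complex) = norm (cnj z * w)" by simp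
    hence "R\<^sup>2 = norm z * norm w" by (simp only: norm_mult norm_of_real complex_mod_cnj) simp
    also have "\<dots> \<le> norm z * R" using that by (simp add: mult_left_mono)
    also have "\<dots> < R\<^sup>2" using z R by (simp add: power2_eq_square)
    finally show False by simp
  qed
  have "circ_mean R (\<lambda>w. h w * (cnj z * w / (of_real (R\<^sup>2) - cnj z * w))) = 0"
    by (subst circ_mean_holomorphic) (use R nz2 in \<open>auto intro!: holomorphic_intros h\<close>)
  hence "cnj (circ_mean R (\<lambda>w. h w * (cnj z * w / (of_real (R\<^sup>2) - cnj z * w)))) = 0" by simp
  also have "cnj (circ_mean R (\<lambda>w. h w * (cnj z * w / (of_real (R\<^sup>2) - cnj z * w)))) =
     circ_mean R (\<lambda>w. cnj (h w * (cnj z * w / (of_real (R\<^sup>2) - cnj z * w))))"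
    by (rule circ_mean_linear[symmetric, OF _ _ bounded_linear_cnj])
       (use R nz2 in \<open>auto intro!: continuous_intros hc\<close>)
  also have "\<dots> = circ_mean R (\<lambda>w. cnj (h w) * (z / (w - z)))"
  proof (rule circ_mean_cong)
    fix w :: complex assume w: "norm w = R"
    have wc: "w * cnj w = (of_real R)\<^sup>2" using w by (simp add: complex_norm_square[symmetric])
    have w0: "cnj w \<noteq> 0" using w R by auto
    have "cnj (cnj z * w / (of_real (R\<^sup>2) - cnj z * w)) = (cnj w * z) / (cnj w * (w - z))"
      by (simp add: wc[symmetric] algebra_simps del: mult_cancel_left1)
    also have "\<dots> = z / (w - z)" using w0 by simp
    finally show "cnj (h w * (cnj z * w / (of_real (R\<^sup>2) - cnj z * w))) = cnj (h w) * (z / (w - z))"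
      by (subst complex_cnj_mult) (simp only:)
  qed (use R in simp)
  finally have 1: "circ_mean R (\<lambda>w. cnj (h w) * (z / (w - z))) = 0" .
  have "h z = circ_mean R (\<lambda>w. h w * w / (w - z))" using circ_mean_Cauchy[OF h z] by simp
  also have "\<dots> = circ_mean R (\<lambda>w. h w + h w * (z / (w - z)))"
    by (rule circ_mean_cong) (use nz R in \<open>auto simp: field_simps\<close>)
  also have "\<dots> = h 0 + circ_mean R (\<lambda>w. h w * (z / (w - z)))"
    by (subst circ_mean_add) (use R nz in \<open>auto intro!: continuous_intros hc simp: circ_mean_holomorphic[OF h]\<close>)
  also have "circ_mean R (\<lambda>w. h w * (z / (w - z))) =
     circ_mean R (\<lambda>w. h w * (z / (w - z))) + circ_mean R (\<lambda>w. cnj (h w) * (z / (w - z)))"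
    using 1 by simp
  also have "\<dots> = circ_mean R (\<lambda>w. h w * (z / (w - z)) + cnj (h w) * (z / (w - z)))"
    by (rule circ_mean_add[symmetric]) (use R nz in \<open>auto intro!: continuous_intros hc\<close>)
  also have "\<dots> = circ_mean R (\<lambda>w. of_real (Re (h w)) * (2 * z / (w - z)))"
  proof (rule circ_mean_cong)
    fix w :: complex
    have "h w * (z / (w - z)) + cnj (h w) * (z / (w - z)) = (h w + cnj (h w)) * (z / (w - z))"
      by (simp only: distrib_right)
    thus "h w * (z / (w - z)) + cnj (h w) * (z / (w - z)) = of_real (Re (h w)) * (2 * z / (w - z))"
      by (simp add: complex_add_cnj)
  qed (use R in simp)
  finally show ?thesis .
qed

text \<open>The kernels 2z/(w-z) and 2z'/(w-z') differ by 2w(z-z')/((w-z)(w-z')). The same bound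
  serves the shift, with the points z + c and z, and in the limit the derivative.\<close>

lemma Schwarz_increment_bound:
  assumes h: "h holomorphic_on cball 0 R" and z: "norm z < R" "norm z' < R"
  shows "norm (h z - h z') \<le> norm (z - z') *
           circ_mean R (\<lambda>w. \<bar>Re (h w)\<bar> * (2 * R / (norm (w - z) * norm (w - z'))))"
proof -
  have R: "R > 0" using z(1) le_less_trans norm_ge_zero by blast
  have hc: "continuous_on (sphere 0 R) h"
    by (rule continuous_on_subset[OF holomorphic_on_imp_continuous_on[OF h]]) auto
  have nz: "w - z \<noteq> 0" "w - z' \<noteq> 0" if "norm w = R" for w using that z by auto
  have c: "continuous_on (sphere 0 R) (\<lambda>w. of_real (Re (h w)) * (2 * y / (w - y)))" if "norm y < R" for y
    using that by (intro continuous_intros hc) auto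
  have "h z - h z' = circ_mean R (\<lambda>w. of_real (Re (h w)) * (2 * z / (w - z)))
     - circ_mean R (\<lambda>w. of_real (Re (h w)) * (2 * z' / (w - z')))"
    by (subst (1 2) Schwarz_formula[OF h]) (use z in auto)
  also have "\<dots> = circ_mean R (\<lambda>w. of_real (Re (h w)) * (2 * z / (w - z)) - of_real (Re (h w)) * (2 * z' / (w - z')))"
    by (rule circ_mean_diff[symmetric]) (use R c z in auto)
  finally have eq: "h z - h z' = circ_mean R (\<lambda>w. of_real (Re (h w)) * (2 * z / (w - z)) - of_real (Re (h w)) * (2 * z' / (w - z')))" .
  have "norm (h z - h z') \<le> circ_mean R (\<lambda>w. norm (of_real (Re (h w)) * (2 * z / (w - z)) - of_real (Re (h w)) * (2 * z' / (w - z'))))"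
    unfolding eq by (rule norm_circ_mean_le[OF continuous_on_diff[OF c c]]) (use R z in auto)
  also have "\<dots> = circ_mean R (\<lambda>w. norm (z - z') * (\<bar>Re (h w)\<bar> * (2 * R / (norm (w - z) * norm (w - z')))))"
  proof (rule circ_mean_cong)
    fix w :: complex assume w: "norm w = R"
    have "of_real (Re (h w)) * (2 * z / (w - z)) - of_real (Re (h w)) * (2 * z' / (w - z')) =
       of_real (Re (h w)) * (2 * w * (z - z') / ((w - z) * (w - z')))"
      using nz[OF w] by (simp add: field_simps)
    hence "norm (of_real (Re (h w)) * (2 * z / (w - z)) - of_real (Re (h w)) * (2 * z' / (w - z'))) =
       norm (of_real (Re (h w)) * (2 * w * (z - z') / ((w - z) * (w - z'))))" by (simp only:)
    also have "\<dots> = norm (z - z') * (\<bar>Re (h w)\<bar> * (2 * R / (norm (w - z) * norm (w - z'))))"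
      by (simp add: norm_mult norm_divide w)
    finally show "norm (of_real (Re (h w)) * (2 * z / (w - z)) - of_real (Re (h w)) * (2 * z' / (w - z'))) = norm (z - z') * (\<bar>Re (h w)\<bar> * (2 * R / (norm (w - z) * norm (w - z'))))" .
  qed (use R in simp)
  also have "\<dots> = norm (z - z') * circ_mean R (\<lambda>w. (\<bar>Re (h w)\<bar> * (2 * R / (norm (w - z) * norm (w - z')))))"
    by (rule circ_mean_cmult)
  finally show ?thesis .
qed

definition poisson_kernel :: "complex \<Rightarrow> complex \<Rightarrow> real" where
  "poisson_kernel z w = Re ((w + z) / (w - z))"

lemma poisson_kernel_eq:
  assumes "norm z \<noteq> norm w"
  shows "poisson_kernel z w = ((norm w)\<^sup>2 - (norm z)\<^sup>2) / (norm (w - z))\<^sup>2"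
proof -
  have "Re ((w + z) * cnj (w - z)) = (norm w)\<^sup>2 - (norm z)\<^sup>2"
    unfolding cmod_power2 by (simp add: power2_eq_square algebra_simps)
  thus ?thesis
    unfolding poisson_kernel_def complex_div_cnj[of "w+z"] by (simp flip: of_real_power)
qed

lemma Re_complex_of_real_mult: "Re (of_real x * z) = x * Re z"
  by simp

lemma Poisson_formula:
  assumes h: "h holomorphic_on cball 0 R" and z: "norm z < R"
  shows "Re (h z) = circ_mean R (\<lambda>w. Re (h w) * poisson_kernel z w)"
proof -
  have R: "R > 0" using z le_less_trans norm_ge_zero by blast
  have hc: "continuous_on (sphere 0 R) h"
    by (rule continuous_on_subset[OF holomorphic_on_imp_continuous_on[OF h]]) auto
  have nz: "w - z \<noteq> 0" if "norm w = R" for w using that z by auto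
  have "Re (h z) = Re (circ_mean R h) + Re (circ_mean R (\<lambda>w. of_real (Re (h w)) * (2 * z / (w - z))))"
    using Schwarz_formula[OF h z] circ_mean_holomorphic[OF h R] by simp
  also have "Re (circ_mean R h) = circ_mean R (\<lambda>w. Re (h w))"
    by (rule circ_mean_linear[symmetric, OF _ _ bounded_linear_Re]) (use R hc in auto)
  also have "Re (circ_mean R (\<lambda>w. of_real (Re (h w)) * (2 * z / (w - z)))) =
     circ_mean R (\<lambda>w. Re (of_real (Re (h w)) * (2 * z / (w - z))))"
    by (rule circ_mean_linear[symmetric, OF _ _ bounded_linear_Re]) (use R hc nz in \<open>auto intro!: continuous_intros\<close>)
  also have "circ_mean R (\<lambda>w. Re (h w)) + \<dots> = circ_mean R (\<lambda>w. Re (h w) + Re (of_real (Re (h w)) * (2 * z / (w - z))))"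
    by (rule circ_mean_add[symmetric]) (use R hc nz in \<open>auto intro!: continuous_intros\<close>)
  also have "\<dots> = circ_mean R (\<lambda>w. Re (h w) * poisson_kernel z w)"
  proof (rule circ_mean_cong)
    fix w :: complex assume w: "norm w = R"
    have "(w + z) / (w - z) = 1 + 2 * z / (w - z)" using nz[OF w] by (simp add: field_simps)
    thus "Re (h w) + Re (of_real (Re (h w)) * (2 * z / (w - z))) = Re (h w) * poisson_kernel z w"
      unfolding poisson_kernel_def by (simp only: Re_complex_of_real_mult) (simp add: algebra_simps)
  qed (use R in simp)
  finally show ?thesis .
qed

text \<open>As a function of the inner point z, the quotient (w+z)/(w-z) is holomorphic with value 1
  at the origin.\<close>

lemma circ_mean_poisson_kernel:
  assumes "norm w > r" "r > 0"
  shows "circ_mean r (\<lambda>z. poisson_kernel z w) = 1"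
proof -
  have nz: "w - z \<noteq> 0" if "norm z \<le> r" for z using that assms by auto
  have "circ_mean r (\<lambda>z. poisson_kernel z w) = Re (circ_mean r (\<lambda>z. (w + z) / (w - z)))"
    unfolding poisson_kernel_def
    by (rule circ_mean_linear[OF _ _ bounded_linear_Re]) (use assms nz in \<open>auto intro!: continuous_intros\<close>)
  also have "circ_mean r (\<lambda>z. (w + z) / (w - z)) = (w + 0) / (w - 0)"
    by (rule circ_mean_holomorphic) (use assms nz in \<open>auto intro!: holomorphic_intros\<close>)
  finally show ?thesis using assms by auto
qed

section \<open>Circle means of negative powers of a distance\<close>

lemma abs_sin_ge_half:
  fixes y :: real
  assumes "\<bar>y\<bar> \<le> pi / 2"
  shows "\<bar>y\<bar> / 2 \<le> \<bar>sin y\<bar>"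
proof -
  have *: "y / 2 \<le> sin y" if y: "0 \<le> y" "y \<le> pi / 2" for y :: real
  proof -
    have "concave_on {0..pi/2} (sin :: real \<Rightarrow> real)"
      by (rule f''_le0_imp_concave[of _ _ cos "\<lambda>x. - sin x"])
         (auto intro!: derivative_eq_intros sin_ge_zero)
    from concave_onD_Icc'[OF this, of y] y have "1 / (pi/2) * y \<le> sin y" by simp
    \<comment> \<open>Concavity gives the chord bound with slope 2/pi, which exceeds 1/2 because pi
      < 4.\<close>
    moreover have "y / 2 \<le> 1 / (pi/2) * y"
      using y mult_right_mono[OF less_imp_le[OF pi_less_4] y(1)] by (simp add: field_simps)
    ultimately show ?thesis by linarith
  qed
  show ?thesis
  proof (cases "y \<ge> 0")
    case True thus ?thesis using *[of y] assms by simp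
  next
    case False thus ?thesis using *[of "-y"] assms by simp
  qed
qed

text \<open>The primitive is odd about s and continuous across s because 1 - \<alpha> > 0, so the
  fundamental theorem of calculus applies with the single point s exempted.\<close>

lemma integral_abs_powr:
  fixes s :: real
  assumes "0 < \<alpha>" "\<alpha> < 1" "a \<le> b"
  shows "((\<lambda>x. \<bar>x - s\<bar> powr (-\<alpha>)) has_integral
     (sgn (b - s) * \<bar>b - s\<bar> powr (1 - \<alpha>) / (1 - \<alpha>) - sgn (a - s) * \<bar>a - s\<bar> powr (1 - \<alpha>) / (1 - \<alpha>))) {a..b}"
proof (rule fundamental_theorem_of_calculus_interior_strong[of "{s}"])
  fix x assume "x \<in> {a<..<b} - {s}"
  hence xs: "x \<noteq> s" by simp
  show "((\<lambda>x. sgn (x - s) * \<bar>x - s\<bar> powr (1 - \<alpha>) / (1 - \<alpha>)) has_vector_derivative \<bar>x - s\<bar> powr - \<alpha>) (at x)"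
  proof (cases "x > s")
    case True
    have "((\<lambda>x. (x - s) powr (1 - \<alpha>) / (1 - \<alpha>)) has_real_derivative ((1 - \<alpha>) * (x - s) powr (1 - \<alpha> - 1) * 1 / (1 - \<alpha>))) (at x)"
      using True by (intro DERIV_cdivide DERIV_fun_powr[of "\<lambda>x. x - s"]) (auto intro!: derivative_eq_intros)
    hence "((\<lambda>x. (x - s) powr (1 - \<alpha>) / (1 - \<alpha>)) has_real_derivative \<bar>x - s\<bar> powr - \<alpha>) (at x)"
      using True assms by simp
    thus ?thesis unfolding has_real_derivative_iff_has_vector_derivative
      by (rule has_vector_derivative_transform_within_open[of _ _ _ "{s<..}"]) (use True in auto)
  next
    case False
    hence "x < s" using xs by simp
    have "((\<lambda>x. - ((s - x) powr (1 - \<alpha>) / (1 - \<alpha>))) has_real_derivative - ((1 - \<alpha>) * (s - x) powr (1 - \<alpha> - 1) * (-1) / (1 - \<alpha>))) (at x)"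
      using \<open>x < s\<close> by (intro DERIV_minus DERIV_cdivide DERIV_fun_powr[of "\<lambda>x. s - x"]) (auto intro!: derivative_eq_intros)
    hence "((\<lambda>x. - ((s - x) powr (1 - \<alpha>) / (1 - \<alpha>))) has_real_derivative \<bar>x - s\<bar> powr - \<alpha>) (at x)"
      using \<open>x < s\<close> assms by simp
    thus ?thesis unfolding has_real_derivative_iff_has_vector_derivative
      by (rule has_vector_derivative_transform_within_open[of _ _ _ "{..<s}"]) (use \<open>x < s\<close> in auto)
  qed
next
  have "continuous (at x) (\<lambda>x. sgn (x - s) * \<bar>x - s\<bar> powr (1 - \<alpha>))" for x
  proof (cases "x = s")
    case True
    have "((\<lambda>x. \<bar>x - s\<bar> powr (1 - \<alpha>)) \<longlongrightarrow> \<bar>s - s\<bar> powr (1 - \<alpha>)) (at s)"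
      using assms by (intro tendsto_powr2 tendsto_intros) auto
    hence "((\<lambda>x. \<bar>x - s\<bar> powr (1 - \<alpha>)) \<longlongrightarrow> 0) (at s)" by simp
    hence "((\<lambda>x. sgn (x - s) * \<bar>x - s\<bar> powr (1 - \<alpha>)) \<longlongrightarrow> 0) (at s)"
      by (rule Lim_null_comparison[rotated]) (auto simp: abs_mult sgn_if intro!: always_eventually)
    thus ?thesis using True by (simp add: isCont_def)
  next
    case False
    have "continuous (at x) (\<lambda>x. \<bar>x - s\<bar> powr (1 - \<alpha>))"
      by (intro continuous_intros) (use False in auto)
    moreover have "continuous (at x) (\<lambda>x. sgn (x - s))"
      using False by (intro continuous_intros) auto
    ultimately show ?thesis by (intro continuous_mult)
  qed
  hence "continuous_on {a..b} (\<lambda>x. sgn (x - s) * \<bar>x - s\<bar> powr (1 - \<alpha>))"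
    using continuous_at_imp_continuous_on by blast
  thus "continuous_on {a..b} (\<lambda>x. sgn (x - s) * \<bar>x - s\<bar> powr (1 - \<alpha>) / (1 - \<alpha>))"
    using assms by (intro continuous_on_divide continuous_on_const \<open>continuous_on {a..b} _\<close>) auto
qed (use assms in auto)

text \<open>The distance from $r e^{i\theta}$ to a point of argument $t$ is at least $r |\sin (\theta - t)|$.\<close>

lemma circ_mean_powr_bound:
  assumes \<alpha>: "0 < \<alpha>" "\<alpha> < 1"
  obtains C where "C > 0"
    "\<And>r a. r > 0 \<Longrightarrow> norm a \<noteq> r \<Longrightarrow> circ_mean r (\<lambda>z. norm (z - a) powr (-\<alpha>)) \<le> C * r powr (-\<alpha>)"
proof -
  \<comment> \<open>8 pi generously bounds the distance from either end of [0, 2 pi] to a singular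
    angle t + k pi with |t| <= pi and -1 <= k <= 3; the factor 2 accounts for the two ends.\<close>
  define B where "B = 2 * (8 * pi) powr (1 - \<alpha>) / (1 - \<alpha>)"
  have Bpos: "B > 0" unfolding B_def using \<alpha> by auto
  define I :: "real \<Rightarrow> int \<Rightarrow> real" where
    "I t k = (sgn (2 * pi - (t + k * pi)) * \<bar>2 * pi - (t + k * pi)\<bar> powr (1 - \<alpha>) / (1 - \<alpha>)
       - sgn (0 - (t + k * pi)) * \<bar>0 - (t + k * pi)\<bar> powr (1 - \<alpha>) / (1 - \<alpha>))" for t k
  have I: "((\<lambda>x. \<bar>x - (t + of_int k * pi)\<bar> powr (-\<alpha>)) has_integral I t k) {0..2*pi}" for t k
    unfolding I_def by (rule integral_abs_powr[OF \<alpha>]) simp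
  have IB: "I t k \<le> B" if "t \<in> {-pi..pi}" "k \<in> {-1..3}" for t k
  proof -
    have sgn_le: "sgn y * \<bar>y\<bar> powr (1 - \<alpha>) / (1 - \<alpha>) \<le> (8 * pi) powr (1 - \<alpha>) / (1 - \<alpha>)"
      "- (sgn y * \<bar>y\<bar> powr (1 - \<alpha>) / (1 - \<alpha>)) \<le> (8 * pi) powr (1 - \<alpha>) / (1 - \<alpha>)"
      if "\<bar>y\<bar> \<le> 8 * pi" for y :: real
    proof -
      have "\<bar>y\<bar> powr (1 - \<alpha>) \<le> (8 * pi) powr (1 - \<alpha>)" using that \<alpha> by (intro powr_mono2) auto
      moreover have "sgn y * \<bar>y\<bar> powr (1 - \<alpha>) \<le> \<bar>y\<bar> powr (1 - \<alpha>)"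
         "- (sgn y * \<bar>y\<bar> powr (1 - \<alpha>)) \<le> \<bar>y\<bar> powr (1 - \<alpha>)" by (auto simp: sgn_if)
      ultimately have "sgn y * \<bar>y\<bar> powr (1 - \<alpha>) \<le> (8 * pi) powr (1 - \<alpha>)"
         "- (sgn y * \<bar>y\<bar> powr (1 - \<alpha>)) \<le> (8 * pi) powr (1 - \<alpha>)" by linarith+
      thus "sgn y * \<bar>y\<bar> powr (1 - \<alpha>) / (1 - \<alpha>) \<le> (8 * pi) powr (1 - \<alpha>) / (1 - \<alpha>)"
      "- (sgn y * \<bar>y\<bar> powr (1 - \<alpha>) / (1 - \<alpha>)) \<le> (8 * pi) powr (1 - \<alpha>) / (1 - \<alpha>)"
        unfolding minus_divide_left using \<alpha> by (intro divide_right_mono; simp)+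
    qed
    have "k = -1 \<or> k = 0 \<or> k = 1 \<or> k = 2 \<or> k = 3" using that by auto
    hence "\<bar>t + of_int k * pi\<bar> \<le> 4 * pi" using that by auto
    hence "\<bar>2 * pi - (t + k * pi)\<bar> \<le> 8 * pi" "\<bar>0 - (t + k * pi)\<bar> \<le> 8 * pi" by linarith+
    from sgn_le(1)[OF this(1)] sgn_le(2)[OF this(2)] show ?thesis
      unfolding I_def B_def by (simp add: field_simps)
  qed
  define C where "C = max 1 (2 * (5 * B) / (2 * pi))"
  show thesis
  proof (rule that[of C])
    show "C > 0" unfolding C_def by simp
    fix r :: real and a :: complex assume r: "r > 0" and a: "norm a \<noteq> r"
    define t where "t = Arg a"
    have t: "t \<in> {-pi..pi}" using Arg_bounded[of a] by (auto simp: t_def)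
    have at: "a = of_real (norm a) * cis t" by (metis t_def rcis_cmod_Arg rcis_def)
    define g where "g = (\<lambda>\<theta>. norm (of_real r * cis \<theta> - a) powr (-\<alpha>))"
    \<comment> \<open>Since \<theta> - t lies in [-pi, 3 pi], the nearest multiple of pi has index
      between -1 and 3. Summing over all five candidates gives one majorant for the whole
      circle.\<close>
    define h where "h = (\<lambda>\<theta>. r powr (-\<alpha>) * (2 * (\<Sum>k\<in>{-1..3::int}. \<bar>\<theta> - (t + of_int k * pi)\<bar> powr (-\<alpha>))))"
    define S where "S = (\<lambda>k::int. t + of_int k * pi) ` {-1..3}"
    have gh: "g \<theta> \<le> h \<theta>" if \<theta>: "\<theta> \<in> {0..2*pi} - S" for \<theta>
    proof -
      define k where "k = \<lfloor>(\<theta> - t) / pi + 1/2\<rfloor>"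
      have k: "\<bar>\<theta> - (t + of_int k * pi)\<bar> \<le> pi / 2"
      proof -
        have "of_int k \<le> (\<theta> - t) / pi + 1/2" "(\<theta> - t) / pi + 1/2 < of_int k + 1"
          unfolding k_def by linarith+
        hence "(of_int k - 1/2) * pi \<le> (\<theta> - t) / pi * pi" "(\<theta> - t) / pi * pi \<le> (of_int k + 1/2) * pi"
          by (intro mult_right_mono; simp)+
        hence "(of_int k - 1/2) * pi \<le> \<theta> - t" "\<theta> - t \<le> (of_int k + 1/2) * pi" by simp_all
        thus ?thesis unfolding abs_le_iff left_diff_distrib distrib_right by linarith
      qed
      have "-2 * pi < of_int k * pi" "of_int k * pi < 4 * pi"
        using k \<theta> t pi_gt_zero unfolding abs_le_iff atLeastAtMost_iff Diff_iff by linarith+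
      hence "-2 < (of_int k :: real)" "of_int k < (4 :: real)"
        by (simp_all only: mult_less_cancel_right_pos[OF pi_gt_zero])
      hence k3: "k \<in> {-1..3}" by auto
      have ne: "\<theta> - (t + of_int k * pi) \<noteq> 0" using \<theta> k3 by (auto simp: S_def)
      define y where "y = \<theta> - (t + of_int k * pi)"
      have "\<bar>sin (\<theta> - t)\<bar> = \<bar>sin (y + of_int k * pi)\<bar>" by (simp add: y_def algebra_simps)
      also have "\<dots> = \<bar>sin y\<bar>" by (simp add: sin_add abs_mult mult.commute[of _ pi])
      finally have sy: "\<bar>sin (\<theta> - t)\<bar> = \<bar>sin y\<bar>" .
      have "of_real r * cis \<theta> - a = cis t * (of_real r * cis (\<theta> - t) - of_real (norm a))"
        by (subst at) (simp add: algebra_simps cis_mult)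
      hence "norm (of_real r * cis \<theta> - a) = norm (of_real r * cis (\<theta> - t) - of_real (norm a))"
        by (simp add: norm_mult)
      also have "\<dots> \<ge> \<bar>Im (of_real r * cis (\<theta> - t) - of_real (norm a))\<bar>" by (rule abs_Im_le_cmod)
      also have "\<bar>Im (of_real r * cis (\<theta> - t) - of_real (norm a))\<bar> = r * \<bar>sin y\<bar>"
        using r by (simp add: abs_mult sy)
      finally have "r * \<bar>sin y\<bar> \<le> norm (of_real r * cis \<theta> - a)" .
      moreover have "r * (\<bar>y\<bar> / 2) \<le> r * \<bar>sin y\<bar>"
        using abs_sin_ge_half[of y] k r by (simp add: y_def)
      ultimately have ge: "r * (\<bar>y\<bar> / 2) \<le> norm (of_real r * cis \<theta> - a)" by linarith
      have y0: "\<bar>y\<bar> > 0" using ne by (simp add: y_def)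
      have "g \<theta> \<le> (r * (\<bar>y\<bar> / 2)) powr (-\<alpha>)"
        unfolding g_def using ge r y0 \<alpha> by (intro powr_mono2') auto
      also have "\<dots> = r powr (-\<alpha>) * (2 powr \<alpha> * \<bar>y\<bar> powr (-\<alpha>))"
        using r y0 by (simp add: powr_mult powr_divide powr_minus field_simps)
      also have "\<dots> \<le> r powr (-\<alpha>) * (2 * \<bar>y\<bar> powr (-\<alpha>))"
        using \<alpha> powr_mono[of \<alpha> 1 2] by (intro mult_left_mono mult_right_mono) auto
      also have "\<dots> \<le> h \<theta>"
      proof -
        have "\<bar>y\<bar> powr (-\<alpha>) \<le> (\<Sum>k\<in>{-1..3::int}. \<bar>\<theta> - (t + of_int k * pi)\<bar> powr (-\<alpha>))"
          unfolding y_def by (rule member_le_sum[OF k3]) auto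
        thus ?thesis unfolding h_def by (intro mult_left_mono) auto
      qed
      finally show ?thesis .
    qed
    have hint: "(h has_integral (r powr (-\<alpha>) * (2 * (\<Sum>k\<in>{-1..3}. I t k)))) {0..2*pi}"
      unfolding h_def by (intro has_integral_mult_right has_integral_sum I) auto
    \<comment> \<open>At a singular angle \<open>powr\<close> sends 0 to 0, so \<open>h\<close> need
      not dominate \<open>g\<close> there; it is replaced by \<open>g\<close> on this finite
      set.\<close>
    have "((\<lambda>\<theta>. if \<theta> \<in> S then g \<theta> else h \<theta>) has_integral (r powr (-\<alpha>) * (2 * (\<Sum>k\<in>{-1..3}. I t k)))) {0..2*pi}"
      by (rule has_integral_spike_finite[OF _ _ hint, of S]) (auto simp: S_def)
    moreover have "continuous_on (sphere 0 r) (\<lambda>z. norm (z - a) powr (-\<alpha>))"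
      by (intro continuous_intros) (use a in auto)
    hence "g integrable_on {0..2*pi}"
      unfolding g_def using integrable_circ[of r "\<lambda>z. norm (z - a) powr (-\<alpha>)"] r by simp
    ultimately have "integral {0..2*pi} g \<le> r powr (-\<alpha>) * (2 * (\<Sum>k\<in>{-1..3}. I t k))"
      by (intro has_integral_le[OF integrable_integral]) (use gh in auto)
    also have "\<dots> \<le> r powr (-\<alpha>) * (2 * (\<Sum>k\<in>{-1..3::int}. B))"
      by (intro mult_left_mono sum_mono IB t) auto
    also have "\<dots> = r powr (-\<alpha>) * (2 * (5 * B))" by simp
    finally have "circ_mean r (\<lambda>z. norm (z - a) powr (-\<alpha>)) \<le> (1/(2*pi)) * (r powr (-\<alpha>) * (2 * (5 * B)))"
      unfolding circ_mean_def g_def real_scaleR_def by (intro mult_left_mono) auto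
    also have "\<dots> = (2 * (5 * B) / (2 * pi)) * r powr (-\<alpha>)" by (simp add: field_simps)
    also have "\<dots> \<le> C * r powr (-\<alpha>)" unfolding C_def by (intro mult_right_mono) auto
    finally show "circ_mean r (\<lambda>z. norm (z - a) powr (-\<alpha>)) \<le> C * r powr (-\<alpha>)" .
  qed
qed

section \<open>Pole orders and counting functions\<close>

definition pole_ord :: "(complex \<Rightarrow> complex) \<Rightarrow> complex \<Rightarrow> nat" where
  "pole_ord f z = (if is_pole f z then nat (- zorder f z) else 0)"

lemma pole_ord_laurent:
  assumes "(\<lambda>w. f (z + w)) has_laurent_expansion F"
  shows "pole_ord f z = nat (- fls_subdegree F)"
proof (cases "is_pole f z")
  case True
  hence "fls_subdegree F < 0" using is_pole_fls_subdegree_iff[OF assms] by simp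
  hence "F \<noteq> 0" by auto
  thus ?thesis using True has_laurent_expansion_zorder[OF assms] by (simp add: pole_ord_def)
next
  case False
  thus ?thesis using is_pole_fls_subdegree_iff[OF assms] by (simp add: pole_ord_def)
qed

lemma pole_ord_cong:
  assumes "eventually (\<lambda>w. f w = g w) (at z)"
  shows "pole_ord f z = pole_ord g z"
  unfolding pole_ord_def using is_pole_cong[OF assms refl] zorder_cong[OF assms refl] by simp

lemma pole_ord_eq_0_iff:
  assumes "f meromorphic_on {z}"
  shows "pole_ord f z = 0 \<longleftrightarrow> \<not> is_pole f z"
proof -
  obtain F where F: "(\<lambda>w. f (z + w)) has_laurent_expansion F"
    using assms by (auto simp: meromorphic_on_def)
  show ?thesis using pole_ord_laurent[OF F] is_pole_fls_subdegree_iff[OF F] by auto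
qed

lemma pole_ord_analytic: "f analytic_on {z} \<Longrightarrow> pole_ord f z = 0"
  by (simp add: pole_ord_def analytic_at_imp_no_pole)

lemma pole_ord_const [simp]: "pole_ord (\<lambda>_. c) z = 0"
  by (simp add: pole_ord_def)

lemma pole_ord_add_le:
  assumes "f meromorphic_on {z}" "g meromorphic_on {z}"
  shows "pole_ord (\<lambda>w. f w + g w) z \<le> max (pole_ord f z) (pole_ord g z)"
proof -
  obtain F G where F: "(\<lambda>w. f (z + w)) has_laurent_expansion F"
    and G: "(\<lambda>w. g (z + w)) has_laurent_expansion G"
    using assms by (auto simp: meromorphic_on_def)
  have "(\<lambda>w. f (z + w) + g (z + w)) has_laurent_expansion F + G"
    by (intro laurent_expansion_intros F G)
  from pole_ord_laurent[OF this] pole_ord_laurent[OF F] pole_ord_laurent[OF G] show ?thesis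
    using fls_plus_subdegree[of F G] by (cases "F + G = 0") auto
qed

lemma pole_ord_uminus [simp]: "pole_ord (\<lambda>w. - f w) z = pole_ord f z"
  by (simp add: pole_ord_def)

lemma pole_ord_diff_le:
  assumes "f meromorphic_on {z}" "g meromorphic_on {z}"
  shows "pole_ord (\<lambda>w. f w - g w) z \<le> max (pole_ord f z) (pole_ord g z)"
  using pole_ord_add_le[OF assms(1), of "\<lambda>w. - g w"] assms(2) by (simp add: meromorphic_on_uminus)

lemma pole_ord_mult_le:
  assumes "f meromorphic_on {z}" "g meromorphic_on {z}"
  shows "pole_ord (\<lambda>w. f w * g w) z \<le> pole_ord f z + pole_ord g z"
proof -
  obtain F G where F: "(\<lambda>w. f (z + w)) has_laurent_expansion F"
    and G: "(\<lambda>w. g (z + w)) has_laurent_expansion G"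
    using assms by (auto simp: meromorphic_on_def)
  have "(\<lambda>w. f (z + w) * g (z + w)) has_laurent_expansion F * G"
    by (intro laurent_expansion_intros F G)
  from pole_ord_laurent[OF this] pole_ord_laurent[OF F] pole_ord_laurent[OF G] show ?thesis
    using fls_mult_subdegree_ge[of F G] by (cases "F * G = 0") auto
qed

lemma pole_ord_power_le:
  assumes "f meromorphic_on {z}"
  shows "pole_ord (\<lambda>w. f w ^ n) z \<le> n * pole_ord f z"
proof (induction n)
  case (Suc n)
  have "(\<lambda>w. f w ^ n) meromorphic_on {z}" by (intro meromorphic_intros assms)
  with Suc show ?case using pole_ord_mult_le[OF assms, of "\<lambda>w. f w ^ n"] by auto
qed auto

lemma pole_ord_sum_le:
  assumes "finite A" "\<And>i. i \<in> A \<Longrightarrow> f i meromorphic_on {z}"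
  shows "pole_ord (\<lambda>w. \<Sum>i\<in>A. f i w) z \<le> (\<Sum>i\<in>A. pole_ord (f i) z)"
  using assms
proof (induction A)
  case (insert i A)
  have "pole_ord (\<lambda>w. f i w + (\<Sum>i\<in>A. f i w)) z \<le> max (pole_ord (f i) z) (pole_ord (\<lambda>w. \<Sum>i\<in>A. f i w) z)"
    using insert by (intro pole_ord_add_le meromorphic_intros) auto
  thus ?case using insert by fastforce
qed auto

lemma deriv_translate: "(\<lambda>w. deriv f (z + w)) = deriv (\<lambda>w. f (z + w))"
  for f :: "complex \<Rightarrow> complex"
proof
  fix w
  show "deriv f (z + w) = deriv (\<lambda>w. f (z + w)) w"
    unfolding deriv_shift_0[of f "z + w"] deriv_shift_0[of "\<lambda>w. f (z + w)" w]
    by (simp add: o_def add.assoc)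
qed

text \<open>A pole of order n >= 1 becomes one of order n + 1 <= 2 n, and a point without pole stays
  so. The purely multiplicative form carries over to counting functions.\<close>

lemma pole_ord_deriv_le:
  assumes "f meromorphic_on {z}"
  shows "pole_ord (deriv f) z \<le> 2 * pole_ord f z"
proof -
  obtain F where F: "(\<lambda>w. f (z + w)) has_laurent_expansion F"
    using assms by (auto simp: meromorphic_on_def)
  have "(\<lambda>w. deriv f (z + w)) = deriv (\<lambda>w. f (z + w))"
    by (rule deriv_translate)
  hence F': "(\<lambda>w. deriv f (z + w)) has_laurent_expansion fls_deriv F"
    using has_laurent_expansion_deriv[OF F] by simp
  have "nat (- fls_subdegree (fls_deriv F)) \<le> 2 * nat (- fls_subdegree F)"
  proof (cases "fls_deriv F = 0")
    case False
    have "fls_subdegree (fls_deriv F) \<ge> fls_subdegree F - 1"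
      by (intro fls_subdegree_geI[OF False]) auto
    \<comment> \<open>In a derivative the coefficient of index -1 is always 0, and the lower ones
      come from vanishing coefficients of \<open>F\<close>.\<close>
    moreover have "fls_nth (fls_deriv F) k = 0" if "fls_subdegree F \<ge> 0" "k < 0" for k
      using that by (cases "k = -1") auto
    hence "fls_subdegree F \<ge> 0 \<longrightarrow> fls_subdegree (fls_deriv F) \<ge> 0"
      using fls_subdegree_geI[OF False] by blast
    ultimately show ?thesis by linarith
  qed auto
  thus ?thesis using pole_ord_laurent[OF F] pole_ord_laurent[OF F'] by simp
qed

lemma pole_ord_logderiv_le:
  assumes "f meromorphic_on {z}"
  shows "pole_ord (\<lambda>w. deriv f w / f w) z \<le> 1"
proof -
  obtain F where F: "(\<lambda>w. f (z + w)) has_laurent_expansion F"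
    using assms by (auto simp: meromorphic_on_def)
  have "(\<lambda>w. deriv f (z + w)) = deriv (\<lambda>w. f (z + w))"
    by (rule deriv_translate)
  hence F': "(\<lambda>w. deriv f (z + w)) has_laurent_expansion fls_deriv F"
    using has_laurent_expansion_deriv[OF F] by simp
  have Q: "(\<lambda>w. deriv f (z + w) / f (z + w)) has_laurent_expansion (fls_deriv F / F)"
    by (intro laurent_expansion_intros F F')
  have "nat (- fls_subdegree (fls_deriv F / F)) \<le> 1"
  proof (cases "fls_deriv F = 0 \<or> F = 0")
    case False
    have "fls_subdegree (fls_deriv F) \<ge> fls_subdegree F - 1"
      using False by (intro fls_subdegree_geI) (auto simp: fls_eq0_below_subdegree)
    thus ?thesis using False by (simp add: fls_divide_subdegree)
  qed auto
  thus ?thesis using pole_ord_laurent[OF Q] by simp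
qed

lemma pole_ord_shift: "pole_ord (\<lambda>w. f (w + c)) z = pole_ord f (z + c)"
proof -
  have "is_pole (\<lambda>w. f (w + c)) z \<longleftrightarrow> is_pole f (z + c)"
    using is_pole_shift_iff[of f c] by (simp add: o_def add_ac)
  moreover have "zorder (\<lambda>w. f (w + c)) z = zorder f (z + c)"
    using zorder_shift[of f "z + c"] zorder_shift[of "\<lambda>w. f (w + c)" z] by (simp add: add_ac)
  ultimately show ?thesis by (simp add: pole_ord_def)
qed

text \<open>Zeros are treated as poles of the inverse, so that a single notion of pole order and a
  single counting function serve both.\<close>

lemma zorder_eq_pole_ord:
  assumes "f meromorphic_on {z}" "eventually (\<lambda>w. f w \<noteq> 0) (at z)"
  shows "zorder f z = int (pole_ord (\<lambda>w. inverse (f w)) z) - int (pole_ord f z)"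
proof -
  obtain F where F: "(\<lambda>w. f (z + w)) has_laurent_expansion F"
    using assms by (auto simp: meromorphic_on_def)
  have F0: "F \<noteq> 0" using has_laurent_expansion_eventually_nonzero_iff[OF F] assms(2) by simp
  have "(\<lambda>w. inverse (f (z + w))) has_laurent_expansion inverse F"
    by (intro laurent_expansion_intros F)
  from pole_ord_laurent[OF this] pole_ord_laurent[OF F] has_laurent_expansion_zorder[OF F F0] show ?thesis
    using F0 by (simp add: fls_inverse_subdegree)
qed

lemma finite_poles:
  assumes "f meromorphic_on UNIV"
  shows "finite {z. norm z \<le> r \<and> is_pole f z}"
proof -
  have "{z. \<not> \<not> is_pole f z} sparse_in (UNIV :: complex set)"
    using meromorphic_on_imp_not_pole_cosparse[OF assms] by (simp add: eventually_cosparse)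
  from sparse_in_compact_finite[OF sparse_in_subset[OF this, of "cball 0 r"]]
  have "finite (cball 0 r \<inter> {z. is_pole f z})" by auto
  moreover have "cball 0 r \<inter> {z. is_pole f z} = {z. norm z \<le> r \<and> is_pole f z}" by auto
  ultimately show ?thesis by simp
qed

section \<open>Counting functions of locally finite multiplicities\<close>

definition loc_finite :: "(complex \<Rightarrow> nat) \<Rightarrow> bool" where
  "loc_finite \<nu> \<longleftrightarrow> (\<forall>r. finite {z. norm z \<le> r \<and> \<nu> z \<noteq> 0})"

text \<open>Poles in the unit disc are weighted as if they were on the unit circle; this changes the
  classical counting function by a bounded amount, but keeps it nonnegative for $r \ge 1$.\<close>

definition counting :: "(complex \<Rightarrow> nat) \<Rightarrow> real \<Rightarrow> real" where
  "counting \<nu> r = (\<Sum>z | norm z \<le> r \<and> \<nu> z \<noteq> 0. real (\<nu> z) * ln (r / max 1 (norm z)))"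

lemma loc_finite_pole_ord:
  assumes "f meromorphic_on UNIV"
  shows "loc_finite (pole_ord f)"
  unfolding loc_finite_def
  by (intro allI finite_subset[OF _ finite_poles[OF assms]]) (auto simp: pole_ord_def split: if_splits)

lemma loc_finite_mono: "loc_finite \<mu> \<Longrightarrow> (\<And>z. \<mu> z = 0 \<Longrightarrow> \<nu> z = 0) \<Longrightarrow> loc_finite \<nu>"
  unfolding loc_finite_def
proof (intro allI)
  fix r assume a: "\<forall>r. finite {z. norm z \<le> r \<and> \<mu> z \<noteq> 0}" "\<And>z. \<mu> z = 0 \<Longrightarrow> \<nu> z = 0"
  show "finite {z. norm z \<le> r \<and> \<nu> z \<noteq> 0}"
    by (rule finite_subset[OF _ a(1)[rule_format, of r]]) (rule Collect_mono, use a(2) in metis)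
qed

lemma loc_finite_add: "loc_finite \<mu> \<Longrightarrow> loc_finite \<nu> \<Longrightarrow> loc_finite (\<lambda>z. \<mu> z + \<nu> z)"
proof (unfold loc_finite_def, intro allI)
  fix r assume a: "\<forall>r. finite {z. norm z \<le> r \<and> \<mu> z \<noteq> 0}" "\<forall>r. finite {z. norm z \<le> r \<and> \<nu> z \<noteq> 0}"
  have "{z. norm z \<le> r \<and> \<mu> z + \<nu> z \<noteq> 0} \<subseteq> {z. norm z \<le> r \<and> \<mu> z \<noteq> 0} \<union> {z. norm z \<le> r \<and> \<nu> z \<noteq> 0}" by auto
  thus "finite {z. norm z \<le> r \<and> \<mu> z + \<nu> z \<noteq> 0}" using a finite_subset by blast
qed

lemma counting_eq_sum:
  assumes "finite A" "{z. norm z \<le> r \<and> \<nu> z \<noteq> 0} \<subseteq> A" "\<And>z. z \<in> A \<Longrightarrow> norm z \<le> r"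
  shows "counting \<nu> r = (\<Sum>z\<in>A. real (\<nu> z) * ln (r / max 1 (norm z)))"
  unfolding counting_def by (rule sum.mono_neutral_left) (use assms in auto)

lemma counting_term_nonneg:
  assumes "r \<ge> 1" "norm z \<le> r"
  shows "ln (r / max 1 (norm z)) \<ge> 0"
proof -
  have "1 \<le> r / max 1 (norm z)" using assms by (subst le_divide_eq_1_pos) auto
  thus ?thesis by (rule ln_ge_zero)
qed

lemma counting_nonneg: "r \<ge> 1 \<Longrightarrow> counting \<nu> r \<ge> 0"
  unfolding counting_def by (intro sum_nonneg mult_nonneg_nonneg counting_term_nonneg) auto

lemma counting_mono:
  assumes "loc_finite \<mu>" "\<And>z. \<nu> z \<le> \<mu> z" "r \<ge> 1"
  shows "counting \<nu> r \<le> counting \<mu> r"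
proof -
  let ?A = "{z. norm z \<le> r \<and> \<mu> z \<noteq> 0}"
  have "finite ?A" using assms(1) by (simp add: loc_finite_def)
  moreover have "{z. norm z \<le> r \<and> \<nu> z \<noteq> 0} \<subseteq> ?A" using assms(2) by (metis (mono_tags, lifting) Collect_mono_iff le_zero_eq)
  ultimately have "counting \<nu> r = (\<Sum>z\<in>?A. real (\<nu> z) * ln (r / max 1 (norm z)))"
    by (intro counting_eq_sum) auto
  also have "\<dots> \<le> counting \<mu> r" unfolding counting_def
    by (intro sum_mono mult_right_mono counting_term_nonneg) (use assms in auto)
  finally show ?thesis .
qed

lemma counting_add:
  assumes "loc_finite \<mu>" "loc_finite \<nu>"
  shows "counting (\<lambda>z. \<mu> z + \<nu> z) r = counting \<mu> r + counting \<nu> r"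
proof -
  let ?A = "{z. norm z \<le> r \<and> \<mu> z + \<nu> z \<noteq> 0}"
  have "finite ?A" using loc_finite_add[OF assms] by (simp add: loc_finite_def)
  hence "counting \<mu> r = (\<Sum>z\<in>?A. real (\<mu> z) * ln (r / max 1 (norm z)))"
    "counting \<nu> r = (\<Sum>z\<in>?A. real (\<nu> z) * ln (r / max 1 (norm z)))"
    by (intro counting_eq_sum; auto)+
  thus ?thesis unfolding counting_def[of "\<lambda>z. \<mu> z + \<nu> z"] by (simp add: sum.distrib algebra_simps)
qed

lemma counting_cmult: "counting (\<lambda>z. n * \<nu> z) r = real n * counting \<nu> r"
  by (cases "n = 0") (auto simp: counting_def sum_distrib_left mult_ac)

text \<open>In the counting function at \<open>R\<close> each point of the smaller disc has weight
  at least ln (R/r), and ln (R/r) >= (R-r)/R.\<close>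

lemma sum_le_counting:
  assumes "loc_finite \<nu>" "1 \<le> r" "r < R"
  shows "(\<Sum>z | norm z \<le> r \<and> \<nu> z \<noteq> 0. real (\<nu> z)) \<le> R / (R - r) * counting \<nu> R"
proof -
  have "(\<Sum>z | norm z \<le> r \<and> \<nu> z \<noteq> 0. real (\<nu> z)) * ((R - r) / R)
     = (\<Sum>z | norm z \<le> r \<and> \<nu> z \<noteq> 0. real (\<nu> z) * ((R - r) / R))"
    by (rule sum_distrib_right)
  also have "\<dots> \<le> (\<Sum>z | norm z \<le> r \<and> \<nu> z \<noteq> 0. real (\<nu> z) * ln (R / max 1 (norm z)))"
  proof (intro sum_mono mult_left_mono)
    fix z assume z: "z \<in> {z. norm z \<le> r \<and> \<nu> z \<noteq> 0}"
    have "(R - r) / R \<le> - ln (r / R)" using ln_le_minus_one[of "r / R"] assms by (simp add: field_simps)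
    also have "\<dots> = ln (R / r)" using assms by (simp add: ln_div)
    also have "\<dots> \<le> ln (R / max 1 (norm z))" using z assms by (simp add: frac_le)
    finally show "(R - r) / R \<le> ln (R / max 1 (norm z))" .
  qed auto
  also have "\<dots> \<le> counting \<nu> R" unfolding counting_def
    using assms by (intro sum_mono2 mult_nonneg_nonneg counting_term_nonneg) (auto simp: loc_finite_def)
  finally show ?thesis using assms by (simp add: field_simps)
qed

text \<open>The function ln x - (1+C) ln (x+C) does not increase for x >= 1, because x + C <= (1+C)
  x. As a result a translation by C costs only a constant factor in the counting function, with no
  additive term that would involve the number of points.\<close>

lemma ln_ratio_shift_le:
  fixes s r C :: real
  assumes s: "1 \<le> s" "s \<le> r" and C: "C \<ge> 0"
  shows "ln (r / s) \<le> (1 + C) * ln ((r + C) / (s + C))"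
proof -
  have "ln r - (1 + C) * ln (r + C) \<le> ln s - (1 + C) * ln (s + C)"
  proof (rule DERIV_nonpos_imp_nonincreasing[OF s(2)])
    fix x assume x: "s \<le> x" "x \<le> r"
    have x1: "x \<ge> 1" using x s by simp
    have "((\<lambda>x. ln x - (1 + C) * ln (x + C)) has_real_derivative (1 / x - (1 + C) * (1 / (x + C)))) (at x)"
      by (rule derivative_eq_intros refl | use x1 C in simp)+
    moreover have "1 / x \<le> (1 + C) / (x + C)"
    proof (subst frac_le_eq)
      have "1 * (x + C) - (1 + C) * x = C - C * x" by (simp add: algebra_simps)
      also have "\<dots> \<le> 0" using mult_left_mono[OF x1 C] by simp
      finally show "(1 * (x + C) - (1 + C) * x) / (x * (x + C)) \<le> 0"
        using x1 C by (intro divide_nonpos_pos) auto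
    qed (use x1 C in auto)
    hence "1 / x - (1 + C) * (1 / (x + C)) \<le> 0" by simp
    ultimately show "\<exists>y. ((\<lambda>x. ln x - (1 + C) * ln (x + C)) has_real_derivative y) (at x) \<and> y \<le> 0"
      by (intro exI conjI)
  qed
  moreover have "ln (r / s) = ln r - ln s" using s by (intro ln_divide_pos) auto
  moreover have "ln ((r + C) / (s + C)) = ln (r + C) - ln (s + C)" using s C by (intro ln_divide_pos) auto
  ultimately show ?thesis by (simp only: right_diff_distrib)
qed

lemma counting_shift_le:
  assumes "loc_finite \<nu>" "r \<ge> 1"
  shows "counting (\<lambda>z. \<nu> (z + c)) r \<le> (1 + norm c) * counting \<nu> (r + norm c)"
proof -
  let ?A = "{z. norm z \<le> r \<and> \<nu> (z + c) \<noteq> 0}" and ?B = "{z. norm z \<le> r + norm c \<and> \<nu> z \<noteq> 0}"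
  have sub: "(\<lambda>z. z + c) ` ?A \<subseteq> ?B"
  proof
    fix w assume "w \<in> (\<lambda>z. z + c) ` ?A"
    then obtain z where z: "z \<in> ?A" "w = z + c" by blast
    thus "w \<in> ?B" using norm_triangle_ineq[of z c] by simp
  qed
  have finB: "finite ?B" using assms(1) by (simp add: loc_finite_def)
  have "counting (\<lambda>z. \<nu> (z + c)) r \<le> (\<Sum>z\<in>?A. (1 + norm c) * (real (\<nu> (z + c)) * ln ((r + norm c) / max 1 (norm (z + c)))))"
    unfolding counting_def
  proof (intro sum_mono)
    fix z assume z: "z \<in> ?A"
    define s where "s = max 1 (norm z)"
    have s: "1 \<le> s" "s \<le> r" using z assms by (auto simp: s_def)
    define C where "C = norm c"
    have C: "C \<ge> 0" by (simp add: C_def)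
    have "ln (r / s) \<le> (1 + C) * ln ((r + C) / (s + C))"
      by (rule ln_ratio_shift_le[OF s C])
    also have "\<dots> \<le> (1 + C) * ln ((r + C) / max 1 (norm (z + c)))"
    proof -
      have "max 1 (norm (z + c)) \<le> s + C"
        using norm_triangle_ineq[of z c] C s(1) max.cobounded2[of 1 "norm z"]
        unfolding s_def C_def by (intro max.boundedI) linarith+
      hence "(r + C) / (s + C) \<le> (r + C) / max 1 (norm (z + c))"
        using C s by (intro frac_le) linarith+
      moreover have "0 < (r + C) / (s + C)" using C s by simp
      ultimately have "ln ((r + C) / (s + C)) \<le> ln ((r + C) / max 1 (norm (z + c)))"
        by (intro ln_mono)
      thus ?thesis using C by (intro mult_left_mono) linarith+
    qed
    finally have "ln (r / s) \<le> (1 + C) * ln ((r + C) / max 1 (norm (z + c)))" .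
    from mult_left_mono[OF this, of "real (\<nu> (z + c))"]
    show "real (\<nu> (z + c)) * ln (r / max 1 (norm z)) \<le> (1 + norm c) * (real (\<nu> (z + c)) * ln ((r + norm c) / max 1 (norm (z + c))))"
      by (simp add: s_def C_def mult_ac)
  qed
  also have "\<dots> = (1 + norm c) * (\<Sum>z\<in>(\<lambda>z. z + c) ` ?A. (real (\<nu> z) * ln ((r + norm c) / max 1 (norm z))))"
    by (subst sum.reindex) (auto simp: inj_on_def sum_distrib_left)
  also have "\<dots> \<le> (1 + norm c) * counting \<nu> (r + norm c)"
    unfolding counting_def using add_increasing2[OF norm_ge_zero[of c] assms(2)]
    by (intro mult_left_mono sum_mono2[OF finB sub] mult_nonneg_nonneg counting_term_nonneg) auto
  finally show ?thesis .
qed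

section \<open>Blaschke factorisation and Jensen's formula\<close>

definition blaschke :: "real \<Rightarrow> complex \<Rightarrow> complex \<Rightarrow> complex" where
  "blaschke R a z = of_real R * (z - a) / (of_real (R\<^sup>2) - cnj a * z)"

lemma blaschke_denom_nz:
  assumes "norm a < R" "norm z \<le> R"
  shows "of_real (R\<^sup>2) - cnj a * z \<noteq> 0"
proof
  assume "of_real (R\<^sup>2) - cnj a * z = 0"
  hence "norm (of_real (R\<^sup>2) :: complex) = norm (cnj a * z)" by simp
  hence "R\<^sup>2 = norm a * norm z" by (simp only: norm_mult norm_of_real complex_mod_cnj) simp
  moreover have "R > 0" using assms(1) norm_ge_zero[of a] by linarith
  ultimately have "R * R \<le> norm a * R" using assms(2) by (simp add: power2_eq_square mult_left_mono)
  thus False using assms(1) \<open>R > 0\<close> by simp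
qed

lemma norm_blaschke_boundary:
  assumes "norm a < R" "norm z = R"
  shows "norm (blaschke R a z) = 1"
proof -
  have zz: "z * cnj z = of_real (R\<^sup>2)" using assms(2) by (simp add: complex_norm_square[symmetric])
  have "of_real (R\<^sup>2) - cnj a * z = z * cnj (z - a)" by (simp only: zz[symmetric]) (simp add: algebra_simps)
  hence "norm (of_real (R\<^sup>2) - cnj a * z) = R * norm (z - a)"
    using assms by (simp only: norm_mult complex_mod_cnj)
  moreover have "z \<noteq> a" "R > 0" using assms norm_ge_zero[of a] by (auto simp del: norm_ge_zero)
  ultimately show ?thesis unfolding blaschke_def by (simp add: norm_divide norm_mult)
qed

lemma blaschke_nz:
  assumes "norm a < R" "norm z \<le> R" "z \<noteq> a"
  shows "blaschke R a z \<noteq> 0"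
proof -
  have "R > 0" using assms(1) norm_ge_zero[of a] by linarith
  thus ?thesis using blaschke_denom_nz[OF assms(1,2)] assms(3) by (auto simp: blaschke_def)
qed

lemma blaschke_analytic:
  assumes "norm a < R" "norm z \<le> R"
  shows "blaschke R a analytic_on {z}"
  unfolding blaschke_def using blaschke_denom_nz[OF assms]
  by (intro analytic_intros) auto

text \<open>On such a circle ln |y| is continuous, so means of it exist without any discussion of
  integrability at zeros and poles. For a meromorphic y that does not vanish identically all but
  countably many radii qualify.\<close>

definition regular_radius :: "(complex \<Rightarrow> complex) \<Rightarrow> real \<Rightarrow> bool" where
  "regular_radius y r \<longleftrightarrow> (\<forall>z. norm z = r \<longrightarrow> y analytic_on {z} \<and> y z \<noteq> 0)"

definition zero_pole_set :: "(complex \<Rightarrow> complex) \<Rightarrow> real \<Rightarrow> complex set" where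
  "zero_pole_set y R = {z. norm z \<le> R \<and> pole_ord y z + pole_ord (\<lambda>w. inverse (y w)) z \<noteq> 0}"

lemma finite_zero_pole_set:
  assumes "y meromorphic_on UNIV"
  shows "finite (zero_pole_set y R)"
proof -
  have "loc_finite (\<lambda>z. pole_ord y z + pole_ord (\<lambda>w. inverse (y w)) z)"
    by (intro loc_finite_add loc_finite_pole_ord meromorphic_intros assms)
  thus ?thesis unfolding loc_finite_def zero_pole_set_def by blast
qed

lemma pole_ords_regular:
  assumes "y analytic_on {z}" "y z \<noteq> 0"
  shows "pole_ord y z = 0" "pole_ord (\<lambda>w. inverse (y w)) z = 0"
  using assms by (auto intro!: pole_ord_analytic analytic_intros)

lemma zero_pole_set_interior:
  assumes "regular_radius y R" "a \<in> zero_pole_set y R"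
  shows "norm a < R"
  using assms pole_ords_regular[of y a] unfolding regular_radius_def zero_pole_set_def by force

text \<open>Dividing out the Blaschke factors leaves a function with removable singularities and
  without zeros on the closed disc. The disc is contractible, so this function has a holomorphic
  logarithm. The identity is claimed only at regular points because the value given to
  \<open>y\<close> at a pole is arbitrary.\<close>

lemma Blaschke_factorisation:
  assumes mero: "y meromorphic_on UNIV" and nz: "\<forall>\<^sub>\<approx>z. y z \<noteq> 0" and reg: "regular_radius y R"
  obtains u where "u holomorphic_on cball 0 R"
    "\<And>z. norm z \<le> R \<Longrightarrow> y analytic_on {z} \<Longrightarrow> y z \<noteq> 0 \<Longrightarrow>
       y z = exp (u z) * (\<Prod>a\<in>zero_pole_set y R. blaschke R a z powi zorder y a)"
proof -
  define S where "S = zero_pole_set y R"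
  have finS: "finite S" unfolding S_def by (rule finite_zero_pole_set[OF mero])
  have Sint: "norm a < R" if "a \<in> S" for a using zero_pole_set_interior[OF reg] that unfolding S_def .
  define q where "q = (\<lambda>z. y z * (\<Prod>a\<in>S. blaschke R a z powi (- zorder y a)))"
  have evnz: "eventually (\<lambda>w. y w \<noteq> 0) (at z)" for z
    using nz by (rule eventually_cosparse_imp_eventually_at) auto
  have mz: "y meromorphic_on {z}" for z using mero by (rule meromorphic_on_subset) auto
  have Pan: "(\<lambda>w. \<Prod>a\<in>A. blaschke R a w powi (- zorder y a)) analytic_on {z}"
    "(\<Prod>a\<in>A. blaschke R a z powi (- zorder y a)) \<noteq> 0"
    if "norm z \<le> R" "A \<subseteq> S" "z \<notin> A" for z A
  proof -
    have fA: "finite A" using finS that finite_subset by blast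
    have nzb: "blaschke R a z \<noteq> 0" if "a \<in> A" for a
      using \<open>A \<subseteq> S\<close> \<open>z \<notin> A\<close> that \<open>norm z \<le> R\<close> Sint[of a] by (intro blaschke_nz) auto
    show "(\<lambda>w. \<Prod>a\<in>A. blaschke R a w powi (- zorder y a)) analytic_on {z}"
      using that nzb Sint by (intro analytic_intros blaschke_analytic) auto
    show "(\<Prod>a\<in>A. blaschke R a z powi (- zorder y a)) \<noteq> 0"
      using fA nzb by (simp add: prod_zero_iff power_int_eq_0_iff)
  qed
  have loc: "\<exists>h. h analytic_on {z} \<and> h z \<noteq> 0 \<and> (\<forall>\<^sub>F w in at z. q w = h w)" if z: "norm z \<le> R" for z
  proof -
    define n where "n = zorder y z"
    have iso: "isolated_singularity_at y z" "not_essential y z" using mz[of z] by (auto simp: meromorphic_at_iff)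
    obtain r where r: "r > 0" "zor_poly y z holomorphic_on cball z r" "zor_poly y z z \<noteq> 0"
      and eq: "\<forall>w\<in>cball z r - {z}. y w = zor_poly y z w * (w - z) powi n \<and> zor_poly y z w \<noteq> 0"
      using zorder_exist[OF iso eventually_frequently[OF _ evnz]] unfolding n_def by auto
    define g where "g = zor_poly y z"
    have gan: "g analytic_on {z}"
      using r by (auto simp: analytic_at_ball g_def intro!: exI[of _ r] elim: holomorphic_on_subset)
    have geq: "\<forall>\<^sub>F w in at z. y w = g w * (w - z) powi n"
      unfolding eventually_at using r eq by (auto intro!: exI[of _ r] simp: g_def dist_commute)
    show ?thesis
    proof (cases "z \<in> S")
      case True
      have zR: "norm z < R" using Sint True by auto
      hence R0: "R > 0" using norm_ge_zero[of z] by linarith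
      \<comment> \<open>The zero or pole of \<open>y\<close> at z cancels against the power
        (w-z)^(-n) inside the Blaschke factor of z; \<open>h\<close> is the remaining product, which
        is analytic and nonzero at z.\<close>
      define h where "h = (\<lambda>w. g w * ((of_real R / (of_real (R\<^sup>2) - cnj z * w)) powi (- n) *
         (\<Prod>a\<in>S-{z}. blaschke R a w powi (- zorder y a))))"
      have d: "of_real (R\<^sup>2) - cnj z * z \<noteq> 0" using blaschke_denom_nz[OF zR z] .
      have han: "h analytic_on {z}"
        unfolding h_def using d R0
        by (intro analytic_on_mult gan Pan(1)[OF z] analytic_on_power_int analytic_on_divide analytic_on_diff
            analytic_on_const analytic_on_ident) auto
      have hz: "h z \<noteq> 0"
        unfolding h_def using d R0 Pan(2)[OF z, of "S - {z}"] r(3) by (simp add: g_def power_int_eq_0_iff)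
      have "\<forall>\<^sub>F w in at z. q w = h w"
        using geq eventually_neq_at_within[of z z UNIV]
      proof eventually_elim
        case (elim w)
        have "(\<Prod>a\<in>S. blaschke R a w powi (- zorder y a)) =
          blaschke R z w powi (- n) * (\<Prod>a\<in>S-{z}. blaschke R a w powi (- zorder y a))"
          using True finS by (simp add: prod.remove[of S z] n_def)
        moreover have "blaschke R z w = (w - z) * (of_real R / (of_real (R\<^sup>2) - cnj z * w))"
          by (simp add: blaschke_def)
        moreover have "(w - z) powi n * (w - z) powi (- n) = 1"
          using elim by (simp add: power_int_minus)
        moreover have "g w * A * (A' * K * P) = A * A' * (g w * (K * P))" for A A' K P
          by (simp only: mult_ac)
        ultimately show ?case unfolding q_def h_def elim(1)
          by (simp only: power_int_mult_distrib mult_1_left)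
      qed
      thus ?thesis using han hz by blast
    next
      case False
      hence "pole_ord y z = 0" "pole_ord (\<lambda>w. inverse (y w)) z = 0" using z by (auto simp: S_def zero_pole_set_def)
      hence n0: "n = 0" unfolding n_def using zorder_eq_pole_ord[OF mz evnz] by simp
      define h where "h = (\<lambda>w. g w * (\<Prod>a\<in>S. blaschke R a w powi (- zorder y a)))"
      have "h analytic_on {z}" unfolding h_def using False by (intro analytic_on_mult gan Pan(1)[OF z]) auto
      moreover have "h z \<noteq> 0" unfolding h_def using Pan(2)[OF z, of S] False r(3) by (simp add: g_def)
      moreover have "\<forall>\<^sub>F w in at z. q w = h w"
        using geq by eventually_elim (simp add: q_def h_def n0)
      ultimately show ?thesis by blast
    qed
  qed
  define Q where "Q = remove_sings q"
  have Q: "Q analytic_on {z} \<and> Q z \<noteq> 0" if zR: "norm z \<le> R" for z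
  proof -
    obtain h where h: "h analytic_on {z}" "h z \<noteq> 0" "\<forall>\<^sub>F w in at z. q w = h w" using loc[OF zR] by blast
    have "q \<midarrow>z\<rightarrow> h z"
      using tendsto_cong[OF h(3)] analytic_at_imp_isCont[OF h(1)] by (simp add: isCont_def)
    moreover have "(\<lambda>w. \<Prod>a\<in>S. blaschke R a w powi (- zorder y a)) meromorphic_on {z}"
      using blaschke_analytic[OF Sint zR]
      by (intro meromorphic_intros) (auto intro!: analytic_on_imp_meromorphic_on)
    hence "q meromorphic_on {z}" unfolding q_def using mz by (intro meromorphic_on_mult)
    hence "isolated_singularity_at q z" by (simp add: meromorphic_at_iff)
    ultimately show ?thesis unfolding Q_def using remove_sings_analytic_at h(2) by (metis remove_sings_eqI)
  qed
  have "Q holomorphic_on cball 0 R"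
    using Q by (intro analytic_imp_holomorphic) (auto simp: analytic_on_analytic_at[of Q "cball 0 R"])
  moreover have "contractible (cball 0 R :: complex set)" by (intro convex_imp_contractible) auto
  ultimately obtain u where u: "u holomorphic_on cball 0 R" "\<And>z. z \<in> cball 0 R \<Longrightarrow> Q z = exp (u z)"
    using contractible_imp_holomorphic_log[of Q "cball 0 R"] Q by (metis mem_cball_0)
  show thesis
  proof (rule that[OF u(1)])
    fix z assume z: "norm z \<le> R" "y analytic_on {z}" "y z \<noteq> 0"
    have zS: "z \<notin> S" using pole_ords_regular[OF z(2,3)] by (simp add: S_def zero_pole_set_def)
    have "q analytic_on {z}" unfolding q_def using zS by (intro analytic_on_mult z(2) Pan(1)[OF z(1)]) auto
    hence "Q z = q z" unfolding Q_def by simp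
    hence "exp (u z) = y z * (\<Prod>a\<in>S. blaschke R a z powi (- zorder y a))"
      using u(2)[of z] z by (simp add: q_def)
    moreover have "(\<Prod>a\<in>S. blaschke R a z powi (- zorder y a)) * (\<Prod>a\<in>S. blaschke R a z powi zorder y a) = 1"
    proof -
      have "blaschke R a z powi (- zorder y a) * blaschke R a z powi zorder y a = 1" if "a \<in> S" for a
      proof -
        have "z \<noteq> a" using that zS by auto
        from blaschke_nz[OF Sint[OF that] z(1) this] show ?thesis by (simp add: power_int_minus)
      qed
      thus ?thesis by (simp add: prod.distrib[symmetric])
    qed
    ultimately show "y z = exp (u z) * (\<Prod>a\<in>zero_pole_set y R. blaschke R a z powi zorder y a)"
      unfolding S_def by (simp add: mult.assoc)
  qed
qed


text \<open>Logarithmic differentiation: the numerator contributes the pole at a, the denominator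
  the pole at the reflected point R^2 / cnj a outside the disc.\<close>

lemma DERIV_blaschke:
  assumes "norm a < R" "norm z \<le> R" "z \<noteq> a"
  shows "(blaschke R a has_field_derivative
     blaschke R a z * (1 / (z - a) + cnj a / (of_real (R\<^sup>2) - cnj a * z))) (at z)"
proof -
  define d where "d = of_real (R\<^sup>2) - cnj a * z"
  have d: "d \<noteq> 0" unfolding d_def by (rule blaschke_denom_nz[OF assms(1,2)])
  have "(blaschke R a has_field_derivative ((of_real R * d - of_real R * (z - a) * (- cnj a)) / (d * d))) (at z)"
    unfolding blaschke_def d_def by (rule derivative_eq_intros refl | use d in \<open>simp add: d_def\<close>)+
  also have "(of_real R * d - of_real R * (z - a) * (- cnj a)) / (d * d) = blaschke R a z * (1 / (z - a) + cnj a / d)"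
    unfolding blaschke_def d_def[symmetric] using d assms(3) by (simp add: field_simps)
  finally show ?thesis unfolding d_def .
qed

lemma DERIV_prod_logderiv:
  fixes f :: "'i \<Rightarrow> complex \<Rightarrow> complex"
  assumes "finite A" "\<And>a. a \<in> A \<Longrightarrow> (f a has_field_derivative f a z * d a) (at z)"
  shows "((\<lambda>w. \<Prod>a\<in>A. f a w) has_field_derivative (\<Prod>a\<in>A. f a z) * (\<Sum>a\<in>A. d a)) (at z)"
  using assms
proof (induction A)
  case (insert a A)
  have "((\<lambda>w. f a w * (\<Prod>a\<in>A. f a w)) has_field_derivative
      f a z * d a * (\<Prod>a\<in>A. f a z) + (\<Prod>a\<in>A. f a z) * (\<Sum>a\<in>A. d a) * f a z) (at z)"
    by (rule DERIV_mult) (use insert in auto)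
  thus ?case using insert(1,2) by (simp add: algebra_simps)
qed auto

lemma ln_power_int_real: "x > 0 \<Longrightarrow> ln (x powi n) = of_int n * ln x" for x :: real
  by (metis less_imp_le less_irrefl ln_powr powr_real_of_int')

lemma eventually_analytic_nhds:
  assumes "y analytic_on {z}"
  shows "eventually (\<lambda>w. y analytic_on {w}) (nhds z)"
proof -
  obtain s where s: "open s" "z \<in> s" "y holomorphic_on s" using assms by (auto simp: analytic_at)
  have "y analytic_on {w}" if "w \<in> s" for w using s that by (auto simp: analytic_at)
  thus ?thesis using s by (auto simp: eventually_nhds)
qed

text \<open>On the boundary every Blaschke factor has modulus 1, so Re u equals ln |y| there, and
  the Schwarz formula controls u by the boundary values of y. The other two equations are the
  logarithm and the logarithmic derivative of the factorisation.\<close>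

lemma Blaschke_log_factorisation:
  assumes mero: "y meromorphic_on UNIV" and nz: "\<forall>\<^sub>\<approx>z. y z \<noteq> 0" and reg: "regular_radius y R"
  obtains u where "u holomorphic_on cball 0 R"
    "\<And>z. norm z = R \<Longrightarrow> Re (u z) = ln (norm (y z))"
    "\<And>z. norm z < R \<Longrightarrow> y analytic_on {z} \<Longrightarrow> y z \<noteq> 0 \<Longrightarrow>
       ln (norm (y z)) = Re (u z) + (\<Sum>a\<in>zero_pole_set y R. of_int (zorder y a) * ln (norm (blaschke R a z)))"
    "\<And>z. norm z < R \<Longrightarrow> y analytic_on {z} \<Longrightarrow> y z \<noteq> 0 \<Longrightarrow>
       deriv y z / y z = deriv u z + (\<Sum>a\<in>zero_pole_set y R. of_int (zorder y a) *
          (1 / (z - a) + cnj a / (of_real (R\<^sup>2) - cnj a * z)))"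
proof -
  obtain u where u: "u holomorphic_on cball 0 R" and
    eq: "\<And>z. norm z \<le> R \<Longrightarrow> y analytic_on {z} \<Longrightarrow> y z \<noteq> 0 \<Longrightarrow>
       y z = exp (u z) * (\<Prod>a\<in>zero_pole_set y R. blaschke R a z powi zorder y a)"
    using Blaschke_factorisation[OF assms] by blast
  define S where "S = zero_pole_set y R"
  have finS: "finite S" unfolding S_def by (rule finite_zero_pole_set[OF mero])
  have Sint: "norm a < R" if "a \<in> S" for a using zero_pole_set_interior[OF reg] that unfolding S_def .
  have notS: "z \<noteq> a" if "y analytic_on {z}" "y z \<noteq> 0" "a \<in> S" for z a
    using pole_ords_regular[OF that(1,2)] that(3) by (auto simp: S_def zero_pole_set_def)
  have ln_eq: "ln (norm (y z)) = Re (u z) + (\<Sum>a\<in>S. of_int (zorder y a) * ln (norm (blaschke R a z)))"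
    if z: "norm z \<le> R" "y analytic_on {z}" "y z \<noteq> 0" for z
  proof -
    have b: "norm (blaschke R a z) > 0" if "a \<in> S" for a
      using blaschke_nz[OF Sint[OF that] z(1) notS[OF z(2,3) that]] by simp
    have "norm (y z) = exp (Re (u z)) * (\<Prod>a\<in>S. norm (blaschke R a z) powi zorder y a)"
      by (subst eq[OF z]) (simp add: norm_mult prod_norm[symmetric] norm_power_int S_def)
    also have "ln \<dots> = Re (u z) + (\<Sum>a\<in>S. ln (norm (blaschke R a z) powi zorder y a))"
      using b finS by (simp add: ln_mult_pos prod_pos ln_prod)
    also have "(\<Sum>a\<in>S. ln (norm (blaschke R a z) powi zorder y a)) = (\<Sum>a\<in>S. of_int (zorder y a) * ln (norm (blaschke R a z)))"
      using b by (intro sum.cong refl) (simp add: ln_power_int_real)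
    finally show ?thesis .
  qed
  show thesis
  proof (rule that[OF u])
    fix z :: complex assume z: "norm z = R"
    have r: "y analytic_on {z}" "y z \<noteq> 0" using reg z by (auto simp: regular_radius_def)
    have "norm (blaschke R a z) = 1" if "a \<in> S" for a using norm_blaschke_boundary[OF Sint[OF that] z] .
    thus "Re (u z) = ln (norm (y z))" using ln_eq[of z] r z by simp
  next
    fix z assume "norm z < R" "y analytic_on {z}" "y z \<noteq> 0"
    thus "ln (norm (y z)) = Re (u z) + (\<Sum>a\<in>zero_pole_set y R. of_int (zorder y a) * ln (norm (blaschke R a z)))"
      using ln_eq[of z] by (simp add: S_def)
  next
    fix z assume z: "norm z < R" "y analytic_on {z}" "y z \<noteq> 0"
    define d where "d = (\<lambda>a. of_int (zorder y a) * (1 / (z - a) + cnj a / (of_real (R\<^sup>2) - cnj a * z)))"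
    have "(u has_field_derivative deriv u z) (at z)"
      using u z(1) by (intro holomorphic_derivI[of _ "ball 0 R"]) (auto elim: holomorphic_on_subset)
    hence 1: "((\<lambda>w. exp (u w)) has_field_derivative exp (u z) * deriv u z) (at z)"
      by (rule DERIV_fun_exp)
    have 2: "((\<lambda>w. \<Prod>a\<in>S. blaschke R a w powi zorder y a) has_field_derivative
       (\<Prod>a\<in>S. blaschke R a z powi zorder y a) * (\<Sum>a\<in>S. d a)) (at z)"
    proof (rule DERIV_prod_logderiv[OF finS])
      fix a assume a: "a \<in> S"
      have nzb: "blaschke R a z \<noteq> 0" using blaschke_nz[OF Sint[OF a] less_imp_le[OF z(1)] notS[OF z(2,3) a]] .
      hence pw: "blaschke R a z powi (zorder y a - 1) * blaschke R a z = blaschke R a z powi zorder y a"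
        by (simp add: power_int_diff)
      have "of_int (zorder y a) * blaschke R a z powi (zorder y a - 1) *
          (blaschke R a z * (1 / (z - a) + cnj a / (of_real (R\<^sup>2) - cnj a * z)))
        = blaschke R a z powi zorder y a * d a"
        by (subst pw[symmetric]) (simp only: d_def mult_ac)
      thus "((\<lambda>w. blaschke R a w powi zorder y a) has_field_derivative blaschke R a z powi zorder y a * d a) (at z)"
        by (rule DERIV_cong[OF DERIV_power_int[OF DERIV_blaschke[OF Sint[OF a] less_imp_le[OF z(1)] notS[OF z(2,3) a]] disjI2[OF nzb]]])
    qed
    have 3: "((\<lambda>w. exp (u w) * (\<Prod>a\<in>S. blaschke R a w powi zorder y a)) has_field_derivative y z * (deriv u z + (\<Sum>a\<in>S. d a))) (at z)"
      using DERIV_mult[OF 1 2] eq[of z] z by (simp add: S_def algebra_simps)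
    have "eventually (\<lambda>w. y analytic_on {w}) (nhds z)" using z(2) by (rule eventually_analytic_nhds)
    moreover have "eventually (\<lambda>w. y w \<noteq> 0) (nhds z)"
      using analytic_at_imp_isCont[OF z(2)] z(3) by (simp add: isCont_def tendsto_imp_eventually_ne eventually_nhds_conv_at)
    moreover have "eventually (\<lambda>w. norm w < R) (nhds z)"
      using z(1) eventually_nhds_in_open[of "ball 0 R" z] by simp
    ultimately have "eventually (\<lambda>w. exp (u w) * (\<Prod>a\<in>S. blaschke R a w powi zorder y a) = y w) (nhds z)"
      by eventually_elim (use eq in \<open>simp add: S_def\<close>)
    from DERIV_cong_ev[OF refl this refl] 3
    have "(y has_field_derivative y z * (deriv u z + (\<Sum>a\<in>S. d a))) (at z)" by simp
    thus "deriv y z / y z = deriv u z + (\<Sum>a\<in>zero_pole_set y R. of_int (zorder y a) *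
          (1 / (z - a) + cnj a / (of_real (R\<^sup>2) - cnj a * z)))"
      using z(3) by (simp add: DERIV_imp_deriv d_def S_def)
  qed
qed

text \<open>The constant is $\log$ of the modulus of the leading Laurent coefficient at $0$, corrected for
  the zeros and poles in the unit disc.\<close>

lemma Jensen_formula:
  assumes mero: "y meromorphic_on UNIV" and nz: "\<forall>\<^sub>\<approx>z. y z \<noteq> 0"
  obtains C where "\<And>R. R \<ge> 1 \<Longrightarrow> regular_radius y R \<Longrightarrow>
    circ_mean R (\<lambda>z. ln (norm (y z))) =
      counting (pole_ord (\<lambda>w. inverse (y w))) R - counting (pole_ord y) R + C"
proof -
  have evnz: "eventually (\<lambda>w. y w \<noteq> 0) (at z)" for z
    using nz by (rule eventually_cosparse_imp_eventually_at) auto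
  have mz: "y meromorphic_on {z}" for z using mero by (rule meromorphic_on_subset) auto
  define m where "m = zorder y 0"
  have iso: "isolated_singularity_at y 0" "not_essential y 0" using mz[of 0] by (auto simp: meromorphic_at_iff)
  obtain r where r: "r > 0" "zor_poly y 0 holomorphic_on cball 0 r" "zor_poly y 0 0 \<noteq> 0"
    and eq: "\<forall>w\<in>cball 0 r - {0}. y w = zor_poly y 0 w * (w - 0) powi m \<and> zor_poly y 0 w \<noteq> 0"
    using zorder_exist[OF iso eventually_frequently[OF _ evnz]] unfolding m_def by auto
  define g where "g = zor_poly y 0"
  have gan: "g analytic_on {0}"
    using r by (auto simp: analytic_at_ball g_def intro!: exI[of _ r] elim: holomorphic_on_subset)
  define S1 where "S1 = zero_pole_set y 1"
  define n where "n = (\<lambda>a. of_int (zorder y a) :: real)"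
  define C where "C = ln (norm (g 0)) - (\<Sum>a\<in>S1-{0}. n a * ln (norm a / max 1 (norm a)))"
  show thesis
  proof (rule that[of C])
    fix R :: real assume R: "R \<ge> 1" and reg: "regular_radius y R"
    define S where "S = zero_pole_set y R"
    have finS: "finite S" unfolding S_def by (rule finite_zero_pole_set[OF mero])
    have Sint: "norm a < R" if "a \<in> S" for a using zero_pole_set_interior[OF reg] that unfolding S_def .
    obtain u where u: "u holomorphic_on cball 0 R" "\<And>z. norm z = R \<Longrightarrow> Re (u z) = ln (norm (y z))" and
     lneq: "\<And>z. norm z < R \<Longrightarrow> y analytic_on {z} \<Longrightarrow> y z \<noteq> 0 \<Longrightarrow>
       ln (norm (y z)) = Re (u z) + (\<Sum>a\<in>S. of_int (zorder y a) * ln (norm (blaschke R a z)))"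
      by (rule Blaschke_log_factorisation[OF mero nz reg, folded S_def]) (rule that)
    have m0: "m = 0" if "0 \<notin> S"
      using that R zorder_eq_pole_ord[OF mz evnz, of 0] by (auto simp: S_def zero_pole_set_def m_def)
    \<comment> \<open>The origin may itself be a zero or a pole of y. Both sides are compared at
      nearby points, where the terms m ln |w| cancel, and the limit at 0 is taken
      afterwards.\<close>
    have ev: "eventually (\<lambda>w. ln (norm (g w)) = Re (u w) + (\<Sum>a\<in>S-{0}. n a * ln (norm (blaschke R a w))) - of_int m * ln R) (at 0)"
    proof -
      have "eventually (\<lambda>w. y analytic_on {w}) (at 0)"
        by (intro eventually_cosparse_imp_eventually_at[OF meromorphic_on_imp_analytic_cosparse[OF mero]]) auto
      moreover have "eventually (\<lambda>w. w \<in> ball 0 (min r R) - {0}) (at (0::complex))"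
        using r R by (intro eventually_at_in_open) auto
      ultimately show ?thesis using evnz[of 0]
      proof eventually_elim
        case (elim w)
        have w: "norm w < R" "w \<noteq> 0" "w \<in> cball 0 r - {0}" using elim by auto
        have yw: "y w = g w * w powi m" "g w \<noteq> 0" using eq w(3) by (auto simp: g_def)
        have "ln (norm (y w)) = ln (norm (g w)) + of_int m * ln (norm w)"
          using w yw(2) unfolding yw(1) by (simp add: norm_mult norm_power_int ln_mult_pos ln_power_int_real)
        moreover have "(\<Sum>a\<in>S. n a * ln (norm (blaschke R a w))) =
            (\<Sum>a\<in>S-{0}. n a * ln (norm (blaschke R a w))) + of_int m * (ln (norm w) - ln R)"
        proof (cases "0 \<in> S")
          case True
          have "norm (blaschke R 0 w) = norm w / R"
            using R by (simp add: blaschke_def norm_mult norm_divide power2_eq_square)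
          hence "ln (norm (blaschke R 0 w)) = ln (norm w) - ln R" using R w by (simp add: ln_divide_pos)
          thus ?thesis using True finS by (simp add: sum.remove[of S 0] n_def m_def)
        next
          case False thus ?thesis using m0 by simp
        qed
        moreover have "ln (norm (y w)) = Re (u w) + (\<Sum>a\<in>S. n a * ln (norm (blaschke R a w)))"
          using lneq[OF w(1) elim(1,3)] by (simp add: n_def)
        ultimately show ?case by (simp add: algebra_simps)
      qed
    qed
    have bl0: "blaschke R a 0 = - a / of_real R" for a
      using R by (simp add: blaschke_def power2_eq_square)
    have lim1: "((\<lambda>w. ln (norm (g w))) \<longlongrightarrow> ln (norm (g 0))) (at 0)"
      using analytic_at_imp_isCont[OF gan] r(3) by (intro tendsto_intros) (auto simp: isCont_def g_def)
    have "isCont u 0" using R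
      by (intro continuous_on_interior[OF holomorphic_on_imp_continuous_on[OF u(1)]]) auto
    moreover have "isCont (blaschke R a) 0" if "a \<in> S" for a
      using analytic_at_imp_isCont[OF blaschke_analytic[OF Sint[OF that], of 0]] R by simp
    ultimately have lim2: "((\<lambda>w. Re (u w) + (\<Sum>a\<in>S-{0}. n a * ln (norm (blaschke R a w))) - of_int m * ln R) \<longlongrightarrow>
       Re (u 0) + (\<Sum>a\<in>S-{0}. n a * ln (norm (blaschke R a 0))) - of_int m * ln R) (at 0)"
      by (intro tendsto_intros) (use R in \<open>auto simp: isCont_def bl0\<close>)
    have g0: "ln (norm (g 0)) = Re (u 0) + (\<Sum>a\<in>S-{0}. n a * ln (norm (blaschke R a 0))) - of_int m * ln R"
      by (rule tendsto_unique[OF _ lim1 tendsto_cong[OF ev, THEN iffD2, OF lim2]]) simp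
    have u0: "Re (u 0) = ln (norm (g 0)) + (\<Sum>a\<in>S-{0}. n a * ln (R / norm a)) + of_int m * ln R"
    proof -
      have "(\<Sum>a\<in>S-{0}. n a * ln (norm (blaschke R a 0))) = - (\<Sum>a\<in>S-{0}. n a * ln (R / norm a))"
        unfolding sum_negf[symmetric] using R
        by (intro sum.cong refl) (auto simp: bl0 norm_divide ln_divide_pos algebra_simps)
      thus ?thesis using g0 by simp
    qed
    have "circ_mean R (\<lambda>z. ln (norm (y z))) = circ_mean R (\<lambda>z. Re (u z))"
      by (rule circ_mean_cong) (use u(2) R in auto)
    also have "\<dots> = Re (circ_mean R u)"
      by (rule circ_mean_linear[OF _ _ bounded_linear_Re])
         (use R holomorphic_on_imp_continuous_on[OF u(1)] in \<open>auto elim: continuous_on_subset\<close>)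
    also have "circ_mean R u = u 0" by (rule circ_mean_holomorphic[OF u(1)]) (use R in simp)
    also note u0
    finally have 1: "circ_mean R (\<lambda>z. ln (norm (y z))) = ln (norm (g 0)) + (\<Sum>a\<in>S-{0}. n a * ln (R / norm a)) + of_int m * ln R" .
    have "counting (pole_ord (\<lambda>w. inverse (y w))) R - counting (pole_ord y) R =
       (\<Sum>a\<in>S. real (pole_ord (\<lambda>w. inverse (y w)) a) * ln (R / max 1 (norm a))) - (\<Sum>a\<in>S. real (pole_ord y a) * ln (R / max 1 (norm a)))"
      by (intro arg_cong2[where f="(-)"] counting_eq_sum finS) (auto simp: S_def zero_pole_set_def)
    also have "\<dots> = (\<Sum>a\<in>S. n a * ln (R / max 1 (norm a)))"
      unfolding sum_subtractf[symmetric] n_def zorder_eq_pole_ord[OF mz evnz] by (simp add: algebra_simps)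
    also have "\<dots> = (\<Sum>a\<in>S-{0}. n a * ln (R / max 1 (norm a))) + of_int m * ln R"
      using finS m0 by (cases "0 \<in> S") (auto simp: sum.remove[of S 0] n_def m_def)
    also have "(\<Sum>a\<in>S-{0}. n a * ln (R / max 1 (norm a))) =
       (\<Sum>a\<in>S-{0}. n a * ln (R / norm a)) + (\<Sum>a\<in>S-{0}. n a * ln (norm a / max 1 (norm a)))"
      unfolding sum.distrib[symmetric]
    proof (intro sum.cong refl)
      fix a assume "a \<in> S - {0}"
      hence "norm a > 0" by simp
      moreover have "max 1 (norm a) > 0" by (simp add: less_max_iff_disj)
      ultimately have "ln (R / max 1 (norm a)) = ln (R / norm a) + ln (norm a / max 1 (norm a))"
        using R by (simp add: ln_divide_pos)
      thus "n a * ln (R / max 1 (norm a)) = n a * ln (R / norm a) + n a * ln (norm a / max 1 (norm a))"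
        by (simp only: distrib_left)
    qed
    \<comment> \<open>Points outside the unit disc contribute ln 1 = 0, so the correction does not
      depend on R.\<close>
    also have "(\<Sum>a\<in>S-{0}. n a * ln (norm a / max 1 (norm a))) = (\<Sum>a\<in>S1-{0}. n a * ln (norm a / max 1 (norm a)))"
      using R finS by (intro sum.mono_neutral_right) (auto simp: S_def S1_def zero_pole_set_def max_def)
    finally show "circ_mean R (\<lambda>z. ln (norm (y z))) =
      counting (pole_ord (\<lambda>w. inverse (y w))) R - counting (pole_ord y) R + C"
      using 1 by (simp add: C_def)
  qed
qed

section \<open>Logarithmic derivatives and logarithmic differences\<close>

text \<open>With s = x + y, each share t/s <= 1 satisfies t/s <= (t/s)^\<alpha>, and the shares of x
  and y add up to 1.\<close>

lemma powr_subadditive: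
  fixes x y \<alpha> :: real
  assumes "0 \<le> x" "0 \<le> y" "0 < \<alpha>" "\<alpha> \<le> 1"
  shows "(x + y) powr \<alpha> \<le> x powr \<alpha> + y powr \<alpha>"
proof (cases "x + y = 0")
  case True
  thus ?thesis using assms by simp
next
  case False
  define s where "s = x + y"
  have s: "s > 0" using False assms by (simp add: s_def)
  have *: "t / s * s powr \<alpha> \<le> t powr \<alpha>" if t: "0 \<le> t" "t \<le> s" for t
  proof (cases "t = 0")
    case False
    have "t / s \<le> (t / s) powr \<alpha>"
      using powr_mono'[of \<alpha> 1 "t / s"] assms s t False by simp
    hence "t / s * s powr \<alpha> \<le> (t / s) powr \<alpha> * s powr \<alpha>" by (intro mult_right_mono) auto
    also have "\<dots> = t powr \<alpha>" using s t by (simp add: powr_divide)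
    finally show ?thesis .
  qed simp
  have "s powr \<alpha> = x / s * s powr \<alpha> + y / s * s powr \<alpha>"
    using s by (simp add: s_def distrib_right[symmetric] add_divide_distrib[symmetric])
  also have "\<dots> \<le> x powr \<alpha> + y powr \<alpha>"
    using *[of x] *[of y] assms by (simp add: s_def add_mono)
  finally show ?thesis by (simp add: s_def)
qed

lemma powr_sum_subadditive:
  fixes f :: "'i \<Rightarrow> real"
  assumes "finite A" "\<And>i. i \<in> A \<Longrightarrow> 0 \<le> f i" "0 < \<alpha>" "\<alpha> \<le> 1"
  shows "(\<Sum>i\<in>A. f i) powr \<alpha> \<le> (\<Sum>i\<in>A. f i powr \<alpha>)"
  using assms
proof (induction A)
  case (insert i A)
  have "(f i + (\<Sum>i\<in>A. f i)) powr \<alpha> \<le> f i powr \<alpha> + (\<Sum>i\<in>A. f i) powr \<alpha>"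
    using insert by (intro powr_subadditive sum_nonneg) auto
  also have "\<dots> \<le> f i powr \<alpha> + (\<Sum>i\<in>A. f i powr \<alpha>)" using insert by simp
  finally show ?case using insert by simp
qed auto

text \<open>By subadditivity \<alpha> ln (1+x) is at most ln (1 + x^\<alpha>). The bound trades a
  logarithm of an inverse distance for its power \<alpha>, to which
  \<open>circ_mean_powr_bound\<close> applies.\<close>

lemma ln_one_plus_le_powr:
  fixes x \<alpha> :: real
  assumes "0 \<le> x" "0 < \<alpha>" "\<alpha> \<le> 1"
  shows "ln (1 + x) \<le> x powr \<alpha> / \<alpha>"
proof -
  have "\<alpha> * ln (1 + x) = ln ((1 + x) powr \<alpha>)" using assms by (simp add: ln_powr)
  also have "\<dots> \<le> ln (1 + x powr \<alpha>)"
    using powr_subadditive[of 1 x \<alpha>] assms by (intro ln_mono) auto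
  also have "\<dots> \<le> x powr \<alpha>" by (rule ln_add_one_self_le_self) simp
  finally show ?thesis using assms by (simp add: field_simps)
qed

lemma abs_ln_quotient_le:
  fixes p q :: complex
  assumes "p \<noteq> 0" "q \<noteq> 0" "norm (p - q) \<le> d" "0 < \<alpha>" "\<alpha> \<le> 1"
  shows "\<bar>ln (norm p) - ln (norm q)\<bar> \<le> (d / norm p) powr \<alpha> / \<alpha> + (d / norm q) powr \<alpha> / \<alpha>"
proof -
  have d0: "d \<ge> 0" using assms(3) norm_ge_zero order_trans by blast
  have *: "ln (norm p) - ln (norm q) \<le> (d / norm q) powr \<alpha> / \<alpha>"
    if "p \<noteq> 0" "q \<noteq> 0" "norm (p - q) \<le> d" for p q :: complex
  proof -
    have "norm p \<le> norm q + d" using norm_triangle_sub[of p q] that by linarith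
    hence "norm p / norm q \<le> 1 + d / norm q" using that by (simp add: field_simps)
    hence "ln (norm p / norm q) \<le> ln (1 + d / norm q)" using that by (intro ln_mono) auto
    also have "\<dots> \<le> (d / norm q) powr \<alpha> / \<alpha>" using d0 assms by (intro ln_one_plus_le_powr) auto
    finally show ?thesis using that by (simp add: ln_divide_pos)
  qed
  have "(d / norm p) powr \<alpha> / \<alpha> \<ge> 0" "(d / norm q) powr \<alpha> / \<alpha> \<ge> 0" using assms by auto
  moreover have "norm (q - p) \<le> d" using assms(3) by (simp add: norm_minus_commute)
  ultimately show ?thesis using *[OF assms(1,2,3)] *[OF assms(2,1)] unfolding abs_le_iff by linarith
qed

text \<open>Jensen's inequality for the concave logarithm, obtained from its tangent at
  \<mu>.\<close>

lemma circ_mean_ln_le: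
  fixes E :: "complex \<Rightarrow> real"
  assumes "continuous_on (sphere 0 r) E" "r \<ge> 0" "\<And>z. norm z = r \<Longrightarrow> E z > 0" "circ_mean r E \<le> \<mu>" "\<mu> > 0"
  shows "circ_mean r (\<lambda>z. ln (E z)) \<le> ln \<mu>"
proof -
  have "circ_mean r (\<lambda>z. ln (E z)) \<le> circ_mean r (\<lambda>z. (ln \<mu> - 1) + (1 / \<mu>) * E z)"
  proof (rule circ_mean_mono)
    fix z :: complex assume z: "norm z = r"
    have "ln (E z / \<mu>) \<le> E z / \<mu> - 1" using assms(3)[OF z] assms(5) by (intro ln_le_minus_one) auto
    thus "ln (E z) \<le> (ln \<mu> - 1) + (1 / \<mu>) * E z" using assms(3)[OF z] assms(5) by (simp add: ln_divide_pos)
  next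
    have "E z \<noteq> 0" if "z \<in> sphere 0 r" for z using assms(3)[of z] that by auto
    thus "continuous_on (sphere 0 r) (\<lambda>z. ln (E z))" using assms(1) by (intro continuous_on_ln) auto
  qed (intro continuous_intros assms)+
  also have "\<dots> = (ln \<mu> - 1) + (1 / \<mu>) * circ_mean r E"
    using circ_mean_cmult[of r "1 / \<mu>" E]
    by (subst circ_mean_add) (use assms in \<open>auto intro!: continuous_intros\<close>)
  also have "(1 / \<mu>) * circ_mean r E \<le> (1 / \<mu>) * \<mu>" using assms by (intro mult_left_mono) auto
  finally show ?thesis using assms by simp
qed

lemma continuous_on_circ_mean_param:
  fixes k :: "complex \<Rightarrow> complex \<Rightarrow> real"
  assumes "continuous_on (S \<times> sphere 0 R) (\<lambda>(z, w). k z w)" "R \<ge> 0"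
  shows "continuous_on S (\<lambda>z. circ_mean R (k z))"
proof -
  have "continuous_on (S \<times> cbox 0 (2*pi)) (\<lambda>x. (fst x, of_real R * cis (snd x) :: complex))"
    by (intro continuous_intros)
  from continuous_on_compose2[OF assms(1) this]
  have "continuous_on (S \<times> cbox 0 (2*pi)) (\<lambda>(z, t). k z (of_real R * cis t))"
    using assms(2) by (auto simp: norm_mult case_prod_unfold image_subset_iff)
  from integral_continuous_on_param[OF this] show ?thesis
    unfolding circ_mean_def by (intro continuous_intros) auto
qed

text \<open>The increment bound is divided by |z' - z|; its right-hand side depends continuously on
  z', so the limit at z can be taken.\<close>

lemma norm_deriv_le_Schwarz:
  assumes h: "h holomorphic_on cball 0 R" and z: "norm z < R"
  shows "norm (deriv h z) \<le> circ_mean R (\<lambda>w. \<bar>Re (h w)\<bar> * (2 * R / (norm (w - z))\<^sup>2))"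
proof -
  have R: "R > 0" using z le_less_trans norm_ge_zero by blast
  have hc: "continuous_on (sphere 0 R) h"
    by (rule continuous_on_subset[OF holomorphic_on_imp_continuous_on[OF h]]) auto
  define k where "k = (\<lambda>z' w. \<bar>Re (h w)\<bar> * (2 * R / (norm (w - z) * norm (w - z'))))"
  have "continuous_on (ball 0 R \<times> sphere 0 R) (\<lambda>x. \<bar>Re (h (snd x))\<bar> * (2 * R / (norm (snd x - z) * norm (snd x - fst x))))"
    by (intro continuous_intros continuous_on_compose2[OF hc]) (use z in auto)
  hence "continuous_on (ball 0 R) (\<lambda>z'. circ_mean R (k z'))"
    unfolding k_def using R by (intro continuous_on_circ_mean_param) (auto simp: case_prod_unfold)
  hence lim2: "((\<lambda>z'. circ_mean R (k z')) \<longlongrightarrow> circ_mean R (k z)) (at z)"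
    using z by (auto simp: continuous_on_eq_continuous_at isCont_def)
  have "(h has_field_derivative deriv h z) (at z)"
    using h z by (intro holomorphic_derivI[of _ "ball 0 R"]) (auto elim: holomorphic_on_subset)
  hence "((\<lambda>z'. (h z' - h z) / (z' - z)) \<longlongrightarrow> deriv h z) (at z)"
    by (simp add: has_field_derivative_iff)
  hence lim1: "((\<lambda>z'. norm ((h z' - h z) / (z' - z))) \<longlongrightarrow> norm (deriv h z)) (at z)"
    by (rule tendsto_norm)
  have "eventually (\<lambda>z'. z' \<in> ball 0 R - {z}) (at z)"
    using z by (intro eventually_at_in_open) auto
  hence "eventually (\<lambda>z'. norm ((h z' - h z) / (z' - z)) \<le> circ_mean R (k z')) (at z)"
  proof eventually_elim
    case (elim z')
    have "norm (h z' - h z) \<le> norm (z' - z) * circ_mean R (k z')"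
      using Schwarz_increment_bound[OF h z, of z'] elim by (simp add: k_def norm_minus_commute)
    thus ?case using elim by (simp add: norm_divide field_simps)
  qed
  from tendsto_le[OF _ lim2 lim1 this] show ?thesis by (simp add: k_def power2_eq_square)
qed

lemma regular_radius_continuous:
  assumes "regular_radius y r"
  shows "continuous_on (sphere 0 r) y" "\<And>z. norm z = r \<Longrightarrow> y z \<noteq> 0" "\<And>z. norm z = r \<Longrightarrow> y analytic_on {z}"
  using assms unfolding regular_radius_def
  by (auto intro!: continuous_at_imp_continuous_on analytic_at_imp_isCont)

section \<open>Mean estimates from the Poisson--Jensen formula\<close>

definition zp_count :: "(complex \<Rightarrow> complex) \<Rightarrow> real \<Rightarrow> real" where
  "zp_count y R = (\<Sum>a\<in>zero_pole_set y R. \<bar>of_int (zorder y a)\<bar>)"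

text \<open>The right-hand sides below bound circle means of the sums over zeros and poles in the
  Poisson--Jensen formula (first summand) and of the boundary term (second summand).\<close>

definition pj_error :: "real \<Rightarrow> (complex \<Rightarrow> complex) \<Rightarrow> real \<Rightarrow> real \<Rightarrow> real" where
  "pj_error \<alpha> y r R = (zp_count y R + R * (R - r) powr (\<alpha> - 2) * circ_mean R (\<lambda>z. \<bar>ln (norm (y z))\<bar>)) * r powr (-\<alpha>)"

lemma zp_count_nonneg: "zp_count y R \<ge> 0"
  unfolding zp_count_def by (intro sum_nonneg) auto

text \<open>The first estimate leads to the lemma on the logarithmic derivative, the second to its
  analogue for y(z+c)/y(z). In both, the Poisson--Jensen expansion is bounded pointwise by powers
  -\<alpha> of distances and then averaged. \<open>c\<close> is fixed beforehand, so
  \<open>C\<close> may depend on it, but not on y, r or R.\<close>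

lemma poisson_jensen_estimates:
  assumes \<alpha>: "0 < \<alpha>" "\<alpha> < 1"
  obtains C where "C > 0"
    "\<And>y r R. y meromorphic_on UNIV \<Longrightarrow> \<forall>\<^sub>\<approx>z. y z \<noteq> 0 \<Longrightarrow> 0 < r \<Longrightarrow> r < R \<Longrightarrow>
       regular_radius y r \<Longrightarrow> regular_radius y R \<Longrightarrow>
       circ_mean r (\<lambda>z. ln (1 + norm (deriv y z / y z))) \<le> 1 / \<alpha> * ln (2 + C * pj_error \<alpha> y r R)"
    "\<And>y r R. y meromorphic_on UNIV \<Longrightarrow> \<forall>\<^sub>\<approx>z. y z \<noteq> 0 \<Longrightarrow> 0 < r \<Longrightarrow> r + 2 * norm c < R \<Longrightarrow>
       regular_radius y r \<Longrightarrow> regular_radius (\<lambda>z. y (z + c)) r \<Longrightarrow> regular_radius y R \<Longrightarrow>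
       circ_mean r (\<lambda>z. \<bar>ln (norm (y (z + c))) - ln (norm (y z))\<bar>) \<le> C * pj_error \<alpha> y r R"
proof -
  obtain C0 where C0: "C0 > 0"
    "\<And>r a. r > 0 \<Longrightarrow> norm a \<noteq> r \<Longrightarrow> circ_mean r (\<lambda>z. norm (z - a) powr (-\<alpha>)) \<le> C0 * r powr (-\<alpha>)"
    using circ_mean_powr_bound[OF \<alpha>] by blast
  \<comment> \<open>The part of the logarithmic derivative of a Blaschke factor that has its pole at
    the reflected point R^2 / cnj a.\<close>
  define \<rho> where "\<rho> = (\<lambda>a R z. cnj a / (of_real (R\<^sup>2) - cnj a * z))"
  have \<rho>_eq: "norm (\<rho> a R z) powr \<alpha> = (if a = 0 then 0 else norm (z - of_real (R\<^sup>2) / cnj a) powr (-\<alpha>))"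
    if "norm a < R" "norm z \<le> R" for a R z
  proof (cases "a = 0")
    case False
    have "\<rho> a R z = - inverse (z - of_real (R\<^sup>2) / cnj a)"
      using blaschke_denom_nz[OF that] False by (simp add: \<rho>_def field_simps)
    hence "norm (\<rho> a R z) = inverse (norm (z - of_real (R\<^sup>2) / cnj a))" by (simp add: norm_inverse)
    thus ?thesis using False by (simp add: inverse_powr powr_minus)
  qed (simp add: \<rho>_def)
  have star: "norm (of_real (R\<^sup>2) / cnj a) > R" if "norm a < R" "a \<noteq> 0" for a :: complex and R
  proof -
    have "R > 0" using that norm_ge_zero[of a] by linarith
    hence "R * norm a < R\<^sup>2" using that by (simp add: power2_eq_square)
    thus ?thesis using that by (simp add: norm_divide norm_power less_divide_eq)
  qed
  have \<rho>_mean: "circ_mean r (\<lambda>z. norm (\<rho> a R (z + d)) powr \<alpha>) \<le> C0 * r powr (-\<alpha>)"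
    and \<rho>_cont: "continuous_on (sphere 0 r) (\<lambda>z. norm (\<rho> a R (z + d)) powr \<alpha>)"
    if "norm a < R" "0 < r" "r + norm d < R" for a r R d
  proof -
    have le: "norm (z + d) \<le> R" if "norm z = r" for z
      using norm_triangle_ineq[of z d] that \<open>r + norm d < R\<close> by linarith
    have "circ_mean r (\<lambda>z. norm (\<rho> a R (z + d)) powr \<alpha>) \<le> C0 * r powr (-\<alpha>) \<and>
      continuous_on (sphere 0 r) (\<lambda>z. norm (\<rho> a R (z + d)) powr \<alpha>)"
    proof (cases "a = 0")
      case True
      thus ?thesis using C0(1) by (simp add: \<rho>_def)
    next
      case False
      define b where "b = of_real (R\<^sup>2) / cnj a - d"
      have "norm b > r" using star[OF that(1) False] that(3) norm_triangle_ineq2[of "of_real (R\<^sup>2) / cnj a" d]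
        by (simp add: b_def)
      hence "norm b \<noteq> r" by simp
      have eq: "norm (\<rho> a R (z + d)) powr \<alpha> = norm (z - b) powr (-\<alpha>)" if "norm z = r" for z
        using \<rho>_eq[OF \<open>norm a < R\<close> le[OF that]] False by (simp add: b_def algebra_simps)
      have "circ_mean r (\<lambda>z. norm (\<rho> a R (z + d)) powr \<alpha>) = circ_mean r (\<lambda>z. norm (z - b) powr (-\<alpha>))"
        by (rule circ_mean_cong) (use eq that in auto)
      moreover have "continuous_on (sphere 0 r) (\<lambda>z. norm (z - b) powr (-\<alpha>))"
        using \<open>norm b \<noteq> r\<close> by (intro continuous_intros) auto
      hence "continuous_on (sphere 0 r) (\<lambda>z. norm (\<rho> a R (z + d)) powr \<alpha>)"
        by (rule continuous_on_eq) (use eq in auto)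
      ultimately show ?thesis using C0(2)[OF that(2) \<open>norm b \<noteq> r\<close>] by simp
    qed
    thus "circ_mean r (\<lambda>z. norm (\<rho> a R (z + d)) powr \<alpha>) \<le> C0 * r powr (-\<alpha>)"
      "continuous_on (sphere 0 r) (\<lambda>z. norm (\<rho> a R (z + d)) powr \<alpha>)" by auto
  qed
  have sing_mean: "circ_mean r (\<lambda>z. norm (z + d - a) powr (-\<alpha>)) \<le> C0 * r powr (-\<alpha>)"
    and sing_cont: "continuous_on (sphere 0 r) (\<lambda>z. norm (z + d - a) powr (-\<alpha>))"
    if "norm (a - d) \<noteq> r" "0 < r" for a d r
  proof -
    have eq: "z + d - a = z - (a - d)" for z :: complex by simp
    show "circ_mean r (\<lambda>z. norm (z + d - a) powr (-\<alpha>)) \<le> C0 * r powr (-\<alpha>)"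
      unfolding eq by (rule C0(2)) (use that in auto)
    show "continuous_on (sphere 0 r) (\<lambda>z. norm (z + d - a) powr (-\<alpha>))"
      unfolding eq using that by (intro continuous_intros) auto
  qed
  \<comment> \<open>Majorant for the boundary term. After interchanging the two means, the inner
    mean over z is again a mean of the power -\<alpha> of a distance.\<close>
  define K where "K = (\<lambda>u r R z. circ_mean R (\<lambda>w. \<bar>Re (u w)\<bar> * (2 * R * (R - r) powr (\<alpha> - 2) * norm (z - w) powr (-\<alpha>))))"
  have K_mean: "circ_mean r (K u r R) \<le> C0 * (2 * R * (R - r) powr (\<alpha> - 2) * circ_mean R (\<lambda>w. \<bar>Re (u w)\<bar>)) * r powr (-\<alpha>)"
    and K_cont: "continuous_on (sphere 0 r) (K u r R)"
    if u: "u holomorphic_on cball 0 R" and r: "0 < r" "r < R" for u :: "complex \<Rightarrow> complex" and r R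
  proof -
    have hc: "continuous_on (sphere 0 R) u"
      by (rule continuous_on_subset[OF holomorphic_on_imp_continuous_on[OF u]]) auto
    have cont: "continuous_on (sphere 0 r \<times> sphere 0 R) (\<lambda>(z, w). \<bar>Re (u w)\<bar> * (2 * R * (R - r) powr (\<alpha> - 2) * norm (z - w) powr (-\<alpha>)))"
      unfolding case_prod_unfold
      by (intro continuous_intros continuous_on_compose2[OF hc]) (use r in auto)
    show "continuous_on (sphere 0 r) (K u r R)"
      unfolding K_def by (rule continuous_on_circ_mean_param[OF cont]) (use r in auto)
    have "circ_mean r (K u r R) = circ_mean R (\<lambda>w. circ_mean r (\<lambda>z. \<bar>Re (u w)\<bar> * (2 * R * (R - r) powr (\<alpha> - 2) * norm (z - w) powr (-\<alpha>))))"
      unfolding K_def by (rule circ_mean_swap[OF cont]) (use r in auto)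
    also have "\<dots> = circ_mean R (\<lambda>w. \<bar>Re (u w)\<bar> * (2 * R * (R - r) powr (\<alpha> - 2) * circ_mean r (\<lambda>z. norm (z - w) powr (-\<alpha>))))"
      by (simp add: circ_mean_cmult)
    also have "\<dots> \<le> circ_mean R (\<lambda>w. (C0 * (2 * R * (R - r) powr (\<alpha> - 2)) * r powr (-\<alpha>)) * \<bar>Re (u w)\<bar>)"
    proof (rule circ_mean_mono)
      have "continuous_on (sphere 0 R \<times> sphere 0 r) (\<lambda>(w, z). norm (z - w) powr (-\<alpha>))"
        unfolding case_prod_unfold by (intro continuous_intros) (use r in auto)
      hence "continuous_on (sphere 0 R) (\<lambda>w. circ_mean r (\<lambda>z. norm (z - w) powr (-\<alpha>)))"
        by (rule continuous_on_circ_mean_param) (use r in auto)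
      thus "continuous_on (sphere 0 R) (\<lambda>w. \<bar>Re (u w)\<bar> * (2 * R * (R - r) powr (\<alpha> - 2) * circ_mean r (\<lambda>z. norm (z - w) powr (-\<alpha>))))"
        by (intro continuous_intros hc)
      show "continuous_on (sphere 0 R) (\<lambda>w. (C0 * (2 * R * (R - r) powr (\<alpha> - 2)) * r powr (-\<alpha>)) * \<bar>Re (u w)\<bar>)"
        by (intro continuous_intros hc)
      fix w :: complex assume w: "norm w = R"
      have "circ_mean r (\<lambda>z. norm (z - w) powr (-\<alpha>)) \<le> C0 * r powr (-\<alpha>)" using r w by (intro C0(2)) auto
      hence "\<bar>Re (u w)\<bar> * (2 * R * (R - r) powr (\<alpha> - 2) * circ_mean r (\<lambda>z. norm (z - w) powr (-\<alpha>)))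
        \<le> \<bar>Re (u w)\<bar> * (2 * R * (R - r) powr (\<alpha> - 2) * (C0 * r powr (-\<alpha>)))"
        using r by (intro mult_left_mono) auto
      also have "\<dots> = (C0 * (2 * R * (R - r) powr (\<alpha> - 2)) * r powr (-\<alpha>)) * \<bar>Re (u w)\<bar>" by (simp only: mult_ac)
      finally show "\<bar>Re (u w)\<bar> * (2 * R * (R - r) powr (\<alpha> - 2) * circ_mean r (\<lambda>z. norm (z - w) powr (-\<alpha>)))
        \<le> (C0 * (2 * R * (R - r) powr (\<alpha> - 2)) * r powr (-\<alpha>)) * \<bar>Re (u w)\<bar>" .
    qed (use r in auto)
    also have "\<dots> = (C0 * (2 * R * (R - r) powr (\<alpha> - 2)) * r powr (-\<alpha>)) * circ_mean R (\<lambda>w. \<bar>Re (u w)\<bar>)"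
      by (rule circ_mean_cmult)
    also have "\<dots> = C0 * (2 * R * (R - r) powr (\<alpha> - 2) * circ_mean R (\<lambda>w. \<bar>Re (u w)\<bar>)) * r powr (-\<alpha>)"
      by (simp only: mult_ac)
    finally show "circ_mean r (K u r R) \<le> C0 * (2 * R * (R - r) powr (\<alpha> - 2) * circ_mean R (\<lambda>w. \<bar>Re (u w)\<bar>)) * r powr (-\<alpha>)" .
  qed
  \<comment> \<open>Of the two inverse distances only the power \<alpha> of one is kept; the rest is
    estimated by R - r. The second distance is a free \<open>s\<close> so that both the derivative
    and the shift are covered.\<close>
  have kern: "1 / (norm (z - w) * s) \<le> (R - r) powr (\<alpha> - 2) * norm (z - w) powr (-\<alpha>)"
    if "norm z = r" "norm w = R" "r < R" "s \<ge> R - r" for z w :: complex and r R s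
  proof -
    define t where "t = norm (z - w)"
    have t: "t \<ge> R - r" using norm_triangle_ineq2[of w z] that by (simp add: t_def norm_minus_commute)
    have "1 / (t * s) = t powr (-\<alpha>) * (t powr (\<alpha> - 1) * s powr (-1))"
      using t that by (simp add: powr_minus powr_diff field_simps)
    also have "\<dots> \<le> t powr (-\<alpha>) * ((R - r) powr (\<alpha> - 1) * (R - r) powr (-1))"
      using t that \<alpha> by (intro mult_left_mono mult_mono powr_mono2') auto
    also have "(R - r) powr (\<alpha> - 1) * (R - r) powr (-1) = (R - r) powr (\<alpha> - 2)"
      by (subst powr_add[symmetric]) (rule arg_cong[where f="\<lambda>x. _ powr x"], simp)
    finally show ?thesis by (simp add: t_def mult_ac)
  qed
  show thesis
  \<comment> \<open>2 C0 serves the logarithmic derivative. The shift needs 4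
    (1+|c|)^\<alpha>/\<alpha> C0 for its four singular terms per zero or pole, and 4 |c| C0 for the
    boundary term.\<close>
  proof (rule that[of "4 * (1 + norm c) powr \<alpha> / \<alpha> * C0 + 4 * norm c * C0 + 2 * C0"])
    show "4 * (1 + norm c) powr \<alpha> / \<alpha> * C0 + 4 * norm c * C0 + 2 * C0 > 0"
      using C0(1) \<alpha> by (intro add_nonneg_pos add_nonneg_nonneg) auto
  next
    fix y :: "complex \<Rightarrow> complex" and r R :: real
    assume y: "y meromorphic_on UNIV" "\<forall>\<^sub>\<approx>z. y z \<noteq> 0" and r: "0 < r" "r < R" and
      reg: "regular_radius y r" "regular_radius y R"
    define S where "S = zero_pole_set y R"
    define n where "n = (\<lambda>a. \<bar>of_int (zorder y a)\<bar> :: real)"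
    have finS: "finite S" unfolding S_def by (rule finite_zero_pole_set[OF y(1)])
    have Sint: "norm a < R" if "a \<in> S" for a using zero_pole_set_interior[OF reg(2)] that unfolding S_def .
    have Snr: "norm a \<noteq> r" if "a \<in> S" for a
      using that pole_ords_regular[of y a] reg(1) by (auto simp: S_def zero_pole_set_def regular_radius_def)
    obtain u where u: "u holomorphic_on cball 0 R" "\<And>z. norm z = R \<Longrightarrow> Re (u z) = ln (norm (y z))" and
     ld: "\<And>z. norm z < R \<Longrightarrow> y analytic_on {z} \<Longrightarrow> y z \<noteq> 0 \<Longrightarrow>
       deriv y z / y z = deriv u z + (\<Sum>a\<in>S. of_int (zorder y a) *
          (1 / (z - a) + cnj a / (of_real (R\<^sup>2) - cnj a * z)))"
      by (rule Blaschke_log_factorisation[OF y reg(2), folded S_def]) (rule that)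
    have hc: "continuous_on (sphere 0 R) u"
      by (rule continuous_on_subset[OF holomorphic_on_imp_continuous_on[OF u(1)]]) auto
    define E where "E = (\<lambda>z. (\<Sum>a\<in>S. n a * (norm (z - a) powr (-\<alpha>) + norm (\<rho> a R z) powr \<alpha>)) + K u r R z)"
    have Kpos: "K u r R z \<ge> 0" if "norm z = r" for z
    proof -
      have "circ_mean R (\<lambda>_. 0 :: real) \<le> K u r R z" unfolding K_def
        by (rule circ_mean_mono) (use r that in \<open>auto intro!: continuous_intros hc mult_nonneg_nonneg\<close>)
      thus ?thesis by simp
    qed
    have Epos: "E z \<ge> 0" if "norm z = r" for z
      unfolding E_def using Kpos[OF that] by (intro add_nonneg_nonneg sum_nonneg mult_nonneg_nonneg) (auto simp: n_def)
    have c1: "continuous_on (sphere 0 r) (\<lambda>z. norm (z - a) powr (-\<alpha>))" if "a \<in> S" for a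
      using sing_cont[of a 0 r] Snr[OF that] r by simp
    have c2: "continuous_on (sphere 0 r) (\<lambda>z. norm (\<rho> a R z) powr \<alpha>)" if "a \<in> S" for a
      using \<rho>_cont[OF Sint[OF that] r(1), of 0] r by simp
    have c3: "continuous_on (sphere 0 r) (K u r R)" by (rule K_cont[OF u(1) r])
    have Econt: "continuous_on (sphere 0 r) E" unfolding E_def by (intro continuous_intros c1 c2 c3)
    have "circ_mean r E = (\<Sum>a\<in>S. n a * (circ_mean r (\<lambda>z. norm (z - a) powr (-\<alpha>)) + circ_mean r (\<lambda>z. norm (\<rho> a R z) powr \<alpha>))) + circ_mean r (K u r R)"
    proof -
      have "circ_mean r (\<lambda>z. \<Sum>a\<in>S. n a * (norm (z - a) powr (-\<alpha>) + norm (\<rho> a R z) powr \<alpha>)) =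
        (\<Sum>a\<in>S. circ_mean r (\<lambda>z. n a * (norm (z - a) powr (-\<alpha>) + norm (\<rho> a R z) powr \<alpha>)))"
        using r finS by (intro circ_mean_sum continuous_on_mult continuous_on_const continuous_on_add c1 c2) auto
      also have "\<dots> = (\<Sum>a\<in>S. n a * (circ_mean r (\<lambda>z. norm (z - a) powr (-\<alpha>)) + circ_mean r (\<lambda>z. norm (\<rho> a R z) powr \<alpha>)))"
        unfolding circ_mean_cmult using r by (intro sum.cong refl arg_cong2[where f="(*)"] circ_mean_add c1 c2) auto
      finally show ?thesis unfolding E_def using r
        by (subst circ_mean_add) (auto intro!: continuous_intros c1 c2 c3)
    qed
    also have "\<dots> \<le> (\<Sum>a\<in>S. n a * (C0 * r powr (-\<alpha>) + C0 * r powr (-\<alpha>))) +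
       C0 * (2 * R * (R - r) powr (\<alpha> - 2) * circ_mean R (\<lambda>w. \<bar>Re (u w)\<bar>)) * r powr (-\<alpha>)"
    proof (intro add_mono sum_mono mult_left_mono K_mean u r)
      fix a assume a: "a \<in> S"
      show "circ_mean r (\<lambda>z. norm (z - a) powr (-\<alpha>)) \<le> C0 * r powr (-\<alpha>)" by (rule C0(2)[OF r(1) Snr[OF a]])
      show "circ_mean r (\<lambda>z. norm (\<rho> a R z) powr \<alpha>) \<le> C0 * r powr (-\<alpha>)"
        using \<rho>_mean[OF Sint[OF a] r(1), of 0] r by simp
    qed (auto simp: n_def)
    also have "circ_mean R (\<lambda>w. \<bar>Re (u w)\<bar>) = circ_mean R (\<lambda>z. \<bar>ln (norm (y z))\<bar>)"
      by (rule circ_mean_cong) (use u(2) r in auto)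
    also have "(\<Sum>a\<in>S. n a * (C0 * r powr (-\<alpha>) + C0 * r powr (-\<alpha>))) = zp_count y R * (2 * C0 * r powr (-\<alpha>))"
      unfolding zp_count_def S_def[symmetric] n_def sum_distrib_right by (intro sum.cong refl) simp
    finally have Emean: "circ_mean r E \<le> (2 * C0) * pj_error \<alpha> y r R"
      unfolding pj_error_def by (simp add: algebra_simps)
    have Apos: "circ_mean R (\<lambda>z. \<bar>ln (norm (y z))\<bar>) \<ge> 0"
    proof -
      have "circ_mean R (\<lambda>_. 0 :: real) \<le> circ_mean R (\<lambda>z. \<bar>Re (u z)\<bar>)"
        by (rule circ_mean_mono) (use r in \<open>auto intro!: continuous_intros hc\<close>)
      also have "\<dots> = circ_mean R (\<lambda>z. \<bar>ln (norm (y z))\<bar>)"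
        by (rule circ_mean_cong) (use u(2) r in auto)
      finally show ?thesis by simp
    qed
    have pjpos: "pj_error \<alpha> y r R \<ge> 0"
      unfolding pj_error_def using r Apos zp_count_nonneg[of y R] by (intro mult_nonneg_nonneg add_nonneg_nonneg) auto
    \<comment> \<open>ln (1 + D) is 1/\<alpha> times the logarithm of (1+D)^\<alpha>, and the power
      \<alpha> distributes over the sum. Since the logarithm stays outside, Jensen's inequality
      later gives a bound that is logarithmic in the error.\<close>
    have pt: "ln (1 + norm (deriv y z / y z)) \<le> 1 / \<alpha> * ln (2 + E z)" if z: "norm z = r" for z
    proof -
      have zR: "norm z < R" using z r by simp
      have yz: "y analytic_on {z}" "y z \<noteq> 0" using reg(1) z by (auto simp: regular_radius_def)
      define D where "D = norm (deriv y z / y z)"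
      have "D \<le> norm (deriv u z) + (\<Sum>a\<in>S. n a * (1 / norm (z - a) + norm (\<rho> a R z)))"
      proof -
        have "D \<le> norm (deriv u z) + norm (\<Sum>a\<in>S. of_int (zorder y a) * (1 / (z - a) + \<rho> a R z))"
          unfolding D_def ld[OF zR yz] \<rho>_def by (rule norm_triangle_ineq)
        also have "norm (\<Sum>a\<in>S. of_int (zorder y a) * (1 / (z - a) + \<rho> a R z)) \<le> (\<Sum>a\<in>S. n a * (1 / norm (z - a) + norm (\<rho> a R z)))"
        proof (rule sum_norm_le)
          fix a
          have "norm (1 / (z - a) + \<rho> a R z) \<le> 1 / norm (z - a) + norm (\<rho> a R z)"
            using norm_triangle_ineq[of "1 / (z - a)" "\<rho> a R z"] by (simp add: norm_divide)
          thus "norm (of_int (zorder y a) * (1 / (z - a) + \<rho> a R z)) \<le> n a * (1 / norm (z - a) + norm (\<rho> a R z))"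
            unfolding norm_mult n_def by (intro mult_mono) auto
        qed
        finally show ?thesis by simp
      qed
      hence "(1 + D) powr \<alpha> \<le> (1 + (norm (deriv u z) + (\<Sum>a\<in>S. n a * (1 / norm (z - a) + norm (\<rho> a R z))))) powr \<alpha>"
        using \<alpha> by (intro powr_mono2) (auto simp: D_def)
      also have "\<dots> \<le> 1 powr \<alpha> + (norm (deriv u z) powr \<alpha> + (\<Sum>a\<in>S. n a * (1 / norm (z - a) + norm (\<rho> a R z))) powr \<alpha>)"
        using \<alpha> by (intro order_trans[OF powr_subadditive] add_left_mono powr_subadditive)
           (auto intro!: add_nonneg_nonneg sum_nonneg mult_nonneg_nonneg simp: n_def)
      \<comment> \<open>The boundary term is bounded by \<open>K\<close> in the first power, so the
        exponent \<alpha> is removed here at the price of 1; this is one of the two units in 2 +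
        E.\<close>
      also have "norm (deriv u z) powr \<alpha> \<le> 1 + norm (deriv u z)"
      proof -
        have "norm (deriv u z) powr \<alpha> \<le> (1 + norm (deriv u z)) powr \<alpha>" using \<alpha> by (intro powr_mono2) auto
        also have "\<dots> \<le> (1 + norm (deriv u z)) powr 1" using \<alpha> by (intro powr_mono) auto
        finally show ?thesis by (simp add: add_nonneg_nonneg)
      qed
      also have "norm (deriv u z) \<le> K u r R z"
      proof -
        have "norm (deriv u z) \<le> circ_mean R (\<lambda>w. \<bar>Re (u w)\<bar> * (2 * R / (norm (w - z))\<^sup>2))"
          by (rule norm_deriv_le_Schwarz[OF u(1) zR])
        also have "\<dots> \<le> K u r R z" unfolding K_def
        proof (rule circ_mean_mono)
          fix w :: complex assume w: "norm w = R"
          have "1 / (norm (z - w) * norm (z - w)) \<le> (R - r) powr (\<alpha> - 2) * norm (z - w) powr (-\<alpha>)"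
            using norm_triangle_ineq2[of w z] z w by (intro kern[OF z w r(2)]) (simp add: norm_minus_commute)
          hence "2 * R * (1 / (norm (z - w) * norm (z - w))) \<le> 2 * R * ((R - r) powr (\<alpha> - 2) * norm (z - w) powr (-\<alpha>))"
            using r by (intro mult_left_mono) auto
          hence "2 * R / (norm (w - z))\<^sup>2 \<le> 2 * R * (R - r) powr (\<alpha> - 2) * norm (z - w) powr (-\<alpha>)"
            by (simp add: power2_eq_square norm_minus_commute mult_ac)
          thus "\<bar>Re (u w)\<bar> * (2 * R / (norm (w - z))\<^sup>2) \<le> \<bar>Re (u w)\<bar> * (2 * R * (R - r) powr (\<alpha> - 2) * norm (z - w) powr (-\<alpha>))"
            by (intro mult_left_mono) auto
        qed (use r zR in \<open>auto intro!: continuous_intros hc\<close>)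
        finally show ?thesis .
      qed
      also have "(\<Sum>a\<in>S. n a * (1 / norm (z - a) + norm (\<rho> a R z))) powr \<alpha> \<le>
          (\<Sum>a\<in>S. n a * (norm (z - a) powr (-\<alpha>) + norm (\<rho> a R z) powr \<alpha>))"
      proof -
        have "(\<Sum>a\<in>S. n a * (1 / norm (z - a) + norm (\<rho> a R z))) powr \<alpha> \<le>
          (\<Sum>a\<in>S. (n a * (1 / norm (z - a) + norm (\<rho> a R z))) powr \<alpha>)"
          using \<alpha> finS by (intro powr_sum_subadditive mult_nonneg_nonneg) (auto simp: n_def)
        also have "\<dots> \<le> (\<Sum>a\<in>S. n a * (norm (z - a) powr (-\<alpha>) + norm (\<rho> a R z) powr \<alpha>))"
        proof (intro sum_mono)
          fix a
          \<comment> \<open>A multiplicity is an integer, hence 0 or at least 1, and does not grow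
            under a power \<alpha> < 1.\<close>
          have "n a powr \<alpha> \<le> n a"
          proof (cases "zorder y a = 0")
            case False
            hence "n a \<ge> 1" unfolding n_def by linarith
            hence "n a powr \<alpha> \<le> n a powr 1" using \<alpha> by (intro powr_mono) auto
            thus ?thesis using \<open>n a \<ge> 1\<close> by simp
          qed (simp add: n_def)
          moreover have "(1 / norm (z - a) + norm (\<rho> a R z)) powr \<alpha> \<le> norm (z - a) powr (-\<alpha>) + norm (\<rho> a R z) powr \<alpha>"
            using powr_subadditive[of "1 / norm (z - a)" "norm (\<rho> a R z)" \<alpha>] \<alpha> by (simp add: powr_divide powr_minus_divide)
          ultimately show "(n a * (1 / norm (z - a) + norm (\<rho> a R z))) powr \<alpha> \<le> n a * (norm (z - a) powr (-\<alpha>) + norm (\<rho> a R z) powr \<alpha>)"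
            by (subst powr_mult) (auto intro!: mult_mono simp: n_def)
        qed
        finally show ?thesis .
      qed
      finally have "(1 + D) powr \<alpha> \<le> 2 + E z" by (simp add: E_def)
      hence "ln ((1 + D) powr \<alpha>) \<le> ln (2 + E z)" by (intro ln_mono) (auto simp: D_def add_nonneg_eq_0_iff)
      moreover have "ln ((1 + D) powr \<alpha>) = \<alpha> * ln (1 + D)" by (simp add: ln_powr D_def add_nonneg_eq_0_iff)
      ultimately show ?thesis using \<alpha> by (simp add: D_def field_simps)
    qed
    have "continuous_on (sphere 0 r) (deriv y)"
      using regular_radius_continuous(3)[OF reg(1)]
      by (intro continuous_at_imp_continuous_on ballI analytic_at_imp_isCont analytic_deriv) auto
    hence lhs_cont: "continuous_on (sphere 0 r) (\<lambda>z. ln (1 + norm (deriv y z / y z)))"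
      using regular_radius_continuous(1,2)[OF reg(1)]
      by (intro continuous_intros) (auto simp: add_nonneg_eq_0_iff)
    have "circ_mean r (\<lambda>z. ln (1 + norm (deriv y z / y z))) \<le> circ_mean r (\<lambda>z. 1 / \<alpha> * ln (2 + E z))"
      using Epos r by (intro circ_mean_mono lhs_cont pt continuous_intros Econt) (auto simp: add_nonneg_eq_0_iff add_pos_nonneg intro: less_imp_neq[OF add_pos_nonneg, symmetric])
    also have "\<dots> = 1 / \<alpha> * circ_mean r (\<lambda>z. ln (2 + E z))" by (rule circ_mean_cmult)
    finally have le: "circ_mean r (\<lambda>z. ln (1 + norm (deriv y z / y z))) \<le> 1 / \<alpha> * circ_mean r (\<lambda>z. ln (2 + E z))" .
    have "circ_mean r (\<lambda>z. ln (2 + E z)) \<le> ln (2 + (2 * C0) * pj_error \<alpha> y r R)"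
    proof (rule circ_mean_ln_le)
      show "circ_mean r (\<lambda>z. 2 + E z) \<le> 2 + 2 * C0 * pj_error \<alpha> y r R"
        using Emean r by (subst circ_mean_add) (auto intro!: continuous_intros Econt)
    qed (use Epos r pjpos C0(1) in \<open>auto intro!: continuous_intros Econt add_pos_nonneg\<close>)
    also have "\<dots> \<le> ln (2 + (4 * (1 + norm c) powr \<alpha> / \<alpha> * C0 + 4 * norm c * C0 + 2 * C0) * pj_error \<alpha> y r R)"
    proof (intro ln_mono add_left_mono mult_right_mono pjpos)
      show "2 * C0 \<le> 4 * (1 + norm c) powr \<alpha> / \<alpha> * C0 + 4 * norm c * C0 + 2 * C0" using C0(1) \<alpha> by simp
      show "0 < 2 + 2 * C0 * pj_error \<alpha> y r R" using pjpos C0(1) by (intro add_pos_nonneg) auto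
    qed
    finally have "1 / \<alpha> * circ_mean r (\<lambda>z. ln (2 + E z)) \<le> 1 / \<alpha> *
       ln (2 + (4 * (1 + norm c) powr \<alpha> / \<alpha> * C0 + 4 * norm c * C0 + 2 * C0) * pj_error \<alpha> y r R)"
      using \<alpha> by (intro mult_left_mono) auto
    with le show "circ_mean r (\<lambda>z. ln (1 + norm (deriv y z / y z))) \<le> 1 / \<alpha> *
       ln (2 + (4 * (1 + norm c) powr \<alpha> / \<alpha> * C0 + 4 * norm c * C0 + 2 * C0) * pj_error \<alpha> y r R)"
      by (rule order_trans)
  next
    fix y :: "complex \<Rightarrow> complex" and r R :: real
    assume y: "y meromorphic_on UNIV" "\<forall>\<^sub>\<approx>z. y z \<noteq> 0" and r: "0 < r" "r + 2 * norm c < R" and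
      reg: "regular_radius y r" "regular_radius (\<lambda>z. y (z + c)) r" "regular_radius y R"
    show "circ_mean r (\<lambda>z. \<bar>ln (norm (y (z + c))) - ln (norm (y z))\<bar>) \<le>
       (4 * (1 + norm c) powr \<alpha> / \<alpha> * C0 + 4 * norm c * C0 + 2 * C0) * pj_error \<alpha> y r R"
    proof -
    have rR: "r < R" "r + norm c < R" using r norm_ge_zero[of c] by linarith+
    define S where "S = zero_pole_set y R"
    define n where "n = (\<lambda>a. \<bar>of_int (zorder y a)\<bar> :: real)"
    define \<kappa> where "\<kappa> = (1 + norm c) powr \<alpha> / \<alpha>"
    have \<kappa>0: "\<kappa> \<ge> 0" using \<alpha> by (simp add: \<kappa>_def)
    have finS: "finite S" unfolding S_def by (rule finite_zero_pole_set[OF y(1)])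
    have Sint: "norm a < R" if "a \<in> S" for a using zero_pole_set_interior[OF reg(3)] that unfolding S_def .
    have yreg: "y analytic_on {z}" "y z \<noteq> 0" "y analytic_on {z + c}" "y (z + c) \<noteq> 0" if z: "norm z = r" for z
    proof -
      have "((\<lambda>z. y (z + c)) \<circ> (\<lambda>z. z - c)) analytic_on {z + c}"
        by (rule analytic_on_compose_gen[of _ _ _ "{z}"]) (use reg(2) z in \<open>auto intro!: analytic_intros simp: regular_radius_def\<close>)
      thus "y analytic_on {z + c}" by (simp add: o_def)
    qed (use reg z in \<open>auto simp: regular_radius_def\<close>)
    have Sne: "z \<noteq> a" "z + c \<noteq> a" if "a \<in> S" "norm z = r" for a z
      using that(1) pole_ords_regular[of y z] pole_ords_regular[of y "z + c"] yreg[OF that(2)]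
      by (auto simp: S_def zero_pole_set_def)
    have Snr: "norm (a - 0) \<noteq> r" "norm (a - c) \<noteq> r" if "a \<in> S" for a
      using Sne[OF that, of a] Sne[OF that, of "a - c"] by auto
    obtain u where u: "u holomorphic_on cball 0 R" "\<And>z. norm z = R \<Longrightarrow> Re (u z) = ln (norm (y z))" and
     lneq: "\<And>z. norm z < R \<Longrightarrow> y analytic_on {z} \<Longrightarrow> y z \<noteq> 0 \<Longrightarrow>
       ln (norm (y z)) = Re (u z) + (\<Sum>a\<in>S. of_int (zorder y a) * ln (norm (blaschke R a z)))"
      by (rule Blaschke_log_factorisation[OF y reg(3), folded S_def]) (rule that)
    have hc: "continuous_on (sphere 0 R) u"
      by (rule continuous_on_subset[OF holomorphic_on_imp_continuous_on[OF u(1)]]) auto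
    define e where "e = (\<lambda>a z. norm (z + c - a) powr (-\<alpha>) + norm (z - a) powr (-\<alpha>) + (norm (\<rho> a R (z + c)) powr \<alpha> + norm (\<rho> a R z) powr \<alpha>))"
    define E where "E = (\<lambda>z. (\<Sum>a\<in>S. n a * (\<kappa> * e a z)) + 2 * norm c * K u r R z)"
    have c1: "continuous_on (sphere 0 r) (\<lambda>z. norm (z - a) powr (-\<alpha>))"
         "continuous_on (sphere 0 r) (\<lambda>z. norm (z + c - a) powr (-\<alpha>))"
         "continuous_on (sphere 0 r) (\<lambda>z. norm (\<rho> a R z) powr \<alpha>)"
         "continuous_on (sphere 0 r) (\<lambda>z. norm (\<rho> a R (z + c)) powr \<alpha>)" if "a \<in> S" for a
      using sing_cont[of a 0 r] sing_cont[of a c r] Snr[OF that] r(1) \<rho>_cont[OF Sint[OF that] r(1), of 0]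
         \<rho>_cont[OF Sint[OF that] r(1), of c] rR by simp_all
    have c3: "continuous_on (sphere 0 r) (K u r R)" by (rule K_cont[OF u(1) r(1) rR(1)])
    have ec: "continuous_on (sphere 0 r) (e a)" if "a \<in> S" for a
      unfolding e_def by (intro continuous_on_add c1 that)
    have Econt: "continuous_on (sphere 0 r) E" unfolding E_def by (intro continuous_intros ec c3)
    have emean: "circ_mean r (e a) \<le> 4 * (C0 * r powr (-\<alpha>))" if a: "a \<in> S" for a
    proof -
      have "circ_mean r (e a) = circ_mean r (\<lambda>z. norm (z + c - a) powr (-\<alpha>)) + circ_mean r (\<lambda>z. norm (z - a) powr (-\<alpha>)) +
         (circ_mean r (\<lambda>z. norm (\<rho> a R (z + c)) powr \<alpha>) + circ_mean r (\<lambda>z. norm (\<rho> a R z) powr \<alpha>))"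
        unfolding e_def using r by (simp add: circ_mean_add c1[OF a] continuous_on_add)
      moreover have "circ_mean r (\<lambda>z. norm (z + c - a) powr (-\<alpha>)) \<le> C0 * r powr (-\<alpha>)"
        by (rule sing_mean[OF Snr(2)[OF a] r(1)])
      moreover have "circ_mean r (\<lambda>z. norm (z - a) powr (-\<alpha>)) \<le> C0 * r powr (-\<alpha>)"
        using sing_mean[OF Snr(1)[OF a] r(1)] by simp
      moreover have "circ_mean r (\<lambda>z. norm (\<rho> a R (z + c)) powr \<alpha>) \<le> C0 * r powr (-\<alpha>)"
        by (rule \<rho>_mean[OF Sint[OF a] r(1) rR(2)])
      moreover have "circ_mean r (\<lambda>z. norm (\<rho> a R z) powr \<alpha>) \<le> C0 * r powr (-\<alpha>)"
        using \<rho>_mean[OF Sint[OF a] r(1), of 0] rR by simp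
      ultimately show ?thesis by linarith
    qed
    have "circ_mean r E = (\<Sum>a\<in>S. n a * (\<kappa> * circ_mean r (e a))) + 2 * norm c * circ_mean r (K u r R)"
    proof -
      have "circ_mean r (\<lambda>z. \<Sum>a\<in>S. n a * (\<kappa> * e a z)) = (\<Sum>a\<in>S. circ_mean r (\<lambda>z. n a * (\<kappa> * e a z)))"
        using r finS by (intro circ_mean_sum continuous_on_mult continuous_on_const ec) auto
      also have "\<dots> = (\<Sum>a\<in>S. n a * (\<kappa> * circ_mean r (e a)))"
        unfolding circ_mean_cmult ..
      finally show ?thesis unfolding E_def using r
        by (subst circ_mean_add) (auto intro!: continuous_intros ec c3 simp: circ_mean_cmult)
    qed
    also have "\<dots> \<le> (\<Sum>a\<in>S. n a * (\<kappa> * (4 * (C0 * r powr (-\<alpha>))))) +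
       2 * norm c * (C0 * (2 * R * (R - r) powr (\<alpha> - 2) * circ_mean R (\<lambda>w. \<bar>Re (u w)\<bar>)) * r powr (-\<alpha>))"
      using \<kappa>0 by (intro add_mono sum_mono mult_left_mono K_mean u r(1) rR(1) emean) (auto simp: n_def)
    also have "circ_mean R (\<lambda>w. \<bar>Re (u w)\<bar>) = circ_mean R (\<lambda>z. \<bar>ln (norm (y z))\<bar>)"
      by (rule circ_mean_cong) (use u(2) rR r in auto)
    also have "(\<Sum>a\<in>S. n a * (\<kappa> * (4 * (C0 * r powr (-\<alpha>))))) = zp_count y R * (4 * \<kappa> * C0 * r powr (-\<alpha>))"
      unfolding zp_count_def S_def[symmetric] n_def sum_distrib_right by (intro sum.cong refl) simp
    finally have Emean: "circ_mean r E \<le> zp_count y R * (4 * \<kappa> * C0 * r powr (-\<alpha>)) +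
       2 * norm c * (C0 * (2 * R * (R - r) powr (\<alpha> - 2) * circ_mean R (\<lambda>z. \<bar>ln (norm (y z))\<bar>)) * r powr (-\<alpha>))" .
    have Apos: "circ_mean R (\<lambda>z. \<bar>ln (norm (y z))\<bar>) \<ge> 0"
    proof -
      have "circ_mean R (\<lambda>_. 0 :: real) \<le> circ_mean R (\<lambda>z. \<bar>Re (u z)\<bar>)"
        by (rule circ_mean_mono) (use r rR in \<open>auto intro!: continuous_intros hc\<close>)
      also have "\<dots> = circ_mean R (\<lambda>z. \<bar>ln (norm (y z))\<bar>)"
        by (rule circ_mean_cong) (use u(2) r rR in auto)
      finally show ?thesis by simp
    qed
    define X where "X = zp_count y R * r powr (-\<alpha>)"
    define Y where "Y = R * (R - r) powr (\<alpha> - 2) * circ_mean R (\<lambda>z. \<bar>ln (norm (y z))\<bar>) * r powr (-\<alpha>)"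
    have XY: "X \<ge> 0" "Y \<ge> 0" using r rR Apos zp_count_nonneg[of y R] by (auto simp: X_def Y_def)
    have pjXY: "pj_error \<alpha> y r R = X + Y" by (simp add: pj_error_def X_def Y_def distrib_right)
    have "circ_mean r E \<le> 4 * \<kappa> * C0 * X + 4 * norm c * C0 * Y"
      using Emean by (simp add: X_def Y_def mult_ac)
    also have "\<dots> \<le> (4 * \<kappa> * C0 + 4 * norm c * C0 + 2 * C0) * X + (4 * \<kappa> * C0 + 4 * norm c * C0 + 2 * C0) * Y"
      using XY \<kappa>0 C0(1) by (intro add_mono mult_right_mono) auto
    finally have Emean': "circ_mean r E \<le> (4 * \<kappa> * C0 + 4 * norm c * C0 + 2 * C0) * pj_error \<alpha> y r R"
      unfolding pjXY by (simp add: distrib_left)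
    have pt: "\<bar>ln (norm (y (z + c))) - ln (norm (y z))\<bar> \<le> E z" if z: "norm z = r" for z
    proof -
      have zR: "norm z < R" "norm (z + c) < R" using z rR norm_triangle_ineq[of z c] by linarith+
      have 1: "\<bar>ln (norm (blaschke R a (z + c))) - ln (norm (blaschke R a z))\<bar> \<le> \<kappa> * e a z" if a: "a \<in> S" for a
      proof -
        have ne: "z + c - a \<noteq> 0" "z - a \<noteq> 0" using Sne[OF a z] by auto
        define p q where "p = of_real (R\<^sup>2) - cnj a * (z + c)" and "q = of_real (R\<^sup>2) - cnj a * z"
        have pq: "p \<noteq> 0" "q \<noteq> 0" unfolding p_def q_def using blaschke_denom_nz[OF Sint[OF a]] zR by auto
        have lnb: "ln (norm (blaschke R a (z + c))) = ln R + ln (norm (z + c - a)) - ln (norm p)"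
          "ln (norm (blaschke R a z)) = ln R + ln (norm (z - a)) - ln (norm q)"
          using ne pq r rR unfolding blaschke_def p_def[symmetric] q_def[symmetric]
          by (simp_all add: norm_mult norm_divide ln_mult_pos ln_divide_pos)
        have d1: "norm ((z + c - a) - (z - a)) \<le> norm c" by simp
        have "p - q = - (cnj a * c)" by (simp add: p_def q_def algebra_simps)
        hence d2: "norm (p - q) \<le> norm a * norm c" by (simp add: norm_mult)
        have b: "\<bar>ln (norm (z + c - a)) - ln (norm (z - a))\<bar> \<le> (norm c / norm (z + c - a)) powr \<alpha> / \<alpha> + (norm c / norm (z - a)) powr \<alpha> / \<alpha>"
          "\<bar>ln (norm p) - ln (norm q)\<bar> \<le> (norm a * norm c / norm p) powr \<alpha> / \<alpha> + (norm a * norm c / norm q) powr \<alpha> / \<alpha>"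
          using \<alpha> by (intro abs_ln_quotient_le ne d1 d2 pq; simp)+
        have c\<kappa>: "norm c powr \<alpha> / \<alpha> \<le> \<kappa>" unfolding \<kappa>_def using \<alpha> by (intro divide_right_mono powr_mono2) auto
        have "(norm c / norm w) powr \<alpha> / \<alpha> \<le> \<kappa> * norm w powr (-\<alpha>)" for w :: complex
        proof -
          have "(norm c / norm w) powr \<alpha> / \<alpha> = norm c powr \<alpha> / \<alpha> * norm w powr (-\<alpha>)"
            by (simp add: powr_divide powr_minus_divide)
          also have "\<dots> \<le> \<kappa> * norm w powr (-\<alpha>)" by (intro mult_right_mono c\<kappa>) auto
          finally show ?thesis .
        qed
        moreover have "(norm a * norm c / norm p) powr \<alpha> / \<alpha> \<le> \<kappa> * norm (\<rho> a R (z + c)) powr \<alpha>"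
        proof -
          have "norm a * norm c / norm p = norm c * norm (\<rho> a R (z + c))" by (simp add: \<rho>_def p_def norm_divide)
          hence "(norm a * norm c / norm p) powr \<alpha> / \<alpha> = norm c powr \<alpha> / \<alpha> * norm (\<rho> a R (z + c)) powr \<alpha>"
            by (simp add: powr_mult)
          also have "\<dots> \<le> \<kappa> * norm (\<rho> a R (z + c)) powr \<alpha>" by (intro mult_right_mono c\<kappa>) auto
          finally show ?thesis .
        qed
        moreover have "(norm a * norm c / norm q) powr \<alpha> / \<alpha> \<le> \<kappa> * norm (\<rho> a R z) powr \<alpha>"
        proof -
          have "norm a * norm c / norm q = norm c * norm (\<rho> a R z)" by (simp add: \<rho>_def q_def norm_divide)
          hence "(norm a * norm c / norm q) powr \<alpha> / \<alpha> = norm c powr \<alpha> / \<alpha> * norm (\<rho> a R z) powr \<alpha>"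
            by (simp add: powr_mult)
          also have "\<dots> \<le> \<kappa> * norm (\<rho> a R z) powr \<alpha>" by (intro mult_right_mono c\<kappa>) auto
          finally show ?thesis .
        qed
        ultimately have "\<bar>ln (norm (z + c - a)) - ln (norm (z - a))\<bar> + \<bar>ln (norm p) - ln (norm q)\<bar> \<le>
          (\<kappa> * norm (z + c - a) powr (-\<alpha>) + \<kappa> * norm (z - a) powr (-\<alpha>)) + (\<kappa> * norm (\<rho> a R (z + c)) powr \<alpha> + \<kappa> * norm (\<rho> a R z) powr \<alpha>)"
          using b by (smt (verit))
        also have "\<dots> = \<kappa> * e a z" by (simp add: e_def distrib_left)
        finally show ?thesis unfolding lnb by linarith
      qed
      have "norm (u (z + c) - u z) \<le> 2 * norm c * K u r R z"
      proof -
        have "norm (u (z + c) - u z) \<le> norm c * circ_mean R (\<lambda>w. \<bar>Re (u w)\<bar> * (2 * R / (norm (w - (z + c)) * norm (w - z))))"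
          using Schwarz_increment_bound[OF u(1) zR(2,1)] by simp
        moreover have "circ_mean R (\<lambda>w. \<bar>Re (u w)\<bar> * (2 * R / (norm (w - (z + c)) * norm (w - z)))) \<le>
          circ_mean R (\<lambda>w. 2 * (\<bar>Re (u w)\<bar> * (2 * R * (R - r) powr (\<alpha> - 2) * norm (z - w) powr (-\<alpha>))))"
        proof (rule circ_mean_mono)
          fix w :: complex assume w: "norm w = R"
          have "norm (w - (z + c)) \<ge> R - (r + norm c)"
            using norm_triangle_ineq2[of w "z + c"] norm_triangle_ineq[of z c] z w by linarith
          \<comment> \<open>Here R > r + 2 |c| enters: the shifted point keeps at least half of the
            distance R - r to the outer circle.\<close>
          hence "2 * norm (w - (z + c)) \<ge> R - r" using r by linarith
          from kern[OF z w rR(1) this] r rR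
          have "4 * R * (1 / (norm (z - w) * (2 * norm (w - (z + c))))) \<le> 4 * R * ((R - r) powr (\<alpha> - 2) * norm (z - w) powr (-\<alpha>))"
            by (intro mult_left_mono) auto
          hence "2 * R / (norm (w - (z + c)) * norm (w - z)) \<le> 2 * (2 * R * (R - r) powr (\<alpha> - 2) * norm (z - w) powr (-\<alpha>))"
            by (simp add: norm_minus_commute mult_ac)
          hence "\<bar>Re (u w)\<bar> * (2 * R / (norm (w - (z + c)) * norm (w - z))) \<le> \<bar>Re (u w)\<bar> * (2 * (2 * R * (R - r) powr (\<alpha> - 2) * norm (z - w) powr (-\<alpha>)))"
            by (intro mult_left_mono) auto
          thus "\<bar>Re (u w)\<bar> * (2 * R / (norm (w - (z + c)) * norm (w - z))) \<le> 2 * (\<bar>Re (u w)\<bar> * (2 * R * (R - r) powr (\<alpha> - 2) * norm (z - w) powr (-\<alpha>)))"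
            by (simp only: mult_ac)
        next
          have "w - (z + c) \<noteq> 0" "w - z \<noteq> 0" if "norm w = R" for w using that zR by auto
          thus "continuous_on (sphere 0 R) (\<lambda>w. \<bar>Re (u w)\<bar> * (2 * R / (norm (w - (z + c)) * norm (w - z))))"
            by (intro continuous_intros hc) auto
        qed (use r rR zR in \<open>auto intro!: continuous_intros hc\<close>)
        moreover have "\<dots> = 2 * K u r R z" unfolding K_def by (rule circ_mean_cmult)
        ultimately have "norm (u (z + c) - u z) \<le> norm c * (2 * K u r R z)"
          using mult_left_mono[OF _ norm_ge_zero[of c]] order_trans by (smt (verit))
        thus ?thesis by (simp add: mult_ac)
      qed
      hence 2: "\<bar>Re (u (z + c)) - Re (u z)\<bar> \<le> 2 * norm c * K u r R z"
        using abs_Re_le_cmod[of "u (z + c) - u z"] by simp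
      have "ln (norm (y (z + c))) - ln (norm (y z)) = (Re (u (z + c)) - Re (u z)) +
         (\<Sum>a\<in>S. of_int (zorder y a) * (ln (norm (blaschke R a (z + c))) - ln (norm (blaschke R a z))))"
        using lneq[OF zR(1) yreg(1,2)[OF z]] lneq[OF zR(2) yreg(3,4)[OF z]]
        by (simp add: right_diff_distrib sum_subtractf)
      also have "\<bar>\<dots>\<bar> \<le> \<bar>Re (u (z + c)) - Re (u z)\<bar> +
         \<bar>\<Sum>a\<in>S. of_int (zorder y a) * (ln (norm (blaschke R a (z + c))) - ln (norm (blaschke R a z)))\<bar>"
        by (rule abs_triangle_ineq)
      also have "\<bar>\<Sum>a\<in>S. of_int (zorder y a) * (ln (norm (blaschke R a (z + c))) - ln (norm (blaschke R a z)))\<bar> \<le>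
         (\<Sum>a\<in>S. n a * (\<kappa> * e a z))"
        by (rule order_trans[OF sum_abs], intro sum_mono, unfold abs_mult n_def, intro mult_left_mono 1) auto
      finally show ?thesis unfolding E_def using 2 by linarith
    qed
    have "continuous_on (sphere 0 r) (\<lambda>z. \<bar>ln (norm (y (z + c))) - ln (norm (y z))\<bar>)"
      using regular_radius_continuous(1,2)[OF reg(1)] regular_radius_continuous(1,2)[OF reg(2)]
      by (intro continuous_intros) auto
    hence "circ_mean r (\<lambda>z. \<bar>ln (norm (y (z + c))) - ln (norm (y z))\<bar>) \<le> circ_mean r E"
      using r pt by (intro circ_mean_mono Econt) auto
    thus ?thesis using Emean' by (simp add: \<kappa>_def)
    qed
  qed
qed

section \<open>Proximity functions and the first main theorem\<close>

lemma proximity_eq: "proximity r f = circ_mean r (\<lambda>z. log_plus (norm (f z)))"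
  by (simp add: proximity_def circ_mean_def)

lemma log_plus_eq_ln_max: "x \<ge> 0 \<Longrightarrow> log_plus x = ln (max 1 x)"
  by (cases "x = 0") (auto simp: log_plus_def max_def)

lemma log_plus_nonneg: "log_plus x \<ge> 0"
  by (simp add: log_plus_def)

lemma log_plus_mono: "0 \<le> x \<Longrightarrow> x \<le> y \<Longrightarrow> log_plus x \<le> log_plus y"
  by (subst (1 2) log_plus_eq_ln_max) (auto intro!: ln_mono)

lemma log_plus_mult: "0 \<le> x \<Longrightarrow> 0 \<le> y \<Longrightarrow> log_plus (x * y) \<le> log_plus x + log_plus y"
proof -
  assume xy: "0 \<le> x" "0 \<le> y"
  show ?thesis
  proof (cases "x = 0 \<or> y = 0")
    case True
    thus ?thesis using log_plus_nonneg[of x] log_plus_nonneg[of y] by (auto simp: log_plus_def)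
  next
    case False
    hence "ln (x * y) = ln x + ln y" using xy by (intro ln_mult_pos) auto
    thus ?thesis unfolding log_plus_def by linarith
  qed
qed

lemma log_plus_add:
  assumes "0 \<le> x" "0 \<le> y"
  shows "log_plus (x + y) \<le> log_plus x + log_plus y + ln 2"
proof -
  have "max 1 (x + y) \<le> 2 * (max 1 x * max 1 y)"
  proof -
    have "x \<le> max 1 x * max 1 y" using mult_mono[of x "max 1 x" 1 "max 1 y"] assms by simp
    moreover have "y \<le> max 1 x * max 1 y" using mult_mono[of 1 "max 1 x" y "max 1 y"] assms by simp
    moreover have "1 \<le> max 1 x * max 1 y" using mult_mono[of 1 "max 1 x" 1 "max 1 y"] by simp
    ultimately show ?thesis by simp
  qed
  moreover have "max 1 (x + y) > 0" "max 1 x > 0" "max 1 y > 0" by (auto simp: less_max_iff_disj)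
  ultimately have "ln (max 1 (x + y)) \<le> ln 2 + (ln (max 1 x) + ln (max 1 y))"
    using ln_mono[of "max 1 (x + y)" "2 * (max 1 x * max 1 y)"] by (simp add: ln_mult_pos)
  thus ?thesis using assms by (simp add: log_plus_eq_ln_max)
qed

lemma log_plus_power: "0 \<le> x \<Longrightarrow> log_plus (x ^ n) = real n * log_plus x"
proof -
  assume "0 \<le> x"
  show ?thesis
  proof (cases "x = 0 \<or> n = 0")
    case True
    thus ?thesis by (cases n) (auto simp: log_plus_def)
  next
    case False
    hence "ln (x ^ n) = real n * ln x" using \<open>0 \<le> x\<close> by (simp add: ln_realpow)
    thus ?thesis unfolding log_plus_def by (simp add: max_mult_distrib_left)
  qed
qed

lemma log_plus_le_ln_one_plus: "0 \<le> x \<Longrightarrow> log_plus x \<le> ln (1 + x)"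
  by (subst log_plus_eq_ln_max) (auto intro!: ln_mono)

lemma abs_ln_eq_log_plus: "x > 0 \<Longrightarrow> \<bar>ln x\<bar> = log_plus x + log_plus (inverse x)"
  by (auto simp: log_plus_def ln_inverse)

lemma ln_eq_log_plus: "x > 0 \<Longrightarrow> ln x = log_plus x - log_plus (inverse x)"
  by (auto simp: log_plus_def ln_inverse)

lemma continuous_on_log_plus:
  fixes f :: "complex \<Rightarrow> complex"
  assumes "continuous_on A f"
  shows "continuous_on A (\<lambda>z. log_plus (norm (f z)))"
proof -
  have "continuous_on A (\<lambda>z. ln (max 1 (norm (f z))))"
    by (intro continuous_intros assms) (auto simp: max_def)
  thus ?thesis by (simp add: log_plus_eq_ln_max)
qed

lemma proximity_nonneg:
  assumes "continuous_on (sphere 0 r) f" "r \<ge> 0"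
  shows "proximity r f \<ge> 0"
  using circ_mean_mono[of r "\<lambda>_. 0" "\<lambda>z. log_plus (norm (f z))"] assms continuous_on_log_plus log_plus_nonneg
  by (auto simp: proximity_eq)

lemma proximity_le_sum:
  assumes "continuous_on (sphere 0 r) f" "finite I" "\<And>i. i \<in> I \<Longrightarrow> continuous_on (sphere 0 r) (g i)" "r \<ge> 0"
    "\<And>z. norm z = r \<Longrightarrow> log_plus (norm (f z)) \<le> (\<Sum>i\<in>I. k i * log_plus (norm (g i z))) + C"
  shows "proximity r f \<le> (\<Sum>i\<in>I. k i * proximity r (g i)) + C"
proof -
  have "proximity r f \<le> circ_mean r (\<lambda>z. (\<Sum>i\<in>I. k i * log_plus (norm (g i z))) + C)"
    unfolding proximity_eq using assms by (intro circ_mean_mono continuous_intros continuous_on_log_plus) auto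
  also have "\<dots> = circ_mean r (\<lambda>z. \<Sum>i\<in>I. k i * log_plus (norm (g i z))) + C"
    using assms by (subst circ_mean_add) (auto intro!: continuous_intros continuous_on_log_plus)
  also have "circ_mean r (\<lambda>z. \<Sum>i\<in>I. k i * log_plus (norm (g i z))) = (\<Sum>i\<in>I. k i * proximity r (g i))"
    using assms by (subst circ_mean_sum) (auto intro!: continuous_intros continuous_on_log_plus simp: circ_mean_cmult proximity_eq)
  finally show ?thesis .
qed

lemma proximity_le2:
  assumes "continuous_on (sphere 0 r) f" "continuous_on (sphere 0 r) g" "continuous_on (sphere 0 r) h" "r \<ge> 0"
    "\<And>z. norm z = r \<Longrightarrow> log_plus (norm (f z)) \<le> log_plus (norm (g z)) + log_plus (norm (h z)) + C"
  shows "proximity r f \<le> proximity r g + proximity r h + C"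
  using proximity_le_sum[of r f "{True, False}" "\<lambda>b. if b then g else h" "\<lambda>_. 1" C] assms by simp

lemma proximity_add:
  assumes "continuous_on (sphere 0 r) f" "continuous_on (sphere 0 r) g" "r \<ge> 0"
  shows "proximity r (\<lambda>z. f z + g z) \<le> proximity r f + proximity r g + ln 2"
proof (rule proximity_le2)
  fix z
  have "log_plus (norm (f z + g z)) \<le> log_plus (norm (f z) + norm (g z))"
    by (intro log_plus_mono norm_triangle_ineq) auto
  also have "\<dots> \<le> log_plus (norm (f z)) + log_plus (norm (g z)) + ln 2" by (rule log_plus_add) auto
  finally show "log_plus (norm (f z + g z)) \<le> log_plus (norm (f z)) + log_plus (norm (g z)) + ln 2" .
qed (intro continuous_intros assms)+

lemma proximity_mult:
  assumes "continuous_on (sphere 0 r) f" "continuous_on (sphere 0 r) g" "r \<ge> 0"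
  shows "proximity r (\<lambda>z. f z * g z) \<le> proximity r f + proximity r g"
  using proximity_le2[of r "\<lambda>z. f z * g z" f g 0] assms
  by (simp add: continuous_on_mult norm_mult log_plus_mult)

section \<open>The characteristic and the first main theorem\<close>

lemma counting_mono_radius:
  assumes "loc_finite \<nu>" "1 \<le> r" "r \<le> R"
  shows "counting \<nu> r \<le> counting \<nu> R"
proof -
  have "counting \<nu> r \<le> (\<Sum>z | norm z \<le> r \<and> \<nu> z \<noteq> 0. real (\<nu> z) * ln (R / max 1 (norm z)))"
    unfolding counting_def
  proof (intro sum_mono mult_left_mono)
    fix z assume "z \<in> {z. norm z \<le> r \<and> \<nu> z \<noteq> 0}"
    have "0 < r / max 1 (norm z)" using assms by (intro divide_pos_pos) (auto simp: less_max_iff_disj)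
    moreover have "r / max 1 (norm z) \<le> R / max 1 (norm z)" using assms by (intro divide_right_mono) auto
    ultimately show "ln (r / max 1 (norm z)) \<le> ln (R / max 1 (norm z))" by (intro ln_mono)
  qed auto
  also have "\<dots> \<le> counting \<nu> R" unfolding counting_def
    using assms by (intro sum_mono2 mult_nonneg_nonneg counting_term_nonneg) (auto simp: loc_finite_def)
  finally show ?thesis .
qed

text \<open>The Nevanlinna characteristic up to a bounded term, with the weights of
  \<open>counting\<close> near the origin.\<close>

definition nchar :: "real \<Rightarrow> (complex \<Rightarrow> complex) \<Rightarrow> real" where
  "nchar r y = proximity r y + counting (pole_ord y) r"

lemma regular_radius_inverse: "regular_radius y r \<Longrightarrow> regular_radius (\<lambda>z. inverse (y z)) r"
  by (auto simp: regular_radius_def intro!: analytic_intros)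

lemma nchar_nonneg:
  assumes "regular_radius y r" "r \<ge> 1"
  shows "proximity r y \<ge> 0" "counting (pole_ord y) r \<ge> 0" "nchar r y \<ge> 0"
  using assms counting_nonneg[of r] proximity_nonneg[of r y] regular_radius_continuous[of y r]
  by (auto simp: nchar_def)

lemma mean_ln_eq:
  assumes "regular_radius y r" "r \<ge> 0"
  shows "circ_mean r (\<lambda>z. ln (norm (y z))) = proximity r y - proximity r (\<lambda>z. inverse (y z))"
    "circ_mean r (\<lambda>z. \<bar>ln (norm (y z))\<bar>) = proximity r y + proximity r (\<lambda>z. inverse (y z))"
proof -
  note c = regular_radius_continuous(1)[OF assms(1)] regular_radius_continuous(1)[OF regular_radius_inverse[OF assms(1)]]
  have "circ_mean r (\<lambda>z. ln (norm (y z))) = circ_mean r (\<lambda>z. log_plus (norm (y z)) - log_plus (norm (inverse (y z))))"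
    by (rule circ_mean_cong) (use assms regular_radius_continuous(2)[OF assms(1)] in \<open>auto simp: ln_eq_log_plus norm_inverse\<close>)
  thus "circ_mean r (\<lambda>z. ln (norm (y z))) = proximity r y - proximity r (\<lambda>z. inverse (y z))"
    using assms c by (simp add: circ_mean_diff continuous_on_log_plus proximity_eq)
  have "circ_mean r (\<lambda>z. \<bar>ln (norm (y z))\<bar>) = circ_mean r (\<lambda>z. log_plus (norm (y z)) + log_plus (norm (inverse (y z))))"
    by (rule circ_mean_cong) (use assms regular_radius_continuous(2)[OF assms(1)] in \<open>auto simp: abs_ln_eq_log_plus norm_inverse\<close>)
  thus "circ_mean r (\<lambda>z. \<bar>ln (norm (y z))\<bar>) = proximity r y + proximity r (\<lambda>z. inverse (y z))"
    using assms c by (simp add: circ_mean_add continuous_on_log_plus proximity_eq)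
qed

text \<open>Jensen's formula with ln |y| split into log+ |y| - log+ |1/y|.\<close>

lemma first_main_theorem:
  assumes mero: "y meromorphic_on UNIV" and nz: "\<forall>\<^sub>\<approx>z. y z \<noteq> 0"
  obtains C where "C \<ge> 0" "\<And>r. r \<ge> 1 \<Longrightarrow> regular_radius y r \<Longrightarrow> \<bar>nchar r (\<lambda>z. inverse (y z)) - nchar r y\<bar> \<le> C"
proof -
  obtain C where C: "\<And>r. r \<ge> 1 \<Longrightarrow> regular_radius y r \<Longrightarrow>
    circ_mean r (\<lambda>z. ln (norm (y z))) = counting (pole_ord (\<lambda>w. inverse (y w))) r - counting (pole_ord y) r + C"
    using Jensen_formula[OF assms] by blast
  show thesis
  proof (rule that[of "\<bar>C\<bar>"])
    fix r :: real assume "r \<ge> 1" "regular_radius y r"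
    thus "\<bar>nchar r (\<lambda>z. inverse (y z)) - nchar r y\<bar> \<le> \<bar>C\<bar>"
      using C[of r] mean_ln_eq(1)[of y r] by (simp add: nchar_def)
  qed simp
qed

text \<open>Zeros and poles up to \<open>R\<close> are counted through the characteristic at the
  still larger radius R', the boundary mean through the characteristic at \<open>R\<close>. By the
  first main theorem the inverse of y costs only a second copy of the characteristic and a
  constant.\<close>

lemma pj_error_le:
  assumes mero: "y meromorphic_on UNIV" and nz: "\<forall>\<^sub>\<approx>z. y z \<noteq> 0"
  obtains C where "C \<ge> 0" "\<And>r R R'. 1 \<le> r \<Longrightarrow> r < R \<Longrightarrow> R < R' \<Longrightarrow>
     regular_radius y R \<Longrightarrow> regular_radius y R' \<Longrightarrow>
     pj_error \<alpha> y r R \<le> (R' / (R' - R) * (2 * nchar R' y + C) + R * (R - r) powr (\<alpha> - 2) * (2 * nchar R y + C)) * r powr (-\<alpha>)"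
proof -
  obtain C where C: "C \<ge> 0" "\<And>r. r \<ge> 1 \<Longrightarrow> regular_radius y r \<Longrightarrow> \<bar>nchar r (\<lambda>z. inverse (y z)) - nchar r y\<bar> \<le> C"
    using first_main_theorem[OF assms] by blast
  have evnz: "eventually (\<lambda>w. y w \<noteq> 0) (at z)" for z
    using nz by (rule eventually_cosparse_imp_eventually_at) auto
  have mz: "y meromorphic_on {z}" for z using mero by (rule meromorphic_on_subset) auto
  show thesis
  proof (rule that[OF C(1)])
    fix r R R' :: real assume r: "1 \<le> r" "r < R" "R < R'" and reg: "regular_radius y R" "regular_radius y R'"
    define \<nu> where "\<nu> = (\<lambda>z. pole_ord y z + pole_ord (\<lambda>w. inverse (y w)) z)"
    have lf: "loc_finite (pole_ord y)" "loc_finite (pole_ord (\<lambda>w. inverse (y w)))"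
      by (intro loc_finite_pole_ord meromorphic_intros mero)+
    have "zp_count y R \<le> (\<Sum>z | norm z \<le> R \<and> \<nu> z \<noteq> 0. real (\<nu> z))"
      unfolding zp_count_def zero_pole_set_def \<nu>_def zorder_eq_pole_ord[OF mz evnz]
      by (intro sum_mono) auto
    also have "\<dots> \<le> R' / (R' - R) * counting \<nu> R'"
      unfolding \<nu>_def using r by (intro sum_le_counting loc_finite_add lf) auto
    also have "counting \<nu> R' = counting (pole_ord y) R' + counting (pole_ord (\<lambda>w. inverse (y w))) R'"
      unfolding \<nu>_def by (rule counting_add[OF lf])
    also have "R' / (R' - R) * \<dots> \<le> R' / (R' - R) * (2 * nchar R' y + C)"
    proof (rule mult_left_mono)
      show "counting (pole_ord y) R' + counting (pole_ord (\<lambda>w. inverse (y w))) R' \<le> 2 * nchar R' y + C"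
        using C(2)[OF _ reg(2)] nchar_nonneg[OF reg(2)] nchar_nonneg[OF regular_radius_inverse[OF reg(2)]] r
        by (simp add: nchar_def)
    qed (use r in auto)
    finally have 1: "zp_count y R \<le> R' / (R' - R) * (2 * nchar R' y + C)" .
    have "circ_mean R (\<lambda>z. \<bar>ln (norm (y z))\<bar>) \<le> 2 * nchar R y + C"
      using C(2)[OF _ reg(1)] nchar_nonneg[OF reg(1)] nchar_nonneg[OF regular_radius_inverse[OF reg(1)]] r
        mean_ln_eq(2)[OF reg(1)] by (simp add: nchar_def)
    hence 2: "R * (R - r) powr (\<alpha> - 2) * circ_mean R (\<lambda>z. \<bar>ln (norm (y z))\<bar>) \<le> R * (R - r) powr (\<alpha> - 2) * (2 * nchar R y + C)"
      using r by (intro mult_left_mono) auto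
    show "pj_error \<alpha> y r R \<le> (R' / (R' - R) * (2 * nchar R' y + C) + R * (R - r) powr (\<alpha> - 2) * (2 * nchar R y + C)) * r powr (-\<alpha>)"
      unfolding pj_error_def by (intro mult_right_mono add_mono 1 2) auto
  qed
qed

section \<open>Windows of radii\<close>

text \<open>A sequence of windows $[r_n, r_n + h_n]$ together with reference sizes $T_n$. The condition on
  $h$ makes the error terms of the Poisson--Jensen estimates small compared with $T_n$.\<close>

locale windows =
  fixes r h T :: "nat \<Rightarrow> real" and \<alpha> :: real
  assumes \<alpha>: "0 < \<alpha>" "\<alpha> < 1"
    and h_le_r: "\<And>n. h n \<le> r n"
    and h_lim: "filterlim h at_top sequentially"
    and T_lim: "filterlim T at_top sequentially"
    and rh_lim: "(\<lambda>n. r n powr (1 - \<alpha>) / h n) \<longlonglongrightarrow> 0"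
begin

text \<open>The fraction \<delta> leaves room for moving to larger radii inside the window. One set
  \<open>E\<close> of finite measure, the same for all n, absorbs the exceptional sets of Nevanlinna
  theory. Both are chosen per property, so that finitely many properties can be combined.\<close>

definition win_pred :: "(nat \<times> real \<Rightarrow> bool) \<Rightarrow> bool" where
  "win_pred P \<longleftrightarrow> (\<exists>\<delta>>0. \<exists>E\<in>lmeasurable. eventually (\<lambda>n. \<forall>s\<in>{r n..r n + \<delta> * h n} - E. P (n, s)) sequentially)"

definition W :: "(nat \<times> real) filter" where
  "W = Abs_filter win_pred"

lemma h_pos: "eventually (\<lambda>n. h n > K) sequentially"
  using h_lim by (simp add: filterlim_at_top_dense)

lemma is_filter_win_pred: "is_filter win_pred"
proof
  show "win_pred (\<lambda>_. True)" unfolding win_pred_def by (intro exI[of _ 1] bexI[of _ "{}"]) auto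
next
  fix P Q assume "win_pred P" "win_pred Q"
  then obtain \<delta>1 \<delta>2 E1 E2 where *: "\<delta>1 > 0" "\<delta>2 > 0" "E1 \<in> lmeasurable" "E2 \<in> lmeasurable"
    "eventually (\<lambda>n. \<forall>s\<in>{r n..r n + \<delta>1 * h n} - E1. P (n, s)) sequentially"
    "eventually (\<lambda>n. \<forall>s\<in>{r n..r n + \<delta>2 * h n} - E2. Q (n, s)) sequentially"
    unfolding win_pred_def by blast
  have "eventually (\<lambda>n. \<forall>s\<in>{r n..r n + min \<delta>1 \<delta>2 * h n} - (E1 \<union> E2). P (n, s) \<and> Q (n, s)) sequentially"
    using *(5,6) h_pos[of 0]
  proof eventually_elim
    case (elim n)
    have "min \<delta>1 \<delta>2 * h n \<le> \<delta>1 * h n" "min \<delta>1 \<delta>2 * h n \<le> \<delta>2 * h n"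
      using elim(3) by (intro mult_right_mono; simp)+
    thus ?case using elim(1,2) by auto
  qed
  thus "win_pred (\<lambda>x. P x \<and> Q x)" unfolding win_pred_def using *(1-4)
    by (intro exI[of _ "min \<delta>1 \<delta>2"] bexI[of _ "E1 \<union> E2"] conjI fmeasurable.Un) auto
next
  fix P Q :: "nat \<times> real \<Rightarrow> bool" assume PQ: "\<forall>x. P x \<longrightarrow> Q x" and "win_pred P"
  then obtain \<delta> E where *: "\<delta> > 0" "E \<in> lmeasurable"
    "eventually (\<lambda>n. \<forall>s\<in>{r n..r n + \<delta> * h n} - E. P (n, s)) sequentially" unfolding win_pred_def by blast
  have "eventually (\<lambda>n. \<forall>s\<in>{r n..r n + \<delta> * h n} - E. Q (n, s)) sequentially"
    using *(3) by eventually_elim (use PQ in auto)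
  thus "win_pred Q" unfolding win_pred_def using * by blast
qed

lemma eventually_W: "eventually P W \<longleftrightarrow> (\<exists>\<delta>>0. \<exists>E\<in>lmeasurable. eventually (\<lambda>n. \<forall>s\<in>{r n..r n + \<delta> * h n} - E. P (n, s)) sequentially)"
  unfolding W_def eventually_Abs_filter[OF is_filter_win_pred] win_pred_def ..

lemma eventually_WI:
  assumes "\<delta> > 0" "E \<in> lmeasurable" "eventually (\<lambda>n. \<forall>s\<in>{r n..r n + \<delta> * h n} - E. P (n, s)) sequentially"
  shows "eventually P W"
  unfolding eventually_W using assms by blast

text \<open>Since \<open>h n\<close> tends to infinity, an interval of length \<delta>
  \<open>h n\<close> eventually has larger measure than \<open>E\<close>, wherever it lies.\<close>

lemma window_not_covered:
  assumes "E \<in> lmeasurable" "\<delta> > 0"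
  shows "eventually (\<lambda>n. \<forall>a. \<exists>s. a \<le> s \<and> s \<le> a + \<delta> * h n \<and> s \<notin> E) sequentially"
  using h_pos[of "measure lebesgue E / \<delta>"] h_pos[of 0]
proof eventually_elim
  case (elim n)
  show ?case
  proof (rule allI, rule ccontr)
    fix a assume "\<not> (\<exists>s. a \<le> s \<and> s \<le> a + \<delta> * h n \<and> s \<notin> E)"
    hence "{a..a + \<delta> * h n} \<subseteq> E" by auto
    hence "measure lebesgue {a..a + \<delta> * h n} \<le> measure lebesgue E"
      using assms by (intro measure_mono_fmeasurable) auto
    thus False using elim assms by (simp add: field_simps)
  qed
qed

lemma W_nontrivial: "W \<noteq> bot"
proof
  assume "W = bot"
  hence "eventually (\<lambda>_. False) W" by simp
  then obtain \<delta> E where *: "\<delta> > 0" "E \<in> lmeasurable"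
    "eventually (\<lambda>n. \<forall>s\<in>{r n..r n + \<delta> * h n} - E. False) sequentially" unfolding eventually_W by blast
  have "eventually (\<lambda>n. False) sequentially"
    using *(3) window_not_covered[OF *(2,1)]
  proof eventually_elim
    case (elim n)
    then obtain s where "r n \<le> s" "s \<le> r n + \<delta> * h n" "s \<notin> E" by blast
    with elim(1) show False by auto
  qed
  thus False by simp
qed

text \<open>Passing to at most a quarter of the original fraction keeps the interval from s +
  \<delta> h to s + 2 \<delta> h inside the original window, and the exceptional set cannot cover
  that interval.\<close>

lemma W_larger_radius:
  assumes "eventually P W"
  obtains \<delta> where "\<delta> > 0" "\<delta> \<le> 1" "eventually (\<lambda>(n, s). \<exists>s'. s + \<delta> * h n \<le> s' \<and> s' \<le> s + 2 * \<delta> * h n \<and> P (n, s')) W"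
proof -
  obtain \<delta>0 E where *: "\<delta>0 > 0" "E \<in> lmeasurable"
    "eventually (\<lambda>n. \<forall>s\<in>{r n..r n + \<delta>0 * h n} - E. P (n, s)) sequentially" using assms unfolding eventually_W by blast
  define \<delta> where "\<delta> = min 1 (\<delta>0 / 4)"
  have \<delta>: "\<delta> > 0" "\<delta> \<le> 1" "4 * \<delta> \<le> \<delta>0" using *(1) by (auto simp: \<delta>_def)
  have "eventually (\<lambda>n. \<forall>s\<in>{r n..r n + \<delta> * h n} - {}. \<exists>s'. s + \<delta> * h n \<le> s' \<and> s' \<le> s + 2 * \<delta> * h n \<and> P (n, s')) sequentially"
    using *(3) window_not_covered[OF *(2) \<delta>(1)] h_pos[of 0]
  proof eventually_elim
    case (elim n)
    show ?case
    proof
      fix s assume s: "s \<in> {r n..r n + \<delta> * h n} - {}"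
      obtain s' where s': "s + \<delta> * h n \<le> s'" "s' \<le> (s + \<delta> * h n) + \<delta> * h n" "s' \<notin> E" using elim(2) by blast
      have "4 * \<delta> * h n \<le> \<delta>0 * h n" using \<delta>(3) elim(3) by (intro mult_right_mono) auto
      moreover have "\<delta> * h n > 0" using \<delta>(1) elim(3) by simp
      ultimately have "s' \<in> {r n..r n + \<delta>0 * h n} - E" using s s' unfolding Diff_iff atLeastAtMost_iff by linarith
      thus "\<exists>s'. s + \<delta> * h n \<le> s' \<and> s' \<le> s + 2 * \<delta> * h n \<and> P (n, s')" using elim(1) s' by auto
    qed
  qed
  hence "eventually (\<lambda>(n, s). \<exists>s'. s + \<delta> * h n \<le> s' \<and> s' \<le> s + 2 * \<delta> * h n \<and> P (n, s')) W"
    by (intro eventually_WI[of \<delta> "{}"]) (use \<delta>(1) in auto)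
  thus thesis using that \<delta> by blast
qed

section \<open>Properties that hold along the window filter\<close>

lemma eventually_W_seq:
  assumes "eventually P sequentially"
  shows "eventually (\<lambda>(n, s). P n) W"
  using assms by (intro eventually_WI[of 1 "{}"]) (auto elim: eventually_mono)

lemma eventually_W_range: "eventually (\<lambda>(n, s). r n \<le> s \<and> s \<le> 2 * r n) W"
proof -
  have "eventually (\<lambda>n. \<forall>s\<in>{r n..r n + 1 * h n} - {}. r n \<le> s \<and> s \<le> 2 * r n) sequentially"
  proof (rule always_eventually, intro allI ballI)
    fix n s assume "s \<in> {r n..r n + 1 * h n} - {}"
    thus "r n \<le> s \<and> s \<le> 2 * r n" using h_le_r[of n] by auto
  qed
  thus ?thesis by (intro eventually_WI[of 1 "{}"]) auto
qed

lemma eventually_W_ge: "eventually (\<lambda>(n, s). s \<ge> K) W"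
  using eventually_W_range eventually_W_seq[OF h_pos[of K]]
proof eventually_elim
  case (elim x)
  thus ?case using h_le_r[of "fst x"] by (auto simp: case_prod_unfold)
qed

lemma eventually_W_T: "eventually (\<lambda>(n, s). T n \<ge> K) W"
  by (rule eventually_W_seq) (use T_lim in \<open>simp add: filterlim_at_top\<close>)

text \<open>A set without limit points is countable, so the radii of circles that meet it form a
  null set, which becomes the exceptional set.\<close>

lemma eventually_W_circle:
  fixes P :: "complex \<Rightarrow> bool"
  assumes "\<forall>\<^sub>\<approx>z. P z"
  shows "eventually (\<lambda>(n, s). \<forall>z. norm z = s \<longrightarrow> P z) W"
proof -
  have "countable {z. \<not> P z}" using assms unfolding eventually_cosparse
    using sparse_imp_countable[of UNIV "{z. \<not> P z}"] by simp
  hence "countable (norm ` {z. \<not> P z})" by (rule countable_image)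
  hence "negligible (\<Union>x\<in>norm ` {z. \<not> P z}. {x})" by (intro negligible_countable_Union) auto
  hence "norm ` {z. \<not> P z} \<in> lmeasurable" using negligible_imp_measurable by simp
  thus ?thesis
    by (intro eventually_WI[of 1 "norm ` {z. \<not> P z}"] always_eventually) auto
qed

lemma eventually_W_regular:
  assumes "y meromorphic_on UNIV" "\<forall>\<^sub>\<approx>z. y z \<noteq> 0"
  shows "eventually (\<lambda>(n, s). regular_radius y s) W"
proof -
  have "\<forall>\<^sub>\<approx>z. y analytic_on {z} \<and> y z \<noteq> 0"
    using meromorphic_on_imp_analytic_cosparse[OF assms(1)] assms(2) by eventually_elim auto
  from eventually_W_circle[OF this] show ?thesis by (simp add: regular_radius_def)
qed

lemma eventually_W_continuous:
  assumes "y meromorphic_on UNIV"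
  shows "eventually (\<lambda>(n, s). continuous_on (sphere 0 s) y) W"
  using eventually_W_circle[OF meromorphic_on_imp_analytic_cosparse[OF assms]]
  by eventually_elim (auto intro!: continuous_at_imp_continuous_on analytic_at_imp_isCont)

text \<open>The relation o(T) from above only: a negligible quantity may be very negative.
  Nonnegativity is supplied separately where it matters.\<close>

definition negl :: "(real \<Rightarrow> real) \<Rightarrow> bool" where
  "negl q \<longleftrightarrow> (\<forall>\<epsilon>>0. eventually (\<lambda>(n, s). q s \<le> \<epsilon> * T n) W)"

definition bdd :: "(real \<Rightarrow> real) \<Rightarrow> bool" where
  "bdd q \<longleftrightarrow> (\<exists>K. eventually (\<lambda>(n, s). q s \<le> K * T n) W)"

lemma negl_mono:
  assumes "negl q" "eventually (\<lambda>(n, s). p s \<le> q s) W"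
  shows "negl p"
  unfolding negl_def
proof (intro allI impI)
  fix \<epsilon> :: real assume "\<epsilon> > 0"
  with assms(1) have "eventually (\<lambda>(n, s). q s \<le> \<epsilon> * T n) W" by (simp add: negl_def)
  thus "eventually (\<lambda>(n, s). p s \<le> \<epsilon> * T n) W" using assms(2) by eventually_elim auto
qed

lemma negl_add:
  assumes "negl p" "negl q"
  shows "negl (\<lambda>s. p s + q s)"
  unfolding negl_def
proof (intro allI impI)
  fix \<epsilon> :: real assume "\<epsilon> > 0"
  hence "\<epsilon> / 2 > 0" by simp
  with assms have "eventually (\<lambda>(n, s). p s \<le> \<epsilon> / 2 * T n) W" "eventually (\<lambda>(n, s). q s \<le> \<epsilon> / 2 * T n) W"
    unfolding negl_def by blast+
  thus "eventually (\<lambda>(n, s). p s + q s \<le> \<epsilon> * T n) W" by eventually_elim auto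
qed

lemma negl_const: "negl (\<lambda>s. c)"
  unfolding negl_def
proof (intro allI impI)
  fix \<epsilon> :: real assume e: "\<epsilon> > 0"
  show "eventually (\<lambda>(n, s). c \<le> \<epsilon> * T n) W"
    using eventually_W_T[of "c / \<epsilon>"] by eventually_elim (use e in \<open>auto simp: field_simps\<close>)
qed

lemma negl_cmult:
  assumes "negl q" "k \<ge> 0"
  shows "negl (\<lambda>s. k * q s)"
proof (cases "k = 0")
  case False
  hence k: "k > 0" using assms by simp
  show ?thesis unfolding negl_def
  proof (intro allI impI)
    fix \<epsilon> :: real assume e: "\<epsilon> > 0"
    hence "\<epsilon> / k > 0" using k by simp
    with assms(1) have "eventually (\<lambda>(n, s). q s \<le> \<epsilon> / k * T n) W" unfolding negl_def by blast
    thus "eventually (\<lambda>(n, s). k * q s \<le> \<epsilon> * T n) W" by eventually_elim (use k in \<open>auto simp: field_simps\<close>)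
  qed
qed (use negl_const[of 0] in simp)

lemma negl_sum:
  assumes "\<And>i. i \<in> I \<Longrightarrow> negl (q i)"
  shows "negl (\<lambda>s. \<Sum>i\<in>I. q i s)"
  using assms by (induction I rule: infinite_finite_induct) (auto intro: negl_add negl_const)

lemma negl_imp_bdd: "negl q \<Longrightarrow> bdd q"
  unfolding negl_def bdd_def by (metis zero_less_one)

lemma bdd_mono:
  assumes "bdd q" "eventually (\<lambda>(n, s). p s \<le> q s) W"
  shows "bdd p"
proof -
  obtain K where "eventually (\<lambda>(n, s). q s \<le> K * T n) W" using assms(1) by (auto simp: bdd_def)
  hence "eventually (\<lambda>(n, s). p s \<le> K * T n) W" using assms(2) by eventually_elim auto
  thus ?thesis by (auto simp: bdd_def)
qed

lemma bdd_add:
  assumes "bdd p" "bdd q"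
  shows "bdd (\<lambda>s. p s + q s)"
proof -
  obtain K1 K2 where "eventually (\<lambda>(n, s). p s \<le> K1 * T n) W" "eventually (\<lambda>(n, s). q s \<le> K2 * T n) W"
    using assms by (auto simp: bdd_def)
  hence "eventually (\<lambda>(n, s). p s + q s \<le> (K1 + K2) * T n) W" by eventually_elim (auto simp: distrib_right)
  thus ?thesis by (auto simp: bdd_def)
qed

lemma bdd_cmult:
  assumes "bdd q" "k \<ge> 0"
  shows "bdd (\<lambda>s. k * q s)"
proof -
  obtain K where "eventually (\<lambda>(n, s). q s \<le> K * T n) W" using assms(1) by (auto simp: bdd_def)
  hence "eventually (\<lambda>(n, s). k * q s \<le> (k * K) * T n) W"
    by eventually_elim (use assms(2) in \<open>auto simp: mult.assoc intro: mult_left_mono\<close>)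
  thus ?thesis by (auto simp: bdd_def)
qed

text \<open>Applied to the proximity function of f: it excludes that f is small compared with its
  own reference sizes.\<close>

lemma not_negl:
  assumes "negl q" "eventually (\<lambda>(n, s). T n \<le> K * q s) W" "K \<ge> 0"
  shows False
proof -
  have "negl (\<lambda>s. K * q s)" by (rule negl_cmult) fact+
  hence "eventually (\<lambda>(n, s). K * q s \<le> 1 / 2 * T n) W" unfolding negl_def by (metis half_gt_zero_iff zero_less_one)
  hence "eventually (\<lambda>_. False) W" using assms(2) eventually_W_T[of 1] by eventually_elim auto
  thus False using W_nontrivial by simp
qed

end

section \<open>Small functions along windows\<close>

lemma meromorphic_zero_dichotomy:
  assumes "y meromorphic_on UNIV"
  shows "(\<forall>\<^sub>\<approx>z. y z = 0) \<or> (\<forall>\<^sub>\<approx>z. y z \<noteq> 0)"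
  using meromorphic_imp_constant_or_avoid[OF assms, of 0] by auto

lemma cosparse_deriv_cong:
  assumes "\<forall>\<^sub>\<approx>z. f z = g z"
  shows "\<forall>\<^sub>\<approx>z. deriv f z = deriv g z"
proof -
  define X where "X = {z. f z \<noteq> g z}"
  have "closed X" using assms unfolding eventually_cosparse X_def by (rule sparse_in_UNIV_imp_closed)
  hence op: "open (- X)" by auto
  show ?thesis using assms
  proof eventually_elim
    case (elim z)
    hence "z \<in> - X" by (simp add: X_def)
    hence "eventually (\<lambda>w. f w = g w) (nhds z)"
      using eventually_nhds_in_open[OF op] by (auto simp: X_def elim: eventually_mono)
    thus ?case by (rule deriv_cong_ev) simp
  qed
qed

lemma cosparse_shift:
  assumes "\<forall>\<^sub>\<approx>z. P z"
  shows "\<forall>\<^sub>\<approx>z. P (z + c :: complex)"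
proof -
  have "eventually (\<lambda>z. P (z + c)) (at x)" for x
  proof -
    have "eventually P (at (x + c))" using assms by (rule eventually_cosparse_imp_eventually_at) simp
    moreover have "at (x + c) = filtermap (\<lambda>z. z + c) (at x)" using filtermap_at_shift[of "-c" x] by simp
    ultimately show ?thesis by (simp add: eventually_filtermap)
  qed
  thus ?thesis by (simp add: eventually_cosparse_open_eq)
qed

lemma meromorphic_shift:
  assumes "f meromorphic_on UNIV"
  shows "(\<lambda>z. f (z + c)) meromorphic_on UNIV"
proof -
  have "(\<lambda>z. z + c) analytic_on UNIV" by (intro analytic_intros)
  from meromorphic_on_compose[OF assms this] show ?thesis by simp
qed

lemma pole_ord_cosparse_cong:
  assumes "\<forall>\<^sub>\<approx>z. f z = g z"
  shows "pole_ord f = pole_ord g"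
  using pole_ord_cong[OF eventually_cosparse_imp_eventually_at[OF assms]] by auto

lemma proximity_cong:
  assumes "\<And>z. norm z = r \<Longrightarrow> f z = g z" "r \<ge> 0"
  shows "proximity r f = proximity r g"
  unfolding proximity_eq by (rule circ_mean_cong) (use assms in auto)

section \<open>Calculus of functions with small proximity or few poles\<close>

context windows
begin

text \<open>Proximity and pole counting are kept apart: a function with few poles may be large on
  circles, and a logarithmic derivative is small on circles however many poles it has.\<close>

definition msmall :: "(complex \<Rightarrow> complex) \<Rightarrow> bool" where
  "msmall y \<longleftrightarrow> y meromorphic_on UNIV \<and> negl (\<lambda>s. proximity s y)"

definition nsmall :: "(complex \<Rightarrow> complex) \<Rightarrow> bool" where
  "nsmall y \<longleftrightarrow> y meromorphic_on UNIV \<and> negl (counting (pole_ord y))"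

definition tame :: "(complex \<Rightarrow> complex) \<Rightarrow> bool" where
  "tame y \<longleftrightarrow> y meromorphic_on UNIV \<and> bdd (\<lambda>s. proximity s y) \<and> bdd (counting (pole_ord y))"

lemma msmall_mero: "msmall y \<Longrightarrow> y meromorphic_on UNIV"
  and nsmall_mero: "nsmall y \<Longrightarrow> y meromorphic_on UNIV"
  and tame_mero: "tame y \<Longrightarrow> y meromorphic_on UNIV"
  by (auto simp: msmall_def nsmall_def tame_def)

lemma small_imp_tame: "msmall y \<Longrightarrow> nsmall y \<Longrightarrow> tame y"
  by (auto simp: msmall_def nsmall_def tame_def negl_imp_bdd)

lemma W_proximity_cong:
  assumes "\<forall>\<^sub>\<approx>z. f z = g z"
  shows "eventually (\<lambda>(n, s). proximity s f = proximity s g) W"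
  using eventually_W_circle[OF assms] eventually_W_ge[of 0]
  by eventually_elim (auto intro: proximity_cong)

lemma msmall_cong:
  assumes "msmall f" "\<forall>\<^sub>\<approx>z. f z = g z" "g meromorphic_on UNIV"
  shows "msmall g"
proof -
  have ev: "eventually (\<lambda>(n, s). proximity s g \<le> proximity s f) W"
    using W_proximity_cong[OF assms(2)] by eventually_elim auto
  have "negl (\<lambda>s. proximity s g)" by (rule negl_mono[OF _ ev]) (use assms(1) in \<open>simp add: msmall_def\<close>)
  thus ?thesis using assms(3) by (simp add: msmall_def)
qed

lemma nsmall_cong:
  assumes "nsmall f" "\<forall>\<^sub>\<approx>z. f z = g z" "g meromorphic_on UNIV"
  shows "nsmall g"
  using assms pole_ord_cosparse_cong[OF assms(2)] by (simp add: nsmall_def)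

lemma tame_cong:
  assumes "tame f" "\<forall>\<^sub>\<approx>z. f z = g z" "g meromorphic_on UNIV"
  shows "tame g"
proof -
  have ev: "eventually (\<lambda>(n, s). proximity s g \<le> proximity s f) W"
    using W_proximity_cong[OF assms(2)] by eventually_elim auto
  have "bdd (\<lambda>s. proximity s g)" by (rule bdd_mono[OF _ ev]) (use assms(1) in \<open>simp add: tame_def\<close>)
  thus ?thesis using assms(1,3) pole_ord_cosparse_cong[OF assms(2)] by (simp add: tame_def)
qed

lemma W_proximity_add:
  assumes "f meromorphic_on UNIV" "g meromorphic_on UNIV"
  shows "eventually (\<lambda>(n, s). proximity s (\<lambda>z. f z + g z) \<le> proximity s f + proximity s g + ln 2) W"
  using eventually_W_continuous[OF assms(1)] eventually_W_continuous[OF assms(2)] eventually_W_ge[of 0]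
  by eventually_elim (auto intro: proximity_add)

lemma W_proximity_mult:
  assumes "f meromorphic_on UNIV" "g meromorphic_on UNIV"
  shows "eventually (\<lambda>(n, s). proximity s (\<lambda>z. f z * g z) \<le> proximity s f + proximity s g) W"
  using eventually_W_continuous[OF assms(1)] eventually_W_continuous[OF assms(2)] eventually_W_ge[of 0]
  by eventually_elim (auto intro: proximity_mult)

lemma proximity_const: "proximity s (\<lambda>_. c) = log_plus (norm c)"
  by (simp add: proximity_eq)

lemma msmall_const: "msmall (\<lambda>_. c)"
  unfolding msmall_def proximity_const by (auto intro: negl_const)

lemma msmall_add: "msmall f \<Longrightarrow> msmall g \<Longrightarrow> msmall (\<lambda>z. f z + g z)"
  unfolding msmall_def
  by (auto intro!: meromorphic_intros negl_mono[OF negl_add[OF negl_add negl_const] W_proximity_add])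

lemma msmall_mult: "msmall f \<Longrightarrow> msmall g \<Longrightarrow> msmall (\<lambda>z. f z * g z)"
  unfolding msmall_def
  by (auto intro!: meromorphic_intros negl_mono[OF negl_add W_proximity_mult])

lemma msmall_uminus: "msmall f \<Longrightarrow> msmall (\<lambda>z. - f z)"
  using msmall_mult[OF msmall_const[of "-1"]] by simp

lemma msmall_diff: "msmall f \<Longrightarrow> msmall g \<Longrightarrow> msmall (\<lambda>z. f z - g z)"
  using msmall_add[of f "\<lambda>z. - g z"] msmall_uminus[of g] by simp

lemma msmall_sum: "(\<And>i. i \<in> I \<Longrightarrow> msmall (f i)) \<Longrightarrow> msmall (\<lambda>z. \<Sum>i\<in>I. f i z)"
  by (induction I rule: infinite_finite_induct) (auto intro: msmall_const msmall_add)

lemma msmall_power: "msmall f \<Longrightarrow> msmall (\<lambda>z. f z ^ k)"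
  by (induction k) (auto intro: msmall_const msmall_mult)

text \<open>Counting functions are monotone and additive in the multiplicities, so it suffices to
  compare pole orders point by point. Sums, products, derivatives and the auxiliary functions of the
  main argument reduce to this.\<close>

lemma nsmall_bound:
  assumes f: "f meromorphic_on UNIV" and "finite I" "\<And>i. i \<in> I \<Longrightarrow> nsmall (g i)"
    "\<And>z. pole_ord f z \<le> k * (\<Sum>i\<in>I. pole_ord (g i) z)"
  shows "nsmall f"
proof -
  have lf: "loc_finite (\<lambda>z. \<Sum>i\<in>J. pole_ord (g i) z)"
    and ceq: "counting (\<lambda>z. \<Sum>i\<in>J. pole_ord (g i) z) s = (\<Sum>i\<in>J. counting (pole_ord (g i)) s)"
    if "J \<subseteq> I" for J s
  proof -
    have "finite J" using assms(2) that finite_subset by blast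
    hence "loc_finite (\<lambda>z. \<Sum>i\<in>J. pole_ord (g i) z) \<and> counting (\<lambda>z. \<Sum>i\<in>J. pole_ord (g i) z) s = (\<Sum>i\<in>J. counting (pole_ord (g i)) s)"
      using that
    proof (induction J)
      case empty
      thus ?case by (simp add: loc_finite_def counting_def)
    next
      case (insert i J)
      have "loc_finite (pole_ord (g i))" using insert.prems assms(3) by (intro loc_finite_pole_ord nsmall_mero) auto
      thus ?case using insert by (auto simp: loc_finite_add counting_add)
    qed
    thus "loc_finite (\<lambda>z. \<Sum>i\<in>J. pole_ord (g i) z)"
      "counting (\<lambda>z. \<Sum>i\<in>J. pole_ord (g i) z) s = (\<Sum>i\<in>J. counting (pole_ord (g i)) s)" by auto
  qed
  have "negl (\<lambda>s. real k * (\<Sum>i\<in>I. counting (pole_ord (g i)) s))"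
    using assms(3) by (intro negl_cmult negl_sum) (auto simp: nsmall_def)
  moreover have "eventually (\<lambda>(n, s). counting (pole_ord f) s \<le> real k * (\<Sum>i\<in>I. counting (pole_ord (g i)) s)) W"
    using eventually_W_ge[of 1]
  proof eventually_elim
    case (elim x)
    have "counting (pole_ord f) s \<le> counting (\<lambda>z. k * (\<Sum>i\<in>I. pole_ord (g i) z)) s" if "s \<ge> 1" for s
      using lf[of I] assms(4) that by (intro counting_mono) (auto elim: loc_finite_mono)
    thus ?case using elim ceq[of I] by (auto simp: counting_cmult)
  qed
  ultimately have "negl (counting (pole_ord f))" by (rule negl_mono)
  thus ?thesis using f by (simp add: nsmall_def)
qed

lemma nsmall_const: "nsmall (\<lambda>_. c)"
proof -
  have "counting (pole_ord (\<lambda>_. c)) = (\<lambda>_. 0)" by (auto simp: counting_def fun_eq_iff)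
  thus ?thesis by (auto simp: nsmall_def negl_const)
qed

lemma nsmall_analytic: "f analytic_on UNIV \<Longrightarrow> nsmall f"
  by (rule nsmall_bound[of f "{}" _ 0])
     (auto simp: analytic_on_imp_meromorphic_on pole_ord_analytic analytic_on_analytic_at[of f UNIV])

lemma mero_at: "f meromorphic_on UNIV \<Longrightarrow> f meromorphic_on {z}"
  by (rule meromorphic_on_subset) auto

lemma nsmall_add: "nsmall f \<Longrightarrow> nsmall g \<Longrightarrow> nsmall (\<lambda>z. f z + g z)"
proof (rule nsmall_bound[of _ "{True, False}" "\<lambda>b. if b then f else g" 1])
  fix z assume "nsmall f" "nsmall g"
  thus "pole_ord (\<lambda>z. f z + g z) z \<le> 1 * (\<Sum>i\<in>{True, False}. pole_ord (if i then f else g) z)"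
    using pole_ord_add_le[of f z g] by (auto simp: mero_at nsmall_mero)
qed (auto intro!: meromorphic_intros simp: nsmall_mero)

lemma nsmall_mult: "nsmall f \<Longrightarrow> nsmall g \<Longrightarrow> nsmall (\<lambda>z. f z * g z)"
proof (rule nsmall_bound[of _ "{True, False}" "\<lambda>b. if b then f else g" 1])
  fix z assume "nsmall f" "nsmall g"
  thus "pole_ord (\<lambda>z. f z * g z) z \<le> 1 * (\<Sum>i\<in>{True, False}. pole_ord (if i then f else g) z)"
    using pole_ord_mult_le[of f z g] by (auto simp: mero_at nsmall_mero)
qed (auto intro!: meromorphic_intros simp: nsmall_mero)

lemma nsmall_uminus: "nsmall f \<Longrightarrow> nsmall (\<lambda>z. - f z)"
  using nsmall_mult[OF nsmall_const[of "-1"]] by simp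

lemma nsmall_diff: "nsmall f \<Longrightarrow> nsmall g \<Longrightarrow> nsmall (\<lambda>z. f z - g z)"
  using nsmall_add[of f "\<lambda>z. - g z"] nsmall_uminus[of g] by simp

lemma nsmall_sum: "(\<And>i. i \<in> I \<Longrightarrow> nsmall (f i)) \<Longrightarrow> nsmall (\<lambda>z. \<Sum>i\<in>I. f i z)"
  by (induction I rule: infinite_finite_induct) (auto intro: nsmall_const nsmall_add)

lemma nsmall_deriv: "nsmall f \<Longrightarrow> nsmall (deriv f)"
  by (rule nsmall_bound[of _ "{()}" "\<lambda>_. f" 2])
     (auto intro!: meromorphic_intros simp: nsmall_mero mero_at pole_ord_deriv_le)

lemma tame_add:
  assumes "tame f" "tame g"
  shows "tame (\<lambda>z. f z + g z)"
proof -
  have m: "f meromorphic_on UNIV" "g meromorphic_on UNIV" using assms tame_mero by auto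
  have "bdd (\<lambda>s. proximity s (\<lambda>z. f z + g z))"
    by (rule bdd_mono[OF bdd_add[OF bdd_add negl_imp_bdd[OF negl_const]] W_proximity_add[OF m]])
       (use assms in \<open>auto simp: tame_def\<close>)
  moreover have "bdd (counting (pole_ord (\<lambda>z. f z + g z)))"
  proof (rule bdd_mono[OF bdd_add])
    show "eventually (\<lambda>(n, s). counting (pole_ord (\<lambda>z. f z + g z)) s \<le> counting (pole_ord f) s + counting (pole_ord g) s) W"
      using eventually_W_ge[of 1]
    proof eventually_elim
      case (elim x)
      have "counting (pole_ord (\<lambda>z. f z + g z)) s \<le> counting (\<lambda>z. pole_ord f z + pole_ord g z) s" if "s \<ge> 1" for s
        using that order_trans[OF pole_ord_add_le[OF mero_at[OF m(1)] mero_at[OF m(2)]]] m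
        by (intro counting_mono loc_finite_add loc_finite_pole_ord) auto
      thus ?case using elim m by (auto simp: counting_add loc_finite_pole_ord)
    qed
  qed (use assms in \<open>auto simp: tame_def\<close>)
  ultimately show ?thesis using m by (auto simp: tame_def intro!: meromorphic_intros)
qed

lemma tame_mult:
  assumes "tame f" "tame g"
  shows "tame (\<lambda>z. f z * g z)"
proof -
  have m: "f meromorphic_on UNIV" "g meromorphic_on UNIV" using assms tame_mero by auto
  have "bdd (\<lambda>s. proximity s (\<lambda>z. f z * g z))"
    by (rule bdd_mono[OF bdd_add W_proximity_mult[OF m]]) (use assms in \<open>auto simp: tame_def\<close>)
  moreover have "bdd (counting (pole_ord (\<lambda>z. f z * g z)))"
  proof (rule bdd_mono[OF bdd_add])
    show "eventually (\<lambda>(n, s). counting (pole_ord (\<lambda>z. f z * g z)) s \<le> counting (pole_ord f) s + counting (pole_ord g) s) W"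
      using eventually_W_ge[of 1]
    proof eventually_elim
      case (elim x)
      have "counting (pole_ord (\<lambda>z. f z * g z)) s \<le> counting (\<lambda>z. pole_ord f z + pole_ord g z) s" if "s \<ge> 1" for s
        using that pole_ord_mult_le[OF mero_at[OF m(1)] mero_at[OF m(2)]] m
        by (intro counting_mono loc_finite_add loc_finite_pole_ord) auto
      thus ?case using elim m by (auto simp: counting_add loc_finite_pole_ord)
    qed
  qed (use assms in \<open>auto simp: tame_def\<close>)
  ultimately show ?thesis using m by (auto simp: tame_def intro!: meromorphic_intros)
qed

lemma tame_const: "tame (\<lambda>_. c)"
  by (intro small_imp_tame msmall_const nsmall_const)

lemma tame_uminus: "tame f \<Longrightarrow> tame (\<lambda>z. - f z)"
  using tame_mult[OF tame_const[of "-1"]] by simp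

lemma tame_diff: "tame f \<Longrightarrow> tame g \<Longrightarrow> tame (\<lambda>z. f z - g z)"
  using tame_add[of f "\<lambda>z. - g z"] tame_uminus[of g] by simp

lemma zero_cong_inverse: "\<forall>\<^sub>\<approx>z. y z = 0 \<Longrightarrow> \<forall>\<^sub>\<approx>z. 0 = inverse (y z :: complex)"
  by (auto elim: eventually_mono)

lemma W_first_main_theorem:
  assumes "y meromorphic_on UNIV" "\<forall>\<^sub>\<approx>z. y z \<noteq> 0"
  obtains C where "eventually (\<lambda>(n, s). nchar s (\<lambda>z. inverse (y z)) \<le> nchar s y + C \<and>
    proximity s (\<lambda>z. inverse (y z)) \<ge> 0 \<and> counting (pole_ord (\<lambda>z. inverse (y z))) s \<ge> 0) W"
proof -
  obtain C where C: "\<And>r. r \<ge> 1 \<Longrightarrow> regular_radius y r \<Longrightarrow> \<bar>nchar r (\<lambda>z. inverse (y z)) - nchar r y\<bar> \<le> C"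
    using first_main_theorem[OF assms] by blast
  have "eventually (\<lambda>(n, s). nchar s (\<lambda>z. inverse (y z)) \<le> nchar s y + C \<and>
    proximity s (\<lambda>z. inverse (y z)) \<ge> 0 \<and> counting (pole_ord (\<lambda>z. inverse (y z))) s \<ge> 0) W"
    using eventually_W_regular[OF assms] eventually_W_ge[of 1]
  proof eventually_elim
    case (elim x)
    thus ?case using C[of "snd x"] nchar_nonneg[OF regular_radius_inverse, of y "snd x"]
      by (auto simp: case_prod_unfold abs_le_iff)
  qed
  thus thesis by (rule that)
qed

text \<open>By the first main theorem. Both kinds of smallness are assumed together because that
  theorem controls only the sum of proximity and counting function. If y vanishes identically, its
  inverse is 0 by the convention for division.\<close>

lemma small_inverse:
  assumes "msmall y" "nsmall y"
  shows "msmall (\<lambda>z. inverse (y z))" "nsmall (\<lambda>z. inverse (y z))"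
proof -
  have m: "y meromorphic_on UNIV" using assms msmall_mero by auto
  hence mi: "(\<lambda>z. inverse (y z)) meromorphic_on UNIV" by (intro meromorphic_intros)
  have "msmall (\<lambda>z. inverse (y z)) \<and> nsmall (\<lambda>z. inverse (y z))"
    using meromorphic_zero_dichotomy[OF m]
  proof
    assume "\<forall>\<^sub>\<approx>z. y z = 0"
    from zero_cong_inverse[OF this] show ?thesis
      using msmall_cong[OF msmall_const[of 0]] nsmall_cong[OF nsmall_const[of 0]] mi by auto
  next
    assume nz: "\<forall>\<^sub>\<approx>z. y z \<noteq> 0"
    obtain C where C: "eventually (\<lambda>(n, s). nchar s (\<lambda>z. inverse (y z)) \<le> nchar s y + C \<and>
      proximity s (\<lambda>z. inverse (y z)) \<ge> 0 \<and> counting (pole_ord (\<lambda>z. inverse (y z))) s \<ge> 0) W"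
      using W_first_main_theorem[OF m nz] by blast
    have q: "negl (\<lambda>s. proximity s y + counting (pole_ord y) s + C)"
      using assms by (intro negl_add negl_const) (auto simp: msmall_def nsmall_def)
    have "negl (\<lambda>s. proximity s (\<lambda>z. inverse (y z)))"
      by (rule negl_mono[OF q]) (use C in \<open>auto simp: nchar_def elim!: eventually_mono\<close>)
    moreover have "negl (counting (pole_ord (\<lambda>z. inverse (y z))))"
      by (rule negl_mono[OF q]) (use C in \<open>auto simp: nchar_def elim!: eventually_mono\<close>)
    ultimately show ?thesis using mi by (auto simp: msmall_def nsmall_def)
  qed
  thus "msmall (\<lambda>z. inverse (y z))" "nsmall (\<lambda>z. inverse (y z))" by auto
qed

lemma tame_inverse:
  assumes "tame y"
  shows "tame (\<lambda>z. inverse (y z))"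
proof -
  have m: "y meromorphic_on UNIV" using assms tame_mero by auto
  hence mi: "(\<lambda>z. inverse (y z)) meromorphic_on UNIV" by (intro meromorphic_intros)
  show ?thesis
    using meromorphic_zero_dichotomy[OF m]
  proof
    assume "\<forall>\<^sub>\<approx>z. y z = 0"
    from zero_cong_inverse[OF this] show ?thesis
      using tame_cong[OF tame_const[of 0]] mi by auto
  next
    assume nz: "\<forall>\<^sub>\<approx>z. y z \<noteq> 0"
    obtain C where C: "eventually (\<lambda>(n, s). nchar s (\<lambda>z. inverse (y z)) \<le> nchar s y + C \<and>
      proximity s (\<lambda>z. inverse (y z)) \<ge> 0 \<and> counting (pole_ord (\<lambda>z. inverse (y z))) s \<ge> 0) W"
      using W_first_main_theorem[OF m nz] by blast
    have q: "bdd (\<lambda>s. proximity s y + counting (pole_ord y) s + C)"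
      using assms by (intro bdd_add negl_imp_bdd[OF negl_const]) (auto simp: tame_def)
    have "bdd (\<lambda>s. proximity s (\<lambda>z. inverse (y z)))"
      by (rule bdd_mono[OF q]) (use C in \<open>auto simp: nchar_def elim!: eventually_mono\<close>)
    moreover have "bdd (counting (pole_ord (\<lambda>z. inverse (y z))))"
      by (rule bdd_mono[OF q]) (use C in \<open>auto simp: nchar_def elim!: eventually_mono\<close>)
    ultimately show ?thesis using mi by (auto simp: tame_def)
  qed
qed

end

section \<open>Logarithmic derivatives, shift quotients and translations along windows\<close>

context windows
begin

text \<open>If R - s and R' - R are of order h, the error is at most a constant times T
  r^(1-\<alpha>)/h, which the condition on the windows makes small. Two nested moves to a larger
  radius are needed, to R for the circle mean and to R' for counting zeros and poles. A fixed
  \<open>d\<close> eventually fits below R - s.\<close>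

lemma W_pj_error:
  assumes y: "tame y" "\<forall>\<^sub>\<approx>z. y z \<noteq> 0" and \<epsilon>: "\<epsilon> > 0"
  shows "eventually (\<lambda>(n, s). \<exists>R. s + d < R \<and> regular_radius y R \<and> pj_error \<alpha> y s R \<le> \<epsilon> * T n) W"
proof -
  have m: "y meromorphic_on UNIV" using y tame_mero by auto
  obtain C where C: "C \<ge> 0" "\<And>r R R'. 1 \<le> r \<Longrightarrow> r < R \<Longrightarrow> R < R' \<Longrightarrow>
     regular_radius y R \<Longrightarrow> regular_radius y R' \<Longrightarrow>
     pj_error \<alpha> y r R \<le> (R' / (R' - R) * (2 * nchar R' y + C) + R * (R - r) powr (\<alpha> - 2) * (2 * nchar R y + C)) * r powr (-\<alpha>)"
    using pj_error_le[OF m y(2)] by blast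
  have "bdd (\<lambda>s. nchar s y)" using y(1) unfolding nchar_def tame_def by (intro bdd_add) auto
  then obtain K where K: "eventually (\<lambda>(n, s). nchar s y \<le> K * T n) W" unfolding bdd_def by blast
  define P0 where "P0 = (\<lambda>(n, s). nchar s y \<le> K * T n \<and> regular_radius y s)"
  have P0: "eventually P0 W" using K eventually_W_regular[OF m y(2)] unfolding P0_def by eventually_elim auto
  obtain \<delta>1 where \<delta>1: "\<delta>1 > 0" "\<delta>1 \<le> 1" and
    e1: "eventually (\<lambda>(n, s). \<exists>s'. s + \<delta>1 * h n \<le> s' \<and> s' \<le> s + 2 * \<delta>1 * h n \<and> P0 (n, s')) W"
    by (rule W_larger_radius[OF P0])
  define P1 where "P1 = (\<lambda>(n, s). P0 (n, s) \<and> (\<exists>s'. s + \<delta>1 * h n \<le> s' \<and> s' \<le> s + 2 * \<delta>1 * h n \<and> P0 (n, s')))"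
  have P1: "eventually P1 W" using e1 P0 unfolding P1_def by eventually_elim auto
  obtain \<delta>2 where \<delta>2: "\<delta>2 > 0" "\<delta>2 \<le> 1" and
    e2: "eventually (\<lambda>(n, s). \<exists>s'. s + \<delta>2 * h n \<le> s' \<and> s' \<le> s + 2 * \<delta>2 * h n \<and> P1 (n, s')) W"
    by (rule W_larger_radius[OF P1])
  define M where "M = max 1 (2 * K + C)"
  define B where "B = (6 / \<delta>1 + 4 * \<delta>2 powr (\<alpha> - 2)) * M"
  have B: "B > 0" unfolding B_def M_def using \<delta>1 by (intro mult_pos_pos add_pos_nonneg) auto
  have small: "eventually (\<lambda>n. r n powr (1 - \<alpha>) / h n < \<epsilon> / B) sequentially"
    using rh_lim \<epsilon> B by (intro order_tendstoD) auto
  show ?thesis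
    using e2 eventually_W_range eventually_W_ge[of 1] eventually_W_T[of 1] eventually_W_seq[OF small]
      eventually_W_seq[OF h_pos[of 1]] eventually_W_seq[OF h_pos[of "d / \<delta>2"]]
  proof eventually_elim
    case (elim x)
    obtain n s where x: "x = (n, s)" by force
    obtain R where R: "s + \<delta>2 * h n \<le> R" "R \<le> s + 2 * \<delta>2 * h n" "P1 (n, R)" using elim(1) x by auto
    then obtain R' where R': "R + \<delta>1 * h n \<le> R'" "R' \<le> R + 2 * \<delta>1 * h n" "P0 (n, R')" by (auto simp: P1_def)
    have P0R: "P0 (n, R)" using R(3) by (simp add: P1_def)
    have s: "r n \<le> s" "s \<le> 2 * r n" "1 \<le> s" and Tn: "T n \<ge> 1" and
      sm: "r n powr (1 - \<alpha>) / h n < \<epsilon> / B" and h1: "h n > 1" "d / \<delta>2 < h n" using elim x by auto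
    have hr: "h n \<le> r n" by (rule h_le_r)
    have dh: "\<delta>1 * h n > 0" "\<delta>2 * h n > 0" "\<delta>1 * h n \<le> h n" "\<delta>2 * h n \<le> h n" "d < \<delta>2 * h n"
      using \<delta>1 \<delta>2 h1 by (auto simp: field_simps)
    have R4: "R \<le> 4 * r n" "R' \<le> 6 * r n" using R R' s hr dh by linarith+
    have "pj_error \<alpha> y s R \<le> (R' / (R' - R) * (2 * nchar R' y + C) + R * (R - s) powr (\<alpha> - 2) * (2 * nchar R y + C)) * s powr (-\<alpha>)"
      by (rule C(2)) (use P0R R' s R dh in \<open>auto simp: P0_def\<close>)
    also have "\<dots> \<le> (6 * r n / (\<delta>1 * h n) * (M * T n) + 4 * r n * (\<delta>2 powr (\<alpha> - 2) / h n) * (M * T n)) * r n powr (-\<alpha>)"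
    proof (intro mult_mono add_mono)
      have MT: "2 * nchar t y + C \<le> M * T n" if "P0 (n, t)" for t
      proof -
        have "2 * nchar t y + C \<le> 2 * K * T n + C * T n"
          using that Tn C(1) mult_left_mono[of 1 "T n" C] by (simp add: P0_def)
        also have "\<dots> = (2 * K + C) * T n" by (simp add: distrib_right)
        also have "\<dots> \<le> M * T n" using Tn by (intro mult_right_mono) (auto simp: M_def)
        finally show ?thesis .
      qed
      show "2 * nchar R' y + C \<le> M * T n" "2 * nchar R y + C \<le> M * T n" using MT R'(3) P0R by auto
      show "0 \<le> 2 * nchar R' y + C" "0 \<le> 2 * nchar R y + C"
        using nchar_nonneg(3)[of y R'] nchar_nonneg(3)[of y R] P0R R'(3) C(1) s R R' dh by (auto simp: P0_def)
      show "R' / (R' - R) \<le> 6 * r n / (\<delta>1 * h n)" using R4 R' dh s by (intro frac_le) auto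
      have "(R - s) powr (\<alpha> - 2) \<le> (\<delta>2 * h n) powr (\<alpha> - 2)" using R dh \<alpha> by (intro powr_mono2') auto
      also have "\<dots> = \<delta>2 powr (\<alpha> - 2) * h n powr (\<alpha> - 2)" using \<delta>2 h1 by (simp add: powr_mult)
      \<comment> \<open>Since h > 1 and \<alpha> - 2 < -1, the exponent may be raised to -1, which
        matches the factor 1/h of the other summand.\<close>
      also have "\<dots> \<le> \<delta>2 powr (\<alpha> - 2) * h n powr (-1)" using h1 \<alpha> by (intro mult_left_mono powr_mono) auto
      finally show "(R - s) powr (\<alpha> - 2) \<le> \<delta>2 powr (\<alpha> - 2) / h n" using h1 by (simp add: powr_minus_divide)
      show "s powr - \<alpha> \<le> r n powr - \<alpha>" using s h1 hr \<alpha> by (intro powr_mono2') auto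
    next
      have rn: "r n > 0" "M * T n \<ge> 0" using h1 hr Tn by (auto simp: M_def)
      show n1: "0 \<le> 6 * r n / (\<delta>1 * h n)" using rn dh by (intro divide_nonneg_pos) auto
      show n2: "0 \<le> 4 * r n * (\<delta>2 powr (\<alpha> - 2) / h n)" using rn h1 by (intro mult_nonneg_nonneg divide_nonneg_pos) auto
      show "0 \<le> 6 * r n / (\<delta>1 * h n) * (M * T n) + 4 * r n * (\<delta>2 powr (\<alpha> - 2) / h n) * (M * T n)"
        by (rule add_nonneg_nonneg[OF mult_nonneg_nonneg[OF n1 rn(2)] mult_nonneg_nonneg[OF n2 rn(2)]])
      show "0 \<le> 4 * r n" using rn by simp
    qed (use R4 in auto)
    also have "\<dots> = B * (r n * r n powr (-\<alpha>) / h n) * T n"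
    proof -
      have "(6 * x / (d * h) * (M * t) + 4 * x * (p / h) * (M * t)) * q = (6 / d + 4 * p) * M * (x * q / h) * t"
        if "d \<noteq> 0" "h \<noteq> 0" for x d h M t p q :: real using that by (simp add: field_simps)
      from this[of \<delta>1 "h n" "r n" M "T n" "\<delta>2 powr (\<alpha> - 2)" "r n powr (-\<alpha>)"] show ?thesis
        unfolding B_def using \<delta>1(1) h1(1) by (simp only:)
    qed
    also have "r n * r n powr (-\<alpha>) = r n powr (1 - \<alpha>)" using h1 hr by (simp add: powr_diff powr_minus_divide)
    also have "B * (r n powr (1 - \<alpha>) / h n) * T n \<le> B * (\<epsilon> / B) * T n"
      using sm B Tn by (intro mult_right_mono mult_left_mono) auto
    also have "\<dots> = \<epsilon> * T n" using B by simp
    finally have "pj_error \<alpha> y s R \<le> \<epsilon> * T n" .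
    moreover have "s + d < R" using R dh by linarith
    ultimately show ?case using P0R x by (auto simp: P0_def)
  qed
qed

lemma cosparse_zero_deriv: "\<forall>\<^sub>\<approx>z. y z = 0 \<Longrightarrow> \<forall>\<^sub>\<approx>z. deriv y z = (0 :: complex)"
  using cosparse_deriv_cong[of y "\<lambda>_. 0"] by simp

text \<open>The error is eventually at most T n, so the proximity function is at most ln (2 + C T
  n)/\<alpha>, which is o(T n).\<close>

lemma msmall_logderiv:
  assumes "tame y"
  shows "msmall (\<lambda>z. deriv y z / y z)"
proof -
  have m: "y meromorphic_on UNIV" using assms tame_mero by auto
  hence md: "(\<lambda>z. deriv y z / y z) meromorphic_on UNIV" by (intro meromorphic_intros)
  show ?thesis using meromorphic_zero_dichotomy[OF m]
  proof
    assume "\<forall>\<^sub>\<approx>z. y z = 0"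
    hence "\<forall>\<^sub>\<approx>z. 0 = deriv y z / y z" by eventually_elim simp
    thus ?thesis using msmall_cong[OF msmall_const[of 0]] md by auto
  next
    assume nz: "\<forall>\<^sub>\<approx>z. y z \<noteq> 0"
    obtain C where C: "C > 0" "\<And>y r R. y meromorphic_on UNIV \<Longrightarrow> \<forall>\<^sub>\<approx>z. y z \<noteq> 0 \<Longrightarrow> 0 < r \<Longrightarrow> r < R \<Longrightarrow>
       regular_radius y r \<Longrightarrow> regular_radius y R \<Longrightarrow>
       circ_mean r (\<lambda>z. ln (1 + norm (deriv y z / y z))) \<le> 1 / \<alpha> * ln (2 + C * pj_error \<alpha> y r R)"
      by (rule poisson_jensen_estimates[OF \<alpha>, of 0]) (rule that)
    have "negl (\<lambda>s. proximity s (\<lambda>z. deriv y z / y z))"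
      unfolding negl_def
    proof (intro allI impI)
      fix \<epsilon> :: real assume \<epsilon>: "\<epsilon> > 0"
      have "((\<lambda>x. ln (2 + C * x) / x) \<longlongrightarrow> 0) at_top"
      proof -
        have *: "filterlim (\<lambda>x. 2 + C * x) at_top at_top"
          by (intro filterlim_tendsto_add_at_top[OF tendsto_const] filterlim_tendsto_pos_mult_at_top[OF tendsto_const C(1) filterlim_ident])
        have 1: "((\<lambda>x. ln (2 + C * x) / (2 + C * x)) \<longlongrightarrow> 0) at_top"
          using filterlim_compose[OF ln_x_over_x_tendsto_0 *] by simp
        have "((\<lambda>x. 2 * inverse x + C) \<longlongrightarrow> 2 * 0 + C) at_top"
          by (intro tendsto_intros tendsto_inverse_0_at_top filterlim_ident)
        from tendsto_mult[OF 1 this]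
        have "((\<lambda>x. ln (2 + C * x) / (2 + C * x) * (2 * inverse x + C)) \<longlongrightarrow> 0) at_top" by simp
        moreover have "eventually (\<lambda>x. ln (2 + C * x) / (2 + C * x) * (2 * inverse x + C) = ln (2 + C * x) / x) at_top"
          using eventually_gt_at_top[of 0]
        proof eventually_elim
          case (elim x)
          have "2 + C * x > 0" using elim C(1) by (intro add_pos_pos) auto
          moreover have "2 * inverse x + C = (2 + C * x) / x" using elim by (simp add: field_simps)
          ultimately show ?case by simp
        qed
        ultimately show ?thesis by (rule Lim_transform_eventually)
      qed
      hence "eventually (\<lambda>x. ln (2 + C * x) / x < \<epsilon> * \<alpha>) at_top" using \<epsilon> \<alpha> by (intro order_tendstoD) auto
      hence "eventually (\<lambda>n. ln (2 + C * T n) / T n < \<epsilon> * \<alpha>) sequentially"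
        using T_lim by (auto simp: filterlim_iff)
      from eventually_W_seq[OF this]
      show "eventually (\<lambda>(n, s). proximity s (\<lambda>z. deriv y z / y z) \<le> \<epsilon> * T n) W"
        using W_pj_error[OF assms nz zero_less_one, of 0] eventually_W_regular[OF m nz] eventually_W_ge[of 1] eventually_W_T[of 1]
          eventually_W_circle[OF meromorphic_on_imp_analytic_cosparse[OF md]]
      proof eventually_elim
        case (elim x)
        obtain n s where x: "x = (n, s)" by force
        obtain R where R: "s < R" "regular_radius y R" "pj_error \<alpha> y s R \<le> T n" using elim(2) x by auto
        have s: "s \<ge> 1" "regular_radius y s" "T n \<ge> 1" "ln (2 + C * T n) / T n < \<epsilon> * \<alpha>" using elim x by auto
        have cont: "continuous_on (sphere 0 s) (\<lambda>z. deriv y z / y z)"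
          using elim(6) x by (auto intro!: continuous_at_imp_continuous_on analytic_at_imp_isCont)
        have "proximity s (\<lambda>z. deriv y z / y z) \<le> circ_mean s (\<lambda>z. ln (1 + norm (deriv y z / y z)))"
          unfolding proximity_eq
        proof (intro circ_mean_mono continuous_on_log_plus cont log_plus_le_ln_one_plus)
          have "1 + norm (deriv y z / y z) \<noteq> 0" for z using norm_ge_zero[of "deriv y z / y z"] by linarith
          thus "continuous_on (sphere 0 s) (\<lambda>z. ln (1 + norm (deriv y z / y z)))"
            by (intro continuous_on_ln continuous_on_add continuous_on_const continuous_on_norm cont) auto
        qed (use s in auto)
        also have "\<dots> \<le> 1 / \<alpha> * ln (2 + C * pj_error \<alpha> y s R)" using R s by (intro C(2) m nz) auto
        also have "\<dots> \<le> 1 / \<alpha> * ln (2 + C * T n)"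
        proof -
          have "0 \<le> circ_mean R (\<lambda>z. \<bar>ln (norm (y z))\<bar>)"
            using mean_ln_eq(2)[OF R(2)] nchar_nonneg(1)[OF R(2)] nchar_nonneg(1)[OF regular_radius_inverse[OF R(2)]] R s by simp
          hence "0 \<le> pj_error \<alpha> y s R" unfolding pj_error_def
            using zp_count_nonneg[of y R] R s by (intro mult_nonneg_nonneg add_nonneg_nonneg) auto
          hence "2 + C * pj_error \<alpha> y s R > 0" using C(1) by (intro add_pos_nonneg) auto
          moreover have "2 + C * pj_error \<alpha> y s R \<le> 2 + C * T n" using R C(1) by (intro add_left_mono mult_left_mono) auto
          ultimately have "ln (2 + C * pj_error \<alpha> y s R) \<le> ln (2 + C * T n)" by (intro ln_mono)
          thus ?thesis using \<alpha> by (intro mult_left_mono) auto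
        qed
        also have "\<dots> \<le> \<epsilon> * T n" using s \<alpha> by (simp add: field_simps)
        finally show ?case using x by simp
      qed
    qed
    thus ?thesis using md by (simp add: msmall_def)
  qed
qed

text \<open>log+ of the quotient is at most the absolute difference of the logarithms. The estimate
  is linear in the error, without an outer logarithm, so the error has to be made smaller than
  \<epsilon>/C times T n.\<close>

lemma msmall_shift_quot:
  assumes "tame y"
  shows "msmall (\<lambda>z. y (z + c) / y z)"
proof -
  have m: "y meromorphic_on UNIV" using assms tame_mero by auto
  have mc: "(\<lambda>z. y (z + c)) meromorphic_on UNIV" by (rule meromorphic_shift[OF m])
  have md: "(\<lambda>z. y (z + c) / y z) meromorphic_on UNIV" by (intro meromorphic_intros m mc)
  show ?thesis using meromorphic_zero_dichotomy[OF m]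
  proof
    assume "\<forall>\<^sub>\<approx>z. y z = 0"
    hence "\<forall>\<^sub>\<approx>z. 0 = y (z + c) / y z" by eventually_elim simp
    thus ?thesis using msmall_cong[OF msmall_const[of 0]] md by auto
  next
    assume nz: "\<forall>\<^sub>\<approx>z. y z \<noteq> 0"
    obtain C where C: "C > 0" "\<And>y r R. y meromorphic_on UNIV \<Longrightarrow> \<forall>\<^sub>\<approx>z. y z \<noteq> 0 \<Longrightarrow> 0 < r \<Longrightarrow> r + 2 * norm c < R \<Longrightarrow>
       regular_radius y r \<Longrightarrow> regular_radius (\<lambda>z. y (z + c)) r \<Longrightarrow> regular_radius y R \<Longrightarrow>
       circ_mean r (\<lambda>z. \<bar>ln (norm (y (z + c))) - ln (norm (y z))\<bar>) \<le> C * pj_error \<alpha> y r R"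
      by (rule poisson_jensen_estimates[OF \<alpha>, of c]) (rule that)
    have "negl (\<lambda>s. proximity s (\<lambda>z. y (z + c) / y z))"
      unfolding negl_def
    proof (intro allI impI)
      fix \<epsilon> :: real assume \<epsilon>: "\<epsilon> > 0"
      hence "\<epsilon> / C > 0" using C(1) by simp
      from W_pj_error[OF assms nz this, of "2 * norm c"]
      show "eventually (\<lambda>(n, s). proximity s (\<lambda>z. y (z + c) / y z) \<le> \<epsilon> * T n) W"
        using eventually_W_regular[OF m nz] eventually_W_ge[of 1]
          eventually_W_regular[OF mc cosparse_shift[OF nz]]
      proof eventually_elim
        case (elim x)
        obtain n s where x: "x = (n, s)" by force
        obtain R where R: "s + 2 * norm c < R" "regular_radius y R" "pj_error \<alpha> y s R \<le> \<epsilon> / C * T n" using elim(1) x by auto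
        have s: "s \<ge> 1" "regular_radius y s" "regular_radius (\<lambda>z. y (z + c)) s" using elim x by auto
        note ry = regular_radius_continuous[OF s(2)] and ryc = regular_radius_continuous[OF s(3)]
        have "proximity s (\<lambda>z. y (z + c) / y z) \<le> circ_mean s (\<lambda>z. \<bar>ln (norm (y (z + c))) - ln (norm (y z))\<bar>)"
          unfolding proximity_eq
        proof (intro circ_mean_mono continuous_on_log_plus)
          show "continuous_on (sphere 0 s) (\<lambda>z. y (z + c) / y z)" using ry ryc by (intro continuous_intros) auto
          show "continuous_on (sphere 0 s) (\<lambda>z. \<bar>ln (norm (y (z + c))) - ln (norm (y z))\<bar>)"
            using ry ryc by (intro continuous_intros) auto
          fix z :: complex assume "norm z = s"
          thus "log_plus (norm (y (z + c) / y z)) \<le> \<bar>ln (norm (y (z + c))) - ln (norm (y z))\<bar>"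
            using ry(2)[of z] ryc(2)[of z] by (simp add: log_plus_def norm_divide ln_divide_pos)
        qed (use s in auto)
        also have "\<dots> \<le> C * pj_error \<alpha> y s R" using R s by (intro C(2) m nz) auto
        also have "\<dots> \<le> C * (\<epsilon> / C * T n)" using R C(1) by (intro mult_left_mono) auto
        also have "\<dots> = \<epsilon> * T n" using C(1) by simp
        finally show ?case using x by simp
      qed
    qed
    thus ?thesis using md by (simp add: msmall_def)
  qed
qed

text \<open>A fixed displacement \<open>d\<close> is eventually shorter than \<delta> h, so
  monotonicity transports the bound back from a larger radius of the same window.\<close>

lemma W_shift_mono:
  assumes "eventually (\<lambda>(n, s). q s \<le> K * T n) W" "\<And>s s'. 1 \<le> s \<Longrightarrow> s \<le> s' \<Longrightarrow> q s \<le> q s'" "d \<ge> 0"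
  shows "eventually (\<lambda>(n, s). q (s + d) \<le> K * T n) W"
proof -
  obtain \<delta> where \<delta>: "\<delta> > 0" "eventually (\<lambda>(n, s). \<exists>s'. s + \<delta> * h n \<le> s' \<and> s' \<le> s + 2 * \<delta> * h n \<and> q s' \<le> K * T n) W"
    using W_larger_radius[OF assms(1)] by (auto simp: case_prod_unfold)
  show ?thesis using \<delta>(2) eventually_W_seq[OF h_pos[of "d / \<delta>"]] eventually_W_ge[of 1]
  proof eventually_elim
    case (elim x)
    obtain n s where x: "x = (n, s)" by force
    obtain s' where s': "s + \<delta> * h n \<le> s'" "q s' \<le> K * T n" using elim(1) x by auto
    have "d < \<delta> * h n" "s \<ge> 1" using elim(2,3) x \<delta>(1) by (auto simp: field_simps)
    hence "q (s + d) \<le> q s'" using s' assms(3) by (intro assms(2)) auto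
    thus ?case using s' x by simp
  qed
qed

lemma counting_shift_W:
  assumes "y meromorphic_on UNIV" "eventually (\<lambda>(n, s). counting (pole_ord y) s \<le> K * T n) W"
  shows "eventually (\<lambda>(n, s). counting (pole_ord (\<lambda>z. y (z + c))) s \<le> (1 + norm c) * K * T n) W"
proof -
  have lf: "loc_finite (pole_ord y)" by (rule loc_finite_pole_ord[OF assms(1)])
  have "eventually (\<lambda>(n, s). counting (pole_ord y) (s + norm c) \<le> K * T n) W"
    by (rule W_shift_mono[OF assms(2)]) (auto intro: counting_mono_radius[OF lf])
  thus ?thesis using eventually_W_ge[of 1]
  proof eventually_elim
    case (elim x)
    obtain n s where x: "x = (n, s)" by force
    have "counting (pole_ord (\<lambda>z. y (z + c))) s \<le> (1 + norm c) * counting (pole_ord y) (s + norm c)"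
      unfolding pole_ord_shift using elim(2) x by (intro counting_shift_le[OF lf]) auto
    also have "\<dots> \<le> (1 + norm c) * (K * T n)" using elim(1) x by (intro mult_left_mono) auto
    finally show ?case using x by (simp add: mult.assoc)
  qed
qed

lemma nsmall_shift: "nsmall y \<Longrightarrow> nsmall (\<lambda>z. y (z + c))"
  unfolding nsmall_def negl_def
proof (intro conjI allI impI)
  assume *: "y meromorphic_on UNIV \<and> (\<forall>\<epsilon>>0. eventually (\<lambda>(n, s). counting (pole_ord y) s \<le> \<epsilon> * T n) W)"
  thus "(\<lambda>z. y (z + c)) meromorphic_on UNIV" by (intro meromorphic_shift) auto
  fix \<epsilon> :: real assume \<epsilon>: "\<epsilon> > 0"
  have c: "1 + norm c > 0" by (simp add: add_pos_nonneg)
  hence "\<epsilon> / (1 + norm c) > 0" using \<epsilon> by simp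
  hence "eventually (\<lambda>(n, s). counting (pole_ord y) s \<le> \<epsilon> / (1 + norm c) * T n) W" using * by blast
  from counting_shift_W[OF _ this, of c] * c
  show "eventually (\<lambda>(n, s). counting (pole_ord (\<lambda>z. y (z + c))) s \<le> \<epsilon> * T n) W" by simp
qed

text \<open>A quotient by an identically vanishing y is 0; its product with y is still f, because f
  vanishes as well in that case.\<close>

lemma quotient_mult_cancel:
  assumes "tame y" "\<forall>\<^sub>\<approx>z. y z = 0 \<Longrightarrow> \<forall>\<^sub>\<approx>z. f z = 0"
  shows "\<forall>\<^sub>\<approx>z. f z / y z * y z = f z"
  using meromorphic_zero_dichotomy[OF tame_mero[OF assms(1)]]
proof
  assume "\<forall>\<^sub>\<approx>z. y z = 0"
  from assms(2)[OF this] show ?thesis by eventually_elim simp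
next
  assume "\<forall>\<^sub>\<approx>z. y z \<noteq> 0"
  thus ?thesis by eventually_elim simp
qed

lemma deriv_quot_mult: "tame y \<Longrightarrow> \<forall>\<^sub>\<approx>z. deriv y z / y z * y z = deriv y z"
  by (rule quotient_mult_cancel) (auto intro: cosparse_zero_deriv)

lemma shift_quot_mult: "tame y \<Longrightarrow> \<forall>\<^sub>\<approx>z. y (z + c) / y z * y z = y (z + c)"
  by (rule quotient_mult_cancel) (auto intro: cosparse_shift)

lemma msmall_logderiv_minus_1:
  assumes "tame y"
  shows "msmall (\<lambda>z. deriv y z / (y z - 1))"
proof -
  have m: "y meromorphic_on UNIV" using assms tame_mero by auto
  have "\<forall>\<^sub>\<approx>z. deriv y z = deriv (\<lambda>w. y w - 1) z"
    using meromorphic_on_imp_analytic_cosparse[OF m]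
    by eventually_elim (auto simp: analytic_on_imp_differentiable_at)
  hence "\<forall>\<^sub>\<approx>z. deriv (\<lambda>w. y w - 1) z / (y z - 1) = deriv y z / (y z - 1)" by eventually_elim simp
  from msmall_cong[OF msmall_logderiv[OF tame_diff[OF assms tame_const]] this]
  show ?thesis by (simp add: meromorphic_intros m)
qed

lemma msmall_deriv: "msmall y \<Longrightarrow> tame y \<Longrightarrow> msmall (deriv y)"
  by (rule msmall_cong[OF msmall_mult[OF msmall_logderiv _] deriv_quot_mult])
     (auto intro: meromorphic_intros tame_mero)

lemma msmall_shift: "msmall y \<Longrightarrow> tame y \<Longrightarrow> msmall (\<lambda>z. y (z + c))"
  by (rule msmall_cong[OF msmall_mult[OF msmall_shift_quot _] shift_quot_mult])
     (auto intro: meromorphic_shift tame_mero)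

lemma bdd_proximity_mult:
  assumes "msmall f" "tame g"
  shows "bdd (\<lambda>s. proximity s (\<lambda>z. f z * g z))"
proof (rule bdd_mono[OF bdd_add W_proximity_mult])
  show "bdd (\<lambda>s. proximity s f)" using assms by (simp add: msmall_def negl_imp_bdd)
  show "bdd (\<lambda>s. proximity s g)" using assms by (simp add: tame_def)
qed (use assms in \<open>auto intro: msmall_mero tame_mero\<close>)

lemma bdd_proximity_cong:
  assumes "bdd (\<lambda>s. proximity s f)" "\<forall>\<^sub>\<approx>z. f z = g z"
  shows "bdd (\<lambda>s. proximity s g)"
proof (rule bdd_mono[OF assms(1)])
  show "eventually (\<lambda>(n, s). proximity s g \<le> proximity s f) W"
    using W_proximity_cong[OF assms(2)] by eventually_elim auto
qed

lemma tame_deriv: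
  assumes "tame y"
  shows "tame (deriv y)"
proof -
  have m: "y meromorphic_on UNIV" using assms tame_mero by auto
  have "bdd (\<lambda>s. proximity s (deriv y))"
    by (rule bdd_proximity_cong[OF bdd_proximity_mult[OF msmall_logderiv[OF assms] assms] deriv_quot_mult[OF assms]])
  moreover have "bdd (counting (pole_ord (deriv y)))"
  proof (rule bdd_mono)
    show "bdd (\<lambda>s. 2 * counting (pole_ord y) s)" using assms by (intro bdd_cmult) (auto simp: tame_def)
    show "eventually (\<lambda>(n, s). counting (pole_ord (deriv y)) s \<le> 2 * counting (pole_ord y) s) W"
      using eventually_W_ge[of 1]
    proof eventually_elim
      case (elim x)
      have lf: "loc_finite (\<lambda>z. 2 * pole_ord y z)"
        by (rule loc_finite_mono[OF loc_finite_pole_ord[OF m]]) auto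
      have "counting (pole_ord (deriv y)) s \<le> counting (\<lambda>z. 2 * pole_ord y z) s" if "s \<ge> 1" for s
        using that pole_ord_deriv_le[OF mero_at[OF m]] by (intro counting_mono lf) auto
      thus ?case using elim by (auto simp: counting_cmult)
    qed
  qed
  ultimately show ?thesis using m by (auto simp: tame_def intro!: meromorphic_intros)
qed

lemma tame_shift:
  assumes "tame y"
  shows "tame (\<lambda>z. y (z + c))"
proof -
  have m: "y meromorphic_on UNIV" using assms tame_mero by auto
  have "bdd (\<lambda>s. proximity s (\<lambda>z. y (z + c)))"
    by (rule bdd_proximity_cong[OF bdd_proximity_mult[OF msmall_shift_quot[OF assms] assms] shift_quot_mult[OF assms]])
  moreover obtain K where "eventually (\<lambda>(n, s). counting (pole_ord y) s \<le> K * T n) W"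
    using assms by (auto simp: tame_def bdd_def)
  hence "bdd (counting (pole_ord (\<lambda>z. y (z + c))))" using counting_shift_W[OF m] unfolding bdd_def by blast
  ultimately show ?thesis using meromorphic_shift[OF m] by (simp add: tame_def)
qed

end

section \<open>Local analysis at shared points\<close>

lemma bigo_imp_not_pole:
  assumes "h meromorphic_on {z}" "h \<in> O[at z](\<lambda>_. 1)"
  shows "pole_ord h z = 0"
proof (rule ccontr)
  assume "pole_ord h z \<noteq> 0"
  hence "is_pole h z" using pole_ord_eq_0_iff[OF assms(1)] by simp
  hence lim: "filterlim (\<lambda>w. norm (h w)) at_top (at z)"
    unfolding is_pole_def by (rule filterlim_at_infinity_imp_norm_at_top)
  obtain c where "eventually (\<lambda>w. norm (h w) \<le> c * norm (1 :: complex)) (at z)"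
    using assms(2) by (auto elim: landau_o.bigE)
  moreover have "eventually (\<lambda>w. norm (h w) > c) (at z)"
    using lim by (auto simp: filterlim_at_top_dense)
  ultimately have "eventually (\<lambda>w. False) (at z)" by eventually_elim auto
  thus False by simp
qed

lemma not_pole_tendsto:
  assumes "h meromorphic_on {z}" "pole_ord h z = 0"
  obtains l where "h \<midarrow>z\<rightarrow> l"
  using assms pole_ord_eq_0_iff[OF assms(1)] by (auto simp: meromorphic_at_iff not_essential_def)

lemma tendsto_imp_bigo: "(h \<midarrow>z\<rightarrow> l) \<Longrightarrow> h \<in> O[at z](\<lambda>_. 1 :: complex)"
  using bigoI_tendsto[of h "\<lambda>_. 1" l "at z"] by auto

text \<open>With y = g (w-z)^n and g analytic and nonzero at z, the logarithmic derivative is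
  n/(w-z) + g'/g.\<close>

lemma tendsto_logderiv_zorder:
  assumes "y meromorphic_on {z}" "eventually (\<lambda>w. y w \<noteq> 0) (at z)"
  shows "(\<lambda>w. (w - z) * (deriv y w / y w)) \<midarrow>z\<rightarrow> of_int (zorder y z)"
proof -
  define n where "n = zorder y z"
  have iso: "isolated_singularity_at y z" "not_essential y z" using assms(1) by (auto simp: meromorphic_at_iff)
  obtain r where r: "r > 0" "zor_poly y z holomorphic_on cball z r" "zor_poly y z z \<noteq> 0"
    and eq: "\<forall>w\<in>cball z r - {z}. y w = zor_poly y z w * (w - z) powi n \<and> zor_poly y z w \<noteq> 0"
    using zorder_exist[OF iso eventually_frequently[OF _ assms(2)]] unfolding n_def by auto
  define g where "g = zor_poly y z"
  have gh: "g holomorphic_on ball z r" using r by (auto simp: g_def elim: holomorphic_on_subset)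
  have ev: "eventually (\<lambda>w. (w - z) * (deriv g w / g w) + of_int n = (w - z) * (deriv y w / y w)) (at z)"
  proof -
    have "eventually (\<lambda>w. w \<in> ball z r - {z}) (at z)" using r by (intro eventually_at_in_open) auto
    thus ?thesis
    proof eventually_elim
      case (elim w)
      have wz: "w \<noteq> z" "w \<in> ball z r" using elim by auto
      have gw: "g w \<noteq> 0" using eq elim by (auto simp: g_def)
      have "(g has_field_derivative deriv g w) (at w)" using gh wz by (intro holomorphic_derivI[of _ "ball z r"]) auto
      moreover have "((\<lambda>w. (w - z) powi n) has_field_derivative of_int n * (w - z) powi (n - 1)) (at w)"
        using wz by (auto intro!: derivative_eq_intros)
      ultimately have "((\<lambda>w. g w * (w - z) powi n) has_field_derivative
          deriv g w * (w - z) powi n + of_int n * (w - z) powi (n - 1) * g w) (at w)"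
        by (rule DERIV_mult)
      moreover have "eventually (\<lambda>w. g w * (w - z) powi n = y w) (nhds w)"
      proof -
        have "eventually (\<lambda>w. w \<in> ball z r - {z}) (nhds w)" using elim by (intro eventually_nhds_in_open) auto
        thus ?thesis by eventually_elim (use eq in \<open>auto simp: g_def\<close>)
      qed
      ultimately have "(y has_field_derivative deriv g w * (w - z) powi n + of_int n * (w - z) powi (n - 1) * g w) (at w)"
        by (simp add: DERIV_cong_ev[OF refl _ refl, of "\<lambda>w. g w * (w - z) powi n" y w])
      hence d: "deriv y w = deriv g w * (w - z) powi n + of_int n * (w - z) powi (n - 1) * g w"
        by (rule DERIV_imp_deriv)
      have yw: "y w = g w * (w - z) powi n" using eq elim by (auto simp: g_def)
      have p1: "(w - z) powi (n - 1) = (w - z) powi n / (w - z)" using wz by (simp add: power_int_diff)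
      have p0: "(w - z) powi n \<noteq> 0" using wz by (simp add: power_int_eq_0_iff)
      show ?case unfolding d yw p1 using wz gw p0 by (simp add: field_simps)
    qed
  qed
  have "isCont (deriv g) z" "isCont g z"
    using gh r by (auto intro!: holomorphic_on_imp_continuous_on[THEN continuous_on_interior] holomorphic_deriv
        simp: interior_open)
  hence "((\<lambda>w. (w - z) * (deriv g w / g w) + of_int n) \<longlongrightarrow> (z - z) * (deriv g z / g z) + of_int n) (at z)"
    using r(3) by (intro tendsto_intros) (auto simp: isCont_def g_def)
  hence "((\<lambda>w. (w - z) * (deriv g w / g w) + of_int n) \<longlongrightarrow> of_int n) (at z)" by simp
  thus ?thesis unfolding n_def[symmetric] using ev by (rule Lim_transform_eventually)
qed

lemma zorder_bigo:
  assumes "y meromorphic_on {z}" "eventually (\<lambda>w. y w \<noteq> 0) (at z)" "zorder y z = int n"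
  shows "y \<in> O[at z](\<lambda>w. (w - z) ^ n)"
proof -
  have iso: "isolated_singularity_at y z" "not_essential y z" using assms(1) by (auto simp: meromorphic_at_iff)
  obtain r where r: "r > 0" "zor_poly y z holomorphic_on cball z r"
    and eq: "\<forall>w\<in>cball z r - {z}. y w = zor_poly y z w * (w - z) powi int n \<and> zor_poly y z w \<noteq> 0"
    using zorder_exist[OF iso eventually_frequently[OF _ assms(2)]] unfolding assms(3) by auto
  have "isCont (zor_poly y z) z"
    using r by (auto intro!: holomorphic_on_imp_continuous_on[THEN continuous_on_interior])
  hence "zor_poly y z \<in> O[at z](\<lambda>_. 1)" by (intro tendsto_imp_bigo) (auto simp: isCont_def)
  hence "(\<lambda>w. zor_poly y z w * (w - z) ^ n) \<in> O[at z](\<lambda>w. 1 * (w - z) ^ n)"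
    by (intro landau_o.big.mult) auto
  moreover have "eventually (\<lambda>w. zor_poly y z w * (w - z) ^ n = y w) (at z)"
    unfolding eventually_at using r eq by (auto intro!: exI[of _ r] simp: dist_commute)
  ultimately show ?thesis using landau_o.big.in_cong by (simp add: landau_o.big.in_cong)
qed

text \<open>After removing the singularity, the quotient is a difference quotient at z and converges
  to the derivative there.\<close>

lemma tendsto_0_divide_ident:
  assumes "h meromorphic_on {z}" "h \<midarrow>z\<rightarrow> 0"
  obtains l where "(\<lambda>w. h w / (w - z)) \<midarrow>z\<rightarrow> l"
proof -
  define H where "H = remove_sings h"
  have "isolated_singularity_at h z" using assms(1) by (simp add: meromorphic_at_iff)
  from remove_sings_analytic_at[OF this assms(2)] have an: "H analytic_on {z}" by (simp add: H_def)
  have "H z = 0" using assms(2) by (simp add: H_def remove_sings_eqI)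
  have "(H has_field_derivative deriv H z) (at z)"
    using an analytic_at_imp_isCont analytic_on_imp_differentiable_at DERIV_deriv_iff_field_differentiable by blast
  hence "((\<lambda>w. (H w - H z) / (w - z)) \<longlongrightarrow> deriv H z) (at z)" by (simp add: has_field_derivative_iff)
  moreover have "eventually (\<lambda>w. (H w - H z) / (w - z) = h w / (w - z)) (at z)"
    using eventually_remove_sings_eq_at[OF \<open>isolated_singularity_at h z\<close>]
    by eventually_elim (simp add: H_def[symmetric] \<open>H z = 0\<close>)
  ultimately have "((\<lambda>w. h w / (w - z)) \<longlongrightarrow> deriv H z) (at z)" by (rule Lim_transform_eventually)
  thus thesis by (rule that)
qed

text \<open>The logarithmic derivative of (F-1)/F, called W_F in the overview; away from F = 0 and F
  = 1 it equals F'/(F(F-1)).\<close>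

definition ld01 :: "(complex \<Rightarrow> complex) \<Rightarrow> complex \<Rightarrow> complex" where
  "ld01 F w = deriv F w / (F w - 1) - deriv F w / F w"

text \<open>The fifth power of the product below times $W_F$ has no pole at a shared point, once multiplied
  by $F(F-1)G(G-1)$: if both multiplicities $p$, $q$ there are at most 4, one factor vanishes and
  cancels the simple pole of $W_F$; otherwise $F(F-1)$ or $G(G-1)$ has a zero of order at least 5.\<close>

definition ratio_prod :: "nat \<Rightarrow> (complex \<Rightarrow> complex) \<Rightarrow> (complex \<Rightarrow> complex) \<Rightarrow> complex \<Rightarrow> complex" where
  "ratio_prod N F G w = (\<Prod>(p, q)\<in>{1..N} \<times> {1..N}.
     of_nat q * (ld01 F w * (F w - G w)) - of_nat p * (ld01 G w * (F w - G w)))"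

lemma mero_ld01: "F meromorphic_on A \<Longrightarrow> ld01 F meromorphic_on A"
  unfolding ld01_def[abs_def] by (intro meromorphic_intros)

lemma mero_ratio_prod: "F meromorphic_on A \<Longrightarrow> G meromorphic_on A \<Longrightarrow> ratio_prod N F G meromorphic_on A"
  unfolding ratio_prod_def[abs_def] case_prod_unfold by (intro meromorphic_intros mero_ld01)

lemma deriv_diff_const_ev:
  assumes "F meromorphic_on {z}"
  shows "eventually (\<lambda>w. deriv (\<lambda>w. F w - c) w = deriv F w) (at z)"
proof -
  have "isolated_singularity_at F z" using assms by (simp add: meromorphic_at_iff)
  hence "eventually (\<lambda>w. F analytic_on {w}) (at z)" by (simp add: isolated_singularity_at_altdef)
  thus ?thesis
  proof eventually_elim
    case (elim w)
    hence "F field_differentiable at w" by (rule analytic_on_imp_differentiable_at) simp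
    thus ?case by (simp add: deriv_diff)
  qed
qed

text \<open>The residue is minus the multiplicity at a zero of F and plus the multiplicity at a
  point where F = 1; the factor 2x - 1 expresses both signs.\<close>

lemma ld01_tendsto:
  assumes F: "F meromorphic_on {z}" "eventually (\<lambda>w. F w \<noteq> 0) (at z)" "eventually (\<lambda>w. F w \<noteq> 1) (at z)"
    and lim: "F \<midarrow>z\<rightarrow> x" and x: "x \<in> {0, 1}"
  obtains p where "p \<ge> 1" "(\<lambda>w. (w - z) * ld01 F w) \<midarrow>z\<rightarrow> (2 * x - 1) * of_nat p"
    "(\<lambda>w. F w * (F w - 1)) \<in> O[at z](\<lambda>w. (w - z) ^ p)"
proof -
  have F1: "(\<lambda>w. F w - 1) meromorphic_on {z}" by (intro meromorphic_intros F)
  have nz1: "eventually (\<lambda>w. F w - 1 \<noteq> 0) (at z)" using F(3) by eventually_elim simp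
  have l0: "(\<lambda>w. (w - z) * (deriv F w / F w)) \<midarrow>z\<rightarrow> of_int (zorder F z)"
    by (rule tendsto_logderiv_zorder[OF F(1,2)])
  have l1: "(\<lambda>w. (w - z) * (deriv F w / (F w - 1))) \<midarrow>z\<rightarrow> of_int (zorder (\<lambda>w. F w - 1) z)"
  proof (rule Lim_transform_eventually[OF tendsto_logderiv_zorder[OF F1 nz1]])
    show "eventually (\<lambda>w. (w - z) * (deriv (\<lambda>w. F w - 1) w / (F w - 1)) = (w - z) * (deriv F w / (F w - 1))) (at z)"
      using deriv_diff_const_ev[OF F(1), of 1] by eventually_elim simp
  qed
  have "(\<lambda>w. (w - z) * ld01 F w) \<midarrow>z\<rightarrow> of_int (zorder (\<lambda>w. F w - 1) z) - of_int (zorder F z)"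
    using tendsto_diff[OF l1 l0] by (simp add: ld01_def right_diff_distrib)
  note lim_ld = this
  have zo: "zorder h z > 0" if "h meromorphic_on {z}" "eventually (\<lambda>w. h w \<noteq> 0) (at z)" "h \<midarrow>z\<rightarrow> 0" for h
  proof -
    have "isolated_zero h z" using that by (simp add: isolated_zero_def)
    thus ?thesis using that(1) by (intro zorder_isolated_zero_pos') (auto simp: meromorphic_at_iff)
  qed
  have zo0: "zorder h z = 0" if "h meromorphic_on {z}" "eventually (\<lambda>w. h w \<noteq> 0) (at z)" "h \<midarrow>z\<rightarrow> c" "c \<noteq> 0" for h c
  proof -
    have "\<not> is_pole h z" using that(3) by (meson at_neq_bot is_pole_def not_tendsto_and_filterlim_at_infinity)
    moreover have "\<not> isolated_zero h z"
      using that(3,4) tendsto_unique[OF _ that(3), of 0] by (auto simp: isolated_zero_def)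
    ultimately show ?thesis using that by (intro not_pole_not_isolated_zero_imp_zorder_eq_0) (auto intro: eventually_frequently)
  qed
  have b: "F \<in> O[at z](\<lambda>_. 1)" "(\<lambda>w. F w - 1) \<in> O[at z](\<lambda>_. 1)"
    using lim by (auto intro!: tendsto_imp_bigo tendsto_intros)
  show thesis
  proof (cases "x = 0")
    case True
    have z0: "zorder F z > 0" using zo[OF F(1,2)] lim True by simp
    have z1: "zorder (\<lambda>w. F w - 1) z = 0"
      using lim True by (intro zo0[OF F1 nz1, of "-1"]) (auto intro!: tendsto_eq_intros)
    define p where "p = nat (zorder F z)"
    have p: "zorder F z = int p" "p \<ge> 1" using z0 by (auto simp: p_def)
    have "F \<in> O[at z](\<lambda>w. (w - z) ^ p)" by (rule zorder_bigo[OF F(1,2) p(1)])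
    from landau_o.big.mult[OF this b(2)] show thesis
      using that[OF p(2)] lim_ld True p z1 by simp
  next
    case False
    hence x1: "x = 1" using x by simp
    have z1: "zorder (\<lambda>w. F w - 1) z > 0"
      using lim x1 by (intro zo[OF F1 nz1]) (auto intro!: tendsto_eq_intros)
    have z0: "zorder F z = 0"
      using lim x1 by (intro zo0[OF F(1,2), of 1]) auto
    define p where "p = nat (zorder (\<lambda>w. F w - 1) z)"
    have p: "zorder (\<lambda>w. F w - 1) z = int p" "p \<ge> 1" using z1 by (auto simp: p_def)
    have "(\<lambda>w. F w - 1) \<in> O[at z](\<lambda>w. (w - z) ^ p)" by (rule zorder_bigo[OF F1 nz1 p(1)])
    from landau_o.big.mult[OF b(1) this] show thesis
      using that[OF p(2)] lim_ld x1 p z0 by simp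
  qed
qed

lemma ld01_bigo:
  assumes F: "F meromorphic_on {z}" and lim: "F \<midarrow>z\<rightarrow> x" and x: "x \<notin> {0, 1}"
  shows "ld01 F \<in> O[at z](\<lambda>_. 1)"
proof -
  have "pole_ord F z = 0" using F lim pole_ord_eq_0_iff[OF F]
    by (meson at_neq_bot is_pole_def not_tendsto_and_filterlim_at_infinity)
  hence "pole_ord (deriv F) z = 0" using pole_ord_deriv_le[OF F] by simp
  then obtain d where "deriv F \<midarrow>z\<rightarrow> d" using F by (auto intro: not_pole_tendsto meromorphic_intros)
  hence "ld01 F \<midarrow>z\<rightarrow> d / (x - 1) - d / x"
    unfolding ld01_def[abs_def] using lim x by (intro tendsto_intros) auto
  thus ?thesis by (rule tendsto_imp_bigo)
qed

text \<open>At a common zero or one, of multiplicities $p$ for $F$ and $q$ for $G$, the functions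
  $q\,W_F(F-G)$ and $p\,W_G(F-G)$ have the same value.\<close>

lemma shared_point_analysis:
  assumes F: "F meromorphic_on {z}" "eventually (\<lambda>w. F w \<noteq> 0) (at z)" "eventually (\<lambda>w. F w \<noteq> 1) (at z)"
    and G: "G meromorphic_on {z}" "eventually (\<lambda>w. G w \<noteq> 0) (at z)" "eventually (\<lambda>w. G w \<noteq> 1) (at z)"
    and lim: "F \<midarrow>z\<rightarrow> x" "G \<midarrow>z\<rightarrow> y" and share: "x = 0 \<longleftrightarrow> y = 0" "x = 1 \<longleftrightarrow> y = 1"
  shows "pole_ord (\<lambda>w. ld01 F w * (F w - G w)) z = 0" (is ?A)
    "pole_ord (\<lambda>w. ld01 G w * (F w - G w)) z = 0" (is ?B)
    "pole_ord (\<lambda>w. F w * (F w - 1) * (G w * (G w - 1)) * (ratio_prod 4 F G w * ld01 F w) ^ 5) z = 0" (is ?C)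
proof -
  define \<Phi> V where "\<Phi> = (\<lambda>w. ld01 F w * (F w - G w))" and "V = (\<lambda>w. ld01 G w * (F w - G w))"
  have mero: "\<Phi> meromorphic_on {z}" "V meromorphic_on {z}"
    "(\<lambda>w. F w * (F w - 1) * (G w * (G w - 1)) * (ratio_prod 4 F G w * ld01 F w) ^ 5) meromorphic_on {z}"
    unfolding \<Phi>_def V_def by (intro meromorphic_intros mero_ld01 mero_ratio_prod F G)+
  have rp: "ratio_prod 4 F G w = (\<Prod>(p, q)\<in>{1..4} \<times> {1..4}. of_nat q * \<Phi> w - of_nat p * V w)" for w
    by (simp add: ratio_prod_def \<Phi>_def V_def)
  have bF: "F \<in> O[at z](\<lambda>_. 1)" "(\<lambda>w. F w - 1) \<in> O[at z](\<lambda>_. 1)"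
     "G \<in> O[at z](\<lambda>_. 1)" "(\<lambda>w. G w - 1) \<in> O[at z](\<lambda>_. 1)" "(\<lambda>w. F w - G w) \<in> O[at z](\<lambda>_. 1)"
    using lim by (auto intro!: tendsto_imp_bigo tendsto_intros)
  have "\<Phi> \<in> O[at z](\<lambda>_. 1) \<and> V \<in> O[at z](\<lambda>_. 1) \<and>
    (\<lambda>w. F w * (F w - 1) * (G w * (G w - 1)) * (ratio_prod 4 F G w * ld01 F w) ^ 5) \<in> O[at z](\<lambda>_. 1)"
  proof (cases "x \<in> {0, 1}")
    case False
    hence y: "y \<notin> {0, 1}" using share by auto
    note b = ld01_bigo[OF F(1) lim(1) False] ld01_bigo[OF G(1) lim(2) y]
    have \<Phi>: "\<Phi> \<in> O[at z](\<lambda>_. 1)" "V \<in> O[at z](\<lambda>_. 1)"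
      unfolding \<Phi>_def V_def using landau_o.big.mult[OF b(1) bF(5)] landau_o.big.mult[OF b(2) bF(5)] by simp_all
    have fac: "(\<lambda>w. of_nat q * \<Phi> w - of_nat p * V w) \<in> O[at z](\<lambda>_. 1)" for p q :: nat
      using sum_in_bigo(2)[OF landau_o.big.mult[OF tendsto_imp_bigo[OF tendsto_const[of "of_nat q"]] \<Phi>(1)]
          landau_o.big.mult[OF tendsto_imp_bigo[OF tendsto_const[of "of_nat p"]] \<Phi>(2)]] by simp
    have "(\<lambda>w. \<Prod>x\<in>{1..4} \<times> {1..4}. of_nat (snd x) * \<Phi> w - of_nat (fst x) * V w) \<in> O[at z](\<lambda>w. \<Prod>x\<in>{1..4::nat} \<times> {1..4::nat}. 1)"
      by (intro landau_o.big_prod fac)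
    hence rpb: "ratio_prod 4 F G \<in> O[at z](\<lambda>_. 1)" unfolding rp[abs_def] case_prod_unfold by simp
    have "(\<lambda>w. F w * (F w - 1) * (G w * (G w - 1)) * (ratio_prod 4 F G w * ld01 F w) ^ 5) \<in> O[at z](\<lambda>_. 1 * 1 * (1 * 1) * (1 * 1) ^ 5)"
      by (intro landau_o.big.mult landau_o.big_power bF rpb b)
    thus ?thesis using \<Phi> by simp
  next
    case True
    hence xy: "y = x" using share by auto
    obtain p where p: "p \<ge> 1" "(\<lambda>w. (w - z) * ld01 F w) \<midarrow>z\<rightarrow> (2 * x - 1) * of_nat p"
      "(\<lambda>w. F w * (F w - 1)) \<in> O[at z](\<lambda>w. (w - z) ^ p)"
      by (rule ld01_tendsto[OF F lim(1) True])
    obtain q where q: "q \<ge> 1" "(\<lambda>w. (w - z) * ld01 G w) \<midarrow>z\<rightarrow> (2 * x - 1) * of_nat q"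
      "(\<lambda>w. G w * (G w - 1)) \<in> O[at z](\<lambda>w. (w - z) ^ q)"
      by (rule ld01_tendsto[OF G lim(2)[unfolded xy] True])
    have "(\<lambda>w. F w - G w) \<midarrow>z\<rightarrow> x - x" using lim xy by (intro tendsto_intros) auto
    \<comment> \<open>F and G have the same limit at the point, so F - G has a zero there, which
      absorbs the simple pole of W_F and of W_G. Only this limit l enters both values, whence the
      proportion p : q.\<close>
    then obtain l where l: "(\<lambda>w. (F w - G w) / (w - z)) \<midarrow>z\<rightarrow> l"
      using tendsto_0_divide_ident[of "\<lambda>w. F w - G w" z] F G by (auto intro: meromorphic_intros)
    have evz: "eventually (\<lambda>w. w \<noteq> z) (at z)" by (simp add: eventually_at_filter)
    have \<Phi>l: "\<Phi> \<midarrow>z\<rightarrow> (2 * x - 1) * of_nat p * l" "V \<midarrow>z\<rightarrow> (2 * x - 1) * of_nat q * l"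
      using evz by (auto intro: Lim_transform_eventually[OF tendsto_mult[OF p(2) l]]
          Lim_transform_eventually[OF tendsto_mult[OF q(2) l]] elim!: eventually_mono simp: \<Phi>_def V_def)
    have \<Phi>: "\<Phi> \<in> O[at z](\<lambda>_. 1)" "V \<in> O[at z](\<lambda>_. 1)" using \<Phi>l tendsto_imp_bigo by blast+
    have fac: "(\<lambda>w. of_nat q' * \<Phi> w - of_nat p' * V w) \<in> O[at z](\<lambda>_. 1)" for p' q' :: nat
      using sum_in_bigo(2)[OF landau_o.big.mult[OF tendsto_imp_bigo[OF tendsto_const[of "of_nat q'"]] \<Phi>(1)]
          landau_o.big.mult[OF tendsto_imp_bigo[OF tendsto_const[of "of_nat p'"]] \<Phi>(2)]] by simp
    have prodb: "(\<lambda>w. \<Prod>x\<in>A. of_nat (snd x) * \<Phi> w - of_nat (fst x) * V w) \<in> O[at z](\<lambda>_. 1)" for A :: "(nat \<times> nat) set"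
    proof -
      have "(\<lambda>w. \<Prod>x\<in>A. of_nat (snd x) * \<Phi> w - of_nat (fst x) * V w) \<in> O[at z](\<lambda>w. \<Prod>x\<in>A. 1)"
        by (intro landau_o.big_prod fac)
      thus ?thesis by simp
    qed
    have wF: "(\<lambda>w. (w - z) * ld01 F w) \<in> O[at z](\<lambda>_. 1)" by (rule tendsto_imp_bigo[OF p(2)])
    have "(\<lambda>w. F w * (F w - 1) * (G w * (G w - 1)) * (ratio_prod 4 F G w * ld01 F w) ^ 5) \<in> O[at z](\<lambda>_. 1)"
    proof (cases "p \<le> 4 \<and> q \<le> 4")
      case True
      have "(\<lambda>w. of_nat q * \<Phi> w - of_nat p * V w) \<midarrow>z\<rightarrow> of_nat q * ((2 * x - 1) * of_nat p * l) - of_nat p * ((2 * x - 1) * of_nat q * l)"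
        by (intro tendsto_intros \<Phi>l)
      hence "(\<lambda>w. of_nat q * \<Phi> w - of_nat p * V w) \<midarrow>z\<rightarrow> 0" by (simp add: mult_ac)
      moreover have "(\<lambda>w. of_nat q * \<Phi> w - of_nat p * V w) meromorphic_on {z}" by (intro meromorphic_intros mero)
      ultimately obtain l' where "(\<lambda>w. (of_nat q * \<Phi> w - of_nat p * V w) / (w - z)) \<midarrow>z\<rightarrow> l'"
        using tendsto_0_divide_ident[of "\<lambda>w. of_nat q * \<Phi> w - of_nat p * V w" z] by metis
      from tendsto_imp_bigo[OF this] have r1: "(\<lambda>w. (of_nat q * \<Phi> w - of_nat p * V w) / (w - z)) \<in> O[at z](\<lambda>_. 1)" .
      have X: "(\<lambda>w. (F w * (F w - 1)) * (G w * (G w - 1)) * (((\<Prod>x\<in>{1..4} \<times> {1..4} - {(p, q)}. of_nat (snd x) * \<Phi> w - of_nat (fst x) * V w) *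
           ((of_nat q * \<Phi> w - of_nat p * V w) / (w - z))) * ((w - z) * ld01 F w)) ^ 5) \<in> O[at z](\<lambda>_. (1 * 1) * (1 * 1) * ((1 * 1) * 1) ^ 5)"
        by (intro landau_o.big.mult landau_o.big_power bF prodb r1 wF)
      have ev: "eventually (\<lambda>w. (F w * (F w - 1)) * (G w * (G w - 1)) * (((\<Prod>x\<in>{1..4} \<times> {1..4} - {(p, q)}. of_nat (snd x) * \<Phi> w - of_nat (fst x) * V w) *
           ((of_nat q * \<Phi> w - of_nat p * V w) / (w - z))) * ((w - z) * ld01 F w)) ^ 5 =
           F w * (F w - 1) * (G w * (G w - 1)) * (ratio_prod 4 F G w * ld01 F w) ^ 5) (at z)"
        using evz
      proof eventually_elim
        case (elim w)
        have "ratio_prod 4 F G w = (of_nat q * \<Phi> w - of_nat p * V w) * (\<Prod>x\<in>{1..4} \<times> {1..4} - {(p, q)}. of_nat (snd x) * \<Phi> w - of_nat (fst x) * V w)"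
          unfolding rp case_prod_unfold using True p(1) q(1) by (subst prod.remove[of _ "(p, q)"]) auto
        moreover have "P * (a / (w - z)) * ((w - z) * b) = a * P * b" for P a b using elim by simp
        ultimately show ?case by (simp only: mult.assoc[of "F w"])
      qed
      from landau_o.big.in_cong[THEN iffD1, OF ev X] show ?thesis by (simp only: mult_1 power_one)
    next
      case False
      \<comment> \<open>One of p and q is at least 5 and the other at least 1, so the subtraction is
        not truncated.\<close>
      define m where "m = p + q - 5"
      have m: "p + q = 5 + m" using False p(1) q(1) unfolding m_def by auto
      have rpb: "ratio_prod 4 F G \<in> O[at z](\<lambda>_. 1)" using prodb[of "{1..4} \<times> {1..4}"] unfolding rp[abs_def] case_prod_unfold .
      have e1: "(\<lambda>w. (w - z) ^ m) \<in> O[at z](\<lambda>_. 1)"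
      proof -
        have "((\<lambda>w. (w - z) ^ m) \<longlongrightarrow> (z - z) ^ m) (at z)" by (intro tendsto_intros)
        thus ?thesis by (rule tendsto_imp_bigo)
      qed
      have "(\<lambda>w. (F w * (F w - 1)) * (G w * (G w - 1))) \<in> O[at z](\<lambda>w. (w - z) ^ p * (w - z) ^ q)"
        by (intro landau_o.big.mult p q)
      from landau_o.big.mult[OF this landau_o.big_power[OF landau_o.big.mult[OF rpb wF], of 5]]
      have "(\<lambda>w. (F w * (F w - 1)) * (G w * (G w - 1)) * (ratio_prod 4 F G w * ((w - z) * ld01 F w)) ^ 5) \<in> O[at z](\<lambda>w. (w - z) ^ (5 + m))"
        by (simp add: power_add[symmetric] m)
      hence "(\<lambda>w. (w - z) ^ 5 * (F w * (F w - 1) * (G w * (G w - 1)) * (ratio_prod 4 F G w * ld01 F w) ^ 5)) \<in> O[at z](\<lambda>w. (w - z) ^ 5 * (w - z) ^ m)"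
        by (simp add: power_add power_mult_distrib mult_ac)
      hence "(\<lambda>w. F w * (F w - 1) * (G w * (G w - 1)) * (ratio_prod 4 F G w * ld01 F w) ^ 5) \<in> O[at z](\<lambda>w. (w - z) ^ m)"
      proof (elim landau_o.bigE)
        fix c assume "c > 0" and ev: "eventually (\<lambda>w. norm ((w - z) ^ 5 * (F w * (F w - 1) * (G w * (G w - 1)) * (ratio_prod 4 F G w * ld01 F w) ^ 5))
           \<le> c * norm ((w - z) ^ 5 * (w - z) ^ m)) (at z)"
        have "eventually (\<lambda>w. norm (F w * (F w - 1) * (G w * (G w - 1)) * (ratio_prod 4 F G w * ld01 F w) ^ 5) \<le> c * norm ((w - z) ^ m)) (at z)"
          using ev evz
        proof eventually_elim
          case (elim w)
          have "norm ((w - z) ^ 5) > 0" using elim(2) by simp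
          moreover have "norm ((w - z) ^ 5) * norm (F w * (F w - 1) * (G w * (G w - 1)) * (ratio_prod 4 F G w * ld01 F w) ^ 5) \<le>
              norm ((w - z) ^ 5) * (c * norm ((w - z) ^ m))"
            using elim(1) by (simp only: norm_mult mult_ac)
          ultimately show ?case by (simp only: mult_le_cancel_left_pos)
        qed
        thus ?thesis by (rule bigoI)
      qed
      thus ?thesis using e1 by (rule landau_o.big_trans)
    qed
    thus ?thesis using \<Phi> by simp
  qed
  thus ?A ?B ?C using bigo_imp_not_pole[OF mero(1)] bigo_imp_not_pole[OF mero(2)] bigo_imp_not_pole[OF mero(3)]
    unfolding \<Phi>_def V_def by auto
qed

section \<open>Pointwise bounds by small quantities\<close>

text \<open>Removing a sparse set from the plane leaves an open connected set, on which a vanishing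
  derivative forces a constant.\<close>

lemma meromorphic_deriv_zero_imp_const:
  assumes m: "y meromorphic_on UNIV" and d: "\<forall>\<^sub>\<approx>z. deriv y z = 0"
  obtains c where "\<forall>\<^sub>\<approx>z. y z = c"
proof -
  have "\<forall>\<^sub>\<approx>z. y analytic_on {z} \<and> deriv y z = 0"
    using meromorphic_on_imp_analytic_cosparse[OF m] d by eventually_elim auto
  hence sp: "{z. \<not> (y analytic_on {z} \<and> deriv y z = 0)} sparse_in UNIV" by (simp add: eventually_cosparse)
  define S where "S = UNIV - {z. \<not> (y analytic_on {z} \<and> deriv y z = 0)}"
  have S: "open S" unfolding S_def using sparse_in_UNIV_imp_closed[OF sp] by auto
  have "connected S" unfolding S_def by (rule sparse_imp_connected[OF _ _ _ sp]) auto
  moreover have "(y has_field_derivative 0) (at z)" if "z \<in> S" for z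
  proof -
    have "y analytic_on {z}" "deriv y z = 0" using that by (auto simp: S_def)
    thus ?thesis by (metis analytic_on_imp_differentiable_at DERIV_deriv_iff_field_differentiable singletonI)
  qed
  ultimately obtain c where c: "\<And>z. z \<in> S \<Longrightarrow> y z = c"
    using DERIV_zero_connected_constant[of S "{}" y] S
    by (metis DERIV_isCont continuous_at_imp_continuous_on finite.emptyI Diff_empty)
  have "\<forall>\<^sub>\<approx>z. z \<in> S" unfolding eventually_cosparse S_def using sp by simp
  hence "\<forall>\<^sub>\<approx>z. y z = c" by eventually_elim (rule c)
  thus thesis by (rule that)
qed

lemma continuous_on_log_plus_real:
  fixes e :: "complex \<Rightarrow> real"
  assumes "continuous_on A e" "\<And>z. e z \<ge> 0"
  shows "continuous_on A (\<lambda>z. log_plus (e z))"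
proof -
  have "continuous_on A (\<lambda>z. ln (max 1 (e z)))"
    by (intro continuous_intros assms) (auto simp: max_def)
  thus ?thesis using assms(2) by (simp add: log_plus_eq_ln_max)
qed

section \<open>Error factors that are negligible in the mean\<close>

context windows
begin

text \<open>Nonnegative real counterpart of \<open>msmall\<close>, for sums of norms that bound a
  function pointwise without being norms of meromorphic functions.\<close>

definition esmall :: "(complex \<Rightarrow> real) \<Rightarrow> bool" where
  "esmall e \<longleftrightarrow> (\<forall>z. e z \<ge> 0) \<and> eventually (\<lambda>(n, s). continuous_on (sphere 0 s) e) W \<and>
     negl (\<lambda>s. circ_mean s (\<lambda>z. log_plus (e z)))"

lemma esmall_norm: "msmall y \<Longrightarrow> esmall (\<lambda>z. norm (y z))"
proof -
  assume y: "msmall y"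
  have "eventually (\<lambda>(n, s). continuous_on (sphere 0 s) (\<lambda>z. norm (y z))) W"
    using eventually_W_continuous[OF msmall_mero[OF y]] by eventually_elim (auto intro: continuous_on_norm)
  thus ?thesis using y by (simp add: esmall_def msmall_def proximity_eq)
qed

lemma esmall_const: "c \<ge> 0 \<Longrightarrow> esmall (\<lambda>_. c)"
  using negl_const[of "log_plus c"] by (simp add: esmall_def case_prod_unfold circ_mean_const)

lemma esmall_combine:
  assumes e: "esmall e1" "esmall e2" and f: "\<And>x y. 0 \<le> x \<Longrightarrow> 0 \<le> y \<Longrightarrow> 0 \<le> f x y"
    "\<And>x y. 0 \<le> x \<Longrightarrow> 0 \<le> y \<Longrightarrow> log_plus (f x y) \<le> log_plus x + log_plus y + C"
    "\<And>A. continuous_on A e1 \<Longrightarrow> continuous_on A e2 \<Longrightarrow> continuous_on A (\<lambda>z. f (e1 z) (e2 z))"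
  shows "esmall (\<lambda>z. f (e1 z) (e2 z))"
proof -
  have nn: "e1 z \<ge> 0" "e2 z \<ge> 0" for z using e by (auto simp: esmall_def)
  have c: "eventually (\<lambda>(n, s). continuous_on (sphere 0 s) e1 \<and> continuous_on (sphere 0 s) e2 \<and> s \<ge> 0) W"
    using e[unfolded esmall_def, THEN conjunct2, THEN conjunct1] eventually_W_ge[of 0] by eventually_elim auto
  have "negl (\<lambda>s. circ_mean s (\<lambda>z. log_plus (e1 z)) + circ_mean s (\<lambda>z. log_plus (e2 z)) + C)"
    using e by (intro negl_add negl_const) (auto simp: esmall_def)
  moreover have "eventually (\<lambda>(n, s). circ_mean s (\<lambda>z. log_plus (f (e1 z) (e2 z))) \<le>
     circ_mean s (\<lambda>z. log_plus (e1 z)) + circ_mean s (\<lambda>z. log_plus (e2 z)) + C) W"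
    using c
  proof eventually_elim
    case (elim x)
    obtain n s where x: "x = (n, s)" by force
    have cs: "continuous_on (sphere 0 s) e1" "continuous_on (sphere 0 s) e2" "s \<ge> 0" using elim x by auto
    note cl = continuous_on_log_plus_real[OF cs(1) nn(1)] continuous_on_log_plus_real[OF cs(2) nn(2)]
    have "circ_mean s (\<lambda>z. log_plus (f (e1 z) (e2 z))) \<le> circ_mean s (\<lambda>z. log_plus (e1 z) + log_plus (e2 z) + C)"
      using cs nn f by (intro circ_mean_mono continuous_on_log_plus_real continuous_on_add continuous_on_const cl) auto
    also have "\<dots> = circ_mean s (\<lambda>z. log_plus (e1 z)) + circ_mean s (\<lambda>z. log_plus (e2 z)) + C"
      using cs cl by (simp add: circ_mean_add continuous_on_add)
    finally show ?case using x by simp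
  qed
  ultimately have "negl (\<lambda>s. circ_mean s (\<lambda>z. log_plus (f (e1 z) (e2 z))))" by (rule negl_mono)
  moreover have "eventually (\<lambda>(n, s). continuous_on (sphere 0 s) (\<lambda>z. f (e1 z) (e2 z))) W"
    using c by eventually_elim (auto intro: f)
  ultimately show ?thesis using nn f(1) by (simp add: esmall_def)
qed

lemma esmall_add: "esmall e1 \<Longrightarrow> esmall e2 \<Longrightarrow> esmall (\<lambda>z. e1 z + e2 z)"
  by (rule esmall_combine[where C = "ln 2"]) (auto intro: log_plus_add continuous_on_add)

lemma esmall_mult: "esmall e1 \<Longrightarrow> esmall e2 \<Longrightarrow> esmall (\<lambda>z. e1 z * e2 z)"
  by (rule esmall_combine[where C = 0]) (auto intro: log_plus_mult continuous_on_mult)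

text \<open>log+ turns the factor \<open>e\<close> into a negligible summand; the summand 1 next to
  |Y| costs ln 2.\<close>

lemma proximity_le_esmall:
  assumes "X meromorphic_on UNIV" "Y meromorphic_on UNIV" "esmall e"
    "\<forall>\<^sub>\<approx>z. norm (X z) \<le> e z * (norm (Y z) + 1)"
  obtains q where "negl q" "eventually (\<lambda>(n, s). proximity s X \<le> proximity s Y + q s) W"
proof -
  have nn: "e z \<ge> 0" for z using assms by (auto simp: esmall_def)
  show thesis
  proof (rule that)
    show "negl (\<lambda>s. circ_mean s (\<lambda>z. log_plus (e z)) + ln 2)"
      using assms(3) by (intro negl_add negl_const) (auto simp: esmall_def)
    show "eventually (\<lambda>(n, s). proximity s X \<le> proximity s Y + (circ_mean s (\<lambda>z. log_plus (e z)) + ln 2)) W"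
      using assms(3)[unfolded esmall_def, THEN conjunct2, THEN conjunct1] eventually_W_ge[of 0]
        eventually_W_continuous[OF assms(1)] eventually_W_continuous[OF assms(2)] eventually_W_circle[OF assms(4)]
    proof eventually_elim
      case (elim x)
      obtain n s where x: "x = (n, s)" by force
      have cs: "continuous_on (sphere 0 s) e" "s \<ge> 0" "continuous_on (sphere 0 s) X" "continuous_on (sphere 0 s) Y"
        and le: "\<And>z. norm z = s \<Longrightarrow> norm (X z) \<le> e z * (norm (Y z) + 1)" using elim x by auto
      note cl = continuous_on_log_plus_real[OF cs(1) nn] continuous_on_log_plus[OF cs(4)]
      have "proximity s X \<le> circ_mean s (\<lambda>z. log_plus (norm (Y z)) + (log_plus (e z) + ln 2))"
        unfolding proximity_eq
      proof (rule circ_mean_mono)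
        fix z :: complex assume z: "norm z = s"
        have "log_plus (norm (X z)) \<le> log_plus (e z * (norm (Y z) + 1))" using le[OF z] by (intro log_plus_mono) auto
        also have "\<dots> \<le> log_plus (e z) + log_plus (norm (Y z) + 1)" using nn by (intro log_plus_mult) auto
        also have "log_plus (norm (Y z) + 1) \<le> log_plus (norm (Y z)) + log_plus 1 + ln 2" by (intro log_plus_add) auto
        finally show "log_plus (norm (X z)) \<le> log_plus (norm (Y z)) + (log_plus (e z) + ln 2)"
          by (simp add: log_plus_def)
      qed (intro continuous_on_log_plus cs continuous_on_add cl continuous_on_const)+
      also have "\<dots> = proximity s Y + (circ_mean s (\<lambda>z. log_plus (e z)) + ln 2)"
        unfolding proximity_eq using cs cl by (simp add: circ_mean_add continuous_on_add)
      finally show ?case using x by simp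
    qed
  qed
qed

lemma msmall_esmall:
  assumes "X meromorphic_on UNIV" "esmall e" "\<forall>\<^sub>\<approx>z. norm (X z) \<le> e z"
  shows "msmall X"
proof -
  have "\<forall>\<^sub>\<approx>z. norm (X z) \<le> e z * (norm (0 :: complex) + 1)" using assms(3) by simp
  from proximity_le_esmall[OF assms(1) meromorphic_on_const assms(2) this]
  obtain q where q: "negl q" "eventually (\<lambda>(n, s). proximity s X \<le> proximity s (\<lambda>_. 0) + q s) W" by blast
  have "negl (\<lambda>s. proximity s (\<lambda>_. 0) + q s)" using q(1) by (auto intro: negl_add negl_const simp: proximity_const)
  from negl_mono[OF this q(2)] show ?thesis using assms(1) by (simp add: msmall_def)
qed

section \<open>Small functions and functions dominated by another one\<close>

definition small :: "(complex \<Rightarrow> complex) \<Rightarrow> bool" where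
  "small y \<longleftrightarrow> msmall y \<and> nsmall y"

lemma small_mero: "small y \<Longrightarrow> y meromorphic_on UNIV"
  and small_tame: "small y \<Longrightarrow> tame y"
  and small_msmall: "small y \<Longrightarrow> msmall y"
  and small_nsmall: "small y \<Longrightarrow> nsmall y"
  by (auto simp: small_def msmall_mero small_imp_tame)

lemma small_const: "small (\<lambda>_. c)"
  and small_add: "small f \<Longrightarrow> small g \<Longrightarrow> small (\<lambda>z. f z + g z)"
  and small_mult: "small f \<Longrightarrow> small g \<Longrightarrow> small (\<lambda>z. f z * g z)"
  and small_diff: "small f \<Longrightarrow> small g \<Longrightarrow> small (\<lambda>z. f z - g z)"
  and small_sum: "(\<And>i. i \<in> I \<Longrightarrow> small (y i)) \<Longrightarrow> small (\<lambda>z. \<Sum>i\<in>I. y i z)"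
  by (simp_all add: small_def msmall_const nsmall_const msmall_add nsmall_add msmall_mult nsmall_mult
      msmall_diff nsmall_diff msmall_sum nsmall_sum)

lemma small_inv: "small f \<Longrightarrow> small (\<lambda>z. inverse (f z))"
  using small_inverse[of f] by (auto simp: small_def)

lemma small_divide: "small f \<Longrightarrow> small g \<Longrightarrow> small (\<lambda>z. f z / g z)"
  using small_mult[OF _ small_inv] by (simp add: divide_inverse)

lemma small_deriv: "small f \<Longrightarrow> small (deriv f)"
  by (simp add: small_def msmall_deriv nsmall_deriv small_imp_tame)

lemma small_shift: "small f \<Longrightarrow> small (\<lambda>z. f (z + c))"
  by (simp add: small_def msmall_shift nsmall_shift small_imp_tame)

text \<open>A class closed under derivatives and shifts, because y'/y and y(z+c)/y(z) have small
  proximity. Thus a linear expression in shifts and derivatives of x, with small coefficients, is x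
  times a factor of small proximity. \<open>tame y\<close> is included because the estimates of
  these quotients require it.\<close>

definition dominated :: "(complex \<Rightarrow> complex) \<Rightarrow> (complex \<Rightarrow> complex) \<Rightarrow> bool" where
  "dominated x y \<longleftrightarrow> tame y \<and> (\<exists>Z. msmall Z \<and> (\<forall>\<^sub>\<approx>z. y z = Z z * x z))"

lemma dominated_refl: "tame x \<Longrightarrow> dominated x x"
  unfolding dominated_def by (intro conjI exI[of _ "\<lambda>_. 1"]) (auto intro: msmall_const)

lemma dominated_add:
  assumes "dominated x y" "dominated x y'"
  shows "dominated x (\<lambda>z. y z + y' z)"
proof -
  obtain Z Z' where Z: "msmall Z" "\<forall>\<^sub>\<approx>z. y z = Z z * x z" "msmall Z'" "\<forall>\<^sub>\<approx>z. y' z = Z' z * x z"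
    using assms by (auto simp: dominated_def)
  have "\<forall>\<^sub>\<approx>z. y z + y' z = (Z z + Z' z) * x z" using Z(2,4) by eventually_elim (simp add: distrib_right)
  moreover have "tame (\<lambda>z. y z + y' z)" using assms by (auto simp: dominated_def intro: tame_add)
  ultimately show ?thesis unfolding dominated_def using msmall_add[OF Z(1,3)] by (intro conjI exI[of _ "\<lambda>z. Z z + Z' z"]) auto
qed

lemma dominated_mult:
  assumes "dominated x y" "msmall m" "tame m"
  shows "dominated x (\<lambda>z. m z * y z)"
proof -
  obtain Z where Z: "msmall Z" "\<forall>\<^sub>\<approx>z. y z = Z z * x z" using assms by (auto simp: dominated_def)
  have "\<forall>\<^sub>\<approx>z. m z * y z = (m z * Z z) * x z" using Z(2) by eventually_elim simp
  moreover have "tame (\<lambda>z. m z * y z)" using assms by (auto simp: dominated_def intro: tame_mult)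
  ultimately show ?thesis unfolding dominated_def using msmall_mult[OF assms(2) Z(1)]
    by (intro conjI exI[of _ "\<lambda>z. m z * Z z"]) auto
qed

lemma dominated_cmult_small: "dominated x y \<Longrightarrow> small m \<Longrightarrow> dominated x (\<lambda>z. m z * y z)"
  by (intro dominated_mult small_msmall small_tame)

lemma dominated_zero: "dominated x (\<lambda>_. 0)"
  unfolding dominated_def by (intro conjI exI[of _ "\<lambda>_. 0"]) (auto intro: msmall_const tame_const)

lemma dominated_sum: "(\<And>i. i \<in> I \<Longrightarrow> dominated x (y i)) \<Longrightarrow> dominated x (\<lambda>z. \<Sum>i\<in>I. y i z)"
  by (induction I rule: infinite_finite_induct) (auto intro: dominated_zero dominated_add)

lemma dominated_deriv:
  assumes "dominated x y"
  shows "dominated x (deriv y)"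
proof -
  obtain Z where Z: "msmall Z" "\<forall>\<^sub>\<approx>z. y z = Z z * x z" and y: "tame y" using assms by (auto simp: dominated_def)
  have "\<forall>\<^sub>\<approx>z. deriv y z = (deriv y z / y z * Z z) * x z"
    using Z(2) deriv_quot_mult[OF y] by eventually_elim (metis mult.assoc)
  thus ?thesis unfolding dominated_def using msmall_mult[OF msmall_logderiv[OF y] Z(1)] tame_deriv[OF y]
    by (intro conjI exI[of _ "\<lambda>z. deriv y z / y z * Z z"]) auto
qed

lemma dominated_shift:
  assumes "dominated x y"
  shows "dominated x (\<lambda>z. y (z + c))"
proof -
  obtain Z where Z: "msmall Z" "\<forall>\<^sub>\<approx>z. y z = Z z * x z" and y: "tame y" using assms by (auto simp: dominated_def)
  have "\<forall>\<^sub>\<approx>z. y (z + c) = (y (z + c) / y z * Z z) * x z"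
    using Z(2) shift_quot_mult[OF y, of c] by eventually_elim (metis mult.assoc)
  thus ?thesis unfolding dominated_def using msmall_mult[OF msmall_shift_quot[OF y] Z(1)] tame_shift[OF y]
    by (intro conjI exI[of _ "\<lambda>z. y (z + c) / y z * Z z"]) auto
qed

end

section \<open>Two functions sharing 0 and 1\<close>

lemma pole_ord_power:
  assumes "f meromorphic_on {z}"
  shows "pole_ord (\<lambda>w. f w ^ n) z = n * pole_ord f z"
proof -
  obtain F where F: "(\<lambda>w. f (z + w)) has_laurent_expansion F"
    using assms by (auto simp: meromorphic_on_def)
  have "(\<lambda>w. f (z + w) ^ n) has_laurent_expansion F ^ n" using F by (rule laurent_expansion_intros)
  from pole_ord_laurent[OF this] pole_ord_laurent[OF F] show ?thesis
    using nat_mult_distrib[of "int n" "- fls_subdegree F"] by (simp add: fls_subdegree_pow)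
qed

lemma proximity_power: "proximity s (\<lambda>z. f z ^ n) = real n * proximity s f"
  unfolding proximity_eq by (simp add: norm_power log_plus_power circ_mean_cmult)

lemma counting_cong: "(\<And>z. \<nu> z = \<mu> z) \<Longrightarrow> counting \<nu> r = counting \<mu> r"
  by (simp add: counting_def)

lemma nchar_power:
  assumes "f meromorphic_on UNIV"
  shows "nchar s (\<lambda>z. f z ^ n) = real n * nchar s f"
proof -
  have "counting (pole_ord (\<lambda>z. f z ^ n)) s = counting (\<lambda>z. n * pole_ord f z) s"
    by (rule counting_cong, rule pole_ord_power) (use assms in \<open>auto intro: meromorphic_on_subset\<close>)
  thus ?thesis unfolding nchar_def by (simp add: proximity_power distrib_left counting_cmult)
qed

lemma ratio01_deriv:
  assumes "F analytic_on {z}" "F z \<noteq> 0" "F z \<noteq> 1"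
  shows "((\<lambda>w. (F w - 1) / F w) has_field_derivative ld01 F z * ((F z - 1) / F z)) (at z)"
proof -
  have "(F has_field_derivative deriv F z) (at z)"
    using assms(1) analytic_on_imp_differentiable_at DERIV_deriv_iff_field_differentiable by blast
  hence "((\<lambda>w. (F w - 1) / F w) has_field_derivative (deriv F z * F z - (F z - 1) * deriv F z) / (F z * F z)) (at z)"
    using assms(2) by (auto intro!: derivative_eq_intros)
  moreover have "(deriv F z * F z - (F z - 1) * deriv F z) / (F z * F z) = ld01 F z * ((F z - 1) / F z)"
    using assms(2,3) unfolding ld01_def by (simp add: divide_simps)
  ultimately show ?thesis by simp
qed

text \<open>W_F and W_G are the logarithmic derivatives of (F-1)/F and (G-1)/G, so the proportion
  between them makes the quotient of the two powers have derivative zero.\<close>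

lemma ratio01_power_relation:
  assumes F: "F meromorphic_on UNIV" "\<forall>\<^sub>\<approx>z. F z \<noteq> 0" "\<forall>\<^sub>\<approx>z. F z \<noteq> 1"
    and G: "G meromorphic_on UNIV" "\<forall>\<^sub>\<approx>z. G z \<noteq> 0" "\<forall>\<^sub>\<approx>z. G z \<noteq> 1"
    and eq: "\<forall>\<^sub>\<approx>z. of_nat q * ld01 F z = of_nat p * ld01 G z"
  obtains C where "C \<noteq> 0" "\<forall>\<^sub>\<approx>z. ((F z - 1) / F z) ^ q = C * ((G z - 1) / G z) ^ p"
proof -
  define y where "y = (\<lambda>z. ((F z - 1) / F z) ^ q * inverse (((G z - 1) / G z) ^ p))"
  have m: "y meromorphic_on UNIV" unfolding y_def by (intro meromorphic_intros F G)
  have "\<forall>\<^sub>\<approx>z. deriv y z = 0"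
    using meromorphic_on_imp_analytic_cosparse[OF F(1)] meromorphic_on_imp_analytic_cosparse[OF G(1)] F(2,3) G(2,3) eq
  proof eventually_elim
    case (elim z)
    define A B where "A = (F z - 1) / F z" and "B = (G z - 1) / G z"
    have AB: "A \<noteq> 0" "B \<noteq> 0" using elim by (auto simp: A_def B_def)
    note d = ratio01_deriv[OF elim(1,3,4)] ratio01_deriv[OF elim(2,5,6)]
    have pd: "((\<lambda>w. ((F w - 1) / F w) ^ q) has_field_derivative of_nat q * ld01 F z * A ^ q) (at z)"
    proof -
      have *: "of_nat q * (A ^ (q - Suc 0) * (ld01 F z * A)) = of_nat q * ld01 F z * A ^ q"
        by (cases q) auto
      show ?thesis using DERIV_power[OF d(1), of q] unfolding A_def[symmetric] *[symmetric] by (simp add: mult_ac)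
    qed
    have pd': "((\<lambda>w. ((G w - 1) / G w) ^ p) has_field_derivative of_nat p * ld01 G z * B ^ p) (at z)"
    proof -
      have *: "of_nat p * (B ^ (p - Suc 0) * (ld01 G z * B)) = of_nat p * ld01 G z * B ^ p"
        by (cases p) auto
      show ?thesis using DERIV_power[OF d(2), of p] unfolding B_def[symmetric] *[symmetric] by (simp add: mult_ac)
    qed
    have "((\<lambda>w. ((G w - 1) / G w) ^ p) z) \<noteq> 0" using AB by (simp add: B_def)
    from DERIV_mult[OF pd DERIV_inverse_fun[OF pd' this]]
    have "(y has_field_derivative (of_nat q * ld01 F z - of_nat p * ld01 G z) * (A ^ q * inverse (B ^ p))) (at z)"
      unfolding y_def A_def[symmetric] B_def[symmetric]
      by (rule DERIV_cong) (use AB in \<open>simp add: field_simps A_def[symmetric] B_def[symmetric]\<close>)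
    hence "(y has_field_derivative 0) (at z)" using elim(7) by simp
    thus ?case by (rule DERIV_imp_deriv)
  qed
  from meromorphic_deriv_zero_imp_const[OF m this] obtain C where C: "\<forall>\<^sub>\<approx>z. y z = C" by blast
  have rel: "\<forall>\<^sub>\<approx>z. ((F z - 1) / F z) ^ q = C * ((G z - 1) / G z) ^ p \<and> C \<noteq> 0"
    using C F(2,3) G(2,3) by eventually_elim (auto simp: y_def field_simps)
  have "\<exists>z :: complex. C \<noteq> 0"
    using eventually_happens[OF rel] by auto
  thus thesis using that[of C] rel by (auto elim: eventually_mono)
qed

section \<open>Smallness of F: pole-free auxiliary function and proportional case\<close>

context windows
begin

lemma W_nchar_inverse_le:
  assumes "y meromorphic_on UNIV" "\<forall>\<^sub>\<approx>z. y z \<noteq> 0"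
  obtains C where "eventually (\<lambda>(n, s). nchar s y \<le> nchar s (\<lambda>z. inverse (y z)) + C) W"
proof -
  obtain C where C: "\<And>r. r \<ge> 1 \<Longrightarrow> regular_radius y r \<Longrightarrow> \<bar>nchar r (\<lambda>z. inverse (y z)) - nchar r y\<bar> \<le> C"
    using first_main_theorem[OF assms] by blast
  have "eventually (\<lambda>(n, s). nchar s y \<le> nchar s (\<lambda>z. inverse (y z)) + C) W"
    using eventually_W_regular[OF assms] eventually_W_ge[of 1]
    by eventually_elim (use C in \<open>force simp: abs_le_iff\<close>)
  thus thesis by (rule that)
qed

lemma W_nchar_one_minus:
  assumes "y meromorphic_on UNIV"
  shows "eventually (\<lambda>(n, s). nchar s (\<lambda>z. 1 - y z) \<le> nchar s y + ln 2) W"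
proof -
  have m: "(\<lambda>z. - y z) meromorphic_on UNIV" using assms by (intro meromorphic_intros)
  have p: "pole_ord (\<lambda>z. 1 + - y z) z \<le> pole_ord y z" for z
    using pole_ord_add_le[OF meromorphic_on_const mero_at[OF m], of 1 z] by simp
  have pm: "proximity s (\<lambda>z. - y z) = proximity s y" for s by (simp add: proximity_eq)
  show ?thesis
    using W_proximity_add[OF meromorphic_on_const m, of 1] eventually_W_ge[of 1]
  proof eventually_elim
    case (elim x)
    obtain n s where x: "x = (n, s)" by force
    have "counting (pole_ord (\<lambda>z. 1 + - y z)) s \<le> counting (pole_ord y) s"
      using elim x by (intro counting_mono loc_finite_pole_ord assms p) auto
    thus ?case using elim x by (simp add: nchar_def pm proximity_const log_plus_def)
  qed
qed

text \<open>(F-1)/F = 1 - 1/F has the characteristic of F up to a constant, and taking an n-th power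
  multiplies the characteristic by n. Only proximity functions remain in the statement: the poles of
  F count on the favourable side and those of G are negligible.\<close>

lemma ratio01_proximity_le:
  assumes F: "F meromorphic_on UNIV" "\<forall>\<^sub>\<approx>z. F z \<noteq> 0"
    and G: "nsmall G" "\<forall>\<^sub>\<approx>z. G z \<noteq> 0"
    and rel: "\<forall>\<^sub>\<approx>z. ((F z - 1) / F z) ^ q = C * ((G z - 1) / G z) ^ p"
  obtains e where "negl e" "eventually (\<lambda>(n, s). q * proximity s F \<le> p * proximity s G + e s) W"
proof -
  define A B where "A = (\<lambda>z. 1 - inverse (F z))" and "B = (\<lambda>z. 1 - inverse (G z))"
  have Gm: "G meromorphic_on UNIV" using G nsmall_mero by auto
  have mi: "(\<lambda>z. inverse (F z)) meromorphic_on UNIV" "(\<lambda>z. inverse (G z)) meromorphic_on UNIV"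
    by (intro meromorphic_intros F Gm)+
  have m: "A meromorphic_on UNIV" "B meromorphic_on UNIV" unfolding A_def B_def by (intro meromorphic_intros F Gm)+
  obtain C1 where C1: "eventually (\<lambda>(n, s). nchar s F \<le> nchar s (\<lambda>z. inverse (F z)) + C1) W"
    using W_nchar_inverse_le[OF F] by blast
  obtain C2 where C2: "eventually (\<lambda>(n, s). nchar s (\<lambda>z. inverse (G z)) \<le> nchar s G + C2 \<and>
    proximity s (\<lambda>z. inverse (G z)) \<ge> 0 \<and> counting (pole_ord (\<lambda>z. inverse (G z))) s \<ge> 0) W"
    using W_first_main_theorem[OF Gm G(2)] by blast
  have rel': "\<forall>\<^sub>\<approx>z. A z ^ q = C * B z ^ p"
    using rel F(2) G(2) by eventually_elim (simp add: A_def B_def field_simps)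
  have mp: "(\<lambda>z. B z ^ p) meromorphic_on UNIV" using m by (intro meromorphic_intros)
  have po: "pole_ord (\<lambda>z. A z ^ q) = pole_ord (\<lambda>z. C * B z ^ p)" by (rule pole_ord_cosparse_cong[OF rel'])
  have pole: "pole_ord (\<lambda>z. C * B z ^ p) z \<le> pole_ord (\<lambda>z. B z ^ p) z" for z
    using pole_ord_mult_le[OF meromorphic_on_const mero_at[OF mp], of C z] by simp
  show thesis
  proof (rule that)
    show "negl (\<lambda>s. real p * counting (pole_ord G) s + (real q * (C1 + ln 2) + real p * (C2 + ln 2) + log_plus (norm C)))"
      using G(1) by (intro negl_add negl_const negl_cmult) (auto simp: nsmall_def)
    show "eventually (\<lambda>(n, s). q * proximity s F \<le> p * proximity s G +
       (real p * counting (pole_ord G) s + (real q * (C1 + ln 2) + real p * (C2 + ln 2) + log_plus (norm C)))) W"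
      using C1 C2 W_nchar_one_minus[OF m(1)] W_nchar_one_minus[OF mi(2)] W_proximity_cong[OF rel']
        W_proximity_mult[OF meromorphic_on_const mp, of C] eventually_W_ge[of 1]
    proof eventually_elim
      case (elim x)
      obtain n s where x: "x = (n, s)" by force
      have s: "s \<ge> 1" using elim x by auto
      have "proximity s F \<le> nchar s F"
        using s counting_nonneg[of s "pole_ord F"] by (simp add: nchar_def)
      also have "nchar s F \<le> nchar s (\<lambda>z. inverse (F z)) + C1" using elim(1) x by simp
      also have "nchar s (\<lambda>z. inverse (F z)) \<le> nchar s A + ln 2" using elim(3) x by (simp add: A_def)
      finally have 1: "real q * proximity s F \<le> real q * (nchar s A + (C1 + ln 2))" by (intro mult_left_mono) auto
      have "counting (pole_ord (\<lambda>z. A z ^ q)) s \<le> counting (pole_ord (\<lambda>z. B z ^ p)) s"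
        unfolding po by (intro counting_mono loc_finite_pole_ord mp pole s)
      moreover have "proximity s (\<lambda>z. A z ^ q) \<le> log_plus (norm C) + proximity s (\<lambda>z. B z ^ p)"
        using elim(5,6) x by (simp add: proximity_const)
      ultimately have "nchar s (\<lambda>z. A z ^ q) \<le> log_plus (norm C) + nchar s (\<lambda>z. B z ^ p)" by (simp add: nchar_def)
      hence 2: "real q * nchar s A \<le> log_plus (norm C) + real p * nchar s B" using m by (simp add: nchar_power)
      have "nchar s B \<le> nchar s (\<lambda>z. inverse (G z)) + ln 2" using elim(4) x by (simp add: B_def)
      also have "nchar s (\<lambda>z. inverse (G z)) \<le> nchar s G + C2" using elim(2) x by simp
      finally have "real p * nchar s B \<le> real p * (nchar s G + (C2 + ln 2))" by (intro mult_left_mono) auto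
      hence "real q * proximity s F \<le> real p * (nchar s G + (C2 + ln 2)) + log_plus (norm C) + real q * (C1 + ln 2)"
        using 1 2 by (simp add: distrib_left)
      thus ?case using x by (simp add: nchar_def distrib_left)
    qed
  qed
qed

text \<open>The product in the last assumption, call it $Y$, is small, and since $W_F$ is of size $1/F$ where $F$
  is large, so is $Y F$; hence $F$ is small.\<close>

lemma pole_free_ratio_small:
  assumes F: "tame F" "\<forall>\<^sub>\<approx>z. F z \<noteq> 0" "\<forall>\<^sub>\<approx>z. F z \<noteq> 1" "\<forall>\<^sub>\<approx>z. ld01 F z \<noteq> 0"
    and G: "G meromorphic_on UNIV" "\<forall>\<^sub>\<approx>z. G z \<noteq> 0" "\<forall>\<^sub>\<approx>z. G z \<noteq> 1"
    and e: "esmall e" "\<forall>\<^sub>\<approx>z. norm (G z) \<le> e z * (norm (F z) + 1)"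
    and \<Psi>: "msmall \<Psi>" "\<forall>\<^sub>\<approx>z. \<Psi> z \<noteq> 0"
    and Y: "nsmall (\<lambda>w. F w * (F w - 1) * (G w * (G w - 1)) * (\<Psi> w * ld01 F w) ^ 5)"
  shows "msmall F"
proof -
  define Y where "Y = (\<lambda>w. F w * (F w - 1) * (G w * (G w - 1)) * (\<Psi> w * ld01 F w) ^ 5)"
  have Fm: "F meromorphic_on UNIV" using F tame_mero by auto
  define A A0 where "A = (\<lambda>z. deriv F z / (F z - 1))" and "A0 = (\<lambda>z. deriv F z / F z)"
  have A0: "msmall A0" unfolding A0_def by (rule msmall_logderiv[OF F(1)])
  have A: "msmall A" unfolding A_def by (rule msmall_logderiv_minus_1[OF F(1)])
  define a where "a = (\<lambda>z. norm (A z) + norm (A0 z))"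
  define E where "E = (\<lambda>z. 2 * ((2 * e z + 1) * (2 * e z + 1)) * (norm (\<Psi> z ^ 5) * (a z * a z * a z * a z * a z)))"
  have Ee: "esmall E" unfolding E_def a_def
    by (intro esmall_mult esmall_add esmall_const esmall_norm e A A0 msmall_power \<Psi>) auto
  have en: "e z \<ge> 0" for z using e by (simp add: esmall_def)
  have an: "a z \<ge> 0" for z by (simp add: a_def)
  have bound: "\<forall>\<^sub>\<approx>z. norm (Y z) * max 1 (norm (F z)) \<le> E z"
    using F(2,3) e(2)
  proof eventually_elim
    case (elim z)
    define M where "M = max 1 (norm (F z))"
    have M: "M \<ge> 1" "norm (F z) \<le> M" by (auto simp: M_def)
    \<comment> \<open>Where |F| >= 1, the identity W_F F = F'/(F-1) gives the decay of W_F;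
      elsewhere M = 1 and the triangle inequality suffices.\<close>
    have W: "norm (ld01 F z) * M \<le> a z"
    proof (cases "norm (F z) \<ge> 1")
      case True
      have "ld01 F z * F z = A z" using elim by (simp add: ld01_def A_def divide_simps) (simp add: algebra_simps)
      hence "norm (ld01 F z) * norm (F z) = norm (A z)" by (metis norm_mult)
      moreover have "M = norm (F z)" using True by (simp add: M_def)
      ultimately show ?thesis by (simp add: a_def)
    next
      case False
      hence "M = 1" by (simp add: M_def)
      thus ?thesis using norm_triangle_ineq4[of "A z" "A0 z"] by (simp add: ld01_def A_def A0_def a_def)
    qed
    have "norm (F z - 1) \<le> 2 * M" using norm_triangle_ineq4[of "F z" 1] M by simp
    hence b1: "norm (F z * (F z - 1)) \<le> M * (2 * M)" unfolding norm_mult using M by (intro mult_mono) auto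
    have g: "norm (G z) \<le> 2 * e z * M"
      using elim(3) mult_left_mono[of "norm (F z) + 1" "2 * M" "e z"] M en[of z] by (simp add: mult_ac)
    hence g1: "norm (G z) \<le> (2 * e z + 1) * M" "norm (G z - 1) \<le> (2 * e z + 1) * M"
      using norm_triangle_ineq4[of "G z" 1] M by (auto simp: distrib_right)
    have "norm (G z * (G z - 1)) \<le> ((2 * e z + 1) * M) * ((2 * e z + 1) * M)" unfolding norm_mult
      using g1 en[of z] M by (intro mult_mono) auto
    hence b2: "norm (F z * (F z - 1) * (G z * (G z - 1))) \<le> (M * (2 * M)) * (((2 * e z + 1) * M) * ((2 * e z + 1) * M))"
      using b1 M unfolding norm_mult[of "F z * (F z - 1)"] by (intro mult_mono) auto
    have b3: "norm (ld01 F z) ^ 5 * M ^ 5 \<le> a z ^ 5"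
      using power_mono[OF W, of 5] M by (simp add: power_mult_distrib)
    \<comment> \<open>Four factors M are spent on F(F-1)G(G-1). The fifth power of W_F supplies
      five, so one factor M is left over for F.\<close>
    have "norm (Y z) * M * M ^ 4 = norm (F z * (F z - 1) * (G z * (G z - 1))) * (norm (\<Psi> z ^ 5) * (norm (ld01 F z) ^ 5 * M ^ 5))"
      by (simp add: Y_def norm_mult norm_power power_mult_distrib eval_nat_numeral)
    also have "\<dots> \<le> ((M * (2 * M)) * (((2 * e z + 1) * M) * ((2 * e z + 1) * M))) * (norm (\<Psi> z ^ 5) * a z ^ 5)"
      using b2 b3 M en[of z] an by (intro mult_mono mult_nonneg_nonneg) auto
    also have "\<dots> = E z * M ^ 4" by (simp add: E_def eval_nat_numeral)
    finally show ?case using M unfolding M_def[symmetric] by (simp add: mult_le_cancel_right)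
  qed
  have Ym: "Y meromorphic_on UNIV" using assms nsmall_mero unfolding Y_def by auto
  have "msmall Y"
  proof (rule msmall_esmall[OF Ym Ee])
    show "\<forall>\<^sub>\<approx>z. norm (Y z) \<le> E z" using bound
    proof eventually_elim
      case (elim z)
      have "norm (Y z) * 1 \<le> norm (Y z) * max 1 (norm (F z))" by (intro mult_left_mono) auto
      thus ?case using elim by linarith
    qed
  qed
  \<comment> \<open>Y has few poles by assumption and small proximity by the bound, so the first
    main theorem passes the smallness to its inverse.\<close>
  hence iY: "msmall (\<lambda>z. inverse (Y z))" using small_inverse(1) assms unfolding Y_def by blast
  have "msmall (\<lambda>z. Y z * F z)"
  proof (rule msmall_esmall[OF _ Ee])
    show "\<forall>\<^sub>\<approx>z. norm (Y z * F z) \<le> E z" using bound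
    proof eventually_elim
      case (elim z)
      have "norm (Y z) * norm (F z) \<le> norm (Y z) * max 1 (norm (F z))" by (intro mult_left_mono) auto
      thus ?case using elim unfolding norm_mult by linarith
    qed
  qed (intro meromorphic_intros Ym Fm)
  from msmall_mult[OF iY this] have "msmall (\<lambda>z. inverse (Y z) * (Y z * F z))" .
  moreover have "\<forall>\<^sub>\<approx>z. inverse (Y z) * (Y z * F z) = F z"
    using F(2,3,4) G(2,3) \<Psi>(2)
  proof eventually_elim
    case (elim z)
    hence "Y z \<noteq> 0" by (simp add: Y_def)
    thus ?case by simp
  qed
  ultimately show "msmall F" using msmall_cong Fm by blast
qed

lemma msmall_ld01: "tame y \<Longrightarrow> msmall (ld01 y)"
  unfolding ld01_def[abs_def] by (intro msmall_diff msmall_logderiv msmall_logderiv_minus_1)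

text \<open>The relation makes x a Moebius transformation of y with the finite value 1/(1-C) at
  infinity. Above the threshold 2|C|/|1-C| the denominator is at least half of |(1-C) y|, so |x| is
  at most 2/|1-C|; below it the given bound by \<open>e\<close> applies.\<close>

lemma moebius_bound:
  fixes x y C :: complex
  assumes "x * ((1 - C) * y + C) = y" "C \<noteq> 1" "norm x \<le> e * (norm y + 1)" "e \<ge> 0"
  shows "norm x \<le> e * (2 * norm C / norm (1 - C) + 1) + 2 / norm (1 - C)"
proof -
  have p: "norm (1 - C) > 0" using assms by simp
  show ?thesis
  proof (cases "norm y \<le> 2 * norm C / norm (1 - C)")
    case True
    have "e * (norm y + 1) \<le> e * (2 * norm C / norm (1 - C) + 1)" using True assms by (intro mult_left_mono) auto
    moreover have "2 / norm (1 - C) \<ge> 0" by simp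
    ultimately show ?thesis using assms by linarith
  next
    case False
    hence y: "2 * norm C < norm (1 - C) * norm y" using p by (simp add: field_simps)
    hence y0: "norm y > 0" using p by (smt (verit) norm_ge_zero mult_nonneg_nonpos)
    have "norm (1 - C) * norm y / 2 \<le> norm ((1 - C) * y + C)"
      using norm_triangle_ineq2[of "(1 - C) * y" "- C"] y by (simp add: norm_mult)
    hence "norm x * (norm (1 - C) * norm y / 2) \<le> norm x * norm ((1 - C) * y + C)" by (intro mult_left_mono) auto
    also have "\<dots> = norm y" using assms(1) by (metis norm_mult)
    finally have "norm x \<le> 2 / norm (1 - C)" using p y0 by (simp add: field_simps)
    moreover have "e * (2 * norm C / norm (1 - C) + 1) \<ge> 0" using assms by simp
    ultimately show ?thesis by linarith
  qed
qed

text \<open>Write m for the proximity function. If p < q, the power relation gives q m(F) <= p m(G)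
  up to a negligible term, and m(G) <= m(F) up to a negligible term by the pointwise bound, so m(F)
  is negligible; the case q < p is similar. If p = q, the relation is a Moebius transformation, with
  C different from 1 because F and G differ.\<close>

lemma proportional_ratio_small:
  assumes F: "nsmall F" "\<forall>\<^sub>\<approx>z. F z \<noteq> 0" "\<forall>\<^sub>\<approx>z. F z \<noteq> 1"
    and G: "nsmall G" "\<forall>\<^sub>\<approx>z. G z \<noteq> 0" "\<forall>\<^sub>\<approx>z. G z \<noteq> 1"
    and ne: "\<not> (\<forall>\<^sub>\<approx>z. F z = G z)"
    and e: "esmall e" "\<forall>\<^sub>\<approx>z. norm (F z) \<le> e z * (norm (G z) + 1)"
    and e': "esmall e'" "\<forall>\<^sub>\<approx>z. norm (G z) \<le> e' z * (norm (F z) + 1)"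
    and eq: "\<forall>\<^sub>\<approx>z. of_nat q * ld01 F z = of_nat p * ld01 G z" and pq: "p \<ge> 1" "q \<ge> 1"
  shows "msmall F"
proof -
  have m: "F meromorphic_on UNIV" "G meromorphic_on UNIV" using F G nsmall_mero by auto
  have en: "e z \<ge> 0" for z using e by (simp add: esmall_def)
  obtain d where d: "negl d" "eventually (\<lambda>(n, s). proximity s F \<le> proximity s G + d s) W"
    using proximity_le_esmall[OF m e] by blast
  obtain d' where d': "negl d'" "eventually (\<lambda>(n, s). proximity s G \<le> proximity s F + d' s) W"
    using proximity_le_esmall[OF m(2,1) e'] by blast
  have pn: "eventually (\<lambda>(n, s). proximity s F \<ge> 0 \<and> proximity s G \<ge> 0) W"
    using eventually_W_continuous[OF m(1)] eventually_W_continuous[OF m(2)] eventually_W_ge[of 0]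
    by eventually_elim (auto simp: proximity_nonneg)
  consider "p < q" | "q < p" | "p = q" by linarith
  thus ?thesis
  proof cases
    case 1
    obtain C where "\<forall>\<^sub>\<approx>z. ((F z - 1) / F z) ^ q = C * ((G z - 1) / G z) ^ p"
      using ratio01_power_relation[OF m(1) F(2,3) m(2) G(2,3) eq] by blast
    from ratio01_proximity_le[OF m(1) F(2) G(1,2) this]
    obtain g where g: "negl g" "eventually (\<lambda>(n, s). q * proximity s F \<le> p * proximity s G + g s) W" by blast
    have "negl (\<lambda>s. real p * d' s + g s)" using d' g by (intro negl_add negl_cmult) auto
    moreover have "eventually (\<lambda>(n, s). proximity s F \<le> real p * d' s + g s) W"
      using g(2) d'(2) pn
    proof eventually_elim
      case (elim x)
      obtain n s where x: "x = (n, s)" by force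
      have "(real p + 1) * proximity s F \<le> q * proximity s F" using 1 elim x by (intro mult_right_mono) auto
      moreover have "real p * proximity s G \<le> real p * (proximity s F + d' s)" using elim x by (intro mult_left_mono) auto
      ultimately show ?case using elim x by (simp add: algebra_simps)
    qed
    ultimately have "negl (\<lambda>s. proximity s F)" by (rule negl_mono)
    thus ?thesis using m by (simp add: msmall_def)
  next
    case 2
    have "\<forall>\<^sub>\<approx>z. of_nat p * ld01 G z = of_nat q * ld01 F z" using eq by eventually_elim simp
    from ratio01_power_relation[OF m(2) G(2,3) m(1) F(2,3) this]
    obtain C where "\<forall>\<^sub>\<approx>z. ((G z - 1) / G z) ^ p = C * ((F z - 1) / F z) ^ q" by blast
    from ratio01_proximity_le[OF m(2) G(2) F(1,2) this]
    obtain g where g: "negl g" "eventually (\<lambda>(n, s). p * proximity s G \<le> q * proximity s F + g s) W" by blast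
    have "negl (\<lambda>s. real q * d s + g s + d s)" using d g by (intro negl_add negl_cmult) auto
    moreover have "eventually (\<lambda>(n, s). proximity s F \<le> real q * d s + g s + d s) W"
      using g(2) d(2) pn
    proof eventually_elim
      case (elim x)
      obtain n s where x: "x = (n, s)" by force
      have "(real q + 1) * proximity s G \<le> p * proximity s G" using 2 elim x by (intro mult_right_mono) auto
      moreover have "real q * proximity s F \<le> real q * (proximity s G + d s)" using elim x by (intro mult_left_mono) auto
      ultimately show ?case using elim x by (simp add: algebra_simps)
    qed
    ultimately have "negl (\<lambda>s. proximity s F)" by (rule negl_mono)
    thus ?thesis using m by (simp add: msmall_def)
  next
    case 3
    have "\<forall>\<^sub>\<approx>z. of_nat 1 * ld01 F z = of_nat 1 * ld01 G z" using eq by eventually_elim (use 3 pq in auto)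
    from ratio01_power_relation[OF m(1) F(2,3) m(2) G(2,3) this]
    obtain C where C: "\<forall>\<^sub>\<approx>z. ((F z - 1) / F z) ^ 1 = C * ((G z - 1) / G z) ^ 1" by blast
    have rel: "\<forall>\<^sub>\<approx>z. F z * ((1 - C) * G z + C) = G z" using C F(2) G(2)
      by eventually_elim (simp add: field_simps)
    have C1: "C \<noteq> 1"
    proof
      assume "C = 1"
      with rel have "\<forall>\<^sub>\<approx>z. F z = G z" by simp
      with ne show False by simp
    qed
    show ?thesis
    proof (rule msmall_esmall[OF m(1)])
      show "esmall (\<lambda>z. e z * (2 * norm C / norm (1 - C) + 1) + 2 / norm (1 - C))"
        by (intro esmall_add esmall_mult e esmall_const) auto
      show "\<forall>\<^sub>\<approx>z. norm (F z) \<le> e z * (2 * norm C / norm (1 - C) + 1) + 2 / norm (1 - C)"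
        using rel e(2) by eventually_elim (rule moebius_bound[OF _ C1 _ en])
    qed
  qed
qed

text \<open>If a finite product of meromorphic functions vanishes identically, so does one of its
  factors. This separates the two mechanisms: all sixteen factors nonzero leads to
  \<open>pole_free_ratio_small\<close>, one zero factor to \<open>proportional_ratio_small\<close>.
  The degenerate case W_F = 0 means that F is constant.\<close>

lemma shared_values_small:
  assumes F: "tame F" "nsmall F" "\<forall>\<^sub>\<approx>z. F z \<noteq> 0" "\<forall>\<^sub>\<approx>z. F z \<noteq> 1"
    and G: "tame G" "nsmall G" "\<forall>\<^sub>\<approx>z. G z \<noteq> 0" "\<forall>\<^sub>\<approx>z. G z \<noteq> 1"
    and ne: "\<not> (\<forall>\<^sub>\<approx>z. F z = G z)"
    and e: "esmall e" "\<forall>\<^sub>\<approx>z. norm (F z) \<le> e z * (norm (G z) + 1)"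
    and e': "esmall e'" "\<forall>\<^sub>\<approx>z. norm (G z) \<le> e' z * (norm (F z) + 1)"
    and \<Phi>: "msmall (\<lambda>w. ld01 F w * (F w - G w))"
    and Y: "nsmall (\<lambda>w. F w * (F w - 1) * (G w * (G w - 1)) * (ratio_prod 4 F G w * ld01 F w) ^ 5)"
  shows "msmall F"
proof -
  have m: "F meromorphic_on UNIV" "G meromorphic_on UNIV" using F G tame_mero by auto
  show ?thesis
  proof (cases "\<forall>\<^sub>\<approx>z. ld01 F z = 0")
    case True
    hence "\<forall>\<^sub>\<approx>z. deriv F z = 0" using F(3,4)
    proof eventually_elim
      case (elim z)
      have "ld01 F z * (F z * (F z - 1)) = deriv F z"
        using elim(2,3) by (simp add: ld01_def divide_simps) (simp add: algebra_simps)
      thus ?case using elim(1) by simp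
    qed
    then obtain c where "\<forall>\<^sub>\<approx>z. F z = c" using meromorphic_deriv_zero_imp_const[OF m(1)] by blast
    hence "\<forall>\<^sub>\<approx>z. c = F z" by eventually_elim simp
    thus ?thesis using msmall_cong[OF msmall_const] m by blast
  next
    case False
    hence W: "\<forall>\<^sub>\<approx>z. ld01 F z \<noteq> 0" using meromorphic_zero_dichotomy mero_ld01[OF m(1)] by blast
    have mFG: "(\<lambda>z. F z - G z) meromorphic_on UNIV" by (intro meromorphic_intros m)
    have FG: "\<forall>\<^sub>\<approx>z. F z - G z \<noteq> 0" using meromorphic_zero_dichotomy[OF mFG] ne by simp
    note ld = msmall_logderiv_minus_1[OF G(1)] msmall_ld01[OF G(1)]
    \<comment> \<open>F - G is at most of size |G| + 1 up to small factors, and this growth is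
      absorbed by W_G, since W_G G = G'/(G-1).\<close>
    have V: "msmall (\<lambda>w. ld01 G w * (F w - G w))"
    proof (rule msmall_esmall)
      show "(\<lambda>w. ld01 G w * (F w - G w)) meromorphic_on UNIV" by (intro meromorphic_intros mero_ld01 m)
      show "esmall (\<lambda>w. e w * (norm (deriv G w / (G w - 1)) + norm (ld01 G w)) + norm (deriv G w / (G w - 1)))"
        by (intro esmall_add esmall_mult esmall_norm ld e)
      show "\<forall>\<^sub>\<approx>w. norm (ld01 G w * (F w - G w)) \<le> e w * (norm (deriv G w / (G w - 1)) + norm (ld01 G w)) + norm (deriv G w / (G w - 1))"
        using e(2) G(3,4)
      proof eventually_elim
        case (elim w)
        have g: "ld01 G w * G w = deriv G w / (G w - 1)"
          using elim by (simp add: ld01_def divide_simps) (simp add: algebra_simps)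
        have "norm (ld01 G w * (F w - G w)) \<le> norm (ld01 G w) * (norm (F w) + norm (G w))"
          unfolding norm_mult by (intro mult_left_mono norm_triangle_ineq4) auto
        also have "\<dots> \<le> norm (ld01 G w) * (e w * (norm (G w) + 1) + norm (G w))"
          using elim by (intro mult_left_mono) auto
        also have "\<dots> = e w * (norm (ld01 G w * G w) + norm (ld01 G w)) + norm (ld01 G w * G w)"
          by (simp add: norm_mult algebra_simps)
        finally show ?case unfolding g .
      qed
    qed
    have rp: "ratio_prod 4 F G meromorphic_on UNIV" by (intro mero_ratio_prod m)
    have rps: "msmall (ratio_prod 4 F G)"
    proof -
      have pr: "finite A \<Longrightarrow> msmall (\<lambda>w. \<Prod>(p, q)\<in>A. of_nat q * (ld01 F w * (F w - G w)) - of_nat p * (ld01 G w * (F w - G w)))" for A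
      proof (induction A rule: finite_induct)
        case (insert x A)
        obtain p q where x: "x = (p, q)" by force
        have "msmall (\<lambda>w. of_nat q * (ld01 F w * (F w - G w)) - of_nat p * (ld01 G w * (F w - G w)))"
          by (intro msmall_diff msmall_mult[OF msmall_const] \<Phi> V)
        from msmall_mult[OF this insert(3)] show ?case using insert(1,2) x by simp
      qed (simp add: msmall_const)
      show ?thesis unfolding ratio_prod_def[abs_def] by (rule pr) simp
    qed
    show ?thesis using meromorphic_zero_dichotomy[OF rp]
    proof
      assume "\<forall>\<^sub>\<approx>z. ratio_prod 4 F G z \<noteq> 0"
      from pole_free_ratio_small[OF F(1,3,4) W m(2) G(3,4) e' rps this Y] show ?thesis .
    next
      assume z: "\<forall>\<^sub>\<approx>z. ratio_prod 4 F G z = 0"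
      define R where "R = (\<lambda>(p::nat, q::nat) w. of_nat q * (ld01 F w * (F w - G w)) - of_nat p * (ld01 G w * (F w - G w)))"
      have "\<exists>x\<in>{1..4}\<times>{1..4}. \<forall>\<^sub>\<approx>w. R x w = 0"
      proof (rule ccontr)
        assume no: "\<not> ?thesis"
        have "\<forall>\<^sub>\<approx>w. R x w \<noteq> 0" if "x \<in> {1..4}\<times>{1..4}" for x
        proof -
          have "R x meromorphic_on UNIV" unfolding R_def case_prod_unfold by (intro meromorphic_intros mero_ld01 m)
          from meromorphic_zero_dichotomy[OF this] show ?thesis using no that by blast
        qed
        hence "\<forall>\<^sub>\<approx>w. \<forall>x\<in>{1..4}\<times>{1..4}. R x w \<noteq> 0" by (simp add: eventually_ball_finite)
        with z have "\<forall>\<^sub>\<approx>w :: complex. False"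
        proof eventually_elim
          case (elim w)
          have "ratio_prod 4 F G w = (\<Prod>x\<in>{1..4}\<times>{1..4}. R x w)" by (simp add: ratio_prod_def R_def case_prod_unfold)
          thus ?case using elim by (simp add: prod_zero_iff)
        qed
        thus False by (simp add: eventually_False)
      qed
      then obtain p q where pq: "p \<in> {1..4}" "q \<in> {1..4}" "\<forall>\<^sub>\<approx>w. R (p, q) w = 0" by blast
      have "\<forall>\<^sub>\<approx>z. of_nat q * ld01 F z = of_nat p * ld01 G z" using pq(3) FG
      proof eventually_elim
        case (elim w)
        have "(of_nat q * ld01 F w - of_nat p * ld01 G w) * (F w - G w) = 0" using elim(1) by (simp add: R_def algebra_simps)
        thus ?case using elim(2) by simp
      qed
      from proportional_ratio_small[OF F(2,3,4) G(2,3,4) ne e e' this] pq show ?thesis by simp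
    qed
  qed
qed

end

section \<open>Functions sharing two small functions\<close>

text \<open>When D and 1/D both have finite limits at z, division by D changes nothing about whether
  a limit is 0, so sharing passes to the normalised functions.\<close>

lemma share_quotient_limits:
  assumes sh: "share_IM f L a" and D: "D \<midarrow>z\<rightarrow> d" "(\<lambda>w. inverse (D w)) \<midarrow>z\<rightarrow> e" "eventually (\<lambda>w. D w \<noteq> 0) (at z)"
    and lim: "(\<lambda>w. (f w - a w) / D w) \<midarrow>z\<rightarrow> x" "(\<lambda>w. (L w - a w) / D w) \<midarrow>z\<rightarrow> y"
  shows "x = 0 \<longleftrightarrow> y = 0"
proof -
  have *: "(\<lambda>w. u w - a w) \<midarrow>z\<rightarrow> 0 \<longleftrightarrow> l = 0" if l: "(\<lambda>w. (u w - a w) / D w) \<midarrow>z\<rightarrow> l" for u l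
  proof
    assume "(\<lambda>w. u w - a w) \<midarrow>z\<rightarrow> 0"
    from tendsto_mult[OF this D(2)] have "(\<lambda>w. (u w - a w) / D w) \<midarrow>z\<rightarrow> 0" by (simp add: divide_inverse)
    with l show "l = 0" using LIM_unique by blast
  next
    assume "l = 0"
    with tendsto_mult[OF D(1) l] have "(\<lambda>w. D w * ((u w - a w) / D w)) \<midarrow>z\<rightarrow> 0" by simp
    thus "(\<lambda>w. u w - a w) \<midarrow>z\<rightarrow> 0"
      by (rule Lim_transform_eventually) (use D(3) in \<open>auto elim!: eventually_mono\<close>)
  qed
  show ?thesis using sh *[OF lim(1)] *[OF lim(2)] by (auto simp: share_IM_def)
qed

text \<open>If L - a vanishes generically, every point is a zero of it in the sense of limits, hence
  a zero of f - a. This excludes G = 0 and G = 1.\<close>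

lemma share_IM_imp_eq:
  assumes sh: "share_IM f L a" and m: "f meromorphic_on UNIV" "a meromorphic_on UNIV"
    and L: "\<forall>\<^sub>\<approx>z. L z = a z"
  shows "\<forall>\<^sub>\<approx>z. f z = a z"
  using meromorphic_on_imp_analytic_cosparse[OF m(1)] meromorphic_on_imp_analytic_cosparse[OF m(2)]
proof eventually_elim
  case (elim z)
  have "eventually (\<lambda>w. L w = a w) (at z)" using L by (rule eventually_cosparse_imp_eventually_at) simp
  hence "(\<lambda>w. L w - a w) \<midarrow>z\<rightarrow> 0" by (intro tendsto_eventually) (auto elim: eventually_mono)
  hence 1: "(\<lambda>w. f w - a w) \<midarrow>z\<rightarrow> 0" using sh by (simp add: share_IM_def)
  have "isCont (\<lambda>w. f w - a w) z" using elim by (intro analytic_at_imp_isCont analytic_intros)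
  hence "(\<lambda>w. f w - a w) \<midarrow>z\<rightarrow> f z - a z" by (simp add: isCont_def)
  from LIM_unique[OF this 1] show ?case by simp
qed

lemma pole_ord_prod_le:
  assumes "\<And>i. i \<in> A \<Longrightarrow> f i meromorphic_on {z}"
  shows "pole_ord (\<lambda>w. \<Prod>i\<in>A. f i w) z \<le> (\<Sum>i\<in>A. pole_ord (f i) z)"
  using assms
proof (induction A rule: infinite_finite_induct)
  case (insert i A)
  have "(\<lambda>w. \<Prod>i\<in>A. f i w) meromorphic_on {z}" using insert.prems by (intro meromorphic_intros) auto
  hence "pole_ord (\<lambda>w. f i w * (\<Prod>i\<in>A. f i w)) z \<le> pole_ord (f i) z + pole_ord (\<lambda>w. \<Prod>i\<in>A. f i w) z"
    by (intro pole_ord_mult_le insert) auto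
  also have "pole_ord (\<lambda>w. \<Prod>i\<in>A. f i w) z \<le> (\<Sum>i\<in>A. pole_ord (f i) z)" using insert by auto
  finally show ?case using insert by simp
qed auto

lemma pole_ord_ld01_le:
  assumes "F meromorphic_on {z}"
  shows "pole_ord (ld01 F) z \<le> 1"
proof -
  have m: "(\<lambda>w. F w - 1) meromorphic_on {z}" by (intro meromorphic_intros assms)
  have ev: "eventually (\<lambda>w. deriv (\<lambda>w. F w - 1) w / (F w - 1) - deriv F w / F w = ld01 F w) (at z)"
    using deriv_diff_const_ev[OF assms, of 1] by eventually_elim (simp add: ld01_def)
  have mm: "(\<lambda>w. deriv (\<lambda>w. F w - 1) w / (F w - 1)) meromorphic_on {z}" "(\<lambda>w. deriv F w / F w) meromorphic_on {z}"
    by (intro meromorphic_intros assms)+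
  have "pole_ord (\<lambda>w. deriv (\<lambda>w. F w - 1) w / (F w - 1) - deriv F w / F w) z \<le> 1"
    using pole_ord_diff_le[OF mm] pole_ord_logderiv_le[OF m] pole_ord_logderiv_le[OF assms] by auto
  thus ?thesis using pole_ord_cong[OF ev] by simp
qed

lemma pole_ord_minus_one_le: "F meromorphic_on {z} \<Longrightarrow> pole_ord (\<lambda>w. F w - 1) z \<le> pole_ord F z"
  using pole_ord_diff_le[of F z "\<lambda>_. 1"] by (auto intro: meromorphic_intros)

lemma pole_ord_ld01_diff_le:
  assumes "F meromorphic_on {z}" "G meromorphic_on {z}" "H meromorphic_on {z}"
  shows "pole_ord (\<lambda>w. ld01 H w * (F w - G w)) z \<le> 1 + max (pole_ord F z) (pole_ord G z)"
proof -
  have "(\<lambda>w. F w - G w) meromorphic_on {z}" by (intro meromorphic_intros assms)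
  from pole_ord_mult_le[OF mero_ld01[OF assms(3)] this] pole_ord_ld01_le[OF assms(3)] pole_ord_diff_le[OF assms(1,2)]
  show ?thesis by linarith
qed

text \<open>Sixteen factors of order at most 1 + B and the simple pole of W_F, raised to the fifth
  power, give 5 (17 + 16 B) = 85 + 80 B; the factors F, F-1, G, G-1 add 4 B.\<close>

lemma pole_ord_crude:
  assumes F: "F meromorphic_on {z}" "pole_ord F z \<le> B" and G: "G meromorphic_on {z}" "pole_ord G z \<le> B"
  shows "pole_ord (\<lambda>w. F w * (F w - 1) * (G w * (G w - 1)) * (ratio_prod 4 F G w * ld01 F w) ^ 5) z \<le> 85 + 84 * B"
proof -
  have b: "pole_ord (\<lambda>w. ld01 H w * (F w - G w)) z \<le> 1 + B" if "H meromorphic_on {z}" for H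
    using pole_ord_ld01_diff_le[OF F(1) G(1) that] F G by linarith
  have fac: "pole_ord (\<lambda>w. of_nat q * (ld01 F w * (F w - G w)) - of_nat p * (ld01 G w * (F w - G w))) z \<le> 1 + B" for p q :: nat
  proof -
    have m: "(\<lambda>w. ld01 H w * (F w - G w)) meromorphic_on {z}" if "H meromorphic_on {z}" for H
      by (intro meromorphic_intros mero_ld01 F G that)
    have m': "(\<lambda>w. of_nat q * (ld01 H w * (F w - G w))) meromorphic_on {z}" if "H meromorphic_on {z}" for H q
      by (intro meromorphic_intros mero_ld01 F G that)
    have "pole_ord (\<lambda>w. of_nat q * (ld01 H w * (F w - G w))) z \<le> 1 + B" if "H meromorphic_on {z}" for H q
      using pole_ord_mult_le[OF meromorphic_on_const m[OF that], of "of_nat q"] b[OF that] by simp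
    from pole_ord_diff_le[OF m'[OF F(1)] m'[OF G(1)], of q p] this[OF F(1), of q] this[OF G(1), of p] show ?thesis by linarith
  qed
  define R where "R = (\<lambda>x w. of_nat (snd x) * (ld01 F w * (F w - G w)) - of_nat (fst x) * (ld01 G w * (F w - G w)))"
  have Rm: "R x meromorphic_on {z}" for x unfolding R_def by (intro meromorphic_intros mero_ld01 F G)
  have "pole_ord (\<lambda>w. \<Prod>x\<in>{1..4::nat}\<times>{1..4::nat}. R x w) z \<le> (\<Sum>x\<in>{1..4::nat}\<times>{1..4::nat}. pole_ord (R x) z)"
    by (rule pole_ord_prod_le[OF Rm])
  also have "\<dots> \<le> (\<Sum>x\<in>{1..4::nat}\<times>{1..4::nat}. 1 + B)" unfolding R_def by (intro sum_mono fac)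
  finally have rp: "pole_ord (ratio_prod 4 F G) z \<le> 16 + 16 * B"
    by (simp add: ratio_prod_def[abs_def] R_def case_prod_unfold)
  have m: "(\<lambda>w. F w - 1) meromorphic_on {z}" "(\<lambda>w. G w - 1) meromorphic_on {z}" "ratio_prod 4 F G meromorphic_on {z}"
    "ld01 F meromorphic_on {z}"
    by (intro meromorphic_intros mero_ld01 mero_ratio_prod F G)+
  have m2: "(\<lambda>w. F w * (F w - 1)) meromorphic_on {z}" "(\<lambda>w. G w * (G w - 1)) meromorphic_on {z}"
     "(\<lambda>w. F w * (F w - 1) * (G w * (G w - 1))) meromorphic_on {z}"
     "(\<lambda>w. ratio_prod 4 F G w * ld01 F w) meromorphic_on {z}"
     "(\<lambda>w. (ratio_prod 4 F G w * ld01 F w) ^ 5) meromorphic_on {z}"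
    by (intro meromorphic_intros m F G)+
  have arith: "y \<le> 85 + 84 * B" if "y \<le> u + v" "u \<le> uf + ug" "uf \<le> a + a'" "ug \<le> g + g'" "v \<le> 5 * r"
    "r \<le> s + l" "s \<le> 16 + 16 * B" "l \<le> 1" "a' \<le> a" "g' \<le> g" "a \<le> B" "g \<le> B"
    for y u v uf ug a a' g g' r s l :: nat
  proof -
    have "r \<le> 17 + 16 * B" using that(6-8) by linarith
    hence "v \<le> 85 + 80 * B" using that(5) by linarith
    moreover have "uf \<le> 2 * B" "ug \<le> 2 * B" using that(3,4,9-12) by linarith+
    ultimately show ?thesis using that(1,2) by linarith
  qed
  show ?thesis
    by (rule arith[OF pole_ord_mult_le[OF m2(3,5)] pole_ord_mult_le[OF m2(1,2)] pole_ord_mult_le[OF F(1) m(1)]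
      pole_ord_mult_le[OF G(1) m(2)] pole_ord_power_le[OF m2(4)] pole_ord_mult_le[OF m(3,4)] rp pole_ord_ld01_le[OF F(1)]
      pole_ord_minus_one_le[OF F(1)] pole_ord_minus_one_le[OF G(1)] F(2) G(2)])
qed

section \<open>The setting of the theorem along windows\<close>

lemma analytic_iterated_deriv: "f analytic_on UNIV \<Longrightarrow> (deriv ^^ i) f analytic_on UNIV"
  by (induction i) (auto intro: analytic_deriv)

text \<open>\<open>T_le\<close> bounds f from below by the reference sizes, whereas the other size
  conditions are upper bounds. It is what a proof that F has small proximity contradicts.\<close>

locale sharing = windows +
  fixes f a1 a2 L :: "complex \<Rightarrow> complex" and b :: "nat \<Rightarrow> complex \<Rightarrow> complex" and c :: complex and k :: nat
  assumes f_entire: "f analytic_on UNIV" and f_tame: "tame f"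
    and T_le: "eventually (\<lambda>(n, s). T n \<le> proximity s f) W"
    and a_small: "small a1" "small a2" and b_small: "\<And>i. i \<le> k \<Longrightarrow> small (b i)"
    and a_distinct: "\<not> (\<forall>\<^sub>\<approx>z. a1 z = a2 z)"
    and L_def: "\<And>z. L z = (\<Sum>i=0..k. b i z * (deriv ^^ i) f (z + c))"
    and share: "share_IM f L a1" "share_IM f L a2"
begin

definition "D z = a2 z - a1 z"
definition "F z = (f z - a1 z) / D z"
definition "G z = (L z - a1 z) / D z"
definition "\<Phi> z = ld01 F z * (F z - G z)"

lemma D_small: "small D" unfolding D_def[abs_def] using a_small by (intro small_diff)

lemma D_nz: "\<forall>\<^sub>\<approx>z. D z \<noteq> 0"
  using meromorphic_zero_dichotomy[OF small_mero[OF D_small]]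
proof
  assume "\<forall>\<^sub>\<approx>z. D z = 0"
  hence "\<forall>\<^sub>\<approx>z. a1 z = a2 z" by eventually_elim (simp add: D_def)
  with a_distinct show ?thesis by simp
qed

lemma f_mero: "f meromorphic_on UNIV" using f_tame tame_mero by auto

lemma f_not_msmall: "\<not> msmall f"
  using not_negl[of "\<lambda>s. proximity s f" 1] T_le by (auto simp: msmall_def)

lemma F_tame: "tame F"
  unfolding F_def[abs_def] divide_inverse
  by (intro tame_mult tame_diff tame_inverse f_tame small_tame[OF a_small(1)] small_tame[OF D_small])

lemma F_mero: "F meromorphic_on UNIV" using F_tame tame_mero by auto

lemma f_eq: "\<forall>\<^sub>\<approx>z. a1 z + D z * F z = f z"
  using D_nz by eventually_elim (simp add: F_def)

lemma F_not_msmall: "\<not> msmall F"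
proof
  assume "msmall F"
  hence "msmall (\<lambda>z. a1 z + D z * F z)"
    by (intro msmall_add msmall_mult small_msmall[OF a_small(1)] small_msmall[OF D_small])
  from msmall_cong[OF this f_eq f_mero] f_not_msmall show False by simp
qed

lemma F_neq_const: "\<forall>\<^sub>\<approx>z. F z \<noteq> x"
proof -
  have "(\<lambda>z. F z - x) meromorphic_on UNIV" by (intro meromorphic_intros F_mero)
  from meromorphic_zero_dichotomy[OF this] show ?thesis
  proof
    assume "\<forall>\<^sub>\<approx>z. F z - x = 0"
    hence "\<forall>\<^sub>\<approx>z. x = F z" by eventually_elim simp
    from msmall_cong[OF msmall_const this F_mero] F_not_msmall show ?thesis by simp
  qed simp
qed

lemma f_nz: "\<forall>\<^sub>\<approx>z. f z \<noteq> 0"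
  using meromorphic_zero_dichotomy[OF f_mero]
proof
  assume "\<forall>\<^sub>\<approx>z. f z = 0"
  hence "\<forall>\<^sub>\<approx>z. 0 = f z" by eventually_elim simp
  from msmall_cong[OF msmall_const this f_mero] f_not_msmall show ?thesis by simp
qed

lemma iterated_dominated: "dominated f ((deriv ^^ i) f)"
  by (induction i) (auto intro: dominated_deriv dominated_refl f_tame)

lemma L_eq: "L = (\<lambda>z. \<Sum>i=0..k. b i z * (deriv ^^ i) f (z + c))"
  using L_def by auto

lemma L_dominated: "dominated f L"
  unfolding L_eq
  by (intro dominated_sum dominated_cmult_small dominated_shift iterated_dominated b_small) simp

lemma L_tame: "tame L" using L_dominated by (simp add: dominated_def)

lemma shift_analytic: "(\<lambda>z. (deriv ^^ i) f (z + c)) analytic_on UNIV"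
proof -
  have "((deriv ^^ i) f \<circ> (\<lambda>z. z + c)) analytic_on UNIV"
    by (rule analytic_on_compose) (auto intro!: analytic_intros analytic_on_subset[OF analytic_iterated_deriv[OF f_entire]])
  thus ?thesis by (simp add: o_def)
qed

lemma G_tame: "tame G"
  unfolding G_def[abs_def] divide_inverse
  by (intro tame_mult tame_diff tame_inverse L_tame small_tame[OF a_small(1)] small_tame[OF D_small])

lemma G_mero: "G meromorphic_on UNIV" using G_tame tame_mero by auto

text \<open>The derivatives of f are entire, so only the coefficients contribute poles.\<close>

lemma L_nsmall: "nsmall L"
  unfolding L_eq by (intro nsmall_sum nsmall_mult small_nsmall[OF b_small] nsmall_analytic shift_analytic) simp

lemma G_nsmall: "nsmall G"
  unfolding G_def[abs_def] divide_inverse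
  by (intro nsmall_mult nsmall_diff L_nsmall small_nsmall[OF a_small(1)] small_nsmall[OF small_inv[OF D_small]])

lemma F_nsmall: "nsmall F"
  unfolding F_def[abs_def] divide_inverse
  by (intro nsmall_mult nsmall_diff nsmall_analytic[OF f_entire] small_nsmall[OF a_small(1)] small_nsmall[OF small_inv[OF D_small]])

lemma L_eq_G: "\<forall>\<^sub>\<approx>z. a1 z + D z * G z = L z"
  using D_nz by eventually_elim (simp add: G_def)

lemma G_nz: "\<forall>\<^sub>\<approx>z. G z \<noteq> 0"
  using meromorphic_zero_dichotomy[OF G_mero]
proof
  assume "\<forall>\<^sub>\<approx>z. G z = 0"
  hence "\<forall>\<^sub>\<approx>z. L z = a1 z" using L_eq_G by eventually_elim simp
  from share_IM_imp_eq[OF share(1) f_mero small_mero[OF a_small(1)] this]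
  have "\<forall>\<^sub>\<approx>z. F z = 0" by eventually_elim (simp add: F_def)
  with F_neq_const[of 0] have "\<forall>\<^sub>\<approx>z :: complex. False" by eventually_elim simp
  thus ?thesis by simp
qed

lemma G_neq_1: "\<forall>\<^sub>\<approx>z. G z \<noteq> 1"
proof -
  have "(\<lambda>z. G z - 1) meromorphic_on UNIV" by (intro meromorphic_intros G_mero)
  from meromorphic_zero_dichotomy[OF this] show ?thesis
  proof
    assume "\<forall>\<^sub>\<approx>z. G z - 1 = 0"
    hence "\<forall>\<^sub>\<approx>z. L z = a2 z" using L_eq_G by eventually_elim (auto simp: D_def)
    from share_IM_imp_eq[OF share(2) f_mero small_mero[OF a_small(2)] this] D_nz
    have "\<forall>\<^sub>\<approx>z. F z = 1" by eventually_elim (simp add: F_def D_def)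
    with F_neq_const[of 1] have "\<forall>\<^sub>\<approx>z :: complex. False" by eventually_elim simp
    thus ?thesis by simp
  qed simp
qed

text \<open>\<open>Z\<close> is the factor L/f of small proximity; inserting f = a1 + D F into L = Z
  f makes G affine in F.\<close>

lemma L_factor:
  obtains Z where "msmall Z" "\<forall>\<^sub>\<approx>z. L z = Z z * f z" "\<forall>\<^sub>\<approx>z. G z = Z z * F z + (Z z - 1) * (a1 z / D z)"
proof -
  obtain Z where Z: "msmall Z" "\<forall>\<^sub>\<approx>z. L z = Z z * f z" using L_dominated by (auto simp: dominated_def)
  moreover have "\<forall>\<^sub>\<approx>z. G z = Z z * F z + (Z z - 1) * (a1 z / D z)"
    using Z(2) D_nz by eventually_elim (simp add: G_def F_def field_simps)
  ultimately show thesis by (rule that)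
qed

lemma \<Phi>_mero: "\<Phi> meromorphic_on UNIV"
  unfolding \<Phi>_def[abs_def] by (intro meromorphic_intros mero_ld01 F_mero G_mero)

text \<open>F - G is affine in F with coefficients of small proximity, and both W_F and W_F F =
  F'/(F-1) are made of logarithmic derivatives.\<close>

lemma \<Phi>_msmall: "msmall \<Phi>"
proof -
  obtain Z where Z: "msmall Z" "\<forall>\<^sub>\<approx>z. G z = Z z * F z + (Z z - 1) * (a1 z / D z)" using L_factor by blast
  have ad: "msmall (\<lambda>z. a1 z / D z)" using a_small D_small by (intro small_msmall small_divide)
  have "msmall (\<lambda>z. (1 - Z z) * (deriv F z / (F z - 1)) - ld01 F z * ((Z z - 1) * (a1 z / D z)))"
    by (intro msmall_diff msmall_mult msmall_const Z msmall_logderiv_minus_1 msmall_ld01 F_tame ad)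
  moreover have "\<forall>\<^sub>\<approx>z. (1 - Z z) * (deriv F z / (F z - 1)) - ld01 F z * ((Z z - 1) * (a1 z / D z)) = \<Phi> z"
    using Z(2) F_neq_const[of 0] F_neq_const[of 1]
  proof eventually_elim
    case (elim z)
    have *: "deriv F z / (F z - 1) = ld01 F z * F z"
      using elim by (simp add: ld01_def divide_simps) (simp add: algebra_simps)
    show ?case unfolding * \<Phi>_def elim(1) by (simp add: algebra_simps)
  qed
  ultimately show ?thesis using msmall_cong \<Phi>_mero by blast
qed

text \<open>Its zeros are the points where sharing can be read off without interference from the
  coefficients. Elsewhere it is at least 1, so that additive constants in pole estimates can be
  absorbed into a multiple of it.\<close>

definition pole_bound :: "complex \<Rightarrow> nat" where
  "pole_bound z = (\<Sum>i=0..k. pole_ord (b i) z) + pole_ord a1 z + pole_ord a2 z + pole_ord (\<lambda>z. inverse (D z)) z"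

lemma nsmall_pole_bound:
  assumes y: "y meromorphic_on UNIV" "\<And>z. pole_ord y z \<le> K * pole_bound z"
  shows "nsmall y"
proof -
  define g where "g = (\<lambda>i. if i \<le> k then b i else if i = Suc k then a1 else if i = Suc (Suc k) then a2 else (\<lambda>z. inverse (D z)))"
  have "(\<Sum>i=0..k. pole_ord (g i) z) = (\<Sum>i=0..k. pole_ord (b i) z)" for z
    by (intro sum.cong) (auto simp: g_def)
  hence pb: "pole_bound z = (\<Sum>i=0..Suc (Suc (Suc k)). pole_ord (g i) z)" for z
    by (simp add: pole_bound_def) (simp add: g_def)
  show ?thesis
  proof (rule nsmall_bound[OF y(1)])
    show "finite {0..Suc (Suc (Suc k))}" by simp
    show "pole_ord y z \<le> K * (\<Sum>i=0..Suc (Suc (Suc k)). pole_ord (g i) z)" for z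
      using y(2)[of z] unfolding pb .
    show "nsmall (g i)" for i
      unfolding g_def using small_nsmall[OF b_small] small_nsmall[OF a_small(1)] small_nsmall[OF a_small(2)]
        small_nsmall[OF small_inv[OF D_small]] by simp
  qed
qed

lemma pole_ord_FG: "pole_ord F z \<le> pole_bound z" "pole_ord G z \<le> pole_bound z"
proof -
  note m = mero_at[OF small_mero[OF a_small(1)], of z] mero_at[OF f_mero, of z] mero_at[OF tame_mero[OF L_tame], of z]
    mero_at[OF small_mero[OF small_inv[OF D_small]], of z]
  have "pole_ord f z = 0" using f_entire by (intro pole_ord_analytic) (auto intro: analytic_on_subset)
  have md: "(\<lambda>z. f z - a1 z) meromorphic_on {z}" "(\<lambda>z. L z - a1 z) meromorphic_on {z}" by (intro meromorphic_intros m)+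
  have an: "(\<lambda>z. (deriv ^^ i) f (z + c)) analytic_on {z}" for i using shift_analytic by (auto intro: analytic_on_subset)
  have mt: "(\<lambda>z. b i z * (deriv ^^ i) f (z + c)) meromorphic_on {z}" if "i \<le> k" for i
    using mero_at[OF small_mero[OF b_small[OF that]], of z] analytic_on_imp_meromorphic_on[OF an] by (intro meromorphic_intros)
  have "pole_ord L z \<le> (\<Sum>i=0..k. pole_ord (\<lambda>z. b i z * (deriv ^^ i) f (z + c)) z)"
    unfolding L_eq by (rule pole_ord_sum_le) (auto intro: mt)
  also have "\<dots> \<le> (\<Sum>i=0..k. pole_ord (b i) z)"
  proof (rule sum_mono)
    fix i assume "i \<in> {0..k}"
    hence "b i meromorphic_on {z}" using mero_at[OF small_mero[OF b_small]] by auto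
    from pole_ord_mult_le[OF this analytic_on_imp_meromorphic_on[OF an]] pole_ord_analytic[OF an]
    show "pole_ord (\<lambda>z. b i z * (deriv ^^ i) f (z + c)) z \<le> pole_ord (b i) z" by (metis add.right_neutral)
  qed
  finally have Lp: "pole_ord L z \<le> (\<Sum>i=0..k. pole_ord (b i) z)" .
  show "pole_ord F z \<le> pole_bound z"
    using pole_ord_mult_le[OF md(1) m(4)] pole_ord_diff_le[OF m(2,1)] \<open>pole_ord f z = 0\<close>
    unfolding F_def[abs_def] divide_inverse pole_bound_def by linarith
  show "pole_ord G z \<le> pole_bound z"
    using pole_ord_mult_le[OF md(2) m(4)] pole_ord_diff_le[OF m(3,1)] Lp
    unfolding G_def[abs_def] divide_inverse pole_bound_def by linarith
qed

text \<open>Here F, G, D and 1/D have finite limits, and sharing a1 and a2 becomes sharing the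
  values 0 and 1, which is the situation of \<open>shared_point_analysis\<close>.\<close>

lemma pole_free_point:
  assumes B: "pole_bound z = 0"
  shows "pole_ord \<Phi> z = 0"
    "pole_ord (\<lambda>w. F w * (F w - 1) * (G w * (G w - 1)) * (ratio_prod 4 F G w * ld01 F w) ^ 5) z = 0"
proof -
  note m = mero_at[OF F_mero, of z] mero_at[OF G_mero, of z] mero_at[OF small_mero[OF D_small], of z]
    mero_at[OF small_mero[OF small_inv[OF D_small]], of z]
  have "pole_ord D z = 0" using B pole_ord_diff_le[OF mero_at[OF small_mero[OF a_small(2)]] mero_at[OF small_mero[OF a_small(1)]], of z]
    by (simp add: pole_bound_def D_def[abs_def])
  then obtain d where d: "D \<midarrow>z\<rightarrow> d" using not_pole_tendsto[OF m(3)] by blast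
  have "pole_ord (\<lambda>z. inverse (D z)) z = 0" using B by (simp add: pole_bound_def)
  then obtain e where e: "(\<lambda>z. inverse (D z)) \<midarrow>z\<rightarrow> e" using not_pole_tendsto[OF m(4)] by blast
  obtain x where x: "F \<midarrow>z\<rightarrow> x" using not_pole_tendsto[OF m(1)] pole_ord_FG(1)[of z] B by auto
  obtain y where y: "G \<midarrow>z\<rightarrow> y" using not_pole_tendsto[OF m(2)] pole_ord_FG(2)[of z] B by auto
  have at: "eventually P (at z)" if "\<forall>\<^sub>\<approx>z. P z" for P
    using that by (rule eventually_cosparse_imp_eventually_at) simp
  note Dnz = at[OF D_nz]
  have 0: "x = 0 \<longleftrightarrow> y = 0"
    using share_quotient_limits[OF share(1) d e Dnz] x y unfolding F_def[abs_def] G_def[abs_def] by blast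
  have "(\<lambda>w. (f w - a2 w) / D w) \<midarrow>z\<rightarrow> x - 1"
    by (rule Lim_transform_eventually[OF tendsto_diff[OF x tendsto_const]])
       (use Dnz in eventually_elim, simp add: F_def D_def field_simps)
  moreover have "(\<lambda>w. (L w - a2 w) / D w) \<midarrow>z\<rightarrow> y - 1"
    by (rule Lim_transform_eventually[OF tendsto_diff[OF y tendsto_const]])
       (use Dnz in eventually_elim, simp add: G_def D_def field_simps)
  ultimately have "x - 1 = 0 \<longleftrightarrow> y - 1 = 0" by (rule share_quotient_limits[OF share(2) d e Dnz])
  hence 1: "x = 1 \<longleftrightarrow> y = 1" by simp
  note sp = shared_point_analysis[OF m(1) at[OF F_neq_const] at[OF F_neq_const] m(2) at[OF G_nz] at[OF G_neq_1] x y 0 1]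
  show "pole_ord \<Phi> z = 0" using sp(1) by (simp add: \<Phi>_def[abs_def])
  show "pole_ord (\<lambda>w. F w * (F w - 1) * (G w * (G w - 1)) * (ratio_prod 4 F G w * ld01 F w) ^ 5) z = 0" by (rule sp(3))
qed

lemma \<Phi>_nsmall: "nsmall \<Phi>"
proof (rule nsmall_pole_bound[OF \<Phi>_mero])
  fix z
  show "pole_ord \<Phi> z \<le> 2 * pole_bound z"
  proof (cases "pole_bound z = 0")
    case False
    thus ?thesis using pole_ord_FG[of z] pole_ord_ld01_diff_le[OF mero_at[OF F_mero] mero_at[OF G_mero] mero_at[OF F_mero], of z]
      by (simp add: \<Phi>_def[abs_def])
  qed (simp add: pole_free_point)
qed

lemma Y_nsmall: "nsmall (\<lambda>w. F w * (F w - 1) * (G w * (G w - 1)) * (ratio_prod 4 F G w * ld01 F w) ^ 5)" (is "nsmall ?Y")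
proof (rule nsmall_pole_bound)
  show "?Y meromorphic_on UNIV" by (intro meromorphic_intros mero_ld01 mero_ratio_prod F_mero G_mero)
  fix z
  \<comment> \<open>169 = 85 + 84: the constant 85 is absorbed because the bound is at least 1 when
    it is not 0.\<close>
  show "pole_ord ?Y z \<le> 169 * pole_bound z"
  proof (cases "pole_bound z = 0")
    case False
    thus ?thesis using pole_ord_crude[OF mero_at[OF F_mero] pole_ord_FG(1) mero_at[OF G_mero] pole_ord_FG(2), of z] by linarith
  qed (simp add: pole_free_point)
qed

lemma \<Phi>_small: "small \<Phi>" using \<Phi>_msmall \<Phi>_nsmall by (simp add: small_def)

end

section \<open>Reduction of L by the first-order relation for f\<close>

context sharing
begin

text \<open>Modulo differential polynomials of $p = f' - \theta f$ with small coefficients, $f^{(i)}$ is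
  $\theta_i f$. The operator $L$ thus becomes $\kappa(z) f(z+c)$ up to terms dominated by $p$.\<close>

definition "\<theta> z = deriv D z / D z + \<Phi> z"

fun \<theta>s :: "nat \<Rightarrow> complex \<Rightarrow> complex" where
  "\<theta>s 0 = (\<lambda>_. 1)"
| "\<theta>s (Suc i) = (\<lambda>z. deriv (\<theta>s i) z + \<theta> z * \<theta>s i z)"

definition "p z = deriv f z - \<theta> z * f z"

fun Q :: "nat \<Rightarrow> complex \<Rightarrow> complex" where
  "Q 0 = (\<lambda>_. 0)"
| "Q (Suc i) = (\<lambda>z. \<theta>s i z * p z + deriv (Q i) z)"

lemma \<theta>_small: "small \<theta>"
  unfolding \<theta>_def[abs_def] by (intro small_add small_divide small_deriv D_small \<Phi>_small)

lemma \<theta>s_small: "small (\<theta>s i)"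
proof (induction i)
  case 0
  show ?case using small_const[of 1] by simp
next
  case (Suc i)
  thus ?case by (auto intro!: small_add small_deriv small_mult \<theta>_small)
qed

lemma p_tame: "tame p"
  unfolding p_def[abs_def] by (intro tame_diff tame_deriv f_tame tame_mult small_tame[OF \<theta>_small])

lemma Q_dominated: "dominated p (Q i)"
proof (induction i)
  case 0
  show ?case using dominated_zero[of p] by simp
next
  case (Suc i)
  thus ?case using dominated_cmult_small[OF dominated_refl[OF p_tame] \<theta>s_small]
    by (auto intro!: dominated_add dominated_deriv)
qed

lemma Q_mero: "Q i meromorphic_on UNIV"
  using Q_dominated[of i] tame_mero by (auto simp: dominated_def)

text \<open>Differentiating \<open>\<theta>s i\<close> f + \<open>Q i\<close> and replacing f' by
  \<theta> f + p produces exactly the two recursions.\<close>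

lemma iterated_deriv_eq: "\<forall>\<^sub>\<approx>z. (deriv ^^ i) f z = \<theta>s i z * f z + Q i z"
proof (induction i)
  case (Suc i)
  from cosparse_deriv_cong[OF this]
    meromorphic_on_imp_analytic_cosparse[OF small_mero[OF \<theta>s_small[of i]]]
    meromorphic_on_imp_analytic_cosparse[OF f_mero] meromorphic_on_imp_analytic_cosparse[OF Q_mero[of i]]
  show ?case
  proof eventually_elim
    case (elim z)
    have d: "(h has_field_derivative deriv h z) (at z)" if "h analytic_on {z}" for h
      using that analytic_on_imp_differentiable_at DERIV_deriv_iff_field_differentiable by blast
    have "((\<lambda>z. \<theta>s i z * f z + Q i z) has_field_derivative
        (deriv (\<theta>s i) z * f z + deriv f z * \<theta>s i z + deriv (Q i) z)) (at z)"
      by (intro DERIV_add DERIV_mult d elim)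
    hence "deriv (\<lambda>z. \<theta>s i z * f z + Q i z) z = deriv (\<theta>s i) z * f z + deriv f z * \<theta>s i z + deriv (Q i) z"
      by (rule DERIV_imp_deriv)
    with elim(1) show ?case by (simp add: p_def algebra_simps)
  qed
qed simp

definition "\<kappa> z = (\<Sum>i=0..k. b i z * \<theta>s i (z + c))"

lemma \<kappa>_small: "small \<kappa>"
  unfolding \<kappa>_def[abs_def] by (intro small_sum small_mult small_shift \<theta>s_small b_small) simp

lemma L_\<kappa>: "\<forall>\<^sub>\<approx>z. L z = \<kappa> z * f (z + c) + (\<Sum>i=0..k. b i z * Q i (z + c))"
proof -
  have "\<forall>\<^sub>\<approx>z. \<forall>i\<in>{0..k}. (deriv ^^ i) f (z + c) = \<theta>s i (z + c) * f (z + c) + Q i (z + c)"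
    using cosparse_shift[OF iterated_deriv_eq] by (intro eventually_ball_finite) auto
  thus ?thesis
  proof eventually_elim
    case (elim z)
    have "L z = (\<Sum>i=0..k. b i z * (deriv ^^ i) f (z + c))" by (rule L_def)
    also have "\<dots> = (\<Sum>i=0..k. b i z * (\<theta>s i (z + c) * f (z + c) + Q i (z + c)))"
      using elim by (intro sum.cong) auto
    finally show ?case by (simp add: \<kappa>_def distrib_left sum.distrib sum_distrib_right mult.assoc)
  qed
qed

definition "P z = deriv F z - \<Phi> z * F z"

text \<open>With f = a1 + D F the term D' F of f' cancels against the summand D'/D of \<theta>,
  which is the reason for that summand. What remains is affine in P with small coefficients.\<close>

lemma p_eq: "\<forall>\<^sub>\<approx>z. p z = D z * P z + (deriv a1 z - \<theta> z * a1 z)"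
  using cosparse_deriv_cong[OF f_eq] D_nz f_eq
    meromorphic_on_imp_analytic_cosparse[OF small_mero[OF a_small(1)]]
    meromorphic_on_imp_analytic_cosparse[OF small_mero[OF D_small]]
    meromorphic_on_imp_analytic_cosparse[OF F_mero]
proof eventually_elim
  case (elim z)
  have d: "(h has_field_derivative deriv h z) (at z)" if "h analytic_on {z}" for h
    using that analytic_on_imp_differentiable_at DERIV_deriv_iff_field_differentiable by blast
  have "((\<lambda>z. a1 z + D z * F z) has_field_derivative (deriv a1 z + (deriv D z * F z + deriv F z * D z))) (at z)"
    by (intro DERIV_add DERIV_mult d elim)
  hence "deriv f z = deriv a1 z + (deriv D z * F z + deriv F z * D z)"
    using elim(1) DERIV_imp_deriv by metis
  thus ?case using elim(2) unfolding p_def P_def \<theta>_def elim(3)[symmetric]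
    by (simp add: field_simps)
qed

text \<open>Inserting F' = W_F F (F-1) gives both terms of P (F-G) the common factor \<Phi> F, and
  (F-1) - (F-G) = G - 1.\<close>

lemma P_relation: "\<forall>\<^sub>\<approx>z. P z * (F z - G z) = \<Phi> z * F z * (G z - 1)"
  using F_neq_const[of 0] F_neq_const[of 1]
proof eventually_elim
  case (elim z)
  have df: "deriv F z = ld01 F z * (F z * (F z - 1))"
    using elim by (simp add: ld01_def divide_simps) (simp add: algebra_simps)
  show ?case unfolding P_def \<Phi>_def df by (simp add: algebra_simps)
qed

text \<open>The reduced form of L is solved for f(z+c) and multiplied by f(z)/f(z+c). Dividing by
  \<kappa> is harmless: \<kappa> is small in both senses, so its inverse has small proximity
  too.\<close>

lemma F_combination:
  assumes "\<not> (\<forall>\<^sub>\<approx>z. \<kappa> z = 0)"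
  obtains Z4 Z5 Z6 where "msmall Z4" "msmall Z5" "msmall Z6"
    "\<forall>\<^sub>\<approx>z. F z = Z4 z * G z + Z5 z * P z + Z6 z"
proof -
  have \<kappa>nz: "\<forall>\<^sub>\<approx>z. \<kappa> z \<noteq> 0" using meromorphic_zero_dichotomy[OF small_mero[OF \<kappa>_small]] assms by blast
  have "dominated p (\<lambda>z. \<Sum>i=0..k. b i z * Q i (z + c))"
    by (intro dominated_sum dominated_cmult_small dominated_shift Q_dominated b_small) simp
  then obtain Zq where Zq: "msmall Zq" "\<forall>\<^sub>\<approx>z. (\<Sum>i=0..k. b i z * Q i (z + c)) = Zq z * p z"
    by (auto simp: dominated_def)
  define Z where "Z = (\<lambda>z. f z / f (z + c))"
  \<comment> \<open>f(z)/f(z+c) is the shift quotient of the function f(z+c) for the step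
    -c.\<close>
  have Z: "msmall Z" using msmall_shift_quot[OF tame_shift[OF f_tame, of c], of "- c"] by (simp add: Z_def)
  define i\<kappa> iD where "i\<kappa> = (\<lambda>z. inverse (\<kappa> z))" and "iD = (\<lambda>z. inverse (D z))"
  have i\<kappa>: "msmall i\<kappa>" "msmall iD" unfolding i\<kappa>_def iD_def
    by (intro small_msmall small_inv \<kappa>_small D_small)+
  have sm: "msmall a1" "msmall (\<lambda>z. deriv a1 z - \<theta> z * a1 z)"
    using a_small by (auto intro!: small_msmall small_diff small_deriv small_mult \<theta>_small)
  show thesis
  proof (rule that)
    show "msmall (\<lambda>z. Z z * i\<kappa> z)" "msmall (\<lambda>z. - (Z z * Zq z * i\<kappa> z))"
      by (intro msmall_mult msmall_uminus Z Zq i\<kappa>)+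
    show "msmall (\<lambda>z. Z z * a1 z * i\<kappa> z * iD z - Z z * Zq z * (deriv a1 z - \<theta> z * a1 z) * i\<kappa> z * iD z - a1 z * iD z)"
      by (intro msmall_mult msmall_diff[OF msmall_diff] Z Zq i\<kappa> sm)
    show "\<forall>\<^sub>\<approx>z. F z = Z z * i\<kappa> z * G z + - (Z z * Zq z * i\<kappa> z) * P z +
      (Z z * a1 z * i\<kappa> z * iD z - Z z * Zq z * (deriv a1 z - \<theta> z * a1 z) * i\<kappa> z * iD z - a1 z * iD z)"
      using L_\<kappa> Zq(2) p_eq D_nz \<kappa>nz cosparse_shift[OF f_nz, of c] L_eq_G
    proof eventually_elim
      case (elim z)
      have f: "f z = Z z * f (z + c)" using elim(6) by (simp add: Z_def)
      have L: "L z = \<kappa> z * f (z + c) + Zq z * p z" using elim(1,2) by simp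
      have "f z = Z z * ((L z - Zq z * p z) * i\<kappa> z)" using f L elim(5) by (simp add: i\<kappa>_def)
      hence f': "f z = Z z * ((a1 z + D z * G z - Zq z * (D z * P z + (deriv a1 z - \<theta> z * a1 z))) * i\<kappa> z)"
        using elim(3,7) by simp
      have DD: "D z * iD z = 1" using elim(4) by (simp add: iD_def)
      have "F z = f z * iD z - a1 z * iD z" by (simp add: F_def iD_def divide_inverse left_diff_distrib)
      also have "f z * iD z = Z z * i\<kappa> z * G z * (D z * iD z) - Z z * Zq z * i\<kappa> z * P z * (D z * iD z)
         + Z z * a1 z * i\<kappa> z * iD z - Z z * Zq z * (deriv a1 z - \<theta> z * a1 z) * i\<kappa> z * iD z"
        unfolding f' by (simp add: algebra_simps)
      finally show ?case unfolding DD by (simp add: algebra_simps)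
    qed
  qed
qed

text \<open>By the relation for $P$, whenever $|G| \le |F|/2$ one has $|P| \le 2|\Phi|(|G|+1)$.\<close>

lemma F_le_G:
  assumes "\<not> (\<forall>\<^sub>\<approx>z. \<kappa> z = 0)"
  obtains e where "esmall e" "\<forall>\<^sub>\<approx>z. norm (F z) \<le> e z * (norm (G z) + 1)"
proof -
  obtain Z4 Z5 Z6 where Z: "msmall Z4" "msmall Z5" "msmall Z6"
    and F: "\<forall>\<^sub>\<approx>z. F z = Z4 z * G z + Z5 z * P z + Z6 z"
    using F_combination[OF assms] by blast
  show thesis
  proof (rule that)
    show "esmall (\<lambda>z. 2 + norm (Z4 z) + 2 * (norm (Z5 z) * norm (\<Phi> z)) + norm (Z6 z))"
      by (intro esmall_add esmall_mult esmall_const esmall_norm Z \<Phi>_msmall) auto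
    show "\<forall>\<^sub>\<approx>z. norm (F z) \<le> (2 + norm (Z4 z) + 2 * (norm (Z5 z) * norm (\<Phi> z)) + norm (Z6 z)) * (norm (G z) + 1)"
      using F P_relation F_neq_const[of 0]
    proof eventually_elim
      case (elim z)
      have nn: "norm (Z4 z) * norm (G z) \<ge> 0" "norm (Z5 z) * norm (\<Phi> z) * (norm (G z) + 1) \<ge> 0"
        "norm (Z6 z) * norm (G z) \<ge> 0" by auto
      show ?case
      proof (cases "norm (G z) \<le> norm (F z) / 2")
        case False
        have "2 * (norm (G z) + 1) \<le> (2 + norm (Z4 z) + 2 * (norm (Z5 z) * norm (\<Phi> z)) + norm (Z6 z)) * (norm (G z) + 1)"
          by (intro mult_right_mono) auto
        moreover have "norm (F z) \<le> 2 * (norm (G z) + 1)" using False by simp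
        ultimately show ?thesis by (rule order_trans[rotated])
      next
        case True
        have "norm (F z) / 2 \<le> norm (F z - G z)" using norm_triangle_ineq2[of "F z" "G z"] True by linarith
        hence "norm (P z) * (norm (F z) / 2) \<le> norm (P z) * norm (F z - G z)" by (intro mult_left_mono) auto
        also have "\<dots> = norm (\<Phi> z) * norm (F z) * norm (G z - 1)" using elim(2) by (metis norm_mult)
        also have "\<dots> \<le> norm (\<Phi> z) * norm (F z) * (norm (G z) + 1)"
          using norm_triangle_ineq4[of "G z" 1] by (intro mult_left_mono) auto
        finally have "norm (P z) * norm (F z) \<le> (2 * norm (\<Phi> z) * (norm (G z) + 1)) * norm (F z)" by (simp add: mult_ac)
        hence P: "norm (P z) \<le> 2 * norm (\<Phi> z) * (norm (G z) + 1)" using elim(3) by (simp add: mult_le_cancel_right)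
        have "norm (F z) \<le> norm (Z4 z * G z) + norm (Z5 z * P z) + norm (Z6 z)"
          unfolding elim(1) by (rule order_trans[OF norm_triangle_ineq add_right_mono[OF norm_triangle_ineq]])
        moreover have "norm (Z5 z) * norm (P z) \<le> norm (Z5 z) * (2 * norm (\<Phi> z) * (norm (G z) + 1))"
          using P by (intro mult_left_mono) auto
        ultimately have "norm (F z) \<le> norm (Z4 z) * norm (G z) + norm (Z5 z) * (2 * norm (\<Phi> z) * (norm (G z) + 1)) + norm (Z6 z)"
          by (simp add: norm_mult)
        also have "\<dots> \<le> (2 + norm (Z4 z) + 2 * (norm (Z5 z) * norm (\<Phi> z)) + norm (Z6 z)) * (norm (G z) + 1)"
          using nn by (simp add: algebra_simps)
        finally show ?thesis .
      qed
    qed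
  qed
qed

lemma G_le_F:
  obtains e where "esmall e" "\<forall>\<^sub>\<approx>z. norm (G z) \<le> e z * (norm (F z) + 1)"
proof -
  obtain Z where Z: "msmall Z" "\<forall>\<^sub>\<approx>z. G z = Z z * F z + (Z z - 1) * (a1 z / D z)" using L_factor by blast
  show thesis
  proof (rule that)
    show "esmall (\<lambda>z. norm (Z z) + norm ((Z z - 1) * (a1 z / D z)))"
      using a_small D_small by (intro esmall_add esmall_norm msmall_mult msmall_diff Z msmall_const small_msmall[OF small_divide])
    show "\<forall>\<^sub>\<approx>z. norm (G z) \<le> (norm (Z z) + norm ((Z z - 1) * (a1 z / D z))) * (norm (F z) + 1)"
      using Z(2)
    proof eventually_elim
      case (elim z)
      define w where "w = (Z z - 1) * (a1 z / D z)"
      have "norm (G z) \<le> norm (Z z) * norm (F z) + norm w"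
        unfolding elim w_def[symmetric] norm_mult[symmetric] by (rule norm_triangle_ineq)
      also have "\<dots> \<le> (norm (Z z) + norm w) * (norm (F z) + 1)" by (simp add: algebra_simps)
      finally show ?case unfolding w_def .
    qed
  qed
qed

text \<open>If \<kappa> does not vanish, F and G bound each other up to small factors; with F
  different from G, \<open>shared_values_small\<close> would make the proximity of F small, against
  \<open>F_not_msmall\<close>.\<close>

theorem f_eq_L_or_\<kappa>_zero: "(\<forall>\<^sub>\<approx>z. f z = L z) \<or> (\<forall>\<^sub>\<approx>z. \<kappa> z = 0)"
proof (rule ccontr)
  assume no: "\<not> ((\<forall>\<^sub>\<approx>z. f z = L z) \<or> (\<forall>\<^sub>\<approx>z. \<kappa> z = 0))"
  obtain e where e: "esmall e" "\<forall>\<^sub>\<approx>z. norm (F z) \<le> e z * (norm (G z) + 1)" using F_le_G no by blast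
  obtain e' where e': "esmall e'" "\<forall>\<^sub>\<approx>z. norm (G z) \<le> e' z * (norm (F z) + 1)" using G_le_F by blast
  have "\<not> (\<forall>\<^sub>\<approx>z. F z = G z)"
  proof
    assume "\<forall>\<^sub>\<approx>z. F z = G z"
    with f_eq L_eq_G have "\<forall>\<^sub>\<approx>z. f z = L z" by eventually_elim auto
    with no show False by blast
  qed
  moreover have "msmall (\<lambda>w. ld01 F w * (F w - G w))" using \<Phi>_msmall by (simp add: \<Phi>_def[abs_def])
  ultimately have "msmall F"
    using shared_values_small[OF F_tame F_nsmall F_neq_const F_neq_const G_tame G_nsmall G_nz G_neq_1 _ e e' _ Y_nsmall] by blast
  with F_not_msmall show False by simp
qed

text \<open>In terms of F and G one finds \<phi> = D \<Phi>, so the quotient that defines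
  \<open>\<psi> 1\<close> is \<theta> at z + c. The recursions then agree because differentiation
  commutes with translation.\<close>

lemma \<psi>_eq_\<theta>s:
  assumes phi: "\<And>z. \<phi> z =
           ((deriv a1 z - deriv a2 z) * (f z - a1 z) - (a1 z - a2 z) * (deriv f z - deriv a1 z))
             * (f z - L z) / ((f z - a1 z) * (f z - a2 z))"
    and psi_1: "\<And>z. \<psi> 1 z =
           (deriv a1 (z + c) - deriv a2 (z + c) - \<phi> (z + c)) / (a1 (z + c) - a2 (z + c))"
    and psi_Suc: "\<And>i z. 1 \<le> i \<Longrightarrow> i \<le> k - 1 \<Longrightarrow> \<psi> (i + 1) z = deriv (\<psi> i) z + \<psi> 1 z * \<psi> i z"
    and i: "1 \<le> i" "i \<le> k"
  shows "\<forall>\<^sub>\<approx>z. \<psi> i z = \<theta>s i (z + c)"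
proof -
  have d: "(h has_field_derivative deriv h z) (at z)" if "h analytic_on {z}" for h :: "complex \<Rightarrow> complex" and z
    using that analytic_on_imp_differentiable_at DERIV_deriv_iff_field_differentiable by blast
  have "\<forall>\<^sub>\<approx>z. (deriv a1 z - deriv a2 z - \<phi> z) / (a1 z - a2 z) = \<theta> z"
    using cosparse_deriv_cong[OF f_eq] D_nz F_neq_const[of 0] F_neq_const[of 1]
      meromorphic_on_imp_analytic_cosparse[OF small_mero[OF a_small(1)]]
      meromorphic_on_imp_analytic_cosparse[OF small_mero[OF a_small(2)]]
      meromorphic_on_imp_analytic_cosparse[OF small_mero[OF D_small]]
      meromorphic_on_imp_analytic_cosparse[OF F_mero] L_eq_G f_eq
  proof eventually_elim
    case (elim z)
    have "(D has_field_derivative (deriv a2 z - deriv a1 z)) (at z)"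
      unfolding D_def[abs_def] by (intro DERIV_diff d elim)
    hence D': "deriv D z = deriv a2 z - deriv a1 z" by (rule DERIV_imp_deriv)
    have "((\<lambda>z. a1 z + D z * F z) has_field_derivative (deriv a1 z + (deriv D z * F z + deriv F z * D z))) (at z)"
      by (intro DERIV_add DERIV_mult d elim)
    hence f': "deriv f z - deriv a1 z = deriv D z * F z + deriv F z * D z"
      using elim(1) DERIV_imp_deriv by (metis add_diff_cancel_left')
    have s0: "a1 z - a2 z = - D z" "a2 z = a1 z + D z" by (auto simp: D_def)
    have s1: "f z - a1 z = D z * F z" "f z - a2 z = D z * (F z - 1)"
      unfolding elim(10)[symmetric] s0(2) by (auto simp: algebra_simps)
    have s2: "f z - L z = D z * (F z - G z)"
      unfolding elim(9,10)[symmetric] by (simp add: algebra_simps)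
    have s3: "deriv a1 z - deriv a2 z = - deriv D z" using D' by simp
    note s = s0(1) s1 s2 s3
    have "\<phi> z = D z * \<Phi> z"
      unfolding phi s f' \<Phi>_def ld01_def using elim(2-4)
      by (simp add: divide_simps) (simp add: algebra_simps)
    thus ?case unfolding s \<theta>_def using elim(2) by (simp add: field_simps)
  qed
  from cosparse_shift[OF this, of c] have 1: "\<forall>\<^sub>\<approx>z. \<psi> 1 z = \<theta> (z + c)" unfolding psi_1 .
  show ?thesis using i
  proof (induction i rule: nat_induct_at_least)
    case base
    show ?case using 1 by (simp add: deriv_const)
  next
    case (Suc i)
    hence IH: "\<forall>\<^sub>\<approx>z. \<psi> i z = \<theta>s i (z + c)" by simp
    have dt: "deriv (\<lambda>z. \<theta>s i (z + c)) z = deriv (\<theta>s i) (z + c)" for z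
      using fun_cong[OF deriv_translate[of "\<theta>s i" c], of z] by (simp add: add.commute)
    from cosparse_deriv_cong[OF IH] IH 1 show ?case
    proof eventually_elim
      case (elim z)
      have "\<psi> (i + 1) z = deriv (\<psi> i) z + \<psi> 1 z * \<psi> i z" using Suc by (intro psi_Suc) auto
      thus ?case using elim by (simp add: dt)
    qed
  qed
qed

end

section \<open>Growth of entire functions of hyper-order less than one\<close>

text \<open>The squared moduli of denominator and numerator differ by (R^2 - |a|^2)(R^2 -
  |z|^2).\<close>

lemma norm_blaschke_le_1:
  assumes "norm a < R" "norm z < R"
  shows "norm (blaschke R a z) \<le> 1"
proof -
  have R: "R > 0" using assms norm_ge_zero[of a] by linarith
  have "(norm (of_real (R\<^sup>2) - cnj a * z))\<^sup>2 - (R * norm (z - a))\<^sup>2 = (R\<^sup>2 - (norm a)\<^sup>2) * (R\<^sup>2 - (norm z)\<^sup>2)"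
    unfolding power_mult_distrib cmod_power2 by (simp add: power2_eq_square algebra_simps)
  moreover have "(norm a)\<^sup>2 \<le> R\<^sup>2" "(norm z)\<^sup>2 \<le> R\<^sup>2" using assms by (intro power_mono; simp)+
  ultimately have "(R * norm (z - a))\<^sup>2 \<le> (norm (of_real (R\<^sup>2) - cnj a * z))\<^sup>2"
    by (smt (verit) mult_nonneg_nonneg)
  hence "R * norm (z - a) \<le> norm (of_real (R\<^sup>2) - cnj a * z)" by (rule power2_le_imp_le) simp
  moreover have "of_real (R\<^sup>2) - cnj a * z \<noteq> 0" using assms by (intro blaschke_denom_nz) auto
  ultimately show ?thesis using R unfolding blaschke_def by (simp add: norm_divide norm_mult divide_le_eq)
qed

lemma zorder_analytic_nonneg:
  assumes "f analytic_on {z}" "eventually (\<lambda>w. f w \<noteq> 0) (at z)"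
  shows "zorder f z \<ge> 0"
proof -
  obtain F where F: "(\<lambda>w. f (z + w)) has_laurent_expansion F"
    using analytic_on_imp_meromorphic_on[OF assms(1)] by (auto simp: meromorphic_on_def)
  have "nat (- fls_subdegree F) = 0"
    using pole_ord_laurent[OF F] pole_ord_analytic[OF assms(1)] by simp
  moreover have "F \<noteq> 0" using has_laurent_expansion_eventually_nonzero_iff[OF F] assms(2) by simp
  ultimately show ?thesis using has_laurent_expansion_zorder[OF F] by simp
qed

lemma poisson_kernel_nonneg:
  assumes "norm z < norm w"
  shows "poisson_kernel z w \<ge> 0"
proof -
  have "(norm z)\<^sup>2 \<le> (norm w)\<^sup>2" using assms by (intro power_mono) auto
  thus ?thesis using assms by (subst poisson_kernel_eq) auto
qed

lemma continuous_on_poisson_kernel: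
  assumes "norm z < R"
  shows "continuous_on (sphere 0 R) (poisson_kernel z)"
  unfolding poisson_kernel_def[abs_def] using assms by (intro continuous_intros) auto

text \<open>Subharmonicity of log+ |f|: an entire f has zeros but no poles, so its Blaschke terms
  are nonpositive inside the disc, and ln |f| is at most the Poisson integral of its boundary
  values.\<close>

lemma log_plus_le_Poisson:
  assumes f: "f analytic_on UNIV" "\<forall>\<^sub>\<approx>z. f z \<noteq> 0" and reg: "regular_radius f R" and z: "norm z < R"
  shows "log_plus (norm (f z)) \<le> circ_mean R (\<lambda>w. log_plus (norm (f w)) * poisson_kernel z w)"
proof -
  have R: "R > 0" using z norm_ge_zero[of z] by linarith
  have an: "f analytic_on {w}" for w using f(1) by (rule analytic_on_subset) auto
  have fc: "continuous_on A f" for A using f(1) analytic_imp_holomorphic holomorphic_on_imp_continuous_on continuous_on_subset by blast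
  have c1: "continuous_on (sphere 0 R) (\<lambda>w. log_plus (norm (f w)) * poisson_kernel z w)"
    by (intro continuous_intros continuous_on_log_plus fc continuous_on_poisson_kernel z)
  have pk: "poisson_kernel z w \<ge> 0" if "norm w = R" for w using poisson_kernel_nonneg z that by auto
  have "circ_mean R (\<lambda>w. 0 :: real) \<le> circ_mean R (\<lambda>w. log_plus (norm (f w)) * poisson_kernel z w)"
    using R pk log_plus_nonneg by (intro circ_mean_mono c1) auto
  hence nn: "circ_mean R (\<lambda>w. log_plus (norm (f w)) * poisson_kernel z w) \<ge> 0" by simp
  show ?thesis
  proof (cases "f z = 0")
    case True
    thus ?thesis using nn by (simp add: log_plus_def)
  next
    case False
    obtain u where u: "u holomorphic_on cball 0 R" "\<And>z. norm z = R \<Longrightarrow> Re (u z) = ln (norm (f z))"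
      "\<And>z. norm z < R \<Longrightarrow> f analytic_on {z} \<Longrightarrow> f z \<noteq> 0 \<Longrightarrow>
         ln (norm (f z)) = Re (u z) + (\<Sum>a\<in>zero_pole_set f R. of_int (zorder f a) * ln (norm (blaschke R a z)))"
      by (rule Blaschke_log_factorisation[OF analytic_on_imp_meromorphic_on[OF f(1)] f(2) reg]) (rule that)
    have "(\<Sum>a\<in>zero_pole_set f R. of_int (zorder f a) * ln (norm (blaschke R a z))) \<le> 0"
    proof (rule sum_nonpos)
      fix a assume a: "a \<in> zero_pole_set f R"
      have aR: "norm a < R" using zero_pole_set_interior[OF reg a] by simp
      have "eventually (\<lambda>w. f w \<noteq> 0) (at a)" using f(2) by (rule eventually_cosparse_imp_eventually_at) simp
      hence "zorder f a \<ge> 0" using an by (intro zorder_analytic_nonneg)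
      moreover have "ln (norm (blaschke R a z)) \<le> 0"
        using norm_blaschke_le_1[OF aR z] by (cases "blaschke R a z = 0") (auto simp: ln_le_zero_iff)
      ultimately show "of_int (zorder f a) * ln (norm (blaschke R a z)) \<le> 0" by (intro mult_nonneg_nonpos) auto
    qed
    hence "ln (norm (f z)) \<le> Re (u z)" using u(3)[OF z an False] by linarith
    also have "Re (u z) = circ_mean R (\<lambda>w. Re (u w) * poisson_kernel z w)" by (rule Poisson_formula[OF u(1) z])
    also have "\<dots> \<le> circ_mean R (\<lambda>w. log_plus (norm (f w)) * poisson_kernel z w)"
    proof (rule circ_mean_mono[OF _ c1])
      have "continuous_on (sphere 0 R) u"
        by (rule continuous_on_subset[OF holomorphic_on_imp_continuous_on[OF u(1)]]) auto
      thus "continuous_on (sphere 0 R) (\<lambda>w. Re (u w) * poisson_kernel z w)"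
        by (intro continuous_intros continuous_on_poisson_kernel z)
      show "Re (u w) * poisson_kernel z w \<le> log_plus (norm (f w)) * poisson_kernel z w" if "norm w = R" for w
        using pk[OF that] u(2)[OF that] by (intro mult_right_mono) (auto simp: log_plus_def)
    qed (use R in auto)
    finally show ?thesis using nn by (simp add: log_plus_def)
  qed
qed

text \<open>The Poisson bound is averaged over the inner circle; after interchanging the means the
  kernel averages to 1.\<close>

lemma proximity_mono_regular:
  assumes f: "f analytic_on UNIV" "\<forall>\<^sub>\<approx>z. f z \<noteq> 0" and reg: "regular_radius f R" and r: "0 < r" "r < R"
  shows "proximity r f \<le> proximity R f"
proof -
  have fc: "continuous_on A f" for A using f(1) analytic_imp_holomorphic holomorphic_on_imp_continuous_on continuous_on_subset by blast
  have c: "continuous_on (sphere 0 r \<times> sphere 0 R) (\<lambda>(z, w). log_plus (norm (f w)) * poisson_kernel z w)"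
    unfolding case_prod_unfold poisson_kernel_def
    by (intro continuous_intros continuous_on_compose2[OF continuous_on_log_plus[OF fc[of UNIV]]]) (use r in auto)
  have "proximity r f \<le> circ_mean r (\<lambda>z. circ_mean R (\<lambda>w. log_plus (norm (f w)) * poisson_kernel z w))"
    unfolding proximity_eq
  proof (rule circ_mean_mono)
    show "continuous_on (sphere 0 r) (\<lambda>z. circ_mean R (\<lambda>w. log_plus (norm (f w)) * poisson_kernel z w))"
      using r by (intro continuous_on_circ_mean_param c) auto
  qed (use r in \<open>auto intro!: continuous_on_log_plus fc log_plus_le_Poisson[OF f reg]\<close>)
  also have "\<dots> = circ_mean R (\<lambda>w. circ_mean r (\<lambda>z. log_plus (norm (f w)) * poisson_kernel z w))"
    using r by (intro circ_mean_swap c) auto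
  also have "\<dots> = circ_mean R (\<lambda>w. log_plus (norm (f w)))"
  proof (rule circ_mean_cong)
    fix w :: complex assume "norm w = R"
    thus "circ_mean r (\<lambda>z. log_plus (norm (f w)) * poisson_kernel z w) = log_plus (norm (f w))"
      using r by (simp add: circ_mean_cmult circ_mean_poisson_kernel)
  qed (use r in auto)
  finally show ?thesis by (simp add: proximity_eq)
qed

lemma exists_regular_radius:
  assumes f: "f meromorphic_on UNIV" "\<forall>\<^sub>\<approx>z. f z \<noteq> 0" and ab: "a < b"
  obtains R where "a < R" "R < b" "regular_radius f R"
proof -
  have "\<forall>\<^sub>\<approx>z. f analytic_on {z} \<and> f z \<noteq> 0"
    using meromorphic_on_imp_analytic_cosparse[OF f(1)] f(2) by eventually_elim auto
  hence "countable {z. \<not> (f analytic_on {z} \<and> f z \<noteq> 0)}" unfolding eventually_cosparse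
    using sparse_imp_countable[of UNIV "{z. \<not> (f analytic_on {z} \<and> f z \<noteq> 0)}"] by simp
  hence "countable (norm ` {z. \<not> (f analytic_on {z} \<and> f z \<noteq> 0)})" by (rule countable_image)
  moreover have "uncountable {a<..<b}" using ab by (simp add: uncountable_open_interval)
  ultimately have "\<not> {a<..<b} \<subseteq> norm ` {z. \<not> (f analytic_on {z} \<and> f z \<noteq> 0)}" using countable_subset by blast
  then obtain R where "R \<in> {a<..<b}" "R \<notin> norm ` {z. \<not> (f analytic_on {z} \<and> f z \<noteq> 0)}" by blast
  thus thesis by (intro that[of R]) (auto simp: regular_radius_def)
qed

lemma continuous_on_proximity:
  assumes "continuous_on UNIV f"
  shows "continuous_on UNIV (\<lambda>s. proximity s f)"
proof -
  have "continuous_on (UNIV \<times> sphere 0 1) (\<lambda>(z, w). log_plus (norm (f (z * w))))"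
    unfolding case_prod_unfold
    by (rule continuous_on_compose2[OF continuous_on_log_plus[OF assms]]) (auto intro!: continuous_intros)
  hence "continuous_on UNIV (\<lambda>z. circ_mean 1 (\<lambda>w. log_plus (norm (f (z * w)))))"
    by (rule continuous_on_circ_mean_param) simp
  from continuous_on_compose2[OF this, of UNIV complex_of_real]
  have "continuous_on UNIV (\<lambda>s. circ_mean 1 (\<lambda>w. log_plus (norm (f (of_real s * w)))))"
    by (simp add: continuous_intros)
  moreover have "circ_mean 1 (\<lambda>w. log_plus (norm (f (of_real s * w)))) = proximity s f" for s
    unfolding proximity_eq circ_mean_def by simp
  ultimately show ?thesis by simp
qed

lemma proximity_mono:
  assumes f: "f analytic_on UNIV" "\<forall>\<^sub>\<approx>z. f z \<noteq> 0" and r: "0 < r" "r \<le> R"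
  shows "proximity r f \<le> proximity R f"
proof (rule ccontr)
  assume no: "\<not> ?thesis"
  have "continuous_on UNIV f" using f(1) analytic_imp_holomorphic holomorphic_on_imp_continuous_on by blast
  hence "isCont (\<lambda>s. proximity s f) R" using continuous_on_proximity by (simp add: continuous_on_eq_continuous_at)
  hence "eventually (\<lambda>s. proximity s f < proximity r f) (at R)"
    using no by (intro order_tendstoD[of _ "proximity R f"]) (auto simp: isCont_def)
  then obtain d where d: "d > 0" "\<And>s. s \<noteq> R \<Longrightarrow> dist s R < d \<Longrightarrow> proximity s f < proximity r f"
    by (auto simp: eventually_at)
  obtain R' where R': "R < R'" "R' < R + d" "regular_radius f R'"
    using exists_regular_radius[OF analytic_on_imp_meromorphic_on[OF f(1)] f(2), of R "R + d"] d(1) by auto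
  have "proximity r f \<le> proximity R' f" using R' r by (intro proximity_mono_regular f) auto
  moreover have "proximity R' f < proximity r f" using R' by (intro d(2)) (auto simp: dist_real_def)
  ultimately show False by simp
qed

lemma entire_nonzero:
  assumes f: "f analytic_on UNIV" "\<not> f constant_on UNIV"
  shows "\<forall>\<^sub>\<approx>z. f z \<noteq> 0"
  using meromorphic_zero_dichotomy[OF analytic_on_imp_meromorphic_on[OF f(1)]]
  proof
    assume z: "\<forall>\<^sub>\<approx>z. f z = 0"
    have "f z = 0" for z
    proof -
      have "isCont f z" using f(1) by (intro analytic_at_imp_isCont) (rule analytic_on_subset, auto)
      hence "f \<midarrow>z\<rightarrow> f z" by (simp add: isCont_def)
      moreover have "f \<midarrow>z\<rightarrow> 0"
        using eventually_cosparse_imp_eventually_at[OF z, of z UNIV] by (intro tendsto_eventually) auto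
      ultimately show ?thesis using LIM_unique by blast
    qed
    hence "f constant_on UNIV" by (auto simp: constant_on_def)
    with f(2) show ?thesis by simp
  qed

text \<open>If the proximity function stayed bounded, the Poisson bound on a circle with R > 2 |z|,
  where the kernel is at most 3, would bound f, against Liouville's theorem. Monotonicity turns
  unboundedness into divergence.\<close>

lemma proximity_at_top:
  assumes f: "f analytic_on UNIV" "\<not> f constant_on UNIV"
  shows "filterlim (\<lambda>r. proximity r f) at_top at_top"
proof -
  have nz: "\<forall>\<^sub>\<approx>z. f z \<noteq> 0" by (rule entire_nonzero[OF f])
  have unb: "\<exists>r\<ge>1. proximity r f > K" for K
  proof (rule ccontr)
    assume "\<not> ?thesis"
    hence K: "\<And>r. r \<ge> 1 \<Longrightarrow> proximity r f \<le> K" by (auto simp: not_less)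
    have "norm (f z) \<le> exp (3 * K)" for z
    proof -
      obtain R where R: "2 * norm z + 1 < R" "regular_radius f R"
        using exists_regular_radius[OF analytic_on_imp_meromorphic_on[OF f(1)] nz, of "2 * norm z + 1" "2 * norm z + 2"] by auto
      have zR: "norm z < R" "R > 0" using R norm_ge_zero[of z] by linarith+
      have fc: "continuous_on A f" for A using f(1) analytic_imp_holomorphic holomorphic_on_imp_continuous_on continuous_on_subset by blast
      have pk: "poisson_kernel z w \<le> 3" if "norm w = R" for w
      proof -
        have "R - norm z \<le> norm (w - z)" using norm_triangle_ineq2[of w z] that by simp
        hence "(R - norm z)\<^sup>2 \<le> (norm (w - z))\<^sup>2" using zR by (intro power_mono) auto
        moreover have "R\<^sup>2 - (norm z)\<^sup>2 \<le> 3 * (R - norm z)\<^sup>2"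
        proof -
          have "3 * (R - norm z)\<^sup>2 - (R\<^sup>2 - (norm z)\<^sup>2) = 2 * ((R - norm z) * (R - 2 * norm z))"
            by (simp add: power2_eq_square algebra_simps)
          also have "\<dots> \<ge> 0" using R zR by simp
          finally show ?thesis by simp
        qed
        ultimately have "R\<^sup>2 - (norm z)\<^sup>2 \<le> 3 * (norm (w - z))\<^sup>2" by linarith
        moreover have "w \<noteq> z" using that zR by auto
        ultimately show ?thesis using that zR by (subst poisson_kernel_eq) (auto simp: divide_le_eq)
      qed
      have "log_plus (norm (f z)) \<le> circ_mean R (\<lambda>w. log_plus (norm (f w)) * poisson_kernel z w)"
        by (rule log_plus_le_Poisson[OF f(1) nz R(2) zR(1)])
      also have "\<dots> \<le> circ_mean R (\<lambda>w. 3 * log_plus (norm (f w)))"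
      proof (rule circ_mean_mono)
        show "log_plus (norm (f w)) * poisson_kernel z w \<le> 3 * log_plus (norm (f w))" if "norm w = R" for w
          using mult_left_mono[OF pk[OF that] log_plus_nonneg[of "norm (f w)"]] by simp
      qed (use zR in \<open>auto intro!: continuous_intros continuous_on_log_plus fc continuous_on_poisson_kernel\<close>)
      also have "\<dots> = 3 * proximity R f" by (simp add: circ_mean_cmult proximity_eq)
      also have "\<dots> \<le> 3 * K" using K[of R] R norm_ge_zero[of z] by (intro mult_left_mono) linarith+
      finally have "ln (norm (f z)) \<le> 3 * K" by (simp add: log_plus_def)
      hence "exp (ln (norm (f z))) \<le> exp (3 * K)" by simp
      thus ?thesis by (cases "f z = 0") auto
    qed
    hence "bounded (range f)" by (auto simp: bounded_iff)
    from Liouville_theorem[OF analytic_imp_holomorphic[OF f(1)] this] f(2) show False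
      by (auto simp: constant_on_def)
  qed
  show ?thesis
    unfolding filterlim_at_top
  proof
    fix K :: real
    obtain r where r: "r \<ge> 1" "proximity r f > K" using unb by blast
    show "eventually (\<lambda>s. K \<le> proximity s f) at_top"
      using eventually_ge_at_top[of r]
      by eventually_elim (use r proximity_mono[OF f(1) nz, of r] in force)
  qed
qed

section \<open>From the hyper-order to a sequence of windows\<close>

lemma nevanlinna_T_entire:
  assumes "f analytic_on UNIV"
  shows "nevanlinna_T r f = proximity r f"
proof -
  have "\<not> is_pole f z" for z using assms by (intro analytic_at_imp_no_pole) (rule analytic_on_subset, auto)
  hence "pole_count t f = 0" for t by (simp add: pole_count_def)
  thus ?thesis by (simp add: nevanlinna_T_def pole_counting_def)
qed

lemma hyper_order_less_1:
  assumes "hyper_order f < 1" and T: "filterlim (\<lambda>r. nevanlinna_T r f) at_top at_top"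
  obtains \<sigma> where "0 < \<sigma>" "\<sigma> < 1" "eventually (\<lambda>r. nevanlinna_T r f \<le> exp (r powr \<sigma>)) at_top"
proof -
  obtain s where s: "hyper_order f < s" "s < 1" using assms(1) dense by blast
  obtain s' where s': "s = ereal s'" using s by (cases s) auto
  \<comment> \<open>1/2 is an arbitrary value that keeps \<sigma> positive.\<close>
  define \<sigma> where "\<sigma> = max s' (1/2)"
  have \<sigma>: "0 < \<sigma>" "\<sigma> < 1" "s' \<le> \<sigma>" using s s' by (auto simp: \<sigma>_def one_ereal_def)
  have "eventually (\<lambda>r. ereal (ln (ln (nevanlinna_T r f)) / ln r) < s) at_top"
    using s(1) unfolding hyper_order_def by (rule Limsup_lessD)
  moreover have "eventually (\<lambda>r. nevanlinna_T r f > exp 1) at_top" using T by (simp add: filterlim_at_top_dense)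
  ultimately have "eventually (\<lambda>r. nevanlinna_T r f \<le> exp (r powr \<sigma>)) at_top"
    using eventually_gt_at_top[of 1]
  proof eventually_elim
    case (elim r)
    have T1: "nevanlinna_T r f > 1" using elim(2) exp_gt_one[of 1] by linarith
    hence lT: "ln (nevanlinna_T r f) > 0" by simp
    have "ln (ln (nevanlinna_T r f)) < s' * ln r" using elim by (simp add: s' divide_less_eq)
    also have "\<dots> \<le> \<sigma> * ln r" using \<sigma> elim by (intro mult_right_mono) auto
    finally have "ln (nevanlinna_T r f) < exp (\<sigma> * ln r)" using lT by (metis exp_less_mono exp_ln)
    hence "ln (nevanlinna_T r f) < r powr \<sigma>" using elim by (simp add: powr_def)
    hence "exp (ln (nevanlinna_T r f)) \<le> exp (r powr \<sigma>)" by simp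
    thus ?case using T1 by simp
  qed
  with \<sigma> that show thesis by blast
qed

lemma filterlim_powr_at_top:
  assumes "0 < a"
  shows "filterlim (\<lambda>x::real. x powr a) at_top at_top"
proof -
  have "filterlim (\<lambda>x. exp (a * ln x)) at_top at_top"
    by (intro filterlim_compose[OF exp_at_top] filterlim_tendsto_pos_mult_at_top[OF tendsto_const assms ln_at_top])
  moreover have "eventually (\<lambda>x. exp (a * ln x) = x powr a) at_top"
    using eventually_gt_at_top[of 0] by eventually_elim (simp add: powr_def)
  ultimately show ?thesis by (rule filterlim_mono_eventually[OF _ order_refl order_refl])
qed

text \<open>If T more than doubled on every step of length \<rho>^\<beta>, the roughly
  \<rho>^(1-\<beta>) steps from \<rho> to 2 \<rho> would push T beyond exp((2\<rho>)^\<sigma>),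
  because 1 - \<beta> > \<sigma>.\<close>

lemma exists_doubling_window:
  fixes T :: "real \<Rightarrow> real"
  assumes mono: "\<And>r s. 0 < r \<Longrightarrow> r \<le> s \<Longrightarrow> T r \<le> T s" and inf: "filterlim T at_top at_top"
    and \<sigma>: "0 < \<sigma>" "\<sigma> < 1" and le: "eventually (\<lambda>r. T r \<le> exp (r powr \<sigma>)) at_top"
    and \<beta>: "0 < \<beta>" "\<beta> < 1 - \<sigma>"
  shows "eventually (\<lambda>\<rho>. \<exists>r. \<rho> \<le> r \<and> r \<le> 2 * \<rho> \<and> T (r + \<rho> powr \<beta>) \<le> 2 * T r) at_top"
proof -
  have fl2: "filterlim (\<lambda>\<rho>::real. 2 * \<rho>) at_top at_top"
    by (intro filterlim_tendsto_pos_mult_at_top[OF tendsto_const] filterlim_ident) auto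
  have "filterlim (\<lambda>\<rho>::real. \<rho> powr (1 - \<beta> - \<sigma>)) at_top at_top" using \<beta> by (intro filterlim_powr_at_top) auto
  \<comment> \<open>The threshold is read off from the final chain: 2^\<sigma>/ln 2 from comparing
    the two exponentials, 1 from rounding the number of steps.\<close>
  hence "eventually (\<lambda>\<rho>::real. \<rho> powr (1 - \<beta> - \<sigma>) > 2 powr \<sigma> / ln 2 + 1) at_top" by (simp add: filterlim_at_top_dense)
  moreover have "eventually (\<lambda>\<rho>. T (2 * \<rho>) \<le> exp ((2 * \<rho>) powr \<sigma>)) at_top"
    using eventually_compose_filterlim[OF le fl2] .
  moreover have "eventually (\<lambda>\<rho>. T \<rho> \<ge> 1) at_top" using inf by (simp add: filterlim_at_top)
  ultimately show ?thesis using eventually_ge_at_top[of 1]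
  proof eventually_elim
    case (elim \<rho>)
    show ?case
    proof (rule ccontr)
      assume no: "\<not> ?thesis"
      define h where "h = \<rho> powr \<beta>"
      have h: "h > 0" using elim by (simp add: h_def)
      define N where "N = nat \<lfloor>\<rho> / h\<rfloor>"
      have N: "real N \<le> \<rho> / h" "\<rho> / h < real N + 1" unfolding N_def using elim h by (auto simp: of_nat_nat)
      hence Nh: "real N * h \<le> \<rho>" using h by (simp add: field_simps)
      have "j \<le> N \<Longrightarrow> 2 ^ j \<le> T (\<rho> + real j * h)" for j
      proof (induction j)
        case 0
        show ?case using elim by simp
      next
        case (Suc j)
        have "real j * h \<le> real N * h" using Suc h by (intro mult_right_mono) auto
        moreover have "real j * h \<ge> 0" using h by simp
        ultimately have "\<rho> \<le> \<rho> + real j * h" "\<rho> + real j * h \<le> 2 * \<rho>" using Nh by linarith+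
        hence "T (\<rho> + real j * h + h) > 2 * T (\<rho> + real j * h)"
          using no unfolding h_def[symmetric] by (meson not_le)
        moreover have "\<rho> + real j * h + h = \<rho> + real (Suc j) * h" by (simp add: algebra_simps)
        ultimately show ?case using Suc by simp
      qed
      from this[of N] have "2 ^ N \<le> T (\<rho> + real N * h)" by simp
      also have "\<dots> \<le> T (2 * \<rho>)" using Nh elim h by (intro mono) (auto intro: add_pos_nonneg)
      also have "\<dots> \<le> exp ((2 * \<rho>) powr \<sigma>)" using elim by simp
      finally have "ln (2 ^ N) \<le> ln (exp ((2 * \<rho>) powr \<sigma>))" by (intro ln_mono) auto
      hence "real N * ln 2 \<le> (2 * \<rho>) powr \<sigma>" by (simp add: ln_realpow)
      hence "real N \<le> 2 powr \<sigma> * \<rho> powr \<sigma> / ln 2" using elim by (simp add: powr_mult field_simps)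
      moreover have "\<rho> / h = \<rho> powr (1 - \<beta>)" using elim by (simp add: h_def powr_diff)
      ultimately have "\<rho> powr (1 - \<beta>) < 2 powr \<sigma> / ln 2 * \<rho> powr \<sigma> + 1" using N(2) by simp
      also have "\<dots> \<le> (2 powr \<sigma> / ln 2 + 1) * \<rho> powr \<sigma>"
        using elim \<sigma> ge_one_powr_ge_zero[of \<rho> \<sigma>] by (simp add: algebra_simps)
      also have "\<dots> \<le> \<rho> powr (1 - \<beta> - \<sigma>) * \<rho> powr \<sigma>" using elim by (intro mult_right_mono) auto
      also have "\<dots> = \<rho> powr (1 - \<beta>)" by (simp add: powr_add[symmetric])
      finally show False by simp
    qed
  qed
qed

theorem windows_exist:
  assumes f: "f analytic_on UNIV" "\<not> f constant_on UNIV" "hyper_order f < 1"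
  obtains r h \<alpha> where "windows r h (\<lambda>n. proximity (r n) f) \<alpha>"
    "\<And>n s. s \<in> {r n..r n + h n} \<Longrightarrow> proximity (r n) f \<le> proximity s f \<and> proximity s f \<le> 2 * proximity (r n) f"
proof -
  have inf: "filterlim (\<lambda>r. proximity r f) at_top at_top" by (rule proximity_at_top[OF f(1,2)])
  have nz: "\<forall>\<^sub>\<approx>z. f z \<noteq> 0" by (rule entire_nonzero[OF f(1,2)])
  note mono = proximity_mono[OF f(1) nz]
  obtain \<sigma> where \<sigma>: "0 < \<sigma>" "\<sigma> < 1" "eventually (\<lambda>r. proximity r f \<le> exp (r powr \<sigma>)) at_top"
    using hyper_order_less_1[OF f(3)] inf unfolding nevanlinna_T_entire[OF f(1)] by blast
  \<comment> \<open>Half of the admissible range \<beta> < 1 - \<sigma>.\<close>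
  define \<beta> where "\<beta> = (1 - \<sigma>) / 2"
  have \<beta>: "0 < \<beta>" "\<beta> < 1 - \<sigma>" "\<beta> < 1" using \<sigma> by (auto simp: \<beta>_def)
  obtain \<rho>0 where \<rho>0: "\<And>\<rho>. \<rho> \<ge> \<rho>0 \<Longrightarrow> \<exists>r. \<rho> \<le> r \<and> r \<le> 2 * \<rho> \<and> proximity (r + \<rho> powr \<beta>) f \<le> 2 * proximity r f"
    using exists_doubling_window[OF mono inf \<sigma> \<beta>(1,2)] by (auto simp: eventually_at_top_linorder)
  define \<rho> where "\<rho> = (\<lambda>n. max 1 \<rho>0 + real n)"
  have \<rho>: "\<rho> n \<ge> 1" "\<rho> n \<ge> \<rho>0" for n by (auto simp: \<rho>_def)
  have \<rho>lim: "filterlim \<rho> at_top sequentially"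
    unfolding \<rho>_def by (intro filterlim_tendsto_add_at_top[OF tendsto_const] filterlim_real_sequentially)
  have "\<exists>r. \<forall>n. \<rho> n \<le> r n \<and> r n \<le> 2 * \<rho> n \<and> proximity (r n + \<rho> n powr \<beta>) f \<le> 2 * proximity (r n) f"
    using \<rho>0[OF \<rho>(2)] by (intro choice) blast
  then obtain r where r: "\<And>n. \<rho> n \<le> r n" "\<And>n. r n \<le> 2 * \<rho> n" "\<And>n. proximity (r n + \<rho> n powr \<beta>) f \<le> 2 * proximity (r n) f"
    by blast
  have rpos: "r n > 0" for n using r(1)[of n] \<rho>(1)[of n] by linarith
  have rlim: "filterlim r at_top sequentially" by (rule filterlim_at_top_mono[OF \<rho>lim]) (simp add: r)
  define h where "h = (\<lambda>n. \<rho> n powr \<beta>)"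
  show thesis
  proof (rule that)
    \<comment> \<open>With \<alpha> = 1 - \<beta>/2 the condition on the windows reads
      r^(\<beta>/2)/\<rho>^\<beta> -> 0, which holds because r is at most 2 \<rho>.\<close>
    show "windows r h (\<lambda>n. proximity (r n) f) (1 - \<beta> / 2)"
    proof
      show "0 < 1 - \<beta> / 2" "1 - \<beta> / 2 < 1" using \<beta> by auto
      show "h n \<le> r n" for n
        using powr_mono[of \<beta> 1 "\<rho> n"] \<beta> \<rho>(1)[of n] r(1)[of n] by (simp add: h_def)
      show "filterlim h at_top sequentially"
        unfolding h_def by (rule filterlim_compose[OF filterlim_powr_at_top[OF \<beta>(1)] \<rho>lim])
      show "filterlim (\<lambda>n. proximity (r n) f) at_top sequentially" by (rule filterlim_compose[OF inf rlim])
      have b: "r n powr (\<beta> / 2) / h n \<le> 2 powr (\<beta> / 2) * \<rho> n powr (- (\<beta> / 2))" for n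
      proof -
        have p: "\<rho> n > 0" using \<rho>(1)[of n] by simp
        have "r n powr (\<beta> / 2) \<le> (2 * \<rho> n) powr (\<beta> / 2)" using r(2) rpos[of n] \<beta> by (intro powr_mono2) auto
        hence "r n powr (\<beta> / 2) / h n \<le> (2 * \<rho> n) powr (\<beta> / 2) / h n" using p by (intro divide_right_mono) (auto simp: h_def)
        also have "\<dots> = 2 powr (\<beta> / 2) * (\<rho> n powr (\<beta> / 2) / \<rho> n powr \<beta>)" using p by (simp add: h_def powr_mult)
        also have "\<rho> n powr (\<beta> / 2) / \<rho> n powr \<beta> = \<rho> n powr (\<beta> / 2 - \<beta>)" by (rule powr_diff[symmetric])
        also have "\<beta> / 2 - \<beta> = - (\<beta> / 2)" by simp
        finally show ?thesis .
      qed
      have "(\<lambda>n. \<rho> n powr (- (\<beta> / 2))) \<longlonglongrightarrow> 0" using \<beta> by (intro tendsto_neg_powr \<rho>lim) auto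
      hence lim: "(\<lambda>n. 2 powr (\<beta> / 2) * \<rho> n powr (- (\<beta> / 2))) \<longlonglongrightarrow> 0" by (intro tendsto_mult_right_zero)
      have "(\<lambda>n. r n powr (\<beta> / 2) / h n) \<longlonglongrightarrow> 0"
        by (rule tendsto_sandwich[OF always_eventually always_eventually tendsto_const lim]) (auto intro: b, simp add: h_def)
      thus "(\<lambda>n. r n powr (1 - (1 - \<beta> / 2)) / h n) \<longlonglongrightarrow> 0" by simp
    qed
    fix n s assume s: "s \<in> {r n..r n + h n}"
    have "proximity s f \<le> proximity (r n + h n) f" using s rpos[of n] by (intro mono) auto
    thus "proximity (r n) f \<le> proximity s f \<and> proximity s f \<le> 2 * proximity (r n) f"
      using s rpos[of n] mono[of "r n" s] r(3)[of n] by (auto simp: h_def)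
  qed
qed

section \<open>Small functions in the sense of Nevanlinna\<close>

lemma integral_inverse_cutoff:
  fixes \<rho> r :: real
  assumes "0 < \<rho>" "\<rho> \<le> r"
  shows "((\<lambda>t. if \<rho> \<le> t then 1 / t else 0) has_integral ln (r / \<rho>)) {0..r}"
proof -
  have "((\<lambda>t. 1 / t) has_integral (ln r - ln \<rho>)) {\<rho>..r}"
    using assms by (intro fundamental_theorem_of_calculus)
      (auto simp flip: has_real_derivative_iff_has_vector_derivative intro!: derivative_eq_intros)
  moreover have "ln r - ln \<rho> = ln (r / \<rho>)" using assms by (simp add: ln_divide_pos)
  moreover have "{\<rho>..r} \<subseteq> {0..r}" using assms by auto
  ultimately have "((\<lambda>t. if t \<in> {\<rho>..r} then 1 / t else 0) has_integral ln (r / \<rho>)) {0..r}"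
    by (subst has_integral_restrict) auto
  thus ?thesis by (rule has_integral_eq[rotated]) auto
qed

lemma pole_count_eq:
  assumes m: "a meromorphic_on UNIV" and t: "t \<le> r"
  shows "real (pole_count t a) = (\<Sum>z | norm z \<le> r \<and> pole_ord a z \<noteq> 0. if norm z \<le> t then real (pole_ord a z) else 0)"
proof -
  have fin: "finite {z. norm z \<le> r \<and> pole_ord a z \<noteq> 0}"
    using loc_finite_pole_ord[OF m] by (simp add: loc_finite_def)
  have ip: "is_pole a z \<longleftrightarrow> pole_ord a z \<noteq> 0" for z
    using pole_ord_eq_0_iff[OF meromorphic_on_subset[OF m subset_UNIV], of z] by simp
  have "pole_count t a = (\<Sum>z | norm z \<le> t \<and> pole_ord a z \<noteq> 0. pole_ord a z)"
    unfolding pole_count_def ip by (intro sum.cong) (auto simp: pole_ord_def split: if_splits)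
  also have "\<dots> = (\<Sum>z | norm z \<le> r \<and> pole_ord a z \<noteq> 0. if norm z \<le> t then pole_ord a z else 0)"
    using t by (intro sum.mono_neutral_cong_left fin) auto
  finally show ?thesis by (simp add: of_nat_sum if_distrib cong: if_cong)
qed

text \<open>Integrating the classical formula pole by pole gives each pole off the origin the weight
  ln (r/|z|); \<open>counting\<close> replaces |z| by max 1 |z|, which can only lower it.\<close>

lemma counting_le_pole_counting:
  assumes m: "a meromorphic_on UNIV" and r: "r \<ge> 1"
  shows "counting (pole_ord a) r \<le> pole_counting r a"
proof -
  define A where "A = {z. norm z \<le> r \<and> pole_ord a z \<noteq> 0}"
  have fin: "finite A" using loc_finite_pole_ord[OF m] by (simp add: loc_finite_def A_def)
  have pc: "real (pole_count t a) = (\<Sum>z\<in>A. if norm z \<le> t then real (pole_ord a z) else 0)" if "t \<le> r" for t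
    using pole_count_eq[OF m that] by (simp add: A_def)
  have pc0: "real (pole_count 0 a) = (\<Sum>z\<in>A. if z = 0 then real (pole_ord a z) else 0)"
    using pc[of 0] r by simp
  have "((\<lambda>t. \<Sum>z\<in>A - {0}. real (pole_ord a z) * (if norm z \<le> t then 1 / t else 0)) has_integral
     (\<Sum>z\<in>A - {0}. real (pole_ord a z) * ln (r / norm z))) {0..r}"
    using fin by (intro has_integral_sum has_integral_mult_right integral_inverse_cutoff) (auto simp: A_def)
  hence "((\<lambda>t. (real (pole_count t a) - real (pole_count 0 a)) / t) has_integral
     (\<Sum>z\<in>A - {0}. real (pole_ord a z) * ln (r / norm z))) {0..r}"
  proof (rule has_integral_eq[rotated])
    fix t assume t: "t \<in> {0..r}"
    have "real (pole_count t a) - real (pole_count 0 a) = (\<Sum>z\<in>A. if z \<noteq> 0 \<and> norm z \<le> t then real (pole_ord a z) else 0)"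
      unfolding pc0 using pc[of t] t by (simp flip: sum_subtractf) (intro sum.cong, auto)
    also have "\<dots> = (\<Sum>z\<in>A - {0}. if norm z \<le> t then real (pole_ord a z) else 0)"
      using fin by (intro sum.mono_neutral_cong_right) auto
    finally show "(\<Sum>z\<in>A - {0}. real (pole_ord a z) * (if norm z \<le> t then 1 / t else 0)) =
      (real (pole_count t a) - real (pole_count 0 a)) / t"
      by (simp add: sum_divide_distrib) (intro sum.cong, auto)
  qed
  hence pceq: "pole_counting r a = (\<Sum>z\<in>A - {0}. real (pole_ord a z) * ln (r / norm z)) + real (pole_count 0 a) * ln r"
    unfolding pole_counting_def by (simp add: integral_unique)
  have "counting (pole_ord a) r = (\<Sum>z\<in>A. real (pole_ord a z) * ln (r / max 1 (norm z)))"
    by (simp add: counting_def A_def)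
  also have "\<dots> = (\<Sum>z\<in>A - {0}. real (pole_ord a z) * ln (r / max 1 (norm z))) + real (pole_count 0 a) * ln r"
    unfolding pc0 using fin by (cases "0 \<in> A") (simp_all add: sum.remove[of A 0] sum.delta)
  also have "\<dots> \<le> pole_counting r a"
    unfolding pceq
  proof (intro add_right_mono sum_mono mult_left_mono)
    fix z assume z: "z \<in> A - {0}"
    hence "r / max 1 (norm z) \<le> r / norm z" using r by (intro divide_left_mono) auto
    thus "ln (r / max 1 (norm z)) \<le> ln (r / norm z)" using z r by (intro ln_mono) (auto simp: max_def)
  qed auto
  finally show ?thesis .
qed

section \<open>Transfer of Nevanlinna smallness to the windows\<close>

context windows
begin

text \<open>The exceptional set of the o-relation becomes the exceptional set of the filter. As f is
  entire, its characteristic is its proximity function, which is at most 2 T n on the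
  window.\<close>

lemma small_functions_imp_small:
  assumes f: "f analytic_on UNIV"
    and T: "\<And>n s. s \<in> {r n..r n + h n} \<Longrightarrow> proximity s f \<le> 2 * T n"
    and a: "a \<in> small_functions f"
  shows "small a"
proof -
  have m: "a meromorphic_on UNIV" using a by (simp add: small_functions_def)
  obtain E where E: "E \<in> lmeasurable"
    and o: "(\<lambda>r. nevanlinna_T r a) \<in> o[inf at_top (principal (- E))](\<lambda>r. nevanlinna_T r f)"
    using a by (auto simp: small_functions_def is_S_def)
  have key: "eventually (\<lambda>(n, s). proximity s a \<le> \<epsilon> * T n \<and> counting (pole_ord a) s \<le> \<epsilon> * T n) W" if \<epsilon>: "\<epsilon> > 0" for \<epsilon>
  proof -
    have "eventually (\<lambda>r. norm (nevanlinna_T r a) \<le> \<epsilon> / 2 * norm (nevanlinna_T r f)) (inf at_top (principal (- E)))"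
      using landau_o.smallD[OF o, of "\<epsilon> / 2"] \<epsilon> by simp
    then obtain S where S: "\<And>s. s \<ge> S \<Longrightarrow> s \<notin> E \<Longrightarrow> norm (nevanlinna_T s a) \<le> \<epsilon> / 2 * norm (nevanlinna_T s f)"
      by (auto simp: eventually_inf_principal eventually_at_top_linorder)
    have fc: "continuous_on A f" for A using f analytic_imp_holomorphic holomorphic_on_imp_continuous_on continuous_on_subset by blast
    have "eventually (\<lambda>(n, s). s \<notin> E \<and> s \<in> {r n..r n + h n}) W"
      by (rule eventually_WI[of 1 E]) (use E in auto)
    thus ?thesis using eventually_W_ge[of "max 1 S"] eventually_W_continuous[OF m]
    proof eventually_elim
      case (elim x)
      obtain n s where x: "x = (n, s)" by force
      have s: "s \<notin> E" "s \<in> {r n..r n + h n}" "s \<ge> 1" "s \<ge> S" and c: "continuous_on (sphere 0 s) a" using elim x by auto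
      have p: "proximity s a \<ge> 0" "proximity s f \<ge> 0" using s by (auto intro!: proximity_nonneg c fc)
      have cn: "counting (pole_ord a) s \<ge> 0" using s by (intro counting_nonneg)
      have "proximity s a + counting (pole_ord a) s \<le> nevanlinna_T s a"
        using counting_le_pole_counting[OF m s(3)] by (simp add: nevanlinna_T_def)
      also have "\<dots> \<le> \<epsilon> / 2 * norm (nevanlinna_T s f)" using S[OF s(4,1)] by simp
      also have "\<dots> \<le> \<epsilon> / 2 * (2 * T n)" using T[OF s(2)] \<epsilon> p
        by (intro mult_left_mono) (auto simp: nevanlinna_T_entire[OF f])
      finally have "proximity s a + counting (pole_ord a) s \<le> \<epsilon> * T n" by simp
      thus ?case using x p cn by simp
    qed
  qed
  have "negl (\<lambda>s. proximity s a)"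
    unfolding negl_def by (intro allI impI eventually_mono[OF key]) auto
  moreover have "negl (counting (pole_ord a))"
    unfolding negl_def by (intro allI impI eventually_mono[OF key]) auto
  ultimately show ?thesis using m by (simp add: small_def msmall_def nsmall_def)
qed

end

theorem theorem1p1:
  fixes f a1 a2 L \<phi> :: "complex \<Rightarrow> complex"
    and b \<psi> :: "nat \<Rightarrow> complex \<Rightarrow> complex"
    and c :: complex and k :: nat
  assumes f_entire: "f holomorphic_on UNIV"
    and f_nonconst: "\<not> f constant_on UNIV"
    and f_order: "hyper_order f < 1"
    and c_nonzero: "c \<noteq> 0"
    and k_pos: "k \<ge> 1"
    and b_small: "\<forall>i\<le>k. b i \<in> small_functions f"
    and b_nonzero: "\<exists>i\<le>k. \<not> (\<forall>\<^sub>\<approx>z. b i z = 0)"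
    and a_small: "a1 \<in> small_functions f" "a2 \<in> small_functions f"
    and a_distinct: "\<not> (\<forall>\<^sub>\<approx>z. a1 z = a2 z)"
    and a_cases: "(c_periodic c a1 \<and> c_periodic c a2)
                  \<or> \<not> (\<exists>C. \<forall>\<^sub>\<approx>z. deriv a1 z - deriv a2 z = C)"
    and L_def: "\<And>z. L z = (\<Sum>i=0..k. b i z * (deriv ^^ i) f (z + c))"
    and phi_def: "\<And>z. \<phi> z =
           ((deriv a1 z - deriv a2 z) * (f z - a1 z) - (a1 z - a2 z) * (deriv f z - deriv a1 z))
             * (f z - L z)
           / ((f z - a1 z) * (f z - a2 z))"
    and psi_1: "\<And>z. \<psi> 1 z =
           (deriv a1 (z + c) - deriv a2 (z + c) - \<phi> (z + c)) / (a1 (z + c) - a2 (z + c))"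
    and psi_Suc: "\<And>i z. 1 \<le> i \<Longrightarrow> i \<le> k - 1 \<Longrightarrow> \<psi> (i + 1) z = deriv (\<psi> i) z + \<psi> 1 z * \<psi> i z"
    and share1: "share_IM f L a1"
    and share2: "share_IM f L a2"
  shows "(\<forall>\<^sub>\<approx>z. f z = L z) \<or> (\<forall>\<^sub>\<approx>z. (\<Sum>i=1..k. b i z * \<psi> i z) = - b 0 z)"
proof -
  have f: "f analytic_on UNIV" using f_entire by (simp add: analytic_on_open)
  obtain r h \<alpha> where win: "windows r h (\<lambda>n. proximity (r n) f) \<alpha>"
    and le: "\<And>n s. s \<in> {r n..r n + h n} \<Longrightarrow> proximity (r n) f \<le> proximity s f \<and> proximity s f \<le> 2 * proximity (r n) f"
    by (rule windows_exist[OF f f_nonconst f_order]) (rule that)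
  interpret windows r h "\<lambda>n. proximity (r n) f" \<alpha> by (rule win)
  have sm: "small a" if "a \<in> small_functions f" for a
    using small_functions_imp_small[OF f _ that] le by blast
  \<comment> \<open>The upper half of this estimate makes f tame, the lower half is
    \<open>T_le\<close>.\<close>
  have ev: "eventually (\<lambda>(n, s). proximity (r n) f \<le> proximity s f \<and> proximity s f \<le> 2 * proximity (r n) f) W"
    by (rule eventually_WI[of 1 "{}"]) (use le in auto)
  interpret sharing r h "\<lambda>n. proximity (r n) f" \<alpha> f a1 a2 L b c k
  proof
    show "tame f" unfolding tame_def
    proof (intro conjI analytic_on_imp_meromorphic_on[OF f])
      show "bdd (\<lambda>s. proximity s f)" unfolding bdd_def
        by (rule exI[of _ 2]) (use ev in \<open>auto elim!: eventually_mono\<close>)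
      show "bdd (counting (pole_ord f))"
        using nsmall_analytic[OF f] by (auto simp: nsmall_def intro: negl_imp_bdd)
    qed
    show "eventually (\<lambda>(n, s). proximity (r n) f \<le> proximity s f) W" using ev by (auto elim!: eventually_mono)
    show "small (b i)" if "i \<le> k" for i using b_small that by (intro sm) auto
  qed (use f a_small a_distinct share1 share2 in \<open>auto intro: sm L_def\<close>)
  have \<psi>: "\<forall>\<^sub>\<approx>z. \<forall>i\<in>{1..k}. \<psi> i z = \<theta>s i (z + c)"
    using \<psi>_eq_\<theta>s[OF phi_def psi_1 psi_Suc] by (intro eventually_ball_finite) auto
  show ?thesis using f_eq_L_or_\<kappa>_zero
  proof
    assume "\<forall>\<^sub>\<approx>z. \<kappa> z = 0"
    with \<psi> have "\<forall>\<^sub>\<approx>z. (\<Sum>i=1..k. b i z * \<psi> i z) = - b 0 z"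
    proof eventually_elim
      case (elim z)
      \<comment> \<open>The term of index 0 is b 0, since \<open>\<theta>s 0\<close> is 1.\<close>
      have "\<kappa> z = b 0 z + (\<Sum>i=1..k. b i z * \<theta>s i (z + c))"
        unfolding \<kappa>_def by (subst sum.atLeast_Suc_atMost) auto
      also have "(\<Sum>i=1..k. b i z * \<theta>s i (z + c)) = (\<Sum>i=1..k. b i z * \<psi> i z)"
        using elim by (intro sum.cong) auto
      finally show ?case using elim by (simp add: eq_neg_iff_add_eq_0 add.commute)
    qed
    thus ?thesis ..
  qed simp
qed

end
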